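(* Monotone answerability of a Boolean conjunctive query with respect to a schema with result bounds whose constraints are unary inclusion dependencies and functional dependencies is decidable, and the problem is in $\mathrm{EXPTIME}$.
   Context: An inclusion dependency is a TGD $R(\vec x)\rightarrow\exists\vec y\,S(\vec z)$ with single body and head atoms and no repeated variables; it is unary (UID) if exactly one variable is exported from body to head. A functional dependency (FD) $D\rightarrow j$ on a relation $R$ asserts that any two $R$-facts agreeing on the positions in $D$ agree on position $j$. A schema consists of a relational signature, constraints, and access methods, each on a relation $R$ with a set of input positions and possibly a result bound $k\in\mathbb{N}_{>0}$. An access on instance $I$ binds the input positions to values of $I$; its matching tuples $M$ are the $R$-tuples agreeing with the binding; a valid output is $J\subseteq M$ with $J=M$ if no bound, and for result bound $k$, $|J|\le k$ and $\forall j\le k$: $|M|\ge j\Rightarrow|J|\ge j$. A monotone plan is a sequence of middleware commands $T:=E$ (relational algebra without difference over earlier tables) and access commands $T\Leftarrow\mathrm{mt}\Leftarrow E$ (each tuple of $E$ used as a binding, union of chosen valid outputs stored in $T$), ending with $\mathrm{Return}\ T_0$; it answers $Q$ if on every (finite or infinite) instance $I$ satisfying the constraints and for every choice of valid outputs, its output is $Q(I)$. $Q$ is monotone answerable if some monotone plan answers it. *)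

theory Defs
  imports Main
begin

text \<open>Relations are named by natural numbers 0..length(rel_arities)-1; positions are 0-based.
 A UID (R,i,S,j) is R(x_0..x_{n-1}) -> exists y. S(..) with x_i at position j of S,
 i.e. R[i] \<subseteq> S[j]. An FD (R,D,j) is D -> j on R. An access method (R,ins,bd)
 has input positions ins and optional result bound bd.\<close>

record schema =
  rel_arities :: "nat list"
  uids    :: "(nat \<times> nat \<times> nat \<times> nat) list"
  fds     :: "(nat \<times> nat list \<times> nat) list"
  methods :: "(nat \<times> nat list \<times> nat option) list"

type_synonym cq = "(nat \<times> nat list) list"  (* Boolean CQ: atoms R(vars); all variables existential *)

type_synonym 'v inst = "(nat \<times> 'v list) set"

definition wf_schema :: "schema \<Rightarrow> bool" where
  "wf_schema S \<longleftrightarrow>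
     (\<forall>(R,i,T,j)\<in>set (uids S). R < length (rel_arities S) \<and> T < length (rel_arities S)
          \<and> i < rel_arities S ! R \<and> j < rel_arities S ! T) \<and>
     (\<forall>(R,D,j)\<in>set (fds S). R < length (rel_arities S) \<and> (\<forall>d\<in>set D. d < rel_arities S ! R)
          \<and> j < rel_arities S ! R) \<and>
     (\<forall>(R,ins,bd)\<in>set (methods S). R < length (rel_arities S) \<and> distinct ins
          \<and> (\<forall>p\<in>set ins. p < rel_arities S ! R) \<and> (\<forall>k. bd = Some k \<longrightarrow> 0 < k))"

definition wf_query :: "schema \<Rightarrow> cq \<Rightarrow> bool" where
  "wf_query S Q \<longleftrightarrow> (\<forall>(R,vs)\<in>set Q. R < length (rel_arities S) \<and> length vs = rel_arities S ! R)"

definition inst_ok :: "schema \<Rightarrow> 'v inst \<Rightarrow> bool" where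
  "inst_ok S I \<longleftrightarrow> (\<forall>(R,t)\<in>I. R < length (rel_arities S) \<and> length t = rel_arities S ! R)"

definition sat_uid :: "'v inst \<Rightarrow> nat \<times> nat \<times> nat \<times> nat \<Rightarrow> bool" where
  "sat_uid I c = (case c of (R,i,T,j) \<Rightarrow>
     (\<forall>t. (R,t) \<in> I \<longrightarrow> (\<exists>u. (T,u) \<in> I \<and> u ! j = t ! i)))"

definition sat_fd :: "'v inst \<Rightarrow> nat \<times> nat list \<times> nat \<Rightarrow> bool" where
  "sat_fd I c = (case c of (R,D,j) \<Rightarrow>
     (\<forall>t u. (R,t) \<in> I \<and> (R,u) \<in> I \<and> (\<forall>d\<in>set D. t ! d = u ! d) \<longrightarrow> t ! j = u ! j))"

definition satisfies :: "schema \<Rightarrow> 'v inst \<Rightarrow> bool" where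
  "satisfies S I \<longleftrightarrow> (\<forall>c\<in>set (uids S). sat_uid I c) \<and> (\<forall>c\<in>set (fds S). sat_fd I c)"

definition cq_holds :: "cq \<Rightarrow> 'v inst \<Rightarrow> bool" where
  "cq_holds Q I \<longleftrightarrow> (\<exists>h :: nat \<Rightarrow> 'v. \<forall>(R,vs)\<in>set Q. (R, map h vs) \<in> I)"

definition cq_ans :: "cq \<Rightarrow> 'v inst \<Rightarrow> 'v list set" where
  "cq_ans Q I = (if cq_holds Q I then {[]} else {})"

definition matching :: "'v inst \<Rightarrow> nat \<Rightarrow> nat list \<Rightarrow> 'v list \<Rightarrow> 'v list set" where
  "matching I R ins b = {t. (R,t) \<in> I \<and> (\<forall>k<length ins. t ! (ins ! k) = b ! k)}"

text \<open>"|M| \<ge> j" for a possibly infinite set M is rendered as: M has a finite subset of size j.\<close>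
definition valid_output :: "'v list set \<Rightarrow> nat option \<Rightarrow> 'v list set \<Rightarrow> bool" where
  "valid_output M bd J \<longleftrightarrow> J \<subseteq> M \<and>
     (case bd of None \<Rightarrow> J = M
      | Some k \<Rightarrow> finite J \<and> card J \<le> k \<and>
          (\<forall>j\<le>k. (\<exists>A\<subseteq>M. finite A \<and> card A = j) \<longrightarrow> j \<le> card J))"

text \<open>Relational algebra without difference (positional, no constants):
  table reference, the 0-ary relation containing the empty tuple, selection by equality of
  two columns, projection/renaming (list of columns), cartesian product, union.\<close>
datatype ra = Tab nat | Unit | Sel nat nat ra | Proj "nat list" ra | Prod ra ra | Union ra ra

fun ra_arity :: "nat list \<Rightarrow> ra \<Rightarrow> nat option" where
  "ra_arity A (Tab i) = (if i < length A then Some (A ! i) else None)"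
| "ra_arity A Unit = Some 0"
| "ra_arity A (Sel i j e) = (case ra_arity A e of Some n \<Rightarrow> if i < n \<and> j < n then Some n else None | None \<Rightarrow> None)"
| "ra_arity A (Proj is e) = (case ra_arity A e of Some n \<Rightarrow> if (\<forall>i\<in>set is. i < n) then Some (length is) else None | None \<Rightarrow> None)"
| "ra_arity A (Prod e1 e2) = (case (ra_arity A e1, ra_arity A e2) of (Some a, Some b) \<Rightarrow> Some (a + b) | _ \<Rightarrow> None)"
| "ra_arity A (Union e1 e2) = (case (ra_arity A e1, ra_arity A e2) of (Some a, Some b) \<Rightarrow> if a = b then Some a else None | _ \<Rightarrow> None)"

fun ra_eval :: "'v list set list \<Rightarrow> ra \<Rightarrow> 'v list set" where
  "ra_eval T (Tab i) = T ! i"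
| "ra_eval T Unit = {[]}"
| "ra_eval T (Sel i j e) = {t \<in> ra_eval T e. t ! i = t ! j}"
| "ra_eval T (Proj is e) = (\<lambda>t. map (\<lambda>i. t ! i) is) ` ra_eval T e"
| "ra_eval T (Prod e1 e2) = {t @ u | t u. t \<in> ra_eval T e1 \<and> u \<in> ra_eval T e2}"
| "ra_eval T (Union e1 e2) = ra_eval T e1 \<union> ra_eval T e2"

text \<open>Command number k defines table k and may only refer to tables < k.
  Mid e:  T_k := e.   Acc m e:  T_k \<Leftarrow> method m \<Leftarrow> e.\<close>
datatype cmd = Mid ra | Acc nat ra

type_synonym plan = "cmd list \<times> nat"   (* commands, returned table *)

definition cmd_arity :: "schema \<Rightarrow> nat list \<Rightarrow> cmd \<Rightarrow> nat option" where
  "cmd_arity S A c = (case c of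
      Mid e \<Rightarrow> ra_arity A e
    | Acc m e \<Rightarrow> (if m < length (methods S) then
         (case methods S ! m of (R, ins, bd) \<Rightarrow>
            if ra_arity A e = Some (length ins) then Some (rel_arities S ! R) else None)
       else None))"

fun ar_step :: "schema \<Rightarrow> nat list option \<Rightarrow> cmd \<Rightarrow> nat list option" where
  "ar_step S None c = None"
| "ar_step S (Some A) c = (case cmd_arity S A c of Some a \<Rightarrow> Some (A @ [a]) | None \<Rightarrow> None)"

definition plan_arities :: "schema \<Rightarrow> cmd list \<Rightarrow> nat list option" where
  "plan_arities S cs = foldl (ar_step S) (Some []) cs"

definition wf_plan :: "schema \<Rightarrow> plan \<Rightarrow> bool" where
  "wf_plan S P = (case P of (cs, r) \<Rightarrow>
     (\<exists>A. plan_arities S cs = Some A \<and> r < length A \<and> A ! r = 0))"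

definition cmd_out :: "schema \<Rightarrow> 'v inst \<Rightarrow> 'v list set list \<Rightarrow> cmd \<Rightarrow> 'v list set set" where
  "cmd_out S I T c = (case c of
      Mid e \<Rightarrow> {ra_eval T e}
    | Acc m e \<Rightarrow> (case methods S ! m of (R, ins, bd) \<Rightarrow>
         {(\<Union>b\<in>ra_eval T e. J b) | J. \<forall>b\<in>ra_eval T e. valid_output (matching I R ins b) bd (J b)}))"

definition runs :: "schema \<Rightarrow> 'v inst \<Rightarrow> cmd list \<Rightarrow> 'v list set list set" where
  "runs S I cs = foldl (\<lambda>X c. {T @ [t] | T t. T \<in> X \<and> t \<in> cmd_out S I T c}) {[]} cs"

definition plan_answers :: "'v itself \<Rightarrow> schema \<Rightarrow> cq \<Rightarrow> plan \<Rightarrow> bool" where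
  "plan_answers _ S Q P \<longleftrightarrow> wf_plan S P \<and>
     (\<forall>I :: 'v inst. inst_ok S I \<and> satisfies S I \<longrightarrow>
        (\<forall>T\<in>runs S I (fst P). T ! snd P = cq_ans Q I))"

definition monotone_answerable :: "'v itself \<Rightarrow> schema \<Rightarrow> cq \<Rightarrow> bool" where
  "monotone_answerable V S Q \<longleftrightarrow> (\<exists>P. plan_answers V S Q P)"

text \<open>The decision problem: well-formed (schema, Boolean CQ) that is monotone answerable.
  Constraints are exactly UIDs and FDs by construction of the schema type.\<close>
definition MonAns :: "'v itself \<Rightarrow> schema \<times> cq \<Rightarrow> bool" where
  "MonAns V x \<longleftrightarrow> (case x of (S, Q) \<Rightarrow> wf_schema S \<and> wf_query S Q \<and> monotone_answerable V S Q)"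

fun bits :: "nat \<Rightarrow> nat list" where
  "bits n = (if n = 0 then [] else n mod 2 # bits (n div 2))"

definition enc_nat :: "nat \<Rightarrow> nat list" where
  "enc_nat n = bits n @ [2]"

definition enc_list :: "('a \<Rightarrow> nat list) \<Rightarrow> 'a list \<Rightarrow> nat list" where
  "enc_list f xs = enc_nat (length xs) @ concat (map f xs)"

fun enc_uid :: "nat \<times> nat \<times> nat \<times> nat \<Rightarrow> nat list" where
  "enc_uid (a, b, c, d) = enc_nat a @ enc_nat b @ enc_nat c @ enc_nat d"

fun enc_fd :: "nat \<times> nat list \<times> nat \<Rightarrow> nat list" where
  "enc_fd (R, D, j) = enc_nat R @ enc_list enc_nat D @ enc_nat j"

fun enc_opt :: "nat option \<Rightarrow> nat list" where
  "enc_opt None = enc_nat 0"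
| "enc_opt (Some k) = enc_nat (Suc k)"

fun enc_meth :: "nat \<times> nat list \<times> nat option \<Rightarrow> nat list" where
  "enc_meth (R, ins, bd) = enc_nat R @ enc_list enc_nat ins @ enc_opt bd"

fun enc_atom :: "nat \<times> nat list \<Rightarrow> nat list" where
  "enc_atom (R, vs) = enc_nat R @ enc_list enc_nat vs"

fun enc_problem :: "schema \<times> cq \<Rightarrow> nat list" where
  "enc_problem (S, Q) = enc_list enc_nat (rel_arities S) @ enc_list enc_uid (uids S)
     @ enc_list enc_fd (fds S) @ enc_list enc_meth (methods S) @ enc_list enc_atom Q"

text \<open>States 0..nstates-1 (0 start, 1 accept, 2 reject; 1 and 2 halting),
  symbols 0..nsyms-1 (input symbols 0,1,2; blank 3). Head moves by -1, 0 or 1.\<close>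
record tm =
  nstates :: nat
  nsyms   :: nat
  delta   :: "nat \<Rightarrow> nat \<Rightarrow> nat \<times> nat \<times> int"

definition tm_ok :: "tm \<Rightarrow> bool" where
  "tm_ok M \<longleftrightarrow> 3 \<le> nstates M \<and> 4 \<le> nsyms M \<and>
     (\<forall>q<nstates M. \<forall>s<nsyms M. case delta M q s of (q', s', d) \<Rightarrow>
        q' < nstates M \<and> s' < nsyms M \<and> d \<in> {-1, 0, 1})"

type_synonym config = "nat \<times> (int \<Rightarrow> nat) \<times> int"

definition tm_step :: "tm \<Rightarrow> config \<Rightarrow> config" where
  "tm_step M cf = (case cf of (q, tp, h) \<Rightarrow>
     if q = 1 \<or> q = 2 then (q, tp, h)
     else (case delta M q (tp h) of (q', s', d) \<Rightarrow> (q', tp(h := s'), h + d)))"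

definition tm_init :: "nat list \<Rightarrow> config" where
  "tm_init w = (0, \<lambda>i. if 0 \<le> i \<and> i < int (length w) then w ! nat i else 3, 0)"

definition tm_state_after :: "tm \<Rightarrow> nat list \<Rightarrow> nat \<Rightarrow> nat" where
  "tm_state_after M w n = fst ((tm_step M ^^ n) (tm_init w))"

definition tm_decides_within :: "tm \<Rightarrow> ('a \<Rightarrow> nat list) \<Rightarrow> ('a \<Rightarrow> bool) \<Rightarrow> (nat \<Rightarrow> nat) \<Rightarrow> bool" where
  "tm_decides_within M enc L t \<longleftrightarrow> tm_ok M \<and>
     (\<forall>x. \<exists>n\<le>t (length (enc x)). tm_state_after M (enc x) n \<in> {1, 2}
            \<and> (tm_state_after M (enc x) n = 1 \<longleftrightarrow> L x))"

definition decidable :: "('a \<Rightarrow> nat list) \<Rightarrow> ('a \<Rightarrow> bool) \<Rightarrow> bool" where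
  "decidable enc L \<longleftrightarrow> (\<exists>M. tm_ok M \<and>
     (\<forall>x. \<exists>n. tm_state_after M (enc x) n \<in> {1, 2}
            \<and> (tm_state_after M (enc x) n = 1 \<longleftrightarrow> L x)))"

definition in_EXPTIME :: "('a \<Rightarrow> nat list) \<Rightarrow> ('a \<Rightarrow> bool) \<Rightarrow> bool" where
  "in_EXPTIME enc L \<longleftrightarrow> (\<exists>M c. tm_decides_within M enc L (\<lambda>n. 2 ^ ((n + 2) ^ c)))"

end

theory Submission
  imports Defs "HOL-Library.Countable" "HOL-Library.Nat_Bijection"
begin

text \<open>A few canonical facts suffice to decide which values can be retrieved: the query atoms, a generic
  fact for each relation that the query forces to be inhabited, and, for each position of such a
  relation, a fact whose value there is known. Forced equality and retrievability of their values are
  least fixed points. A certificate maps the query atoms to facts that the accesses are bound to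
  return. If there is one, enough rounds of all accesses followed by the conjunctive query of all
  facts bound to be returned answer the query. If there is none, the chase with nulls yields a model of
  the query and one refuting it in which every access can be answered alike, so that no monotone
  plan tells them apart. Positions are written in binary, so there are exponentially many names, but
  a certificate has polynomially many bits; hence fixed points and the search for a certificate take
  time polynomial in \<open>2 ^ (n + 2) ^ 10\<close>.\<close>

section \<open>Static analysis of a schema and a query\<close>

text \<open>Two obstacles shape the criterion. First, UIDs may be cyclic, so the chase is infinite
  and knowledge can only be tracked per relation and position. This loses nothing because a UID
  exports a single value: a fact created by the chase shares with the rest only that value and the
  constants of its relation, and at its other positions it looks like any fact of the relation.
  Constants are the positions where FDs and UIDs together leave one value. Any further interaction
  is avoided by creating a fact only where the value does not yet occur, so that an FD with a
  non-constant position on its left concerns only copies of one fact or of base facts. Second, a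
  result-bounded access returns an arbitrary choice of matches, of which only the FD closure of the
  inputs is predictable. In the counterexample, a hidden fact that an access can hit therefore has
  infinitely many copies that agree with it there and are fresh elsewhere, enough for any bound. The
  constants of the two models need not coincide unless accessed facts force it, which is why the
  names \<open>G2\<close> are separate from \<open>Ge\<close>.\<close>

datatype nm = Va nat | Ge nat nat | Kg nat nat nat | G2 nat nat

datatype bid = At nat | Gn nat | Kn nat nat

text \<open>A value in a certificate is either whatever stands at a position of some slot
  (\<open>PN\<close>) or a value with a name known from the analysis (\<open>PB\<close>).\<close>

datatype pname = PN nat nat | PB nm

text \<open>The three reasons why a fact must exist once the accesses have been answered: it answers
  an access, its relation is inhabited, or a UID chain forces it to carry a given value.\<close>

datatype slot = SC bid nat | SR nat | SF nat nat pname

locale problem =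
  fixes S :: schema and Q :: cq
begin

abbreviation "ar T \<equiv> rel_arities S ! T"
abbreviation "nrel \<equiv> length (rel_arities S)"
abbreviation "nmeth \<equiv> length (methods S)"
abbreviation "U R i T j \<equiv> (R, i, T, j) \<in> set (uids S)"

definition "mrel m = fst (methods S ! m)"
definition "mins m = fst (snd (methods S ! m))"
definition "mbound m = snd (snd (methods S ! m))"

text \<open>Positions at which all facts of a relation carry the same value in every model. FDs with
  an empty left side start the induction; a UID into such a position leaves only one value to
  export.\<close>

inductive const_pos :: "nat \<Rightarrow> nat \<Rightarrow> bool" where
  const_fd: "(R, D, j) \<in> set (fds S) \<Longrightarrow> (\<And>d. d \<in> set D \<Longrightarrow> const_pos R d) \<Longrightarrow> const_pos R j"
| const_uid: "U R i T j \<Longrightarrow> const_pos T j \<Longrightarrow> const_pos R i"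

inductive fdcl :: "nat \<Rightarrow> nat set \<Rightarrow> nat \<Rightarrow> bool" for R X where
  fdcl_base: "p \<in> X \<Longrightarrow> fdcl R X p"
| fdcl_const: "const_pos R p \<Longrightarrow> fdcl R X p"
| fdcl_fd: "(R, D, j) \<in> set (fds S) \<Longrightarrow> (\<And>d. d \<in> set D \<Longrightarrow> fdcl R X d) \<Longrightarrow> fdcl R X j"

text \<open>Given a fact that matches the binding, these are the positions where some answer is sure
  to agree with it: without a bound the fact itself is returned, with a bound only the FD closure is
  guaranteed.\<close>

definition det :: "nat \<Rightarrow> nat \<Rightarrow> bool" where
  "det m p \<longleftrightarrow> mbound m = None \<or> fdcl (mrel m) (set (mins m)) p"

inductive reach :: "nat \<Rightarrow> bool" where
  reach_atom: "(T, vs) \<in> set Q \<Longrightarrow> reach T"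
| reach_uid: "reach R \<Longrightarrow> U R i T j \<Longrightarrow> reach T"

definition up :: "((nat \<times> nat) \<times> (nat \<times> nat)) set" where
  "up = {((R, i), (T, j)) | R i T j. U R i T j}\<^sup>*"

fun brel :: "bid \<Rightarrow> nat" where
  "brel (At k) = fst (Q ! k)"
| "brel (Gn T) = T"
| "brel (Kn T q) = T"

fun bnm :: "bid \<Rightarrow> nat \<Rightarrow> nm" where
  "bnm (At k) p = Va (snd (Q ! k) ! p)"
| "bnm (Gn T) p = Ge T p"
| "bnm (Kn T q) p = Kg T q p"

fun bok :: "bid \<Rightarrow> bool" where
  "bok (At k) = (k < length Q)"
| "bok (Gn T) = reach T"
| "bok (Kn T q) = (reach T \<and> q < ar T)"

text \<open>The constraints cannot be applied to the query alone: besides the query atoms there is, for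
  each relation forced to be inhabited, a fact \<open>Gn T\<close> standing for an arbitrary \<open>T\<close>-fact, and for
  each of its positions a fact \<open>Kn T q\<close> standing for a \<open>T\<close>-fact whose \<open>q\<close>-th value is already known.
  \<open>sim\<close> is the forced equality, \<open>kn\<close> says that a value can be obtained by accesses, and \<open>rel2\<close> that
  the accessed facts alone force a relation to be inhabited (with constants \<open>G2\<close>).\<close>

inductive sim :: "nm \<Rightarrow> nm \<Rightarrow> bool" and kn :: "nm \<Rightarrow> bool" and rel2 :: "nat \<Rightarrow> bool" where
  sim_base: "bok f \<Longrightarrow> p < ar (brel f) \<Longrightarrow> sim (bnm f p) (bnm f p)"
| sim_g2: "rel2 T \<Longrightarrow> p < ar T \<Longrightarrow> sim (G2 T p) (G2 T p)"
| sim_sym: "sim a b \<Longrightarrow> sim b a"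
| sim_trans: "sim a b \<Longrightarrow> sim b c \<Longrightarrow> sim a c"
| sim_fd: "bok f \<Longrightarrow> bok g \<Longrightarrow> brel f = R \<Longrightarrow> brel g = R \<Longrightarrow> (R, D, j) \<in> set (fds S) \<Longrightarrow>
     (\<And>d. d \<in> set D \<Longrightarrow> sim (bnm f d) (bnm g d)) \<Longrightarrow> sim (bnm f j) (bnm g j)"
| sim_uid: "bok f \<Longrightarrow> U (brel f) i T j \<Longrightarrow> const_pos T j \<Longrightarrow> sim (bnm f i) (Ge T j)"
| sim_kn: "bok f \<Longrightarrow> m < nmeth \<Longrightarrow> mrel m = brel f \<Longrightarrow> (\<And>p. p \<in> set (mins m) \<Longrightarrow> kn (bnm f p)) \<Longrightarrow>
     const_pos (brel f) p \<Longrightarrow> p < ar (brel f) \<Longrightarrow> sim (bnm f p) (G2 (brel f) p)"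
| sim_uid2: "rel2 R \<Longrightarrow> U R i T j \<Longrightarrow> const_pos T j \<Longrightarrow> sim (G2 R i) (G2 T j)"
| rel2_kn: "bok f \<Longrightarrow> m < nmeth \<Longrightarrow> mrel m = brel f \<Longrightarrow> (\<And>p. p \<in> set (mins m) \<Longrightarrow> kn (bnm f p)) \<Longrightarrow> rel2 (brel f)"
| rel2_uid: "rel2 R \<Longrightarrow> U R i T j \<Longrightarrow> rel2 T"
| kn_sim: "kn a \<Longrightarrow> sim a b \<Longrightarrow> kn b"
| kn_det: "bok f \<Longrightarrow> m < nmeth \<Longrightarrow> mrel m = brel f \<Longrightarrow> (\<And>p. p \<in> set (mins m) \<Longrightarrow> kn (bnm f p)) \<Longrightarrow>
     det m p \<Longrightarrow> p < ar (brel f) \<Longrightarrow> kn (bnm f p)"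
| kn_gen: "bok f \<Longrightarrow> p < ar (brel f) \<Longrightarrow> kn (Ge (brel f) p) \<Longrightarrow> kn (bnm f p)"
| kn_uid: "bok f \<Longrightarrow> U (brel f) i T j \<Longrightarrow> kn (Ge T j) \<Longrightarrow> kn (bnm f i)"
| kn_rel: "bok f \<Longrightarrow> q < ar (brel f) \<Longrightarrow> p < ar (brel f) \<Longrightarrow> kn (bnm f q) \<Longrightarrow> kn (Kg (brel f) q p) \<Longrightarrow> kn (bnm f p)"
| kn_self: "bok f \<Longrightarrow> p < ar (brel f) \<Longrightarrow> kn (bnm f p) \<Longrightarrow> kn (Kg (brel f) p p)"
| kn_step: "bok f \<Longrightarrow> U (brel f) i T j \<Longrightarrow> kn (bnm f i) \<Longrightarrow> kn (Kg T j j)"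
| kn_all: "bok f \<Longrightarrow> m < nmeth \<Longrightarrow> mrel m = brel f \<Longrightarrow> (\<And>p. p \<in> set (mins m) \<Longrightarrow> kn (bnm f p)) \<Longrightarrow>
     q < ar (brel f) \<Longrightarrow> kn (Kg (brel f) q q)"

definition usable :: "bid \<Rightarrow> nat \<Rightarrow> bool" where
  "usable f m \<longleftrightarrow> bok f \<and> m < nmeth \<and> mrel m = brel f \<and> (\<forall>p\<in>set (mins m). kn (bnm f p))"

text \<open>A retrieved value occurring at position \<open>q\<close> of \<open>T\<close> can be used
  to retrieve a \<open>T\<close>-fact that carries it there.\<close>

definition follow :: "nat \<Rightarrow> nat \<Rightarrow> bool" where
  "follow T q \<longleftrightarrow> (\<exists>m. usable (Kn T q) m \<and> det m q)"

text \<open>Where facts forced by the accesses must contain the value \<open>n\<close>: in an answer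
  that preserves it, as a constant of an inhabited relation, or as a retrieved value that has been
  followed along UIDs.\<close>

definition pos2 :: "nm \<Rightarrow> nat \<Rightarrow> nat \<Rightarrow> bool" where
  "pos2 n T q \<longleftrightarrow> q < ar T \<and>
     ((\<exists>f m. usable f m \<and> det m q \<and> brel f = T \<and> sim (bnm f q) n)
    \<or> (rel2 T \<and> const_pos T q \<and> sim (G2 T q) n)
    \<or> (\<exists>f p. bok f \<and> p < ar (brel f) \<and> kn (bnm f p) \<and> sim (bnm f p) n \<and> ((brel f, p), (T, q)) \<in> up \<and> follow T q))"

fun srel :: "slot \<Rightarrow> nat" where
  "srel (SC f m) = brel f" | "srel (SR T) = T" | "srel (SF T q e) = T"

text \<open>\<open>PN k p\<close> for the slot \<open>k\<close> itself stands for a value about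
  which nothing is known; the only other slots showing it are those that import it.\<close>

fun sname :: "nat \<Rightarrow> slot \<Rightarrow> nat \<Rightarrow> pname" where
  "sname k (SC f m) p = (if det m p then PB (bnm f p) else PN k p)"
| "sname k (SR T) p = (if const_pos T p then PB (G2 T p) else PN k p)"
| "sname k (SF T q e) p = (if p = q then e else if const_pos T p then PB (G2 T p) else PN k p)"

fun pnsim :: "pname \<Rightarrow> pname \<Rightarrow> bool" where
  "pnsim (PN l p) (PN l' p') = (l = l' \<and> p = p')"
| "pnsim (PB a) (PB b) = sim a b"
| "pnsim _ _ = False"

text \<open>References go to strictly earlier slots, so that the facts of a certificate can be found
  one after the other.\<close>

fun slot_ok :: "(nat \<Rightarrow> slot) \<Rightarrow> nat \<Rightarrow> slot \<Rightarrow> bool" where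
  "slot_ok sl k (SC f m) = usable f m"
| "slot_ok sl k (SR T) = rel2 T"
| "slot_ok sl k (SF T q (PN l p)) = (l < k \<and> q < ar T \<and> p < ar (srel (sl l)) \<and> ((srel (sl l), p), (T, q)) \<in> up)"
| "slot_ok sl k (SF T q (PB n)) = (q < ar T \<and> (\<exists>R i. pos2 n R i \<and> ((R, i), (T, q)) \<in> up))"

text \<open>Two slots per atom are enough: the image of the atom and the fact in which the value
  imported by that image was born (see \<open>v2_query_cert\<close>).\<close>

definition cert :: bool where
  "cert \<longleftrightarrow> (\<exists>N\<le>2 * length Q. \<exists>sl s. (\<forall>k<N. slot_ok sl k (sl k)) \<and>
     (\<forall>a<length Q. s a < N \<and> srel (sl (s a)) = fst (Q ! a)) \<and>
     (\<forall>a<length Q. \<forall>b<length Q. \<forall>p<length (snd (Q ! a)). \<forall>q<length (snd (Q ! b)).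
        snd (Q ! a) ! p = snd (Q ! b) ! q \<longrightarrow>
        pnsim (sname (s a) (sl (s a)) p) (sname (s b) (sl (s b)) q)))"

section \<open>Elementary properties of the analysis\<close>

lemma up_refl [simp]: "(a, a) \<in> up"
  by (simp add: up_def)

lemma up_step: "(a, (R, i)) \<in> up \<Longrightarrow> U R i T j \<Longrightarrow> (a, (T, j)) \<in> up"
  unfolding up_def by (rule rtrancl_into_rtrancl) auto

lemma up_trans: "(a, b) \<in> up \<Longrightarrow> (b, c) \<in> up \<Longrightarrow> (a, c) \<in> up"
  unfolding up_def by (rule rtrancl_trans)

lemma up_induct [consumes 1, case_names refl step]:
  assumes "((R, i), (T, j)) \<in> up" "P R i"
    "\<And>T j T' j'. ((R, i), (T, j)) \<in> up \<Longrightarrow> P T j \<Longrightarrow> U T j T' j' \<Longrightarrow> P T' j'"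
  shows "P T j"
proof -
  have "(\<lambda>(T, j). P T j) (T, j)"
    using assms(1) unfolding up_def
  proof (induction "(T, j)" arbitrary: T j rule: rtrancl_induct)
    case base then show ?case using assms(2) by simp
  next
    case (step y)
    obtain T0 j0 where y: "y = (T0, j0)" by (cases y)
    then show ?case using step assms(3)[of T0 j0 T j] by (auto simp: up_def)
  qed
  then show ?thesis by simp
qed

lemma up_induct_back [consumes 1, case_names refl step]:
  assumes "((R, i), (T, j)) \<in> up" "P T j"
    "\<And>R i R' i'. U R i R' i' \<Longrightarrow> ((R', i'), (T, j)) \<in> up \<Longrightarrow> P R' i' \<Longrightarrow> P R i"
  shows "P R i"
proof -
  have "(\<lambda>(R, i). P R i) (R, i)"
    using assms(1) unfolding up_def
  proof (induction "(R, i)" arbitrary: R i rule: converse_rtrancl_induct)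
    case base then show ?case using assms(2) by simp
  next
    case (step z)
    obtain T0 j0 where y: "z = (T0, j0)" by (cases z)
    then show ?case using step assms(3)[of R i T0 j0] by (auto simp: up_def)
  qed
  then show ?thesis by simp
qed

lemma bok_reach: "bok f \<Longrightarrow> reach (brel f)"
proof (cases f)
  case (At k)
  then show "bok f \<Longrightarrow> ?thesis" using reach_atom[of "fst (Q ! k)" "snd (Q ! k)"] by simp
qed auto

lemma usable_intros:
  assumes "usable f m"
  shows "rel2 (brel f)"
    and "det m p \<Longrightarrow> p < ar (brel f) \<Longrightarrow> kn (bnm f p)"
    and "q < ar (brel f) \<Longrightarrow> kn (Kg (brel f) q q)"
    and "const_pos (brel f) p \<Longrightarrow> p < ar (brel f) \<Longrightarrow> sim (bnm f p) (G2 (brel f) p)"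
proof -
  have u: "bok f" "m < nmeth" "mrel m = brel f" "\<And>p. p \<in> set (mins m) \<Longrightarrow> kn (bnm f p)"
    using assms unfolding usable_def by auto
  show "rel2 (brel f)" using rel2_kn[OF u] by simp
  show "det m p \<Longrightarrow> p < ar (brel f) \<Longrightarrow> kn (bnm f p)" using kn_det[OF u] by simp
  show "q < ar (brel f) \<Longrightarrow> kn (Kg (brel f) q q)" using kn_all[OF u] by simp
  show "const_pos (brel f) p \<Longrightarrow> p < ar (brel f) \<Longrightarrow> sim (bnm f p) (G2 (brel f) p)" using sim_kn[OF u] by simp
qed

lemma det_const: "const_pos (mrel m) p \<Longrightarrow> det m p"
  by (simp add: det_def fdcl_const)

lemma det_ins: "p \<in> set (mins m) \<Longrightarrow> det m p"
  by (simp add: det_def fdcl_base)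

lemma det_fd: "(mrel m, D, j) \<in> set (fds S) \<Longrightarrow> (\<And>d. d \<in> set D \<Longrightarrow> det m d) \<Longrightarrow> det m j"
  unfolding det_def by (cases "mbound m = None") (simp_all add: fdcl_fd)

end

locale wf_problem = problem +
  assumes wfS: "wf_schema S" and wfQ: "wf_query S Q"
begin

lemma uid_wf: "U R i T j \<Longrightarrow> R < nrel \<and> T < nrel \<and> i < ar R \<and> j < ar T"
  using wfS unfolding wf_schema_def by fast

lemma fd_wf: "(R, D, j) \<in> set (fds S) \<Longrightarrow> R < nrel \<and> j < ar R \<and> (\<forall>d\<in>set D. d < ar R)"
  using wfS unfolding wf_schema_def by fast

lemma meth_wf: "m < nmeth \<Longrightarrow> mrel m < nrel \<and> (\<forall>p\<in>set (mins m). p < ar (mrel m)) \<and> (\<forall>k. mbound m = Some k \<longrightarrow> 0 < k)"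
proof -
  assume "m < nmeth"
  then have "methods S ! m \<in> set (methods S)" by simp
  moreover obtain R ins bd where "methods S ! m = (R, ins, bd)" by (cases "methods S ! m")
  ultimately show ?thesis using wfS unfolding wf_schema_def mrel_def mins_def mbound_def by fastforce
qed

lemma query_wf: "a < length Q \<Longrightarrow> fst (Q ! a) < nrel \<and> length (snd (Q ! a)) = ar (fst (Q ! a))"
proof -
  assume "a < length Q"
  then have "Q ! a \<in> set Q" by simp
  then show ?thesis using wfQ unfolding wf_query_def by (simp add: case_prod_beta)
qed

lemma reach_wf: "reach T \<Longrightarrow> T < nrel"
proof (induction rule: reach.induct)
  case (reach_atom T vs)
  then show ?case using wfQ unfolding wf_query_def by fast
qed (use uid_wf in blast)

lemma const_wf: "const_pos R p \<Longrightarrow> p < ar R"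
  by (induction rule: const_pos.induct) (simp_all add: fd_wf uid_wf)

lemma up_wf: "((R, i), (T, j)) \<in> up \<Longrightarrow> i < ar R \<Longrightarrow> j < ar T"
  by (induction rule: up_induct) (blast dest: uid_wf)+

lemma reach_up: "((R, i), (T, j)) \<in> up \<Longrightarrow> reach R \<Longrightarrow> reach T"
  by (induction rule: up_induct) (blast intro: reach_uid)+

lemma rel2_up: "((R, i), (T, j)) \<in> up \<Longrightarrow> rel2 R \<Longrightarrow> rel2 T"
  by (induction rule: up_induct) (blast intro: rel2_uid)+

lemma const_up: "((R, i), (T, j)) \<in> up \<Longrightarrow> const_pos T j \<Longrightarrow> const_pos R i"
  by (induction rule: up_induct_back) (blast intro: const_uid)+

lemma rel2_reach: "rel2 T \<Longrightarrow> reach T"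
  by (induction rule: sim_kn_rel2.inducts(3)[where ?P1.0 = "\<lambda>_ _. True" and ?P2.0 = "\<lambda>_. True"])
    (blast intro: reach_uid bok_reach)+

lemma rel2_wf: "rel2 T \<Longrightarrow> T < nrel"
  using rel2_reach reach_wf by blast

end

section \<open>Instances, homomorphisms and accesses\<close>

locale model = wf_problem S Q for S Q +
  fixes I :: "'v inst"
  assumes Iok: "inst_ok S I" and Isat: "satisfies S I"
begin

lemma len: "(T, u) \<in> I \<Longrightarrow> length u = ar T"
  using Iok unfolding inst_ok_def by fast

lemma uid: "(R, t) \<in> I \<Longrightarrow> U R i T j \<Longrightarrow> \<exists>u. (T, u) \<in> I \<and> u ! j = t ! i"
  using Isat unfolding satisfies_def sat_uid_def by fast

lemma fd: "(R, D, j) \<in> set (fds S) \<Longrightarrow> (R, t) \<in> I \<Longrightarrow> (R, u) \<in> I \<Longrightarrow>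
   (\<And>d. d \<in> set D \<Longrightarrow> t ! d = u ! d) \<Longrightarrow> t ! j = u ! j"
  using Isat unfolding satisfies_def sat_fd_def by fast

lemma up_uid: "((R, i), (T, j)) \<in> up \<Longrightarrow> (R, t) \<in> I \<Longrightarrow> \<exists>u. (T, u) \<in> I \<and> u ! j = t ! i"
proof (induction rule: up_induct)
  case refl
  then show ?case by blast
next
  case (step T j T' j')
  then obtain u where u: "(T, u) \<in> I" "u ! j = t ! i" by blast
  then show ?case using uid[OF u(1) \<open>U T j T' j'\<close>] by simp
qed

lemma const_unique: "const_pos R p \<Longrightarrow> (R, t) \<in> I \<Longrightarrow> (R, u) \<in> I \<Longrightarrow> t ! p = u ! p"
proof (induction arbitrary: t u rule: const_pos.induct)
  case (const_fd R D j)
  then show ?case using fd by metis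
next
  case (const_uid R i T j)
  obtain t' u' where "(T, t') \<in> I" "t' ! j = t ! i" "(T, u') \<in> I" "u' ! j = u ! i"
    using uid const_uid by metis
  then show ?case using const_uid by metis
qed

lemma fdcl_agree: "fdcl R X p \<Longrightarrow> (R, t) \<in> I \<Longrightarrow> (R, u) \<in> I \<Longrightarrow> (\<And>x. x \<in> X \<Longrightarrow> t ! x = u ! x) \<Longrightarrow> t ! p = u ! p"
proof (induction rule: fdcl.induct)
  case (fdcl_const p)
  then show ?case using const_unique by blast
next
  case (fdcl_fd D j)
  then show ?case using fd by metis
qed auto

text \<open>Truth of the query is not assumed: \<open>rel2\<close> is generated by usable accesses
  and UIDs alone, so a fact for every usable access suffices. This is what soundness of a
  certificate relies on.\<close>

lemma rel2_inhabited:
  assumes "rel2 T" "\<And>f m. usable f m \<Longrightarrow> \<exists>u. (brel f, u) \<in> I"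
  shows "\<exists>u. (T, u) \<in> I"
  using assms(1)
proof (induction rule: sim_kn_rel2.inducts(3)[where ?P1.0 = "\<lambda>_ _. True" and ?P2.0 = "\<lambda>_. True"])
  case (rel2_kn f m)
  then show ?case using assms(2)[of f m] unfolding usable_def by blast
next
  case (rel2_uid R i T j)
  then show ?case using uid by blast
qed auto

end

definition vals :: "(nat \<Rightarrow> 'v inst) \<Rightarrow> nat \<Rightarrow> 'v set" where
  "vals K t = (\<Union>(R, u)\<in>K t. set u)"

text \<open>Plans are abstracted to a growing family of subsets of \<open>I\<close> in which every
  access with values of stage \<open>t\<close> has been answered by stage
  \<open>t + 1\<close>.\<close>

locale access_run = model S Q I for S Q and I :: "'v inst" +
  fixes K :: "nat \<Rightarrow> 'v inst"
  assumes K_sub: "K t \<subseteq> I" and K_mono: "K t \<subseteq> K (Suc t)"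
    and K_access: "m < length (methods S) \<Longrightarrow> length b = length (problem.mins S m) \<Longrightarrow> set b \<subseteq> vals K t \<Longrightarrow>
      \<exists>J. valid_output (matching I (problem.mrel S m) (problem.mins S m) b) (problem.mbound S m) J
         \<and> (\<forall>u\<in>J. (problem.mrel S m, u) \<in> K (Suc t))"
begin

lemma K_le: "s \<le> t \<Longrightarrow> K s \<subseteq> K t"
  using K_mono by (rule lift_Suc_mono_le)

lemma vals_le: "s \<le> t \<Longrightarrow> vals K s \<subseteq> vals K t"
  unfolding vals_def using K_le[of s t] by blast

lemma vals_nth: "(R, u) \<in> K t \<Longrightarrow> p < ar R \<Longrightarrow> u ! p \<in> vals K t"
proof -
  assume a: "(R, u) \<in> K t" "p < ar R"
  then have "length u = ar R" using len K_sub by blast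
  then have "u ! p \<in> set u" using a by simp
  then show ?thesis unfolding vals_def using a by blast
qed

text \<open>Under a bound the particular fact \<open>u\<close> may be withheld, but the bound is
  positive, so some match is returned, and any match agrees with \<open>u\<close> on the FD closure
  of the inputs.\<close>

lemma access:
  assumes "m < nmeth" "(mrel m, u) \<in> I" "\<And>p. p \<in> set (mins m) \<Longrightarrow> u ! p \<in> vals K t"
  shows "\<exists>w. (mrel m, w) \<in> K (Suc t) \<and> (\<forall>p<ar (mrel m). det m p \<longrightarrow> w ! p = u ! p)"
proof -
  let ?b = "map (\<lambda>p. u ! p) (mins m)"
  let ?M = "matching I (mrel m) (mins m) ?b"
  have "set ?b \<subseteq> vals K t" using assms(3) by auto
  then obtain J where J: "valid_output ?M (mbound m) J" "\<forall>u\<in>J. (mrel m, u) \<in> K (Suc t)"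
    using K_access[OF assms(1), of ?b t] by auto
  have uM: "u \<in> ?M" using assms(2) by (simp add: matching_def)
  show ?thesis
  proof (cases "mbound m")
    case None
    then have "u \<in> J" using J(1) uM unfolding valid_output_def by simp
    then show ?thesis using J(2) by blast
  next
    case (Some k)
    have k: "0 < k" using meth_wf assms(1) Some by blast
    have "\<exists>A\<subseteq>?M. finite A \<and> card A = 1" using uM by (intro exI[of _ "{u}"]) simp
    then have "1 \<le> card J" using J(1) Some k unfolding valid_output_def by auto
    then obtain w where w: "w \<in> J" by (metis card.empty equals0I not_one_le_zero)
    then have wM: "w \<in> ?M" using J(1) unfolding valid_output_def by auto
    have "w ! p = u ! p" if "det m p" for p
    proof -
      have "fdcl (mrel m) (set (mins m)) p" using that Some unfolding det_def by simp
      then show ?thesis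
      proof (rule fdcl_agree)
        fix x assume "x \<in> set (mins m)"
        then show "w ! x = u ! x" using wM unfolding matching_def by (auto simp: in_set_conv_nth)
      qed (use wM assms(2) in \<open>auto simp: matching_def\<close>)
    qed
    then show ?thesis using w J(2) by blast
  qed
qed

end

section \<open>Homomorphisms from the names into an instance\<close>

context problem
begin

definition tuple :: "(nm \<Rightarrow> 'v) \<Rightarrow> bid \<Rightarrow> 'v list" where
  "tuple h f = map (\<lambda>p. h (bnm f p)) [0..<ar (brel f)]"

text \<open>In a model of the query both constants of a position are the same value; the two names
  are distinguished only by how much is assumed in order to derive equalities about them.\<close>

definition hom :: "'v inst \<Rightarrow> (nm \<Rightarrow> 'v) \<Rightarrow> bool" where
  "hom I h \<longleftrightarrow> (\<forall>f. bok f \<longrightarrow> (brel f, tuple h f) \<in> I) \<and>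
     (\<forall>T p. reach T \<longrightarrow> const_pos T p \<longrightarrow> h (G2 T p) = h (Ge T p))"

text \<open>From stage \<open>s\<close> on, \<open>h\<close> sends each \<open>Kn T q\<close> to a fact whose \<open>q\<close>-th value has been retrieved as soon
  as there is such a fact.\<close>

definition anchored :: "'v inst \<Rightarrow> (nat \<Rightarrow> 'v inst) \<Rightarrow> nat \<Rightarrow> (nm \<Rightarrow> 'v) \<Rightarrow> bool" where
  "anchored I K s h \<longleftrightarrow> hom I h \<and> (\<forall>s'\<ge>s. \<forall>T q u. reach T \<longrightarrow> q < ar T \<longrightarrow> (T, u) \<in> I \<longrightarrow> u ! q \<in> vals K s' \<longrightarrow>
     h (Kg T q q) \<in> vals K s')"

text \<open>The fact behind \<open>Gn T\<close> is arbitrary, so any \<open>T\<close>-fact may be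
  put in its place. This turns knowledge of \<open>Ge T p\<close> into knowledge of position
  \<open>p\<close> of every \<open>T\<close>-fact.\<close>

definition set_gen :: "nat \<Rightarrow> 'v list \<Rightarrow> (nm \<Rightarrow> 'v) \<Rightarrow> nm \<Rightarrow> 'v" where
  "set_gen T u h n = (case n of Ge T' p \<Rightarrow> if T' = T then u ! p else h n | _ \<Rightarrow> h n)"

definition set_kg :: "nat \<Rightarrow> nat \<Rightarrow> 'v list \<Rightarrow> (nm \<Rightarrow> 'v) \<Rightarrow> nm \<Rightarrow> 'v" where
  "set_kg T q u h n = (case n of Kg T' q' p \<Rightarrow> if T' = T \<and> q' = q then u ! p else h n | _ \<Rightarrow> h n)"

lemma tuple_nth [simp]: "p < ar (brel f) \<Longrightarrow> tuple h f ! p = h (bnm f p)"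
  by (simp add: tuple_def)

lemma hom_fact: "hom I h \<Longrightarrow> bok f \<Longrightarrow> (brel f, tuple h f) \<in> I"
  by (simp add: hom_def)

end

context model
begin

text \<open>\<open>G2\<close> is tied to \<open>Ge\<close> only on reachable relations, so the
  induction carries \<open>reach\<close> in the place of \<open>rel2\<close>.\<close>

lemma hom_sim:
  assumes "hom I h" shows "sim a b \<Longrightarrow> h a = h b"
proof (induction rule: sim_kn_rel2.inducts(1)[where ?P2.0 = "\<lambda>_. True" and ?P3.0 = reach])
  case (sim_fd f g R D j)
  have j: "j < ar R" "\<And>d. d \<in> set D \<Longrightarrow> d < ar R" using fd_wf sim_fd by blast+
  show ?case using fd[OF sim_fd(5), of "tuple h f" "tuple h g"] hom_fact[OF assms] sim_fd j
    by (metis tuple_nth)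
next
  case (sim_uid f i T j)
  have T: "bok (Gn T)" using reach_uid[OF bok_reach[OF sim_uid(1)] sim_uid(2)] by simp
  obtain u where u: "(T, u) \<in> I" "u ! j = tuple h f ! i" using uid hom_fact[OF assms] sim_uid by blast
  have "u ! j = tuple h (Gn T) ! j"
    using const_unique[OF sim_uid(3) u(1), of "tuple h (Gn T)"] hom_fact[OF assms T] by simp
  then show ?case using u uid_wf[OF sim_uid(2)] by simp
next
  case (sim_kn f m p)
  have T: "bok (Gn (brel f))" using bok_reach sim_kn by simp
  have "tuple h f ! p = tuple h (Gn (brel f)) ! p"
    using const_unique[OF sim_kn(6), of "tuple h f" "tuple h (Gn (brel f))"] hom_fact[OF assms] sim_kn(1) T by fastforce
  then show ?case using sim_kn assms bok_reach unfolding hom_def by simp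
next
  case (sim_uid2 R i T j)
  then have T: "bok (Gn T)" "bok (Gn R)" "const_pos R i" using reach_uid const_uid by auto
  obtain u where u: "(T, u) \<in> I" "u ! j = tuple h (Gn R) ! i"
    using uid[of R "tuple h (Gn R)"] hom_fact[OF assms T(2)] sim_uid2 by fastforce
  have "u ! j = tuple h (Gn T) ! j"
    using const_unique[OF sim_uid2(4) u(1), of "tuple h (Gn T)"] hom_fact[OF assms T(1)] by simp
  then have "h (Ge R i) = h (Ge T j)" using u uid_wf[OF sim_uid2(3)] by simp
  then show ?case using T sim_uid2 assms unfolding hom_def by simp
qed (auto intro: bok_reach reach_uid)

lemma set_gen_hom:
  assumes h: "hom I h" and u: "(T, u) \<in> I" and T: "reach T"
  shows "hom I (set_gen T u h)"
  unfolding hom_def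
proof (intro conjI allI impI)
  fix f assume f: "bok f"
  show "(brel f, tuple (set_gen T u h) f) \<in> I"
  proof (cases "f = Gn T")
    case True
    then have "tuple (set_gen T u h) f = u"
      using len[OF u] by (auto simp: tuple_def set_gen_def intro: nth_equalityI)
    then show ?thesis using True u by simp
  next
    case False
    then have "tuple (set_gen T u h) f = tuple h f"
      by (cases f) (auto simp: tuple_def set_gen_def)
    then show ?thesis using hom_fact[OF h f] by simp
  qed
next
  fix T' p assume a: "reach T'" "const_pos T' p"
  \<comment> \<open>Exchanging the generic fact does not change its constants, so the tie between
    \<open>G2\<close> and \<open>Ge\<close> survives.\<close>
  have "u ! p = h (Ge T p)" if "T' = T"
    using const_unique[of T p u "tuple h (Gn T)"] u hom_fact[OF h, of "Gn T"] a that const_wf[OF a(2)] by simp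
  then show "set_gen T u h (G2 T' p) = set_gen T u h (Ge T' p)"
    using h a unfolding hom_def by (auto simp: set_gen_def)
qed

lemma set_kg_hom:
  assumes h: "hom I h" and u: "(T, u) \<in> I"
  shows "hom I (set_kg T q u h)"
  unfolding hom_def
proof (intro conjI allI impI)
  fix f assume f: "bok f"
  show "(brel f, tuple (set_kg T q u h) f) \<in> I"
  proof (cases "f = Kn T q")
    case True
    then have "tuple (set_kg T q u h) f = u"
      using len[OF u] by (auto simp: tuple_def set_kg_def intro: nth_equalityI)
    then show ?thesis using True u by simp
  next
    case False
    then have "tuple (set_kg T q u h) f = tuple h f"
      by (cases f) (auto simp: tuple_def set_kg_def)
    then show ?thesis using hom_fact[OF h f] by simp
  qed
next
  fix T' p assume a: "reach T'" "const_pos T' p"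
  then show "set_kg T q u h (G2 T' p) = set_kg T q u h (Ge T' p)"
    using h unfolding hom_def by (auto simp: set_kg_def)
qed

lemma reach_inhabited: "cq_holds Q I \<Longrightarrow> reach T \<Longrightarrow> \<exists>u. (T, u) \<in> I"
proof -
  assume "cq_holds Q I"
  then obtain h where h: "\<forall>(R, vs)\<in>set Q. (R, map h vs) \<in> I" unfolding cq_holds_def by blast
  show "reach T \<Longrightarrow> ?thesis"
  proof (induction rule: reach.induct)
    case (reach_atom T vs)
    then show ?case using h by blast
  next
    case (reach_uid R i T j)
    then show ?case using uid by blast
  qed
qed

end

context access_run
begin

text \<open>For each position choose a fact whose value there is retrieved at the earliest possible
  stage; it is then retrieved by every stage at which some value of that position is.\<close>

lemma anchored_exists:
  assumes "cq_holds Q I" shows "\<exists>h. anchored I K 0 h"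
proof -
  obtain h0 where h0: "\<forall>(R, vs)\<in>set Q. (R, map h0 vs) \<in> I" using assms unfolding cq_holds_def by blast
  obtain g where g: "\<And>T. reach T \<Longrightarrow> (T, g T) \<in> I" using reach_inhabited[OF assms] by metis
  have "\<exists>u. (T, u) \<in> I \<and> (\<forall>s v. (T, v) \<in> I \<longrightarrow> v ! q \<in> vals K s \<longrightarrow> u ! q \<in> vals K s)" if T: "reach T" for T q
  proof (cases "\<exists>s v. (T, v) \<in> I \<and> v ! q \<in> vals K s")
    case True
    define s where "s = (LEAST s. \<exists>v. (T, v) \<in> I \<and> v ! q \<in> vals K s)"
    have "\<exists>v. (T, v) \<in> I \<and> v ! q \<in> vals K s" unfolding s_def using True by (rule LeastI_ex)
    then obtain u where u: "(T, u) \<in> I" "u ! q \<in> vals K s" by blast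
    have "u ! q \<in> vals K s'" if "(T, v) \<in> I" "v ! q \<in> vals K s'" for s' v
    proof -
      have "s \<le> s'" unfolding s_def using that by (intro Least_le) blast
      then show ?thesis using vals_le u by blast
    qed
    then show ?thesis using u by blast
  qed (use g T in blast)
  then obtain k where k: "\<And>T q. reach T \<Longrightarrow> (T, k T q) \<in> I"
    "\<And>T q s v. reach T \<Longrightarrow> (T, v) \<in> I \<Longrightarrow> v ! q \<in> vals K s \<Longrightarrow> k T q ! q \<in> vals K s"
    by metis
  define h where "h = (\<lambda>n. case n of Va x \<Rightarrow> h0 x | Ge T p \<Rightarrow> g T ! p | Kg T q p \<Rightarrow> k T q ! p | G2 T p \<Rightarrow> g T ! p)"
  have "(brel f, tuple h f) \<in> I" if f: "bok f" for f
  proof (cases f)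
    case (At a)
    obtain R vs where q: "Q ! a = (R, vs)" by (cases "Q ! a")
    have "(R, vs) \<in> set Q" using f At q by (metis bok.simps(1) nth_mem)
    then have "(R, map h0 vs) \<in> I" using h0 by blast
    moreover have "tuple h f = map h0 vs" using At f q query_wf[of a]
      by (auto simp: tuple_def h_def intro: nth_equalityI)
    ultimately show ?thesis using At q by simp
  next
    case (Gn T)
    then have "tuple h f = g T" using len[OF g[of T]] f by (auto simp: tuple_def h_def intro: nth_equalityI)
    then show ?thesis using Gn g f by simp
  next
    case (Kn T q)
    then have "tuple h f = k T q" using len[OF k(1)[of T q]] f by (auto simp: tuple_def h_def intro: nth_equalityI)
    then show ?thesis using Kn k f by simp
  qed
  then have "hom I h" unfolding hom_def by (simp add: h_def)
  then have "anchored I K 0 h" unfolding anchored_def using k(2) by (simp add: h_def)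
  then show ?thesis by blast
qed

lemma anchoredD:
  "anchored I K s h \<Longrightarrow> reach T \<Longrightarrow> q < ar T \<Longrightarrow> (T, u) \<in> I \<Longrightarrow> u ! q \<in> vals K s' \<Longrightarrow> s \<le> s' \<Longrightarrow> h (Kg T q q) \<in> vals K s'"
  unfolding anchored_def by blast

lemma anchored_gen:
  "anchored I K s h \<Longrightarrow> (T, u) \<in> I \<Longrightarrow> reach T \<Longrightarrow> anchored I K s (set_gen T u h)"
  unfolding anchored_def using set_gen_hom[of h T u] by (simp add: set_gen_def)

text \<open>The new representative is known to be retrieved only from stage \<open>s'\<close> on,
  hence the anchor moves from \<open>s\<close> to \<open>s'\<close>.\<close>

lemma anchored_kg:
  "anchored I K s h \<Longrightarrow> (T, u) \<in> I \<Longrightarrow> u ! q \<in> vals K s' \<Longrightarrow> s \<le> s' \<Longrightarrow> anchored I K s' (set_kg T q u h)"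
  unfolding anchored_def using set_kg_hom[of h T u q] vals_le[of s'] by (auto simp: set_kg_def)

end

section \<open>Knowable values are retrieved after uniformly many rounds\<close>

context wf_problem
begin

lemma uniform_stage:
  fixes P :: "'a \<Rightarrow> nat \<Rightarrow> bool"
  assumes "finite X" "\<And>x. x \<in> X \<Longrightarrow> \<exists>t. P x t" "\<And>x s t. P x s \<Longrightarrow> s \<le> t \<Longrightarrow> P x t"
  shows "\<exists>t. \<forall>x\<in>X. P x t"
proof -
  obtain g where g: "\<And>x. x \<in> X \<Longrightarrow> P x (g x)" using assms(2) by metis
  have "P x (Max (g ` X))" if "x \<in> X" for x
    using g[OF that] assms(3) assms(1) that by (meson Max_ge finite_imageI imageI)
  then show ?thesis by blast
qed

text \<open>A plan has a fixed length, so the number \<open>t\<close> of stages must not depend on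
  the instance. Starting stage and homomorphism are quantified as well, because the induction on
  \<open>kn\<close> begins again at later stages and with other facts behind the generic
  names.\<close>

definition retrieved :: "'v itself \<Rightarrow> nm \<Rightarrow> nat \<Rightarrow> bool" where
  "retrieved _ n t \<longleftrightarrow> (\<forall>(I :: 'v inst) K s h. access_run S Q I K \<longrightarrow> anchored I K s h \<longrightarrow> h n \<in> vals K (s + t))"

lemma retrieved_mono: "retrieved V n s \<Longrightarrow> s \<le> t \<Longrightarrow> retrieved V n t"
  unfolding retrieved_def by (meson access_run.vals_le add_left_mono subsetD)

lemma retrieved_ins:
  assumes "\<And>p. p \<in> set (mins m) \<Longrightarrow> \<exists>t. retrieved V (bnm f p) t"
  shows "\<exists>t. \<forall>p\<in>set (mins m). retrieved V (bnm f p) t"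
  using uniform_stage[of "set (mins m)" "\<lambda>p. retrieved V (bnm f p)"] assms retrieved_mono by blast

lemma retrieved_access:
  assumes "bok f" "m < nmeth" "mrel m = brel f" "\<And>p. p \<in> set (mins m) \<Longrightarrow> retrieved TYPE('v) (bnm f p) t"
    and r: "access_run S Q (I :: 'v inst) K" and h: "anchored I K s h"
  shows "\<exists>w. (brel f, w) \<in> K (Suc (s + t)) \<and> (\<forall>p<ar (brel f). det m p \<longrightarrow> w ! p = h (bnm f p))"
proof -
  have "(brel f, tuple h f) \<in> I" using h assms(1) hom_fact unfolding anchored_def by blast
  moreover have "tuple h f ! p \<in> vals K (s + t)" if "p \<in> set (mins m)" for p
    using assms(4)[OF that] r h meth_wf[OF assms(2)] that assms(3) unfolding retrieved_def by simp
  ultimately show ?thesis using access_run.access[OF r assms(2), of "tuple h f" "s + t"] assms(3) by simp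
qed

lemma kn_retrieved: "kn n \<Longrightarrow> \<exists>t. retrieved TYPE('v) n t"
proof (induction rule: sim_kn_rel2.inducts(2)[where ?P1.0 = sim and ?P3.0 = "\<lambda>_. True"])
  case (kn_sim a b)
  then obtain t where t: "retrieved TYPE('v) a t" by blast
  have "retrieved TYPE('v) b t" unfolding retrieved_def
  proof (intro allI impI)
    fix I :: "'v inst" and K s h assume r: "access_run S Q I K" and h: "anchored I K s h"
    interpret access_run S Q I K by (rule r)
    have "h a = h b" using hom_sim h kn_sim unfolding anchored_def by blast
    then show "h b \<in> vals K (s + t)" using t r h unfolding retrieved_def by metis
  qed
  then show ?case by blast
next
  case (kn_det f m p)
  then obtain t where t: "\<forall>p\<in>set (mins m). retrieved TYPE('v) (bnm f p) t" using retrieved_ins by blast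
  have "retrieved TYPE('v) (bnm f p) (Suc t)" unfolding retrieved_def
  proof (intro allI impI)
    fix I :: "'v inst" and K s h assume r: "access_run S Q I K" and h: "anchored I K s h"
    interpret access_run S Q I K by (rule r)
    obtain w where "(brel f, w) \<in> K (Suc (s + t))" "\<forall>p<ar (brel f). det m p \<longrightarrow> w ! p = h (bnm f p)"
      using retrieved_access[OF kn_det(1-3) _ r h] t by blast
    then show "h (bnm f p) \<in> vals K (s + Suc t)" using vals_nth kn_det by (metis add_Suc_right)
  qed
  then show ?case by blast
next
  case (kn_gen f p)
  then obtain t where t: "retrieved TYPE('v) (Ge (brel f) p) t" by blast
  have "retrieved TYPE('v) (bnm f p) t" unfolding retrieved_def
  proof (intro allI impI)
    fix I :: "'v inst" and K s h assume r: "access_run S Q I K" and h: "anchored I K s h"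
    interpret access_run S Q I K by (rule r)
    have "(brel f, tuple h f) \<in> I" using h kn_gen hom_fact unfolding anchored_def by blast
    \<comment> \<open>The fact of \<open>f\<close> itself takes the role of the generic fact, and
      the hypothesis is applied to the changed homomorphism.\<close>
    then have "anchored I K s (set_gen (brel f) (tuple h f) h)" using anchored_gen h bok_reach kn_gen by blast
    then have "set_gen (brel f) (tuple h f) h (Ge (brel f) p) \<in> vals K (s + t)" using t r unfolding retrieved_def by blast
    then show "h (bnm f p) \<in> vals K (s + t)" using kn_gen by (simp add: set_gen_def)
  qed
  then show ?case by blast
next
  case (kn_uid f i T j)
  then obtain t where t: "retrieved TYPE('v) (Ge T j) t" by blast
  have "retrieved TYPE('v) (bnm f i) t" unfolding retrieved_def
  proof (intro allI impI)
    fix I :: "'v inst" and K s h assume r: "access_run S Q I K" and h: "anchored I K s h"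
    interpret access_run S Q I K by (rule r)
    have "(brel f, tuple h f) \<in> I" using h kn_uid hom_fact unfolding anchored_def by blast
    then obtain u where u: "(T, u) \<in> I" "u ! j = tuple h f ! i" using uid kn_uid by blast
    have "anchored I K s (set_gen T u h)" using anchored_gen h bok_reach kn_uid u reach_uid by blast
    then have "set_gen T u h (Ge T j) \<in> vals K (s + t)" using t r unfolding retrieved_def by blast
    then show "h (bnm f i) \<in> vals K (s + t)" using u uid_wf[OF kn_uid(2)] by (simp add: set_gen_def)
  qed
  then show ?case by blast
next
  case (kn_rel f q p)
  then obtain t1 t2 where t: "retrieved TYPE('v) (bnm f q) t1" "retrieved TYPE('v) (Kg (brel f) q p) t2" by blast
  have "retrieved TYPE('v) (bnm f p) (t1 + t2)" unfolding retrieved_def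
  proof (intro allI impI)
    fix I :: "'v inst" and K s h assume r: "access_run S Q I K" and h: "anchored I K s h"
    interpret access_run S Q I K by (rule r)
    have f: "(brel f, tuple h f) \<in> I" using h kn_rel hom_fact unfolding anchored_def by blast
    have "tuple h f ! q \<in> vals K (s + t1)" using t(1) r h kn_rel(3) kn_rel unfolding retrieved_def by simp
    \<comment> \<open>From stage \<open>s + t1\<close> on the value at \<open>q\<close> is
      retrieved, so the fact of \<open>f\<close> may stand for \<open>Kn\<close>; the remaining
      \<open>t2\<close> stages are counted from there.\<close>
    then have "anchored I K (s + t1) (set_kg (brel f) q (tuple h f) h)" using anchored_kg[OF h f] by simp
    then have "set_kg (brel f) q (tuple h f) h (Kg (brel f) q p) \<in> vals K (s + t1 + t2)"
      using t(2) r unfolding retrieved_def by blast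
    then show "h (bnm f p) \<in> vals K (s + (t1 + t2))" using kn_rel by (simp add: set_kg_def add.assoc)
  qed
  then show ?case by blast
next
  case (kn_self f p)
  then obtain t where t: "retrieved TYPE('v) (bnm f p) t" by blast
  have "retrieved TYPE('v) (Kg (brel f) p p) t" unfolding retrieved_def
  proof (intro allI impI)
    fix I :: "'v inst" and K s h assume r: "access_run S Q I K" and h: "anchored I K s h"
    interpret access_run S Q I K by (rule r)
    have f: "(brel f, tuple h f) \<in> I" using h kn_self hom_fact unfolding anchored_def by blast
    have "tuple h f ! p \<in> vals K (s + t)" using t r h kn_self unfolding retrieved_def by simp
    then show "h (Kg (brel f) p p) \<in> vals K (s + t)"
      using anchoredD[OF h bok_reach[OF kn_self(1)] kn_self(2) f] by simp
  qed
  then show ?case by blast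
next
  case (kn_step f i T j)
  then obtain t where t: "retrieved TYPE('v) (bnm f i) t" by blast
  have "retrieved TYPE('v) (Kg T j j) t" unfolding retrieved_def
  proof (intro allI impI)
    fix I :: "'v inst" and K s h assume r: "access_run S Q I K" and h: "anchored I K s h"
    interpret access_run S Q I K by (rule r)
    have f: "(brel f, tuple h f) \<in> I" using h kn_step hom_fact unfolding anchored_def by blast
    then obtain u where u: "(T, u) \<in> I" "u ! j = tuple h f ! i" using uid kn_step by blast
    have "u ! j \<in> vals K (s + t)" using t r h u uid_wf[OF kn_step(2)] unfolding retrieved_def by simp
    then show "h (Kg T j j) \<in> vals K (s + t)"
      using anchoredD[OF h _ _ u(1)] uid_wf[OF kn_step(2)] reach_uid[OF bok_reach[OF kn_step(1)] kn_step(2)] by simp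
  qed
  then show ?case by blast
next
  case (kn_all f m q)
  then obtain t where t: "\<forall>p\<in>set (mins m). retrieved TYPE('v) (bnm f p) t" using retrieved_ins by blast
  have "retrieved TYPE('v) (Kg (brel f) q q) (Suc t)" unfolding retrieved_def
  proof (intro allI impI)
    fix I :: "'v inst" and K s h assume r: "access_run S Q I K" and h: "anchored I K s h"
    interpret access_run S Q I K by (rule r)
    obtain w where w: "(brel f, w) \<in> K (Suc (s + t))"
      using retrieved_access[OF kn_all(1-3) _ r h] t by blast
    then have "w ! q \<in> vals K (Suc (s + t))" using vals_nth kn_all by blast
    then show "h (Kg (brel f) q q) \<in> vals K (s + Suc t)"
      using anchoredD[OF h bok_reach[OF kn_all(1)] \<open>q < ar (brel f)\<close>] w K_sub by (metis add_Suc_right le_add1 subsetD)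
  qed
  then show ?case by blast
qed (auto intro: sim_kn_rel2.intros)

end

section \<open>The query of retrieved facts\<close>

text \<open>Variables of the query of retrieved facts. \<open>EN\<close> is a class of names and may
  be shared by several facts, whereas \<open>EC\<close> and \<open>EF\<close> are private to one
  copied or followed fact.\<close>

datatype en = EN nm | EC bid nat nat | EF bid nat nat nat nat

context problem
begin

text \<open>\<open>sim\<close> is reflexive only on names that occur, so the representative is
  meaningful only for these.\<close>

definition "rep n = (SOME n'. sim n n')"

definition "copy_fact f m = (brel f, map (\<lambda>p. if det m p then EN (rep (bnm f p)) else EC f m p) [0..<ar (brel f)])"

definition "follow_fact f i T q = (T, map (\<lambda>p. if p = q then EN (rep (bnm f i)) else EF f i T q p) [0..<ar T])"

definition follows :: "bid \<Rightarrow> nat \<Rightarrow> nat \<Rightarrow> nat \<Rightarrow> bool" where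
  "follows f i T q \<longleftrightarrow> bok f \<and> i < ar (brel f) \<and> kn (bnm f i) \<and> ((brel f, i), (T, q)) \<in> up \<and> q < ar T \<and> follow T q"

definition EQ :: "(nat \<times> en list) set" where
  "EQ = {copy_fact f m | f m. usable f m} \<union> {follow_fact f i T q | f i T q. follows f i T q}"

lemma rep_sim: "sim a b \<Longrightarrow> rep a = rep b"
proof -
  assume h: "sim a b"
  have "sim a = sim b" using sim_trans[OF sim_sym[OF h]] sim_trans[OF h] by blast
  then show ?thesis by (simp add: rep_def)
qed

lemma sim_rep: "sim a b \<Longrightarrow> sim a (rep a)"
  unfolding rep_def by (rule someI)

lemma sim_rep_base: "bok f \<Longrightarrow> p < ar (brel f) \<Longrightarrow> sim (bnm f p) (rep (bnm f p))"
  using sim_rep sim_base by blast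

lemma rep_eq_sim:
  assumes "sim a a'" "sim b b'" "rep a = rep b" shows "sim a b"
  using sim_trans[OF sim_rep[OF assms(1)]] sim_sym[OF sim_rep[OF assms(2)]] assms(3) by simp

lemma kn_rep: "bok f \<Longrightarrow> p < ar (brel f) \<Longrightarrow> kn (rep (bnm f p)) \<longleftrightarrow> kn (bnm f p)"
  using sim_rep_base kn_sim sim_sym by blast

end

section \<open>Every model of the query matches the query of retrieved facts\<close>

context wf_problem
begin

lemma finite_bok: "finite {f. bok f}"
proof (rule finite_subset)
  show "{f. bok f} \<subseteq> At ` {..<length Q} \<union> Gn ` {..<nrel} \<union> (\<lambda>(T, q). Kn T q) ` (SIGMA T:{..<nrel}. {..<ar T})"
  proof
    fix f assume "f \<in> {f. bok f}"
    then show "f \<in> At ` {..<length Q} \<union> Gn ` {..<nrel} \<union> (\<lambda>(T, q). Kn T q) ` (SIGMA T:{..<nrel}. {..<ar T})"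
      using reach_wf by (cases f) force+
  qed
qed auto

lemma finite_usable: "finite {(f, m). usable f m}"
  by (rule finite_subset[of _ "{f. bok f} \<times> {..<nmeth}"]) (auto simp: usable_def finite_bok)

lemma finite_follows: "finite {(f, i, T, q). follows f i T q}"
proof -
  have fin: "finite (SIGMA f:{f. bok f}. SIGMA i:{..<ar (brel f)}. SIGMA T:{..<nrel}. {..<ar T})"
    using finite_bok by (intro finite_SigmaI) auto
  have "{(f, i, T, q). follows f i T q} \<subseteq> (SIGMA f:{f. bok f}. SIGMA i:{..<ar (brel f)}. SIGMA T:{..<nrel}. {..<ar T})"
    using reach_up bok_reach reach_wf unfolding follows_def by fastforce
  then show ?thesis using fin finite_subset by blast
qed

lemma finite_EQ: "finite EQ"
proof -
  have "EQ = (\<lambda>(f, m). copy_fact f m) ` {(f, m). usable f m} \<union>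
     (\<lambda>(f, i, T, q). follow_fact f i T q) ` {(f, i, T, q). follows f i T q}"
    unfolding EQ_def by (auto simp: image_iff) blast+
  then show ?thesis using finite_usable finite_follows by simp
qed

definition copied :: "'v itself \<Rightarrow> bid \<times> nat \<Rightarrow> nat \<Rightarrow> bool" where
  "copied _ x t \<longleftrightarrow> (\<forall>(I :: 'v inst) K h. access_run S Q I K \<longrightarrow> anchored I K 0 h \<longrightarrow>
     (\<exists>w. (brel (fst x), w) \<in> K t \<and> (\<forall>p<ar (brel (fst x)). det (snd x) p \<longrightarrow> w ! p = h (bnm (fst x) p))))"

definition followed :: "'v itself \<Rightarrow> bid \<times> nat \<times> nat \<times> nat \<Rightarrow> nat \<Rightarrow> bool" where
  "followed _ x t \<longleftrightarrow> (case x of (f, i, T, q) \<Rightarrow> \<forall>(I :: 'v inst) K h. access_run S Q I K \<longrightarrow> anchored I K 0 h \<longrightarrow>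
     (\<exists>w. (T, w) \<in> K t \<and> w ! q = h (bnm f i)))"

lemma usable_copied:
  assumes "usable f m" shows "\<exists>t. copied TYPE('v) (f, m) t"
proof -
  have a: "bok f" "m < nmeth" "mrel m = brel f" "\<And>p. p \<in> set (mins m) \<Longrightarrow> kn (bnm f p)"
    using assms unfolding usable_def by auto
  obtain t where t: "\<forall>p\<in>set (mins m). retrieved TYPE('v) (bnm f p) t"
    using retrieved_ins kn_retrieved a(4) by metis
  have "copied TYPE('v) (f, m) (Suc t)"
    unfolding copied_def
  proof (intro allI impI)
    fix I :: "'v inst" and K h assume r: "access_run S Q I K" and h: "anchored I K 0 h"
    show "\<exists>w. (brel (fst (f, m)), w) \<in> K (Suc t) \<and> (\<forall>p<ar (brel (fst (f, m))). det (snd (f, m)) p \<longrightarrow> w ! p = h (bnm (fst (f, m)) p))"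
      using retrieved_access[OF a(1-3) _ r h, of t] t by simp
  qed
  then show ?thesis by blast
qed

lemma follows_followed:
  assumes "follows f i T q" shows "\<exists>t. followed TYPE('v) (f, i, T, q) t"
proof -
  have a: "bok f" "i < ar (brel f)" "kn (bnm f i)" "((brel f, i), (T, q)) \<in> up" "q < ar T"
    using assms unfolding follows_def by auto
  obtain m where m: "usable (Kn T q) m" "det m q" using assms unfolding follows_def follow_def by blast
  then have b: "bok (Kn T q)" "m < nmeth" "mrel m = T" "\<And>p. p \<in> set (mins m) \<Longrightarrow> kn (bnm (Kn T q) p)"
    unfolding usable_def by auto
  obtain t1 where t1: "retrieved TYPE('v) (bnm f i) t1" using kn_retrieved a(3) by blast
  obtain t2 where t2: "\<forall>p\<in>set (mins m). retrieved TYPE('v) (bnm (Kn T q) p) t2"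
    using retrieved_ins kn_retrieved b(4) by metis
  have "followed TYPE('v) (f, i, T, q) (Suc (t1 + t2))"
    unfolding followed_def prod.case
  proof (intro allI impI)
    fix I :: "'v inst" and K h assume r: "access_run S Q I K" and h: "anchored I K 0 h"
    interpret access_run S Q I K by (rule r)
    have f: "(brel f, tuple h f) \<in> I" using h a(1) hom_fact unfolding anchored_def by blast
    then obtain u where u: "(T, u) \<in> I" "u ! q = h (bnm f i)" using up_uid[OF a(4)] a(2) by fastforce
    have "h (bnm f i) \<in> vals K (0 + t1)" using t1 r h unfolding retrieved_def by blast
    then have "u ! q \<in> vals K t1" using u by simp
    \<comment> \<open>The fact \<open>u\<close> at the end of the UID chain is put behind
      \<open>Kn T q\<close>. The access provided by \<open>follow\<close> then returns a fact that
      agrees with \<open>u\<close> at \<open>q\<close>.\<close>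
    then have an: "anchored I K t1 (set_kg T q u h)" using anchored_kg[OF h u(1)] by simp
    obtain w where w: "(T, w) \<in> K (Suc (t1 + t2))" "\<forall>p<ar T. det m p \<longrightarrow> w ! p = set_kg T q u h (Kg T q p)"
      using retrieved_access[OF b(1,2) _ _ r an, of t2] t2 b(3) by auto
    then have "w ! q = h (bnm f i)" using m a(5) u by (simp add: set_kg_def)
    then show "\<exists>w. (T, w) \<in> K (Suc (t1 + t2)) \<and> w ! q = h (bnm f i)" using w by blast
  qed
  then show ?thesis by blast
qed

text \<open>\<open>EQ\<close> consists of finitely many facts, each available after a number of
  stages independent of the instance, so one maximum serves all of them.\<close>

lemma EQ_matched:
  "\<exists>t. \<forall>(I :: 'v inst) K. access_run S Q I K \<longrightarrow> cq_holds Q I \<longrightarrow> (\<exists>\<rho>. \<forall>(R, ns)\<in>EQ. (R, map \<rho> ns) \<in> K t)"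
proof -
  have "\<exists>t. \<forall>x\<in>{(f, m). usable f m}. copied TYPE('v) x t"
  proof (rule uniform_stage[OF finite_usable])
    fix x s t assume "copied TYPE('v) x s" "s \<le> t"
    then show "copied TYPE('v) x t" unfolding copied_def using access_run.K_le by blast
  qed (use usable_copied in auto)
  then obtain t1 where t1: "\<And>f m. usable f m \<Longrightarrow> copied TYPE('v) (f, m) t1" by blast
  have "\<exists>t. \<forall>x\<in>{(f, i, T, q). follows f i T q}. followed TYPE('v) x t"
  proof (rule uniform_stage[OF finite_follows])
    fix x s t assume "followed TYPE('v) x s" "s \<le> t"
    then show "followed TYPE('v) x t" unfolding followed_def using access_run.K_le by (cases x) (simp, blast)
  qed (use follows_followed in auto)
  then obtain t2 where t2: "\<And>f i T q. follows f i T q \<Longrightarrow> followed TYPE('v) (f, i, T, q) t2" by blast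
  have "\<exists>\<rho>. \<forall>(R, ns)\<in>EQ. (R, map \<rho> ns) \<in> K (max t1 t2)"
    if r: "access_run S Q I K" and q: "cq_holds Q I" for I :: "'v inst" and K
  proof -
    interpret access_run S Q I K by (rule r)
    obtain h where h: "anchored I K 0 h" using anchored_exists[OF q] by blast
    then have hom: "hom I h" unfolding anchored_def by blast
    have "\<exists>w. (brel f, w) \<in> K (max t1 t2) \<and> (\<forall>p<ar (brel f). det m p \<longrightarrow> w ! p = h (bnm f p))"
      if "usable f m" for f m
      using t1[OF that] r h K_le[of t1 "max t1 t2"] unfolding copied_def by fastforce
    then obtain c where c: "\<And>f m. usable f m \<Longrightarrow> (brel f, c f m) \<in> K (max t1 t2)"
      "\<And>f m p. usable f m \<Longrightarrow> p < ar (brel f) \<Longrightarrow> det m p \<Longrightarrow> c f m ! p = h (bnm f p)" by metis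
    have "\<exists>w. (T, w) \<in> K (max t1 t2) \<and> w ! q = h (bnm f i)"
      if "follows f i T q" for f i T q
      using t2[OF that] r h K_le[of t2 "max t1 t2"] unfolding followed_def by fastforce
    then obtain d where d: "\<And>f i T q. follows f i T q \<Longrightarrow> (T, d f i T q) \<in> K (max t1 t2)"
      "\<And>f i T q. follows f i T q \<Longrightarrow> d f i T q ! q = h (bnm f i)" by metis
    define \<rho> where "\<rho> = (\<lambda>e. case e of EN n \<Rightarrow> h n | EC f m p \<Rightarrow> c f m ! p | EF f i T q p \<Rightarrow> d f i T q ! p)"
    have hr: "h (rep (bnm f p)) = h (bnm f p)" if "bok f" "p < ar (brel f)" for f p
      using hom_sim[OF hom sim_rep_base[OF that]] by simp
    have cf: "(R, map \<rho> ns) \<in> K (max t1 t2)" if u: "usable f m" and x: "(R, ns) = copy_fact f m" for R ns f m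
    proof -
      have f: "bok f" using u usable_def by blast
      have "length (c f m) = ar (brel f)" using c(1)[OF u] K_sub len by blast
      then have "map \<rho> ns = c f m" using x c(2)[OF u] hr[OF f]
        by (auto simp: copy_fact_def \<rho>_def intro!: nth_equalityI)
      then show ?thesis using c(1)[OF u] x by (simp add: copy_fact_def)
    qed
    have df: "(R, map \<rho> ns) \<in> K (max t1 t2)" if u: "follows f i T q" and x: "(R, ns) = follow_fact f i T q" for R ns f i T q
    proof -
      have f: "bok f" "i < ar (brel f)" using u follows_def by blast+
      have "length (d f i T q) = ar T" using d(1)[OF u] K_sub len by blast
      then have "map \<rho> ns = d f i T q" using x d(2)[OF u] hr[OF f]
        by (auto simp: follow_fact_def \<rho>_def intro!: nth_equalityI)
      then show ?thesis using d(1)[OF u] x by (simp add: follow_fact_def)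
    qed
    show ?thesis using cf df unfolding EQ_def by (intro exI[of _ \<rho>]) blast
  qed
  then show ?thesis by blast
qed

end

section \<open>Soundness of a certificate\<close>

context model
begin

text \<open>The image of \<open>EQ\<close> need not come from a homomorphism of the base facts, and
  the query is not assumed. Names are interpreted through \<open>\<rho>\<close>, the constraints of
  \<open>I\<close> supply one fact per slot in order, and the equalities of the certificate turn
  these facts into an image of the query.\<close>

lemma EQ_cert:
  assumes \<rho>: "\<And>R ns. (R, ns) \<in> EQ \<Longrightarrow> (R, map \<rho> ns) \<in> I" and "cert"
  shows "cq_holds Q I"
proof -
  have copy: "\<exists>w. (brel f, w) \<in> I \<and> (\<forall>p<ar (brel f). w ! p = \<rho> (if det m p then EN (rep (bnm f p)) else EC f m p))"
    if "usable f m" for f m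
  proof -
    have "copy_fact f m \<in> EQ" using that unfolding EQ_def by blast
    then have "(brel f, snd (copy_fact f m)) \<in> EQ" by (simp add: copy_fact_def)
    then have "(brel f, map \<rho> (snd (copy_fact f m))) \<in> I" by (rule \<rho>)
    then show ?thesis
      by (intro exI[of _ "map \<rho> (snd (copy_fact f m))"]) (auto simp: copy_fact_def)
  qed
  have fol: "\<exists>w. (T, w) \<in> I \<and> w ! q = \<rho> (EN (rep (bnm f i)))" if "follows f i T q" for f i T q
  proof -
    have "follow_fact f i T q \<in> EQ" using that unfolding EQ_def by blast
    then have "(T, snd (follow_fact f i T q)) \<in> EQ" by (simp add: follow_fact_def)
    then have "(T, map \<rho> (snd (follow_fact f i T q))) \<in> I" by (rule \<rho>)
    then show ?thesis using that unfolding follows_def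
      by (intro exI[of _ "map \<rho> (snd (follow_fact f i T q))"]) (auto simp: follow_fact_def)
  qed
  have inh: "\<exists>u. (T, u) \<in> I" if "rel2 T" for T
    using rel2_inhabited[OF that] copy by blast
  \<comment> \<open>By \<open>const_unique\<close> the choice does not matter at constant positions,
    and only there is \<open>v\<close> used.\<close>
  define v where "v = (\<lambda>T p. (SOME u. (T, u) \<in> I) ! p)"
  have v: "u ! p = v T p" if "(T, u) \<in> I" "const_pos T p" for T u p
    unfolding v_def using const_unique[OF that(2,1)] that(1) by (metis someI)
  \<comment> \<open>A constant \<open>G2 T p\<close> is read off from \<open>I\<close>, since
    \<open>T\<close> may be inhabited through UIDs alone and then no fact of \<open>EQ\<close> need
    mention it.\<close>
  define val where "val = (\<lambda>n. case n of G2 T p \<Rightarrow> (if const_pos T p then v T p else \<rho> (EN (rep n))) | _ \<Rightarrow> \<rho> (EN (rep n)))"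
  have valb: "val (bnm f p) = \<rho> (EN (rep (bnm f p)))" for f p
    by (cases f) (auto simp: val_def)
  have valG: "val (Ge T p) = \<rho> (EN (rep (Ge T p)))" for T p by (simp add: val_def)
  have val: "sim a b \<Longrightarrow> val a = val b" for a b
  proof (induction rule: sim_kn_rel2.inducts(1)[where ?P2.0 = kn and ?P3.0 = rel2])
    case (sim_fd f g R D j)
    have "sim (bnm f j) (bnm g j)" using sim_kn_rel2.sim_fd[of f g R D j] sim_fd by blast
    then show ?case by (simp add: valb rep_sim)
  next
    case (sim_uid f i T j)
    have "sim (bnm f i) (Ge T j)" using sim_kn_rel2.sim_uid[of f i T j] sim_uid by blast
    then show ?case by (simp add: valb valG rep_sim)
  next
    case (sim_kn f m p)
    then have "usable f m" unfolding usable_def by blast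
    then obtain w where w: "(brel f, w) \<in> I" "\<forall>p<ar (brel f). w ! p = \<rho> (if det m p then EN (rep (bnm f p)) else EC f m p)"
      using copy by blast
    have "det m p" using det_const[of m p] sim_kn by simp
    then have "w ! p = val (bnm f p)" using w(2) sim_kn valb by simp
    then show ?case using v[OF w(1)] sim_kn by (simp add: val_def)
  next
    case (sim_uid2 R i T j)
    then have "const_pos R i" using const_uid by blast
    obtain u where u: "(R, u) \<in> I" using inh sim_uid2 by blast
    obtain u' where u': "(T, u') \<in> I" "u' ! j = u ! i" using uid u sim_uid2 by blast
    then show ?case using v[OF u \<open>const_pos R i\<close>] v[OF u'(1)] sim_uid2 \<open>const_pos R i\<close> by (simp add: val_def)
  qed (auto intro: sim_kn_rel2.intros)
  have pos: "\<exists>w. (T, w) \<in> I \<and> w ! q = val n" if p2: "pos2 n T q" for n T q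
    using p2 unfolding pos2_def
  proof (elim conjE disjE exE)
    fix f m assume a: "q < ar T" "usable f m" "det m q" "brel f = T" "sim (bnm f q) n"
    then show ?thesis using copy[OF a(2)] val[OF a(5)] valb by metis
  next
    assume a: "q < ar T" "rel2 T" "const_pos T q" "sim (G2 T q) n"
    then show ?thesis using inh[OF a(2)] v val[OF a(4)] by (auto simp: val_def)
  next
    fix f p assume a: "q < ar T" "bok f" "p < ar (brel f)" "kn (bnm f p)" "sim (bnm f p) n" "((brel f, p), T, q) \<in> up" "follow T q"
    then have "follows f p T q" unfolding follows_def by blast
    then show ?thesis using fol val[OF a(5)] valb by metis
  qed
  obtain N sl s where c: "\<forall>k<N. slot_ok sl k (sl k)" "\<forall>a<length Q. s a < N \<and> srel (sl (s a)) = fst (Q ! a)"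
     "\<forall>a<length Q. \<forall>b<length Q. \<forall>p<length (snd (Q ! a)). \<forall>q<length (snd (Q ! b)).
        snd (Q ! a) ! p = snd (Q ! b) ! q \<longrightarrow> pnsim (sname (s a) (sl (s a)) p) (sname (s b) (sl (s b)) q)"
    using \<open>cert\<close> unfolding cert_def by blast
  define pv where "pv = (\<lambda>(u :: nat \<Rightarrow> 'v list) e. case e of PN l p \<Rightarrow> u l ! p | PB n \<Rightarrow> val n)"
  define good where "good = (\<lambda>u k. (srel (sl k), u k) \<in> I \<and> (\<forall>p<ar (srel (sl k)). u k ! p = pv u (sname k (sl k) p)))"
  have "\<exists>u. \<forall>k<n. good u k" if "n \<le> N" for n
    using that
  proof (induction n)
    case 0 then show ?case by simp
  next
    case (Suc n)
    then obtain u where u: "\<forall>k<n. good u k" by auto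
    have ok: "slot_ok sl n (sl n)" using c(1) Suc by auto
    have "\<exists>w. (srel (sl n), w) \<in> I \<and> (\<forall>p<ar (srel (sl n)). w ! p = pv (u(n := w)) (sname n (sl n) p))"
    proof (cases "sl n")
      case (SC f m)
      then have "usable f m" using ok by simp
      then obtain w where "(brel f, w) \<in> I" "\<forall>p<ar (brel f). w ! p = \<rho> (if det m p then EN (rep (bnm f p)) else EC f m p)"
        using copy by blast
      then show ?thesis using SC by (intro exI[of _ w]) (auto simp: pv_def valb)
    next
      case (SR T)
      then have "rel2 T" using ok by simp
      then obtain w where w: "(T, w) \<in> I" using inh by blast
      then show ?thesis using SR v[OF w] by (intro exI[of _ w]) (auto simp: pv_def val_def)
    next
      case (SF T q e)
      have "\<exists>w. (T, w) \<in> I \<and> w ! q = pv (u(n := w)) e"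
      proof (cases e)
        case (PN l p)
        then have l: "l < n" "p < ar (srel (sl l))" "((srel (sl l), p), (T, q)) \<in> up" using ok SF by auto
        then have "(srel (sl l), u l) \<in> I" using u good_def by auto
        then show ?thesis using up_uid[OF l(3)] l PN by (auto simp: pv_def)
      next
        case (PB x)
        then obtain R i where r: "pos2 x R i" "((R, i), (T, q)) \<in> up" using ok SF by auto
        then obtain w where w: "(R, w) \<in> I" "w ! i = val x" using pos by blast
        then show ?thesis using up_uid[OF r(2) w(1)] PB by (auto simp: pv_def)
      qed
      then obtain w where w: "(T, w) \<in> I" "w ! q = pv (u(n := w)) e" by blast
      then show ?thesis using SF v[OF w(1)] by (intro exI[of _ w]) (auto simp: pv_def val_def)
    qed
    then obtain w where w: "(srel (sl n), w) \<in> I" "\<forall>p<ar (srel (sl n)). w ! p = pv (u(n := w)) (sname n (sl n) p)" by blast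
    have keep: "good (u(n := w)) k" if "k < n" for k
    proof -
      have "pv (u(n := w)) (sname k (sl k) p) = pv u (sname k (sl k) p)" for p
      proof -
        have "slot_ok sl k (sl k)" using c(1) Suc that by auto
        \<comment> \<open>A slot refers only to itself and to earlier slots, so adding the fact for
          slot \<open>n\<close> leaves the earlier ones correct.\<close>
        moreover have "l \<le> k" if "sname k (sl k) p = PN l x" for l x
          using that calculation by (cases "sl k") (auto split: if_splits)
        ultimately show ?thesis using that by (cases "sname k (sl k) p") (auto simp: pv_def)
      qed
      then show ?thesis using u that unfolding good_def by auto
    qed
    have "good (u(n := w)) n" using w by (simp add: good_def)
    then have "\<forall>k<Suc n. good (u(n := w)) k" using keep less_Suc_eq by auto
    then show ?case by blast
  qed
  then obtain u where u: "\<And>k. k < N \<Longrightarrow> good u k" by blast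
  have pns: "pv u a = pv u b" if "pnsim a b" for a b
    using that by (cases a; cases b) (auto simp: pv_def val)
  define occ where "occ = (\<lambda>x (a, p). a < length Q \<and> p < length (snd (Q ! a)) \<and> snd (Q ! a) ! p = x)"
  \<comment> \<open>Each variable is read at one chosen occurrence; the last clause of
    \<open>cert\<close> makes all its occurrences agree.\<close>
  define h where "h = (\<lambda>x. case (SOME ap. occ x ap) of (a, p) \<Rightarrow> u (s a) ! p)"
  have hv: "h (snd (Q ! a) ! p) = u (s a) ! p" if ap: "a < length Q" "p < length (snd (Q ! a))" for a p
  proof -
    obtain b q where b: "(SOME ap. occ (snd (Q ! a) ! p) ap) = (b, q)" by fastforce
    have "occ (snd (Q ! a) ! p) (a, p)" using ap by (simp add: occ_def)
    then have "occ (snd (Q ! a) ! p) (b, q)" using someI[of "occ (snd (Q ! a) ! p)"] b by metis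
    then have o: "b < length Q" "q < length (snd (Q ! b))" "snd (Q ! b) ! q = snd (Q ! a) ! p" by (auto simp: occ_def)
    then have "pnsim (sname (s b) (sl (s b)) q) (sname (s a) (sl (s a)) p)" using c(3) ap by metis
    then have "pv u (sname (s b) (sl (s b)) q) = pv u (sname (s a) (sl (s a)) p)" using pns by blast
    moreover have "u (s b) ! q = pv u (sname (s b) (sl (s b)) q)"
      using u[of "s b"] c(2) o query_wf[OF o(1)] by (simp add: good_def)
    moreover have "u (s a) ! p = pv u (sname (s a) (sl (s a)) p)"
      using u[of "s a"] c(2) ap query_wf[OF ap(1)] by (simp add: good_def)
    ultimately show ?thesis using b by (simp add: h_def)
  qed
  have "(R, map h vs) \<in> I" if at: "(R, vs) \<in> set Q" for R vs
  proof -
    obtain a where a: "a < length Q" "Q ! a = (R, vs)" using at by (meson in_set_conv_nth)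
    have g: "(R, u (s a)) \<in> I" using u[of "s a"] c(2) a by (simp add: good_def)
    have "map h vs = u (s a)" using hv[OF a(1)] a len[OF g] query_wf[OF a(1)] by (auto intro!: nth_equalityI)
    then show ?thesis using g by simp
  qed
  then show ?thesis unfolding cq_holds_def by blast
qed

end

section \<open>Plans and runs\<close>

lemma runs_snoc: "runs S I (cs @ [c]) = {T @ [t] | T t. T \<in> runs S I cs \<and> t \<in> cmd_out S I T c}"
  by (simp add: runs_def)

lemma runs_Nil [simp]: "runs S I [] = {[]}"
  by (simp add: runs_def)

lemma plan_arities_snoc: "plan_arities S (cs @ [c]) = ar_step S (plan_arities S cs) c"
  by (simp add: plan_arities_def)

lemma plan_arities_Nil [simp]: "plan_arities S [] = Some []"
  by (simp add: plan_arities_def)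

lemma runs_length: "T \<in> runs S I cs \<Longrightarrow> length T = length cs"
  by (induction cs arbitrary: T rule: rev_induct) (auto simp: runs_snoc)

lemma runs_take: "T \<in> runs S I (cs @ ds) \<Longrightarrow> take (length cs) T \<in> runs S I cs"
proof (induction ds arbitrary: T rule: rev_induct)
  case Nil
  then show ?case using runs_length[of T] by simp
next
  case (snoc d ds)
  then obtain T' t where "T = T' @ [t]" "T' \<in> runs S I (cs @ ds)"
    unfolding append_assoc[symmetric] runs_snoc by blast
  then show ?case using snoc(1)[of T'] runs_length[of T'] by simp
qed

lemma runs_nth:
  assumes "T \<in> runs S I cs" "k < length cs"
  shows "T ! k \<in> cmd_out S I (take k T) (cs ! k)"
proof -
  have cs: "cs = (take k cs @ [cs ! k]) @ drop (Suc k) cs" using assms(2) by (simp add: id_take_nth_drop)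
  then have "take (Suc k) T \<in> runs S I (take k cs @ [cs ! k])"
    using runs_take[of T S I "take k cs @ [cs ! k]" "drop (Suc k) cs"] assms by simp
  then obtain T' t where t: "take (Suc k) T = T' @ [t]" "T' \<in> runs S I (take k cs)" "t \<in> cmd_out S I T' (cs ! k)"
    unfolding runs_snoc by blast
  have "length T' = k" using runs_length[OF t(2)] assms(2) by simp
  moreover have "take (Suc k) T = take k T @ [T ! k]" using runs_length[OF assms(1)] assms(2) by (simp add: take_Suc_conv_app_nth)
  ultimately show ?thesis using t runs_length[OF assms(1)] assms(2) by simp
qed

lemma plan_arities_length: "plan_arities S cs = Some A \<Longrightarrow> length A = length cs"
proof (induction cs arbitrary: A rule: rev_induct)
  case (snoc c cs)
  then show ?case by (cases "plan_arities S cs") (auto simp: plan_arities_snoc split: option.splits)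
qed simp

lemma ra_arity_append: "ra_arity A e = Some n \<Longrightarrow> ra_arity (A @ B) e = Some n"
  by (induction e arbitrary: n) (auto simp: nth_append split: option.splits if_splits)

lemma ra_eval_append:
  "ra_arity A e = Some n \<Longrightarrow> length T = length A \<Longrightarrow> ra_eval (T @ T') e = ra_eval T e"
  by (induction e arbitrary: n) (auto simp: nth_append split: option.splits if_splits)

lemma ra_eval_tuples:
  assumes "length T = length A" "\<And>i u. i < length A \<Longrightarrow> u \<in> T ! i \<Longrightarrow> length u = A ! i \<and> set u \<subseteq> D"
  shows "ra_arity A e = Some n \<Longrightarrow> u \<in> ra_eval T e \<Longrightarrow> length u = n \<and> set u \<subseteq> D"
proof (induction e arbitrary: n u)
  case (Proj js e)
  then obtain m where m: "ra_arity A e = Some m" "\<forall>i\<in>set js. i < m" "n = length js"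
    by (auto split: option.splits if_splits)
  from Proj obtain t where t: "t \<in> ra_eval T e" "u = map (\<lambda>i. t ! i) js" by auto
  have "length t = m" "set t \<subseteq> D" using Proj(1)[OF m(1) t(1)] by auto
  then show ?case using m t by (auto simp: subset_iff)
qed (use assms in \<open>fastforce split: option.splits if_splits\<close>)+

lemma ra_eval_mono:
  assumes "length T = length A" "\<And>i. i < length A \<Longrightarrow> T ! i \<subseteq> T' ! i"
  shows "ra_arity A e = Some n \<Longrightarrow> ra_eval T e \<subseteq> ra_eval T' e"
proof (induction e arbitrary: n)
  case (Prod e1 e2)
  then obtain a b where "ra_arity A e1 = Some a" "ra_arity A e2 = Some b" by (auto split: option.splits)
  then show ?case using Prod.IH by fastforce
next
  case (Union e1 e2)
  then obtain a b where "ra_arity A e1 = Some a" "ra_arity A e2 = Some b" by (auto split: option.splits)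
  then show ?case using Union.IH by fastforce
qed (use assms in \<open>auto split: option.splits if_splits\<close>)

text \<open>This lets a second instance imitate the first: an answer given on the first is completed
  to a valid answer on the second.\<close>

lemma valid_output_extend:
  assumes "finite J" "J \<subseteq> M" "card J \<le> k"
  shows "\<exists>J'. J \<subseteq> J' \<and> valid_output M (Some k) J'"
proof (cases "finite M \<and> card M < k")
  case True
  have "\<And>B. B \<subseteq> M \<Longrightarrow> card B \<le> card M" using True card_mono by blast
  then have "valid_output M (Some k) M" unfolding valid_output_def using True by auto
  then show ?thesis using assms by blast
next
  case False
  have "\<exists>J'. J \<subseteq> J' \<and> J' \<subseteq> M \<and> finite J' \<and> card J' = k"
  proof (cases "finite M")
    case True
    then have "k \<le> card M" using False by simp
    then obtain J' where "J \<subseteq> J'" "J' \<subseteq> M" "card J' = k"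
      using exists_subset_between[of J k M] assms True by blast
    then show ?thesis using True finite_subset by blast
  next
    case False
    then have "infinite (M - J)" using assms(1) by simp
    then obtain B where B: "B \<subseteq> M - J" "finite B" "card B = k - card J" using infinite_arbitrarily_large by meson
    have "card (J \<union> B) = k" using B assms by (subst card_Un_disjoint) auto
    then show ?thesis using B assms by (intro exI[of _ "J \<union> B"]) auto
  qed
  then obtain J' where J': "J \<subseteq> J'" "J' \<subseteq> M" "finite J'" "card J' = k" by blast
  then have "valid_output M (Some k) J'" unfolding valid_output_def by auto
  then show ?thesis using J' by blast
qed

lemma valid_output_exists: "\<exists>J. valid_output M bd J"
proof (cases bd)
  case None
  then show ?thesis by (intro exI[of _ M]) (simp add: valid_output_def)
next
  case (Some k)
  then show ?thesis using valid_output_extend[of "{}" M k] by auto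
qed

text \<open>A monotone plan cannot distinguish \<open>I1\<close> from \<open>I2\<close> when all accesses on \<open>I1\<close> can be answered
  inside the common part \<open>A\<close>.\<close>

lemma not_answerable:
  fixes I1 I2 A :: "'v inst"
  assumes 1: "inst_ok S I1" "satisfies S I1" "cq_holds Q I1"
    and 2: "inst_ok S I2" "satisfies S I2" "\<not> cq_holds Q I2"
    and A: "A \<subseteq> I1" "A \<subseteq> I2"
    and acc: "\<And>m b. m < length (methods S) \<Longrightarrow> length b = length (problem.mins S m) \<Longrightarrow>
      set b \<subseteq> (\<Union>(R, u)\<in>A. set u) \<Longrightarrow>
      \<exists>J. valid_output (matching I1 (problem.mrel S m) (problem.mins S m) b) (problem.mbound S m) J
         \<and> (\<forall>u\<in>J. (problem.mrel S m, u) \<in> A)"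
  shows "\<not> monotone_answerable TYPE('v) S Q"
proof
  define D where "D = (\<Union>(R, u)\<in>A. set u)"
  have main: "plan_arities S cs = Some As \<Longrightarrow> \<exists>T1\<in>runs S I1 cs. \<exists>T2\<in>runs S I2 cs.
     \<forall>i<length As. T1 ! i \<subseteq> T2 ! i \<and> (\<forall>u\<in>T1 ! i. length u = As ! i \<and> set u \<subseteq> D)" for cs As
  proof (induction cs arbitrary: As rule: rev_induct)
    case Nil
    then show ?case by simp
  next
    case (snoc c cs)
    then obtain A0 a where a: "plan_arities S cs = Some A0" "cmd_arity S A0 c = Some a" "As = A0 @ [a]"
      by (cases "plan_arities S cs") (auto simp: plan_arities_snoc split: option.splits)
    obtain T1 T2 where T: "T1 \<in> runs S I1 cs" "T2 \<in> runs S I2 cs"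
      "\<And>i. i < length A0 \<Longrightarrow> T1 ! i \<subseteq> T2 ! i"
      "\<And>i u. i < length A0 \<Longrightarrow> u \<in> T1 ! i \<Longrightarrow> length u = A0 ! i \<and> set u \<subseteq> D"
      using snoc(1)[OF a(1)] by blast
    have L: "length T1 = length A0" "length T2 = length A0"
      using T runs_length plan_arities_length[OF a(1)] by metis+
    have "\<exists>t1\<in>cmd_out S I1 T1 c. \<exists>t2\<in>cmd_out S I2 T2 c. t1 \<subseteq> t2 \<and> (\<forall>u\<in>t1. length u = a \<and> set u \<subseteq> D)"
    proof (cases c)
      case (Mid e)
      then have e: "ra_arity A0 e = Some a" using a(2) by (simp add: cmd_arity_def)
      have "ra_eval T1 e \<subseteq> ra_eval T2 e" by (rule ra_eval_mono[OF L(1) T(3) e])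
      moreover have "\<forall>u\<in>ra_eval T1 e. length u = a \<and> set u \<subseteq> D" using ra_eval_tuples[OF L(1) T(4) e] by blast
      ultimately show ?thesis using Mid by (simp add: cmd_out_def)
    next
      case (Acc m e)
      obtain R ins bd where m: "methods S ! m = (R, ins, bd)" by (cases "methods S ! m")
      then have p: "problem.mrel S m = R" "problem.mins S m = ins" "problem.mbound S m = bd"
        by (simp_all add: problem.mrel_def problem.mins_def problem.mbound_def)
      have e: "m < length (methods S)" "ra_arity A0 e = Some (length ins)" "a = rel_arities S ! R"
        using a(2) Acc m by (auto simp: cmd_arity_def split: if_splits)
      have sub: "ra_eval T1 e \<subseteq> ra_eval T2 e" by (rule ra_eval_mono[OF L(1) T(3) e(2)])
      have "\<exists>J. valid_output (matching I1 R ins b) bd J \<and> (\<forall>u\<in>J. (R, u) \<in> A)" if "b \<in> ra_eval T1 e" for b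
        using acc[OF e(1), of b] ra_eval_tuples[OF L(1) T(4) e(2) that] p unfolding D_def by simp
      then obtain J1 where J1: "\<And>b. b \<in> ra_eval T1 e \<Longrightarrow> valid_output (matching I1 R ins b) bd (J1 b)"
        "\<And>b u. b \<in> ra_eval T1 e \<Longrightarrow> u \<in> J1 b \<Longrightarrow> (R, u) \<in> A" by metis
      \<comment> \<open>Bindings that also occur on the first instance receive a superset of the
        answer given there; for the others any valid answer will do.\<close>
      have "\<exists>J. valid_output (matching I2 R ins b) bd J \<and> (b \<in> ra_eval T1 e \<longrightarrow> J1 b \<subseteq> J)" for b
      proof (cases "b \<in> ra_eval T1 e")
        case True
        have sub: "J1 b \<subseteq> matching I2 R ins b"
          using J1[OF True] A(2) unfolding valid_output_def matching_def by blast
        show ?thesis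
        proof (cases bd)
          case None
          then show ?thesis using sub by (intro exI[of _ "matching I2 R ins b"]) (simp add: valid_output_def)
        next
          case (Some k)
          then show ?thesis using valid_output_extend[OF _ sub, of k] J1(1)[OF True] unfolding valid_output_def by auto
        qed
      qed (use valid_output_exists in blast)
      then obtain J2 where J2: "\<And>b. valid_output (matching I2 R ins b) bd (J2 b)"
        "\<And>b. b \<in> ra_eval T1 e \<Longrightarrow> J1 b \<subseteq> J2 b" by metis
      have a1: "(\<Union>b\<in>ra_eval T1 e. J1 b) \<in> cmd_out S I1 T1 c" using J1(1) Acc m by (auto simp: cmd_out_def)
      have a2: "(\<Union>b\<in>ra_eval T2 e. J2 b) \<in> cmd_out S I2 T2 c" using J2(1) Acc m by (auto simp: cmd_out_def)
      have a3: "(\<Union>b\<in>ra_eval T1 e. J1 b) \<subseteq> (\<Union>b\<in>ra_eval T2 e. J2 b)" using J2(2) sub by blast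
      have a4: "length u = a \<and> set u \<subseteq> D" if "u \<in> (\<Union>b\<in>ra_eval T1 e. J1 b)" for u
      proof -
        have "(R, u) \<in> A" using that J1(2) by blast
        then show ?thesis using A(1) 1(1) e(3) unfolding D_def inst_ok_def by fast
      qed
      show ?thesis by (intro bexI[OF _ a1] bexI[OF _ a2] conjI[OF a3] ballI a4)
    qed
    then obtain t1 t2 where t: "t1 \<in> cmd_out S I1 T1 c" "t2 \<in> cmd_out S I2 T2 c" "t1 \<subseteq> t2"
      "\<forall>u\<in>t1. length u = a \<and> set u \<subseteq> D" by blast
    show ?case
    proof (intro bexI)
      show "\<forall>i<length As. (T1 @ [t1]) ! i \<subseteq> (T2 @ [t2]) ! i \<and> (\<forall>u\<in>(T1 @ [t1]) ! i. length u = As ! i \<and> set u \<subseteq> D)"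
        using T(3,4) t(3,4) L a(3) by (auto simp: nth_append less_Suc_eq)
    qed (use T t in \<open>auto simp: runs_snoc\<close>)
  qed
  assume "monotone_answerable TYPE('v) S Q"
  then obtain cs r where P: "plan_answers TYPE('v) S Q (cs, r)" unfolding monotone_answerable_def by auto
  then obtain As where As: "plan_arities S cs = Some As" "r < length As"
    unfolding plan_answers_def wf_plan_def by auto
  obtain T1 T2 where T: "T1 \<in> runs S I1 cs" "T2 \<in> runs S I2 cs" "T1 ! r \<subseteq> T2 ! r"
    using main[OF As(1)] As(2) by blast
  have "T1 ! r = cq_ans Q I1" "T2 ! r = cq_ans Q I2" using P T 1 2 unfolding plan_answers_def by auto
  then show False using T(3) 1 2 by (simp add: cq_ans_def)
qed

section \<open>The plan as relational algebra\<close>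

fun prods :: "ra list \<Rightarrow> ra" where
  "prods [] = Unit" | "prods (e # es) = Prod e (prods es)"

text \<open>The empty list gets a placeholder: the lemmas about \<open>unions\<close> concern
  non-empty lists only.\<close>

fun unions :: "ra list \<Rightarrow> ra" where
  "unions [] = Unit" | "unions [e] = e" | "unions (e # es) = Union e (unions es)"

fun sels :: "(nat \<times> nat) list \<Rightarrow> ra \<Rightarrow> ra" where
  "sels [] e = e" | "sels ((c, d) # ps) e = Sel c d (sels ps e)"

lemma prods_eval: "ra_eval T (prods es) = {concat us | us. list_all2 (\<lambda>e u. u \<in> ra_eval T e) es us}"
proof (induction es)
  case (Cons e es)
  have "ra_eval T (prods (e # es)) = {t @ concat us | t us. t \<in> ra_eval T e \<and> list_all2 (\<lambda>e u. u \<in> ra_eval T e) es us}"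
    using Cons by auto
  also have "\<dots> = {concat us | us. list_all2 (\<lambda>e u. u \<in> ra_eval T e) (e # es) us}"
    unfolding list_all2_Cons1 by (auto, metis concat.simps(2), blast)
  finally show ?case .
qed simp

lemma prods_arity: "list_all2 (\<lambda>e n. ra_arity A e = Some n) es ns \<Longrightarrow> ra_arity A (prods es) = Some (sum_list ns)"
  by (induction es ns rule: list_all2_induct) auto

lemma unions_eval: "es \<noteq> [] \<Longrightarrow> ra_eval T (unions es) = (\<Union>e\<in>set es. ra_eval T e)"
  by (induction es rule: unions.induct) auto

lemma unions_arity: "es \<noteq> [] \<Longrightarrow> (\<And>e. e \<in> set es \<Longrightarrow> ra_arity A e = Some n) \<Longrightarrow> ra_arity A (unions es) = Some n"
  by (induction es rule: unions.induct) auto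

lemma sels_eval: "ra_eval T (sels ps e) = {t \<in> ra_eval T e. \<forall>(c, d)\<in>set ps. t ! c = t ! d}"
  by (induction ps e rule: sels.induct) auto

lemma sels_arity: "ra_arity A e = Some n \<Longrightarrow> (\<And>c d. (c, d) \<in> set ps \<Longrightarrow> c < n \<and> d < n) \<Longrightarrow> ra_arity A (sels ps e) = Some n"
proof (induction ps e rule: sels.induct)
  case (2 c d ps e)
  have "ra_arity A (sels ps e) = Some n" by (rule "2.IH") (use 2 in auto)
  moreover have "c < n" "d < n" using "2.prems"(2)[of c d] by auto
  ultimately show ?case by simp
qed simp

context problem
begin

text \<open>One unary expression per column of each table; products of these expressions produce
  every binding over the values retrieved so far.\<close>

definition tvals :: "nat list \<Rightarrow> ra list" where
  "tvals rs = concat (map (\<lambda>i. map (\<lambda>p. Proj [p] (Tab i)) [0..<ar (rs ! i)]) [0..<length rs])"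

text \<open>All accesses of a round refer to tables of earlier rounds. In the first round there are
  no columns, so exactly the methods without inputs are called, with \<open>Unit\<close> as the
  binding.\<close>

definition new_round :: "nat list \<Rightarrow> (nat \<times> ra) list" where
  "new_round rs = concat (map (\<lambda>m. map (\<lambda>es. (m, prods es)) (List.n_lists (length (mins m)) (tvals rs))) [0..<nmeth])"

abbreviation "trels xs \<equiv> map (\<lambda>x. mrel (fst x)) xs"

fun rounds :: "nat \<Rightarrow> (nat \<times> ra) list" where
  "rounds 0 = []"
| "rounds (Suc n) = rounds n @ new_round (trels (rounds n))"

abbreviation "cmds xs \<equiv> map (\<lambda>(m, e). Acc m e) xs"

abbreviation "tars xs \<equiv> map (\<lambda>R. ar R) (trels xs)"

definition tfacts :: "(nat \<times> ra) list \<Rightarrow> 'v list set list \<Rightarrow> 'v inst" where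
  "tfacts xs T = {(mrel (fst (xs ! i)), u) | i u. i < length xs \<and> u \<in> T ! i}"

lemma tfactsI: "i < length xs \<Longrightarrow> u \<in> T ! i \<Longrightarrow> mrel (fst (xs ! i)) = R \<Longrightarrow> (R, u) \<in> tfacts xs T"
  unfolding tfacts_def by blast

lemma tvals_set: "e \<in> set (tvals rs) \<longleftrightarrow> (\<exists>i p. i < length rs \<and> p < ar (rs ! i) \<and> e = Proj [p] (Tab i))"
  by (auto simp: tvals_def image_iff Bex_def)

lemma tvals_arity: "e \<in> set (tvals (trels xs)) \<Longrightarrow> ra_arity (tars xs) e = Some 1"
  by (auto simp: tvals_set)

lemma new_round_set: "(m, e) \<in> set (new_round rs) \<longleftrightarrow>
    m < nmeth \<and> (\<exists>es. e = prods es \<and> length es = length (mins m) \<and> set es \<subseteq> set (tvals rs))"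
  by (auto simp: new_round_def set_n_lists)

lemma new_round_arity:
  assumes "(m, e) \<in> set (new_round (trels xs))"
  shows "m < nmeth \<and> ra_arity (tars xs) e = Some (length (mins m))"
proof -
  obtain es where es: "m < nmeth" "e = prods es" "length es = length (mins m)" "set es \<subseteq> set (tvals (trels xs))"
    using assms new_round_set by blast
  have "list_all2 (\<lambda>e n. ra_arity (tars xs) e = Some n) es (replicate (length es) 1)"
  proof (rule list_all2_all_nthI)
    fix i assume i: "i < length es"
    then have "es ! i \<in> set (tvals (trels xs))" using es(4) by (meson nth_mem subsetD)
    then show "ra_arity (tars xs) (es ! i) = Some (replicate (length es) 1 ! i)"
      using tvals_arity[of "es ! i" xs] i by simp
  qed simp
  then show ?thesis using prods_arity[of "tars xs" es] es by (simp add: sum_list_replicate)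
qed

lemma cmds_arity:
  assumes "plan_arities S (cmds xs) = Some (tars xs)"
    and "\<And>m e. (m, e) \<in> set ys \<Longrightarrow> m < nmeth \<and> ra_arity (tars xs) e = Some (length (mins m))"
  shows "plan_arities S (cmds (xs @ ys)) = Some (tars (xs @ ys))"
  using assms(2)
proof (induction ys rule: rev_induct)
  case Nil
  then show ?case using assms(1) by simp
next
  case (snoc y ys)
  obtain m e where y: "y = (m, e)" by (cases y)
  have ih: "plan_arities S (cmds (xs @ ys)) = Some (tars (xs @ ys))" by (rule snoc(1)) (use snoc(2) in auto)
  have "m < nmeth" "ra_arity (tars xs @ tars ys) e = Some (length (mins m))"
    using snoc(2)[of m e] ra_arity_append y by auto
  then have "cmd_arity S (tars (xs @ ys)) (Acc m e) = Some (ar (mrel m))"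
    by (auto simp: cmd_arity_def mins_def mrel_def case_prod_beta)
  moreover have "cmds (xs @ ys @ [y]) = cmds (xs @ ys) @ [Acc m e]" using y by simp
  ultimately show ?case using ih y by (simp only: plan_arities_snoc) simp
qed

lemma rounds_arity: "plan_arities S (cmds (rounds n)) = Some (tars (rounds n))"
proof (induction n)
  case (Suc n)
  show ?case using cmds_arity[OF Suc new_round_arity] by simp
qed simp

lemma rounds_prefix: "s \<le> t \<Longrightarrow> \<exists>ys. rounds t = rounds s @ ys"
proof (induction t)
  case (Suc t)
  then show ?case by (cases "s = Suc t") (auto simp: le_Suc_eq)
qed simp

end

section \<open>Runs of the plan\<close>

context model
begin

lemma runs_exist: "\<exists>T. T \<in> runs S I cs"
proof (induction cs rule: rev_induct)
  case (snoc c cs)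
  then obtain T where T: "T \<in> runs S I cs" by blast
  have "\<exists>t. t \<in> cmd_out S I T c"
  proof (cases c)
    case (Acc m e)
    obtain R ins bd where m: "methods S ! m = (R, ins, bd)" by (cases "methods S ! m")
    have "\<forall>b. \<exists>J. valid_output (matching I R ins b) bd J" using valid_output_exists by blast
    then obtain J where "\<And>b. valid_output (matching I R ins b) bd (J b)" by metis
    then show ?thesis using Acc m by (auto simp: cmd_out_def)
  qed (simp add: cmd_out_def)
  then show ?case using T by (auto simp: runs_snoc)
qed simp

lemma tfacts_sub:
  assumes T: "T \<in> runs S I (cmds xs)" shows "tfacts xs T \<subseteq> I"
proof
  fix x assume "x \<in> tfacts xs T"
  then obtain i u where x: "x = (mrel (fst (xs ! i)), u)" "i < length xs" "u \<in> T ! i" unfolding tfacts_def by blast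
  obtain m e where me: "xs ! i = (m, e)" by (cases "xs ! i")
  obtain R ins bd where m: "methods S ! m = (R, ins, bd)" by (cases "methods S ! m")
  have "T ! i \<in> cmd_out S I (take i T) (Acc m e)" using runs_nth[OF T, of i] x me by simp
  then obtain J where J: "T ! i = (\<Union>b\<in>ra_eval (take i T) e. J b)"
    "\<forall>b\<in>ra_eval (take i T) e. valid_output (matching I R ins b) bd (J b)"
    using m by (auto simp: cmd_out_def)
  then have "(R, u) \<in> I" using x(3) unfolding valid_output_def matching_def by blast
  then show "x \<in> I" using x me m by (simp add: mrel_def)
qed

text \<open>After the last round the family is continued by \<open>I\<close>, where every access is
  answered trivially, because \<open>access_run\<close> asks for all stages.\<close>

lemma rounds_access_run:
  assumes T: "T \<in> runs S I (cmds (rounds N))"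
  shows "access_run S Q I (\<lambda>t. if t \<le> N then tfacts (rounds t) (take (length (rounds t)) T) else I)"
    (is "access_run S Q I ?K")
proof (unfold_locales)
  have LT: "length T = length (rounds N)" using runs_length[OF T] by simp
  have pre: "take (length (rounds t)) T \<in> runs S I (cmds (rounds t))" if t: "t \<le> N" for t
  proof -
    obtain ys where "rounds N = rounds t @ ys" using rounds_prefix[OF t] by blast
    then show ?thesis using runs_take[of T S I "cmds (rounds t)" "cmds ys"] T by simp
  qed
  show sub: "?K t \<subseteq> I" for t using tfacts_sub pre by auto
  show "?K t \<subseteq> ?K (Suc t)" for t
  proof (cases "Suc t \<le> N")
    case True
    have "tfacts (rounds t) (take (length (rounds t)) T) \<subseteq> tfacts (rounds (Suc t)) (take (length (rounds (Suc t))) T)"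
      unfolding tfacts_def by (auto simp: nth_append)
    then show ?thesis using True by simp
  qed (use sub[of t] in auto)
  fix m and b :: "'v list" and t
  assume m: "m < nmeth" and b: "length b = length (mins m)" "set b \<subseteq> vals ?K t"
  show "\<exists>J. valid_output (matching I (mrel m) (mins m) b) (mbound m) J \<and> (\<forall>u\<in>J. (mrel m, u) \<in> ?K (Suc t))"
  proof (cases "Suc t \<le> N")
    case False
    obtain J where "valid_output (matching I (mrel m) (mins m) b) (mbound m) J" using valid_output_exists by blast
    then show ?thesis using False unfolding valid_output_def matching_def by auto
  next
    case True
    define xs where "xs = rounds t"
    define T0 where "T0 = take (length xs) T"
    have T0: "T0 \<in> runs S I (cmds xs)" using pre[of t] True by (simp add: T0_def xs_def)
    have L0: "length T0 = length xs" using runs_length[OF T0] by simp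
    have "\<exists>e\<in>set (tvals (trels xs)). [v] \<in> ra_eval T0 e" if "v \<in> set b" for v
    proof -
      have "v \<in> (\<Union>(R, u)\<in>tfacts xs T0. set u)" using that b(2) True by (auto simp: vals_def xs_def T0_def)
      then obtain i u where i: "i < length xs" "u \<in> T0 ! i" "v \<in> set u" unfolding tfacts_def by blast
      then have "(mrel (fst (xs ! i)), u) \<in> I" using tfacts_sub[OF T0] unfolding tfacts_def by blast
      then have l: "length u = ar (mrel (fst (xs ! i)))" using len by blast
      obtain p where p: "p < length u" "u ! p = v" using i(3) by (meson in_set_conv_nth)
      have "Proj [p] (Tab i) \<in> set (tvals (trels xs))" using p i l by (simp add: tvals_set)
      moreover have "[v] \<in> ra_eval T0 (Proj [p] (Tab i))" using p i by auto
      ultimately show ?thesis by blast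
    qed
    then obtain ev where ev: "\<And>v. v \<in> set b \<Longrightarrow> ev v \<in> set (tvals (trels xs)) \<and> [v] \<in> ra_eval T0 (ev v)" by metis
    define e where "e = prods (map ev b)"
    have me: "(m, e) \<in> set (new_round (trels xs))" unfolding new_round_set e_def
      using ev m b(1) by (intro conjI exI[of _ "map ev b"]) auto
    have "list_all2 (\<lambda>e u. u \<in> ra_eval T0 e) (map ev b) (map (\<lambda>v. [v]) b)"
      using ev by (auto simp: list_all2_conv_all_nth)
    moreover have "concat (map (\<lambda>v. [v]) b) = b" by (induction b) auto
    ultimately have be: "b \<in> ra_eval T0 e" unfolding e_def prods_eval
      by (intro CollectI exI[of _ "map (\<lambda>v. [v]) b"]) simp
    obtain k where k: "k < length (new_round (trels xs))" "new_round (trels xs) ! k = (m, e)" using me by (meson in_set_conv_nth)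
    define i where "i = length xs + k"
    have xi: "rounds (Suc t) ! i = (m, e)" "i < length (rounds (Suc t))" using k by (simp_all add: i_def xs_def nth_append)
    define T1 where "T1 = take (length (rounds (Suc t))) T"
    have T1: "T1 \<in> runs S I (cmds (rounds (Suc t)))" using pre[OF True] by (simp only: T1_def)
    obtain R ins bd where mm: "methods S ! m = (R, ins, bd)" by (cases "methods S ! m")
    have "T1 ! i \<in> cmd_out S I (take i T1) (Acc m e)" using runs_nth[OF T1, of i] xi by (simp del: rounds.simps)
    then obtain J where J: "T1 ! i = (\<Union>b\<in>ra_eval (take i T1) e. J b)"
      "\<forall>b\<in>ra_eval (take i T1) e. valid_output (matching I R ins b) bd (J b)"
      using mm by (auto simp: cmd_out_def)
    have "length xs \<le> i" "i \<le> length (rounds (Suc t))" using xi by (simp_all add: i_def)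
    \<comment> \<open>The binding expression was built from the tables of earlier rounds, so other
      accesses of the same round do not change its value.\<close>
    then have "take (length xs) (take i T1) = T0" by (simp add: T0_def T1_def min_def)
    then have "take i T1 = T0 @ drop (length xs) (take i T1)" by (metis append_take_drop_id)
    then have "ra_eval (take i T1) e = ra_eval T0 e"
      using ra_eval_append[of "tars xs" e _ T0] new_round_arity[OF me] L0 by (metis length_map)
    then have "valid_output (matching I R ins b) bd (J b)" "J b \<subseteq> T1 ! i" using J be by auto
    moreover have "(mrel m, u) \<in> ?K (Suc t)" if "u \<in> T1 ! i" for u
    proof -
      have "(mrel m, u) \<in> tfacts (rounds (Suc t)) T1"
        unfolding tfacts_def using that xi by (intro CollectI exI[of _ i] exI[of _ u]) (simp del: rounds.simps)
      then show ?thesis using True by (simp only: T1_def if_True)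
    qed
    ultimately show ?thesis using mm by (intro exI[of _ "J b"]) (auto simp: mrel_def mins_def mbound_def)
  qed
qed

end

lemma concat_lengths:
  "list_all2 (\<lambda>(R, ns) u. length u = length ns) E us \<Longrightarrow> length (concat us) = length (concat (map snd E))"
  by (induction E us rule: list_all2_induct) auto

lemma concat_split:
  "list_all2 (\<lambda>(R, ns) u. length u = length ns) E us \<Longrightarrow> concat us = map \<rho> (concat (map snd E)) \<Longrightarrow>
   us = map (\<lambda>x. map \<rho> (snd x)) E"
  by (induction E us rule: list_all2_induct) (auto simp: append_eq_append_conv)

context problem
begin

definition eqcols :: "'n list \<Rightarrow> (nat \<times> nat) list" where
  "eqcols ns = filter (\<lambda>(c, d). ns ! c = ns ! d) (List.product [0..<length ns] [0..<length ns])"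

text \<open>The facts of one relation are spread over many tables, so there is one disjunct for each
  choice of a table per atom. The final projection to no columns makes the result Boolean.\<close>

definition match_expr :: "(nat \<times> ra) list \<Rightarrow> (nat \<times> 'n list) list \<Rightarrow> ra" where
  "match_expr xs E = unions (map (\<lambda>ts. Proj [] (sels (eqcols (concat (map snd E))) (prods (map Tab ts))))
     (product_lists (map (\<lambda>(R, ns). filter (\<lambda>i. mrel (fst (xs ! i)) = R) [0..<length xs]) E)))"

lemma choice_iff: "ts \<in> set (product_lists (map (\<lambda>(R, ns). filter (\<lambda>i. mrel (fst (xs ! i)) = R) [0..<length xs]) E))
    \<longleftrightarrow> list_all2 (\<lambda>t (R, ns). t < length xs \<and> mrel (fst (xs ! t)) = R) ts E"
  unfolding product_lists_set by (auto simp: list_all2_map2 case_prod_beta list_all2_conv_all_nth)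

lemma assignment_exists:
  assumes "length u = length ns" "\<And>c d. c < length ns \<Longrightarrow> d < length ns \<Longrightarrow> ns ! c = ns ! d \<Longrightarrow> u ! c = u ! d"
  shows "\<exists>\<rho>. u = map \<rho> ns"
proof -
  define \<rho> where "\<rho> = (\<lambda>n. u ! (SOME c. c < length ns \<and> ns ! c = n))"
  have "u ! c = \<rho> (ns ! c)" if "c < length ns" for c
  proof -
    let ?d = "SOME d. d < length ns \<and> ns ! d = ns ! c"
    have "?d < length ns \<and> ns ! ?d = ns ! c" by (rule someI[of _ c]) (use that in simp)
    then show ?thesis using assms(2)[of c ?d] that by (simp add: \<rho>_def)
  qed
  then show ?thesis using assms(1) by (intro exI[of _ \<rho>]) (auto intro: nth_equalityI)
qed

lemma eqcols_iff:
  assumes "length u = length ns"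
  shows "(\<forall>(c, d)\<in>set (eqcols ns). u ! c = u ! d) \<longleftrightarrow> (\<exists>\<rho>. u = map \<rho> ns)"
proof
  assume h: "\<forall>(c, d)\<in>set (eqcols ns). u ! c = u ! d"
  show "\<exists>\<rho>. u = map \<rho> ns"
  proof (rule assignment_exists[OF assms])
    fix c d assume "c < length ns" "d < length ns" "ns ! c = ns ! d"
    then have "(c, d) \<in> set (eqcols ns)" by (simp add: eqcols_def)
    then show "u ! c = u ! d" using h by blast
  qed
qed (auto simp: eqcols_def)

lemma match_expr_arity:
  assumes ne: "\<And>R ns. (R, ns) \<in> set E \<Longrightarrow> R \<in> set (trels xs) \<and> length ns = ar R"
  shows "ra_arity (tars xs) (match_expr xs E) = Some 0"
    and "product_lists (map (\<lambda>(R, ns). filter (\<lambda>i. mrel (fst (xs ! i)) = R) [0..<length xs]) E) \<noteq> []"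
proof -
  have "\<exists>t. t < length xs \<and> mrel (fst (xs ! t)) = fst x" if x: "x \<in> set E" for x
  proof -
    have "fst x \<in> set (trels xs)" using ne[of "fst x" "snd x"] x by simp
    then obtain t where "t < length xs" "trels xs ! t = fst x" by (metis in_set_conv_nth length_map)
    then show ?thesis by auto
  qed
  then obtain f where f: "\<And>x. x \<in> set E \<Longrightarrow> f x < length xs \<and> mrel (fst (xs ! f x)) = fst x" by metis
  have "list_all2 (\<lambda>t (R, ns). t < length xs \<and> mrel (fst (xs ! t)) = R) (map f E) E"
    using f by (auto simp: list_all2_conv_all_nth case_prod_beta)
  then have "map f E \<in> set (product_lists (map (\<lambda>(R, ns). filter (\<lambda>i. mrel (fst (xs ! i)) = R) [0..<length xs]) E))"
    by (rule choice_iff[THEN iffD2])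
  then show 2: "product_lists (map (\<lambda>(R, ns). filter (\<lambda>i. mrel (fst (xs ! i)) = R) [0..<length xs]) E) \<noteq> []"
    by (simp only: length_greater_0_conv[symmetric] length_pos_if_in_set)
  show "ra_arity (tars xs) (match_expr xs E) = Some 0" unfolding match_expr_def
  proof (rule unions_arity)
    fix e assume "e \<in> set (map (\<lambda>ts. Proj [] (sels (eqcols (concat (map snd E))) (prods (map Tab ts))))
       (product_lists (map (\<lambda>(R, ns). filter (\<lambda>i. mrel (fst (xs ! i)) = R) [0..<length xs]) E)))"
    then obtain ts where ts: "e = Proj [] (sels (eqcols (concat (map snd E))) (prods (map Tab ts)))"
      "list_all2 (\<lambda>t (R, ns). t < length xs \<and> mrel (fst (xs ! t)) = R) ts E"
      unfolding set_map using choice_iff[THEN iffD1] by blast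
    have "list_all2 (\<lambda>e n. ra_arity (tars xs) e = Some n) (map Tab ts) (map (\<lambda>x. length (snd x)) E)"
    proof (rule list_all2_all_nthI)
      show l: "length (map Tab ts) = length (map (\<lambda>x. length (snd x)) E)" using ts(2) list_all2_lengthD by simp
      fix i assume "i < length (map Tab ts)"
      then have i: "i < length E" "ts ! i < length xs" "mrel (fst (xs ! (ts ! i))) = fst (E ! i)"
        using ts(2) l by (auto simp: list_all2_conv_all_nth case_prod_beta)
      have "length (snd (E ! i)) = ar (fst (E ! i))" using ne[of "fst (E ! i)" "snd (E ! i)"] i(1) by simp
      then show "ra_arity (tars xs) (map Tab ts ! i) = Some (map (\<lambda>x. length (snd x)) E ! i)" using i l by simp
    qed
    then have "ra_arity (tars xs) (prods (map Tab ts)) = Some (length (concat (map snd E)))"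
      using prods_arity by (fastforce simp: length_concat comp_def)
    then have "ra_arity (tars xs) (sels (eqcols (concat (map snd E))) (prods (map Tab ts))) = Some (length (concat (map snd E)))"
      by (rule sels_arity) (auto simp: eqcols_def)
    then show "ra_arity (tars xs) e = Some 0" using ts(1) by simp
  qed (use 2 in simp)
qed

end

context model
begin

lemma match_expr_eval:
  assumes T: "T \<in> runs S I (cmds xs)"
    and ne: "\<And>R ns. (R, ns) \<in> set E \<Longrightarrow> R \<in> set (trels xs) \<and> length ns = ar R"
  shows "ra_eval T (match_expr xs E) = (if \<exists>\<rho>. \<forall>(R, ns)\<in>set E. (R, map \<rho> ns) \<in> tfacts xs T then {[]} else {})"
proof -
  let ?ns = "concat (map snd E)"
  let ?ok = "\<lambda>ts us. list_all2 (\<lambda>t (R, ns). t < length xs \<and> mrel (fst (xs ! t)) = R) ts E \<and>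
     list_all2 (\<lambda>t u. u \<in> T ! t) ts us"
  have lens: "list_all2 (\<lambda>(R, ns) u. length u = length ns) E us" if ok: "?ok ts us" for ts us
  proof -
    have "length (us ! i) = length (snd (E ! i))" if i: "i < length E" for i
    proof -
      have t: "ts ! i < length xs" "mrel (fst (xs ! (ts ! i))) = fst (E ! i)" "us ! i \<in> T ! (ts ! i)"
        using ok i by (auto simp: list_all2_conv_all_nth case_prod_beta)
      then have "(fst (E ! i), us ! i) \<in> I" using tfacts_sub[OF T] tfactsI[of "ts ! i"] by blast
      then show ?thesis using len ne[of "fst (E ! i)" "snd (E ! i)"] i by simp
    qed
    then show ?thesis using ok by (auto simp: list_all2_conv_all_nth case_prod_beta)
  qed
  have "ra_eval T (match_expr xs E) =
    (\<Union>ts\<in>{ts. list_all2 (\<lambda>t (R, ns). t < length xs \<and> mrel (fst (xs ! t)) = R) ts E}.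
       (\<lambda>_. []) ` {u \<in> {concat us | us. list_all2 (\<lambda>t u. u \<in> T ! t) ts us}. \<forall>(c, d)\<in>set (eqcols ?ns). u ! c = u ! d})"
  proof -
    have s1: "set (product_lists (map (\<lambda>(R, ns). filter (\<lambda>i. mrel (fst (xs ! i)) = R) [0..<length xs]) E)) =
       {ts. list_all2 (\<lambda>t (R, ns). t < length xs \<and> mrel (fst (xs ! t)) = R) ts E}"
      using choice_iff by blast
    have s2: "map (\<lambda>ts. Proj [] (sels (eqcols ?ns) (prods (map Tab ts))))
       (product_lists (map (\<lambda>(R, ns). filter (\<lambda>i. mrel (fst (xs ! i)) = R) [0..<length xs]) E)) \<noteq> []"
      using match_expr_arity(2)[OF ne] by simp
    show ?thesis
      unfolding match_expr_def unions_eval[OF s2] set_map s1 by (simp add: prods_eval sels_eval list_all2_map1)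
  qed
  also have "\<dots> = (if \<exists>ts us. ?ok ts us \<and> (\<exists>\<rho>. concat us = map \<rho> ?ns) then {[]} else {})"
  proof -
    have key: "(\<forall>(c, d)\<in>set (eqcols ?ns). concat us ! c = concat us ! d) \<longleftrightarrow> (\<exists>\<rho>. concat us = map \<rho> ?ns)"
      if ok: "?ok ts us" for ts us
    proof -
      have "length (concat us) = length ?ns"
        by (rule concat_lengths[OF lens[OF ok]])
      then show ?thesis by (rule eqcols_iff)
    qed
    let ?X = "\<lambda>ts. {u \<in> {concat us | us. list_all2 (\<lambda>t u. u \<in> T ! t) ts us}. \<forall>(c, d)\<in>set (eqcols ?ns). u ! c = u ! d}"
    let ?C = "{ts. list_all2 (\<lambda>t (R, ns). t < length xs \<and> mrel (fst (xs ! t)) = R) ts E}"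
    show ?thesis
    proof (cases "\<exists>ts us. ?ok ts us \<and> (\<exists>\<rho>. concat us = map \<rho> ?ns)")
      case True
      then obtain ts us where o: "?ok ts us" "\<exists>\<rho>. concat us = map \<rho> ?ns" by blast
      have c: "concat us \<in> ?X ts" using key[OF o(1)] o by blast
      have "ts \<in> ?C" using o by blast
      then have "[] \<in> (\<Union>ts\<in>?C. (\<lambda>_. []) ` ?X ts)" using imageI[OF c, of "\<lambda>_. []"] by (rule UN_I)
      then have "(\<Union>ts\<in>?C. (\<lambda>_. []) ` ?X ts) = {[]}" by blast
      then show ?thesis using True by (simp only: if_True)
    next
      case False
      have "?X ts = {}" if ts: "ts \<in> ?C" for ts
      proof (rule ccontr)
        assume "?X ts \<noteq> {}"
        then obtain us where us: "list_all2 (\<lambda>t u. u \<in> T ! t) ts us"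
          "\<forall>(c, d)\<in>set (eqcols ?ns). concat us ! c = concat us ! d" by blast
        have "?ok ts us" using ts us by blast
        then show False using key us False by blast
      qed
      then have "(\<Union>ts\<in>?C. (\<lambda>_. []) ` ?X ts) = {}" by blast
      then show ?thesis using False by (simp only: if_False)
    qed
  qed
  also have "(\<exists>ts us. ?ok ts us \<and> (\<exists>\<rho>. concat us = map \<rho> ?ns)) \<longleftrightarrow> (\<exists>\<rho>. \<forall>(R, ns)\<in>set E. (R, map \<rho> ns) \<in> tfacts xs T)"
  proof
    assume "\<exists>ts us. ?ok ts us \<and> (\<exists>\<rho>. concat us = map \<rho> ?ns)"
    then obtain ts us \<rho> where ok: "?ok ts us" and r: "concat us = map \<rho> ?ns" by blast
    have "us = map (\<lambda>x. map \<rho> (snd x)) E"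
      by (rule concat_split[OF lens[OF ok] r])
    then have "(fst (E ! i), map \<rho> (snd (E ! i))) \<in> tfacts xs T" if "i < length E" for i
      using ok that by (intro tfactsI[of "ts ! i"]) (auto simp: list_all2_conv_all_nth case_prod_beta)
    then show "\<exists>\<rho>. \<forall>(R, ns)\<in>set E. (R, map \<rho> ns) \<in> tfacts xs T"
      by (intro exI[of _ \<rho>]) (metis (no_types, lifting) case_prodI2 fst_conv in_set_conv_nth snd_conv)
  next
    assume "\<exists>\<rho>. \<forall>(R, ns)\<in>set E. (R, map \<rho> ns) \<in> tfacts xs T"
    then obtain \<rho> where \<rho>: "\<And>R ns. (R, ns) \<in> set E \<Longrightarrow> (R, map \<rho> ns) \<in> tfacts xs T" by blast
    have "\<exists>t. t < length xs \<and> mrel (fst (xs ! t)) = fst x \<and> map \<rho> (snd x) \<in> T ! t" if "x \<in> set E" for x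
      using \<rho>[of "fst x" "snd x"] that unfolding tfacts_def by auto
    then obtain f where f: "\<And>x. x \<in> set E \<Longrightarrow> f x < length xs \<and> mrel (fst (xs ! f x)) = fst x \<and> map \<rho> (snd x) \<in> T ! f x"
      by metis
    have "?ok (map f E) (map (\<lambda>x. map \<rho> (snd x)) E)"
      using f by (auto simp: list_all2_conv_all_nth case_prod_beta)
    moreover have "concat (map (\<lambda>x. map \<rho> (snd x)) E) = map \<rho> ?ns" by (simp add: map_concat comp_def)
    ultimately show "\<exists>ts us. ?ok ts us \<and> (\<exists>\<rho>. concat us = map \<rho> ?ns)" by blast
  qed
  finally show ?thesis .
qed

end

section \<open>From a certificate to a plan\<close>

context wf_problem
begin

text \<open>A single value everywhere satisfies all UIDs and FDs, and also the query. This instance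
  serves to read off static properties of the rounds.\<close>

lemma full_model: "model S Q {(T, replicate (ar T) (a :: 'v)) | T. T < nrel}"
proof
  show "inst_ok S {(T, replicate (ar T) a) |T. T < nrel}" by (auto simp: inst_ok_def)
  show "satisfies S {(T, replicate (ar T) a) |T. T < nrel}"
    unfolding satisfies_def
  proof (intro conjI ballI)
    fix c assume c: "c \<in> set (uids S)"
    obtain R i T j where "c = (R, i, T, j)" by (cases c)
    then show "sat_uid {(T, replicate (ar T) a) |T. T < nrel} c" using uid_wf[of R i T j] c by (auto simp: sat_uid_def)
  next
    fix c assume c: "c \<in> set (fds S)"
    obtain R D j where "c = (R, D, j)" by (cases c)
    then show "sat_fd {(T, replicate (ar T) a) |T. T < nrel} c" by (auto simp: sat_fd_def)
  qed
qed

lemma full_holds: "cq_holds Q {(T, replicate (ar T) (a :: 'v)) | T. T < nrel}"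
  unfolding cq_holds_def
proof (intro exI[of _ "\<lambda>_. a"] ballI, clarsimp)
  fix R vs assume "(R, vs) \<in> set Q"
  then have "R < nrel" "length vs = ar R" using wfQ unfolding wf_query_def by fast+
  then show "map (\<lambda>_. a) vs = replicate (ar R) a \<and> R < nrel" by (simp add: map_replicate_const)
qed

theorem cert_answerable:
  assumes cert shows "monotone_answerable TYPE('v) S Q"
proof -
  obtain t where t: "\<And>(I :: 'v inst) K. access_run S Q I K \<Longrightarrow> cq_holds Q I \<Longrightarrow>
     (\<exists>\<rho>. \<forall>(R, ns)\<in>EQ. (R, map \<rho> ns) \<in> K t)" using EQ_matched by blast
  obtain E where E: "set E = EQ" using finite_list[OF finite_EQ] by blast
  define xs where "xs = rounds t"
  have match: "\<exists>\<rho>. \<forall>(R, ns)\<in>set E. (R, map \<rho> ns) \<in> tfacts xs T"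
    if I: "model S Q I" "cq_holds Q I" and T: "T \<in> runs S I (cmds xs)" for I :: "'v inst" and T
  proof -
    interpret model S Q I by (rule I(1))
    have "length T = length xs" using runs_length[OF T] by simp
    then show ?thesis using t[OF rounds_access_run[OF T[unfolded xs_def]] I(2)] E by (simp add: xs_def)
  qed
  \<comment> \<open>\<open>E\<close> is matched in a run on the one-value model. Hence each of its
    relations has a table after \<open>t\<close> rounds, and its atoms have the right arity.\<close>
  have ne: "R \<in> set (trels xs) \<and> length ns = ar R" if "(R, ns) \<in> set E" for R ns
  proof -
    let ?I = "{(T, replicate (ar T) (undefined :: 'v)) | T. T < nrel}"
    interpret model S Q ?I by (rule full_model)
    obtain T where T: "T \<in> runs S ?I (cmds xs)" using runs_exist by blast
    obtain \<rho> where "\<forall>(R, ns)\<in>set E. (R, map \<rho> ns) \<in> tfacts xs T" using match[OF full_model full_holds T] by blast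
    then have m: "(R, map \<rho> ns) \<in> tfacts xs T" using that by blast
    then have "length (map \<rho> ns) = ar R" using tfacts_sub[OF T] len by blast
    then show ?thesis using m by (auto simp: tfacts_def)
  qed
  let ?P = "(cmds xs @ [Mid (match_expr xs E)], length xs)"
  have "plan_arities S (cmds xs @ [Mid (match_expr xs E)]) = Some (tars xs @ [0])"
    using rounds_arity[of t] match_expr_arity(1)[OF ne] by (simp add: plan_arities_snoc xs_def cmd_arity_def)
  then have "wf_plan S ?P" unfolding wf_plan_def by (simp add: nth_append)
  moreover have "T ! length xs = cq_ans Q I"
    if I: "inst_ok S I" "satisfies S I" and T: "T \<in> runs S I (cmds xs @ [Mid (match_expr xs E)])" for I :: "'v inst" and T
  proof -
    interpret model S Q I by unfold_locales (use I in auto)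
    obtain T' where T': "T' \<in> runs S I (cmds xs)" "T = T' @ [ra_eval T' (match_expr xs E)]"
      using T unfolding runs_snoc cmd_out_def by auto
    have "length T' = length xs" using runs_length[OF T'(1)] by simp
    then have "T ! length xs = ra_eval T' (match_expr xs E)" using T'(2) by (simp add: nth_append)
    also have "\<dots> = cq_ans Q I"
    proof (cases "cq_holds Q I")
      case True
      then show ?thesis using match_expr_eval[OF T'(1) ne] match[OF model_axioms True T'(1)] by (simp add: cq_ans_def)
    next
      case False
      have "\<not> (\<exists>\<rho>. \<forall>(R, ns)\<in>set E. (R, map \<rho> ns) \<in> tfacts xs T')"
        using EQ_cert[OF _ assms] False E tfacts_sub[OF T'(1)] by blast
      then show ?thesis using match_expr_eval[OF T'(1) ne] False by (simp add: cq_ans_def)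
    qed
    finally show ?thesis .
  qed
  ultimately have "plan_answers TYPE('v) S Q ?P" unfolding plan_answers_def by auto
  then show ?thesis unfolding monotone_answerable_def by blast
qed

end

section \<open>Counterexample models\<close>

text \<open>Elements are the classes of names and nulls \<open>Nl f p\<close> born at position \<open>p\<close> of the fact \<open>f\<close>. Facts:
  \<open>Bf\<close> are the base facts, \<open>Gf\<close> witnesses that a relation is inhabited, \<open>Cp f m i\<close> is the \<open>i\<close>-th possible
  answer of method \<open>m\<close> resembling \<open>f\<close>, and \<open>Fi t e T q\<close> is created because \<open>e\<close> needs a \<open>T\<close>-fact at \<open>q\<close>:
  hidden (\<open>HT\<close>, first model only), open (\<open>OT\<close>, in both) or private to the second model (\<open>VT\<close>).\<close>

datatype tg = HT | OT | VT

datatype el = Bs nm | Nl fd nat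
  and fd = Bf bid | Gf nat | Fi tg el nat nat | Cp fd nat nat

text \<open>Countability of all facts and elements is what embeds both models into an arbitrary
  infinite type of values.\<close>

instance nm :: countable by countable_datatype
instance bid :: countable by countable_datatype
instance tg :: countable by countable_datatype
instance el :: countable by countable_datatype
instance fd :: countable by countable_datatype

section \<open>Facts and elements of the two models\<close>

context problem
begin

fun frel :: "fd \<Rightarrow> nat" where
  "frel (Bf b) = brel b" | "frel (Gf T) = T" | "frel (Fi t e T q) = T" | "frel (Cp f m i) = frel f"

text \<open>A created fact has the value it was created for, constants and fresh nulls. Facts
  private to the second model take the constants \<open>G2\<close>, those of the first take
  \<open>Ge\<close>.\<close>

fun tup :: "fd \<Rightarrow> nat \<Rightarrow> el" where
  "tup (Bf b) p = Bs (rep (bnm b p))"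
| "tup (Gf T) p = (if const_pos T p then Bs (rep (G2 T p)) else Nl (Gf T) p)"
| "tup (Fi t e T q) p = (if p = q then e else if const_pos T p then Bs (rep ((if t = VT then G2 else Ge) T p))
     else Nl (Fi t e T q) p)"
| "tup (Cp f m i) p = (if det m p then tup f p else Nl (Cp f m i) p)"

fun own :: "fd \<Rightarrow> nat \<Rightarrow> bool" where
  "own (Bf b) p = False"
| "own (Gf T) p = (\<not> const_pos T p)"
| "own (Fi t e T q) p = (p \<noteq> q \<and> \<not> const_pos T p)"
| "own (Cp f m i) p = (\<not> det m p)"

text \<open>A hidden fact is tied to its origin only at the position of its creation, so one of its
  nulls is accessible exactly if the generic value at that position is known. Nulls of shared facts
  are always accessible.\<close>

fun acce :: "el \<Rightarrow> bool" where
  "acce (Bs n) = kn n"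
| "acce (Nl f p) = (case f of Fi HT e T q \<Rightarrow> kn (Ge T p) | Fi OT e T q \<Rightarrow> True | Cp f m i \<Rightarrow> True | _ \<Rightarrow> False)"

fun hid :: "fd \<Rightarrow> bool" where
  "hid (Bf b) = True" | "hid (Gf T) = False" | "hid (Fi t e T q) = (t = HT)" | "hid (Cp f m i) = False"

fun pos1 :: "el \<Rightarrow> (nat \<times> nat) set" where
  "pos1 (Bs n) = {(brel f, p) | f p. bok f \<and> p < ar (brel f) \<and> rep (bnm f p) = n}"
| "pos1 (Nl f p) = {(frel f, p)}"

definition "nd1 e = up `` pos1 e"

text \<open>The birth fact of a null from a hidden fact is absent from the second model; the
  position survives there only if some usable access copies the null.\<close>

fun birth2 :: "el \<Rightarrow> (nat \<times> nat) set" where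
  "birth2 (Bs n) = {(brel f, q) | f m q. usable f m \<and> det m q \<and> q < ar (brel f) \<and> rep (bnm f q) = n}
     \<union> {(T, q) | T q. rel2 T \<and> const_pos T q \<and> rep (G2 T q) = n}"
| "birth2 (Nl f p) = (if hid f \<longrightarrow> (\<exists>m. usable (Gn (frel f)) m \<and> det m p) then {(frel f, p)} else {})"

definition "pos2s e = birth2 e \<union> {(T, q). (T, q) \<in> nd1 e \<and> acce e \<and> follow T q}"

definition "nd2 e = up `` pos2s e"

text \<open>An \<open>Fi\<close> fact is created only at positions where its element was not born,
  as in a restricted chase; this is what keeps the FDs true. It is open exactly if an access could
  retrieve a fact with that value there. Copies are made of hidden facts only, since shared facts
  can be returned themselves.\<close>

fun v1 :: "fd \<Rightarrow> bool" and d1 :: "el \<Rightarrow> bool" where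
  "v1 (Bf b) = bok b"
| "v1 (Gf T) = False"
| "v1 (Fi t e T q) = (d1 e \<and> t \<noteq> VT \<and> (T, q) \<in> nd1 e \<and> (T, q) \<notin> pos1 e \<and> (t = OT \<longleftrightarrow> acce e \<and> follow T q))"
| "v1 (Cp f m i) = (v1 f \<and> hid f \<and> m < nmeth \<and> mrel m = frel f \<and> (\<forall>p\<in>set (mins m). acce (tup f p)))"
| "d1 (Bs n) = True"
| "d1 (Nl f p) = (v1 f \<and> p < ar (frel f) \<and> own f p)"

text \<open>Nulls of hidden facts count as elements of the second model although their birth facts
  are missing, because copies may carry them.\<close>

fun v2 :: "fd \<Rightarrow> bool" and d2 :: "el \<Rightarrow> bool" where
  "v2 (Bf b) = False"
| "v2 (Gf T) = rel2 T"
| "v2 (Fi t e T q) = (if t = VT then d2 e \<and> (T, q) \<in> nd2 e \<and> (T, q) \<notin> pos2s e else t = OT \<and> v1 (Fi t e T q))"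
| "v2 (Cp f m i) = v1 (Cp f m i)"
| "d2 (Bs n) = True"
| "d2 (Nl f p) = ((if hid f then v1 f else v2 f) \<and> p < ar (frel f) \<and> own f p)"

fun shared :: "fd \<Rightarrow> bool" where
  "shared (Fi t e T q) = (t = OT)" | "shared (Cp f m i) = True" | "shared _ = False"

text \<open>\<open>root\<close> undoes a copy, and \<open>dt f p\<close> says that \<open>f\<close>
  inherits its value at \<open>p\<close> from its root.\<close>

fun root :: "fd \<Rightarrow> fd" where
  "root (Cp f m i) = f" | "root f = f"

fun dt :: "fd \<Rightarrow> nat \<Rightarrow> bool" where
  "dt (Cp f m i) p = det m p" | "dt f p = True"

lemma own_tup: "own f p \<Longrightarrow> tup f p = Nl f p"
  by (cases f) auto

lemma tup_root: "dt f p \<Longrightarrow> tup f p = tup (root f) p"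
  by (cases f) auto

lemma frel_root [simp]: "frel (root f) = frel f"
  by (cases f) auto

lemma nd1E: "(T, q) \<in> nd1 e \<Longrightarrow> (\<And>R i. (R, i) \<in> pos1 e \<Longrightarrow> ((R, i), (T, q)) \<in> up \<Longrightarrow> P) \<Longrightarrow> P"
  unfolding nd1_def by force

lemma nd2E: "(T, q) \<in> nd2 e \<Longrightarrow> (\<And>R i. (R, i) \<in> pos2s e \<Longrightarrow> ((R, i), (T, q)) \<in> up \<Longrightarrow> P) \<Longrightarrow> P"
  unfolding nd2_def by force

lemma nd1_step: "(R, i) \<in> nd1 e \<Longrightarrow> U R i T j \<Longrightarrow> (T, j) \<in> nd1 e"
  unfolding nd1_def using up_step by blast

lemma nd2_step: "(R, i) \<in> nd2 e \<Longrightarrow> U R i T j \<Longrightarrow> (T, j) \<in> nd2 e"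
  unfolding nd2_def using up_step by blast

lemma pos1_nd1: "x \<in> pos1 e \<Longrightarrow> x \<in> nd1 e"
  unfolding nd1_def by (cases x) (blast intro: up_refl)

lemma pos2s_nd2: "x \<in> pos2s e \<Longrightarrow> x \<in> nd2 e"
  unfolding nd2_def by (cases x) (blast intro: up_refl)

end

section \<open>The first model satisfies the constraints\<close>

context wf_problem
begin

lemma v1_reach: "v1 f \<Longrightarrow> reach (frel f)"
  and d1_pos1: "d1 e \<Longrightarrow> (T, q) \<in> pos1 e \<Longrightarrow> reach T \<and> q < ar T"
proof (induction f and e arbitrary: and T q rule: v1_d1.induct)
  case (1 b)
  then show ?case using bok_reach by simp
next
  case (3 t e T q)
  then show ?case using reach_up by (auto elim!: nd1E)
next
  case (5 n)
  then show ?case using bok_reach by auto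
qed auto

lemma nd1_reach: "d1 e \<Longrightarrow> (T, q) \<in> nd1 e \<Longrightarrow> reach T \<and> q < ar T"
  by (erule nd1E) (meson d1_pos1 reach_up up_wf)

lemma tup_d1: "v1 f \<Longrightarrow> p < ar (frel f) \<Longrightarrow> d1 (tup f p)"
  by (induction f p rule: tup.induct) auto

lemma base_pos1: "bok f \<Longrightarrow> p < ar (brel f) \<Longrightarrow> (brel f, p) \<in> pos1 (Bs (rep (bnm f p)))"
  by auto

lemma tup_nd1: "v1 f \<Longrightarrow> p < ar (frel f) \<Longrightarrow> (frel f, p) \<in> nd1 (tup f p)"
proof (induction f p rule: tup.induct)
  case (1 b p)
  then show ?case using pos1_nd1[OF base_pos1] by simp
next
  case (3 t e T q p)
  have "reach T" using v1_reach[OF 3(1)] by simp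
  then have "(T, p) \<in> nd1 (Bs (rep (Ge T p)))" using pos1_nd1[OF base_pos1[of "Gn T" p]] 3 by simp
  moreover have "(T, p) \<in> nd1 (Nl (Fi t e T q) p)" by (rule pos1_nd1) simp
  ultimately show ?case using 3 by auto
next
  case (4 f m i p)
  moreover have "(frel f, p) \<in> nd1 (Nl (Cp f m i) p)" by (rule pos1_nd1) simp
  ultimately show ?case by auto
qed auto

lemma const_sim: "const_pos R p \<Longrightarrow> bok f \<Longrightarrow> brel f = R \<Longrightarrow> sim (bnm f p) (Ge R p)"
proof (induction arbitrary: f rule: const_pos.induct)
  case (const_fd R D j)
  have "bok (Gn R)" using bok_reach const_fd by auto
  then show ?case using sim_fd[of f "Gn R" R D j] const_fd by auto
next
  case (const_uid R i T j)
  have "sim (bnm f i) (Ge T j)" using sim_uid[of f i T j] const_uid by blast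
  moreover have "sim (Ge R i) (Ge T j)" using sim_uid[of "Gn R" i T j] const_uid bok_reach by auto
  ultimately show ?case using sim_sym sim_trans by blast
qed

lemma Ge_up: "((R, i), (T, q)) \<in> up \<Longrightarrow> kn (Ge T q) \<Longrightarrow> reach R \<Longrightarrow> kn (Ge R i)"
proof (induction rule: up_induct_back)
  case (step R i R' i')
  then show ?case using kn_uid[of "Gn R" i R' i'] reach_uid by auto
qed

text \<open>\<open>kn_uid\<close> carries knowledge of a generic value backwards along the UID chain
  to the birth position of \<open>e\<close>, where \<open>kn_gen\<close> applies to every base
  fact.\<close>

lemma acce_of_gen:
  assumes e: "d1 e" "(T, q) \<in> nd1 e" "kn (Ge T q)"
  shows "acce e"
  using e(2)
proof (rule nd1E)
  fix R i assume p: "(R, i) \<in> pos1 e" and u: "((R, i), (T, q)) \<in> up"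
  have k: "kn (Ge R i)" using Ge_up[OF u e(3)] d1_pos1[OF e(1) p] by blast
  show ?thesis
  proof (cases e)
    case (Bs n)
    then obtain f where f: "bok f" "i < ar (brel f)" "rep (bnm f i) = n" "brel f = R" using p by auto
    then show ?thesis using Bs kn_gen[OF f(1,2)] kn_rep[OF f(1,2)] k by simp
  next
    case (Nl f j)
    then show ?thesis using k p e(1) by (cases f) (auto split: tg.split)
  qed
qed

lemma Kg_up: "((R, i), (T, q)) \<in> up \<Longrightarrow> kn (Kg R i i) \<Longrightarrow> reach R \<Longrightarrow> i < ar R \<Longrightarrow> kn (Kg T q q)"
proof (induction rule: up_induct)
  case (step T j T' j')
  then show ?case using kn_step[of "Kn T j" j T' j'] reach_up up_wf by auto
qed

lemma usable_Kn_of_gen: "usable (Gn T) m \<Longrightarrow> q < ar T \<Longrightarrow> usable (Kn T q) m"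
  unfolding usable_def using kn_gen[of "Kn T q"] meth_wf[of m] by auto

text \<open>A method that can be used on a hidden fact does not reach the position through which the fact
  was created, for otherwise the fact would be open.\<close>

lemma hidden_usable:
  assumes v: "v1 (Fi HT e T q)" and K: "acce e \<Longrightarrow> kn (Kg T q q)"
    and m: "m < nmeth" "mrel m = T" "\<forall>p\<in>set (mins m). acce (tup (Fi HT e T q) p)"
  shows "usable (Gn T) m \<and> \<not> det m q"
proof -
  have d: "d1 e" "(T, q) \<in> nd1 e" "\<not> (acce e \<and> follow T q)" using v by auto
  have T: "reach T" "q < ar T" using nd1_reach d by blast+
  have g: "kn (Ge T p)" if p: "p \<in> set (mins m)" "p \<noteq> q" for p
  proof -
    have pa: "p < ar T" using meth_wf m p by blast
    then show ?thesis using m(3) p kn_rep[of "Gn T" p] T by (auto split: if_splits)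
  qed
  have e: "acce e" if "q \<in> set (mins m)" using m(3) that by auto
  have noK: "False" if "acce e" "usable (Kn T q) m" "det m q"
    using d(3) that unfolding follow_def by blast
  show ?thesis
  \<comment> \<open>If \<open>q\<close> is an input whose generic value is unknown, the method is
    usable on \<open>Kn T q\<close>. Otherwise it is usable on \<open>Gn T\<close>, and if it
    determined \<open>q\<close>, the generic value and hence \<open>e\<close> would be known. Either
    way \<open>follow T q\<close> would hold and the fact would be open.\<close>
  proof (cases "q \<in> set (mins m) \<and> \<not> kn (Ge T q)")
    case True
    then have a: "acce e" using e by blast
    have "kn (Kg T q p)" if p: "p \<in> set (mins m)" for p
    proof (cases "p = q")
      case False
      then show ?thesis using g p kn_gen[of "Kn T q" p] meth_wf m T by auto
    qed (use K a in simp)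
    then have "usable (Kn T q) m" unfolding usable_def using m T by auto
    then show ?thesis using noK a det_ins True by blast
  next
    case False
    then have u: "usable (Gn T) m" unfolding usable_def using g m T by auto
    have "\<not> det m q"
    proof
      assume dq: "det m q"
      then have "kn (Ge T q)" using usable_intros(2)[OF u, of q] T by simp
      then have "acce e" using acce_of_gen d by blast
      then show False using noK usable_Kn_of_gen[OF u T(2)] dq by blast
    qed
    then show ?thesis using u by blast
  qed
qed

lemma usable_Bf: "v1 (Cp (Bf b) m i) \<longleftrightarrow> usable b m"
proof -
  have "kn (rep (bnm b p)) = kn (bnm b p)" if "bok b" "m < nmeth" "mrel m = brel b" "p \<in> set (mins m)" for p
    using kn_rep[of b p] meth_wf[OF that(2)] that by auto
  then show ?thesis by (auto simp: usable_def)
qed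

text \<open>Some retrieved value stands at such a position, so the one behind \<open>Kn R i\<close>
  is known. For the null of a copied hidden fact this rests on \<open>hidden_usable\<close>, whose
  premise concerns the smaller element the fact was created for; hence the induction on
  size.\<close>

lemma acce_Kg: "d1 e \<Longrightarrow> acce e \<Longrightarrow> (R, i) \<in> pos1 e \<Longrightarrow> kn (Kg R i i)"
proof (induction e arbitrary: R i rule: measure_induct_rule[where f = size])
  case (less e)
  note ri = d1_pos1[OF less(2,4)]
  show ?case
  proof (cases e)
    case (Bs n)
    then obtain f where f: "bok f" "i < ar (brel f)" "rep (bnm f i) = n" "brel f = R" using less by auto
    then show ?thesis using kn_self[OF f(1,2)] kn_rep[OF f(1,2)] less(3) Bs by simp
  next
    case (Nl f p)
    then have f: "v1 f" "R = frel f" "i = p" "own f p" using less by auto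
    show ?thesis
    proof (cases f)
      case (Fi t e' T q)
      show ?thesis
      proof (cases t)
        case HT
        then have "kn (Ge T p)" using less(3) Nl Fi by simp
        then show ?thesis using kn_self[of "Gn T" p] ri f Fi by simp
      next
        case OT
        then have "follow T q" using f Fi by simp
        then obtain m where "usable (Kn T q) m" unfolding follow_def by blast
        then show ?thesis using usable_intros(3)[of "Kn T q" m p] ri f Fi by simp
      qed (use f Fi in simp)
    next
      case (Cp g m j)
      show ?thesis
      proof (cases g)
        case (Bf b)
        then have "usable b m" using usable_Bf f Cp by simp
        then show ?thesis using usable_intros(3)[of b m p] ri f Cp Bf by simp
      next
        case (Fi t e' T q)
        then have v: "v1 (Fi HT e' T q)" "m < nmeth" "mrel m = T" "\<forall>p\<in>set (mins m). acce (tup (Fi HT e' T q) p)"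
          using f Cp by auto
        have K: "kn (Kg T q q)" if a: "acce e'"
        proof -
          have "(T, q) \<in> nd1 e'" "d1 e'" using v by auto
          moreover have "size e' < size e" using Nl Cp Fi by simp
          ultimately show ?thesis using less(1)[of e'] a Kg_up d1_pos1 by (elim nd1E) blast
        qed
        have "usable (Gn T) m" using hidden_usable[OF v(1) K v(2-4)] by blast
        then show ?thesis using usable_intros(3)[of "Gn T" m p] ri f Cp Fi by simp
      qed (use f Cp in auto)
    qed (use f in auto)
  qed
qed

lemma acce_nd1_Kg: "d1 e \<Longrightarrow> acce e \<Longrightarrow> (T, q) \<in> nd1 e \<Longrightarrow> kn (Kg T q q)"
  by (erule nd1E) (meson acce_Kg d1_pos1 Kg_up)

lemma copy_cases:
  assumes "v1 (Cp f m i)"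
  obtains (base) b where "f = Bf b" "usable b m"
  | (hidden) e T q where "f = Fi HT e T q" "usable (Gn T) m" "\<not> det m q" "v1 f"
proof (cases f)
  case (Bf b)
  then show ?thesis using base usable_Bf assms by blast
next
  case (Fi t e T q)
  then have v: "v1 (Fi HT e T q)" "t = HT" "m < nmeth" "mrel m = T" "\<forall>p\<in>set (mins m). acce (tup (Fi HT e T q) p)"
    using assms by auto
  have "acce e \<Longrightarrow> kn (Kg T q q)" using acce_nd1_Kg v(1) by auto
  then show ?thesis using hidden[of e T q] hidden_usable[OF v(1) _ v(3-5)] Fi v by blast
qed (use assms in auto)

text \<open>Bindings taken from the common part of the models therefore consist of accessible
  elements, which is what the condition on copies in \<open>v1\<close> asks for.\<close>

lemma shared_acce:
  assumes v: "v1 f" and "shared f" and p: "p < ar (frel f)"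
  shows "acce (tup f p)"
proof (cases f)
  case (Cp g m i)
  have "v1 (Cp g m i)" using v Cp by simp
  then show ?thesis
  proof (cases rule: copy_cases)
    case (base b)
    then show ?thesis using usable_intros(2)[OF base(2), of p] kn_rep[of b p] p Cp unfolding usable_def by auto
  next
    case (hidden e T q)
    then have "det m p \<Longrightarrow> kn (Ge T p)" using usable_intros(2)[OF hidden(2), of p] p Cp by simp
    moreover have "kn (rep (Ge T p)) = kn (Ge T p)"
      using kn_rep[of "Gn T" p] hidden(2) p Cp hidden(1) unfolding usable_def by simp
    ultimately show ?thesis using hidden Cp by auto
  qed
next
  case (Fi t e T q)
  then have t: "t = OT" "acce e" "follow T q" using assms by auto
  then obtain m where m: "usable (Kn T q) m" unfolding follow_def by blast
  have T: "reach T" using v1_reach[OF v] Fi by simp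
  have "kn (rep (Ge T p))" if c: "const_pos T p"
  proof -
    have "det m p" using det_const[of m p] m c unfolding usable_def by simp
    then have "kn (Kg T q p)" using usable_intros(2)[OF m, of p] p Fi by simp
    moreover have "sim (Kg T q p) (Ge T p)" using const_sim[OF c, of "Kn T q"] m unfolding usable_def by simp
    ultimately have "kn (Ge T p)" using kn_sim by blast
    then show ?thesis using kn_rep[of "Gn T" p] T p Fi by simp
  qed
  then show ?thesis using Fi t by auto
qed (use assms in auto)

lemma own_not_const: "v1 f \<or> v2 f \<Longrightarrow> own f p \<Longrightarrow> \<not> const_pos (frel f) p"
proof (cases f)
  case (Cp g m i)
  then show "v1 f \<or> v2 f \<Longrightarrow> own f p \<Longrightarrow> ?thesis" using det_const[of m p] by auto
qed auto

text \<open>Constancy passes backwards along UIDs, so the birth position is constant as well. No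
  null is born at a constant position, and base facts carry the generic constant there.\<close>

lemma const_el:
  assumes e: "d1 e" "(T, q) \<in> nd1 e" and c: "const_pos T q"
  shows "e = Bs (rep (Ge T q))"
  using e(2)
proof (rule nd1E)
  fix R i assume p: "(R, i) \<in> pos1 e" and u: "((R, i), (T, q)) \<in> up"
  have cR: "const_pos R i" using const_up[OF u c] .
  have T: "reach T" "q < ar T" using nd1_reach e by blast+
  show ?thesis
  proof (cases e)
    case (Bs n)
    then obtain f where f: "bok f" "i < ar (brel f)" "rep (bnm f i) = n" "brel f = R" using p by auto
    have R: "reach R" using bok_reach f by blast
    have "reach R \<longrightarrow> sim (Ge R i) (Ge T q)" using u
    proof (induction rule: up_induct_back)
      case refl
      then show ?case using sim_base[of "Gn T" q] T by simp
    next
      case (step R i R' i')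
      have "const_pos R' i'" using const_up[OF step(2) c] .
      then show ?case using step sim_uid[of "Gn R" i R' i'] reach_uid[of R i R' i'] sim_trans[of "Ge R i" "Ge R' i'"] by auto
    qed
    then have "sim (bnm f i) (Ge T q)" using const_sim[OF cR f(1,4)] R sim_trans by blast
    then show ?thesis using rep_sim f Bs by simp
  next
    case (Nl f j)
    then show ?thesis using own_not_const[of f j] e(1) p cR by auto
  qed
qed

lemma tup_const: "v1 f \<Longrightarrow> const_pos (frel f) p \<Longrightarrow> tup f p = Bs (rep (Ge (frel f) p))"
  using const_el tup_d1 tup_nd1 const_wf by blast

text \<open>Any other uncopied fact could hold the null at \<open>d\<close> only as the value it was
  created for, but creation is excluded at birth positions.\<close>

lemma tup_null0:
  assumes "v1 g" "tup g d = Nl f d" "frel g = frel f" "\<And>g' m i. g \<noteq> Cp g' m i"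
  shows "g = f"
  using assms by (cases g) (auto split: if_splits)

lemma tup_null:
  assumes "v1 g" "tup g d = Nl f d" "frel g = frel f"
  shows "g = f \<or> (\<exists>m i. g = Cp f m i \<and> det m d)"
proof (cases "\<exists>g' m i. g = Cp g' m i")
  case True
  then obtain g' m i where g: "g = Cp g' m i" by blast
  show ?thesis
  proof (cases "det m d")
    case True
    have "g' = f"
      by (rule tup_null0[of g' d]) (use assms g True in auto)
    then show ?thesis using g True by blast
  qed (use assms g in auto)
qed (use tup_null0 assms in blast)

lemma origin:
  assumes v: "v1 f" and d: "d < ar (frel f)" "\<not> const_pos (frel f) d"
  shows "(\<exists>h. tup f d = Nl h d \<and> frel h = frel f) \<or>
    dt f d \<and> ((\<exists>a. root f = Bf a \<and> bok a \<and> tup f d = Bs (rep (bnm a d))) \<or>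
      (\<exists>t. root f = Fi t (tup f d) (frel f) d \<and> v1 (root f)))"
proof (cases f)
  case (Cp g m i)
  then show ?thesis using v d by (cases "det m d"; cases g) auto
qed (use v d in auto)

text \<open>The heart of FD satisfaction: at a non-constant position a value identifies its fact up
  to copying, except among base facts, whose equalities \<open>sim\<close> controls.\<close>

lemma agree1:
  assumes f: "v1 f" and g: "v1 g" and T: "frel f = T" "frel g = T" and d: "d < ar T" "\<not> const_pos T d"
    and eq: "tup f d = tup g d"
  shows "f = g \<or> dt f d \<and> dt g d \<and> (root f = root g \<or> (\<exists>a b. root f = Bf a \<and> root g = Bf b))"
proof (cases "\<exists>h. tup f d = Nl h d \<and> frel h = T")
  case True
  then obtain h where h: "tup f d = Nl h d" "frel h = T" by blast
  have 1: "f = h \<or> (\<exists>m i. f = Cp h m i \<and> det m d)" using tup_null f h T by simp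
  have 2: "g = h \<or> (\<exists>m i. g = Cp h m i \<and> det m d)" using tup_null[of g d h] g h T eq by simp
  have "root h = h \<and> dt h d" if "hid h" using that by (cases h) auto
  then show ?thesis using 1 2 f g by auto
next
  case False
  then have 1: "dt f d \<and> ((\<exists>a. root f = Bf a \<and> bok a \<and> tup f d = Bs (rep (bnm a d))) \<or>
      (\<exists>t. root f = Fi t (tup f d) T d \<and> v1 (root f)))" using origin[OF f, of d] d T by auto
  have 2: "dt g d \<and> ((\<exists>a. root g = Bf a \<and> bok a \<and> tup g d = Bs (rep (bnm a d))) \<or>
      (\<exists>t. root g = Fi t (tup g d) T d \<and> v1 (root g)))" using origin[OF g, of d] d T eq False by auto
  have rel: "frel (root f) = T" "frel (root g) = T" using T by simp_all
  have no: False if a: "root x = Bf a" "bok a" "e = Bs (rep (bnm a d))" "frel (root x) = T" "v1 (Fi t e T d)" for x a e t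
  proof -
    have "(T, d) \<in> pos1 e" using base_pos1[OF a(2), of d] a d by simp
    then show False using a(5) by simp
  qed
  consider (bb) a b where "root f = Bf a" "root g = Bf b"
    | (bf) a t where "root f = Bf a" "bok a" "tup f d = Bs (rep (bnm a d))" "v1 (Fi t (tup g d) T d)"
    | (fb) a t where "root g = Bf a" "bok a" "tup g d = Bs (rep (bnm a d))" "v1 (Fi t (tup f d) T d)"
    | (ff) t t' where "root f = Fi t (tup f d) T d" "root g = Fi t' (tup g d) T d" "v1 (root f)" "v1 (root g)"
    using 1 2 by metis
  then show ?thesis
  proof cases
    case bb
    then show ?thesis using 1 2 by blast
  next
    case (bf a t)
    then show ?thesis using no[of f a "tup g d" t] rel eq by simp
  next
    case (fb a t)
    then show ?thesis using no[of g a "tup f d" t] rel eq by simp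
  next
    case (ff t t')
    have "v1 (Fi t (tup f d) T d)" "v1 (Fi t' (tup f d) T d)" using ff eq by simp_all
    then have "t = t'" by (cases t; cases t') simp_all
    then show ?thesis using ff eq 1 2 by simp
  qed
qed

text \<open>If the left side is constant, so is \<open>j\<close>. Otherwise agreement leaves equal
  facts, two copies of one root, or copies of base facts. The determined positions are closed under
  FDs, so \<open>j\<close> is inherited from the roots, and between base facts \<open>sim_fd\<close>
  applies.\<close>

lemma fd_from_agreement:
  assumes fd: "(R, D, j) \<in> set (fds S)" and eq: "\<And>d. d \<in> set D \<Longrightarrow> tup f d = tup g d"
    and c: "const_pos R j \<Longrightarrow> tup f j = tup g j"
    and mf: "\<And>f' m i. f = Cp f' m i \<Longrightarrow> mrel m = R" and mg: "\<And>g' m i. g = Cp g' m i \<Longrightarrow> mrel m = R"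
    and bf: "\<And>a. root f = Bf a \<Longrightarrow> bok a \<and> brel a = R" and bg: "\<And>a. root g = Bf a \<Longrightarrow> bok a \<and> brel a = R"
    and agree: "\<And>d. d \<in> set D \<Longrightarrow> \<not> const_pos R d \<Longrightarrow>
      f = g \<or> dt f d \<and> dt g d \<and> (root f = root g \<or> (\<exists>a b. root f = Bf a \<and> root g = Bf b))"
  shows "tup f j = tup g j"
proof (cases "f = g \<or> (\<forall>d\<in>set D. const_pos R d)")
  case True
  then show ?thesis using c const_fd[OF fd] by blast
next
  case False
  then obtain d0 where d0: "d0 \<in> set D" "\<not> const_pos R d0" by blast
  have dtc: "dt x d" if "const_pos R d" "\<And>f' m i. x = Cp f' m i \<Longrightarrow> mrel m = R" for x d
    using that det_const by (cases x) auto
  have "dt f d \<and> dt g d" if "d \<in> set D" for d using agree[OF that] dtc mf mg False by blast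
  then have dj: "dt f j" "dt g j"
  proof -
    have "dt x j" if "\<And>d. d \<in> set D \<Longrightarrow> dt x d" "\<And>f' m i. x = Cp f' m i \<Longrightarrow> mrel m = R" for x
      using that det_fd[of _ D j] fd by (cases x) auto
    then show "dt f j" "dt g j" using \<open>\<And>d. d \<in> set D \<Longrightarrow> dt f d \<and> dt g d\<close> mf mg by blast+
  qed
  have dd: "dt f d" "dt g d" if "d \<in> set D" for d
    using \<open>\<And>d. d \<in> set D \<Longrightarrow> dt f d \<and> dt g d\<close> that by blast+
  consider "root f = root g" | a b where "root f = Bf a" "root g = Bf b" using agree[OF d0] False by blast
  then show ?thesis
  proof cases
    case 1
    then show ?thesis using tup_root dj by metis
  next
    case (2 a b)
    have ab: "bok a" "bok b" "brel a = R" "brel b = R" using bf bg 2 by blast+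
    have "sim (bnm a d) (bnm b d)" if d: "d \<in> set D" for d
    proof -
      have "d < ar R" using fd_wf fd d by blast
      moreover have "rep (bnm a d) = rep (bnm b d)"
        using eq[OF d] tup_root[OF dd(1)[OF d]] tup_root[OF dd(2)[OF d]] 2 by simp
      ultimately show ?thesis using rep_eq_sim[OF sim_base sim_base] ab by metis
    qed
    then have "sim (bnm a j) (bnm b j)" using sim_fd[OF ab fd] by blast
    then show ?thesis using tup_root dj 2 rep_sim by simp
  qed
qed

lemma fd1:
  assumes "(R, D, j) \<in> set (fds S)" "v1 f" "v1 g" "frel f = R" "frel g = R" "\<And>d. d \<in> set D \<Longrightarrow> tup f d = tup g d"
  shows "tup f j = tup g j"
proof (rule fd_from_agreement[OF assms(1,6)])
  show "const_pos R j \<Longrightarrow> tup f j = tup g j" using tup_const assms by metis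
  show "root f = Bf a \<Longrightarrow> bok a \<and> brel a = R" for a using assms by (cases f) auto
  show "root g = Bf a \<Longrightarrow> bok a \<and> brel a = R" for a using assms by (cases g) auto
  show "f = g \<or> dt f d \<and> dt g d \<and> (root f = root g \<or> (\<exists>a b. root f = Bf a \<and> root g = Bf b))"
    if "d \<in> set D" "\<not> const_pos R d" for d
    using agree1[OF assms(2-5) _ that(2)] assms(6) that(1) fd_wf[OF assms(1)] by blast
qed (use assms in auto)

lemma uid1:
  assumes f: "v1 f" and u: "U (frel f) i T j"
  shows "\<exists>g. v1 g \<and> frel g = T \<and> tup g j = tup f i"
proof -
  let ?e = "tup f i"
  have i: "i < ar (frel f)" using uid_wf u by blast
  have e: "d1 ?e" "(T, j) \<in> nd1 ?e" using tup_d1[OF f i] nd1_step[OF tup_nd1[OF f i] u] by auto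
  show ?thesis
  proof (cases "(T, j) \<in> pos1 ?e")
    case True
    show ?thesis
    proof (cases ?e)
      case (Bs n)
      then obtain b where "bok b" "brel b = T" "rep (bnm b j) = n" using True by auto
      then show ?thesis using Bs by (intro exI[of _ "Bf b"]) simp
    next
      case (Nl h p)
      then show ?thesis using True e own_tup by (intro exI[of _ h]) auto
    qed
  next
    case False
    then show ?thesis using e
      by (intro exI[of _ "Fi (if acce ?e \<and> follow T j then OT else HT) ?e T j"]) auto
  qed
qed

section \<open>The second model satisfies the constraints\<close>

lemma follow_rel2: "follow T q \<Longrightarrow> rel2 T"
  unfolding follow_def using usable_intros(1)[of "Kn T q"] by auto

lemma v2_rel2: "v2 f \<Longrightarrow> rel2 (frel f)"
  and d2_pos2s: "d2 e \<Longrightarrow> (T, q) \<in> pos2s e \<Longrightarrow> rel2 T \<and> q < ar T"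
proof (induction f and e arbitrary: and T q rule: v2_d2.induct)
  case (3 t e T q)
  show ?case
  proof (cases "t = VT")
    case True
    then show ?thesis using 3 rel2_up by (auto elim!: nd2E)
  next
    case False
    then show ?thesis using 3 follow_rel2 by auto
  qed
next
  case (4 f m i)
  then have "v1 (Cp f m i)" by simp
  then show ?case by (cases rule: copy_cases) (use usable_intros(1) in fastforce)+
next
  case (5 n)
  show ?case using 5(2) unfolding pos2s_def
  proof (elim UnE)
    assume "(T, q) \<in> birth2 (Bs n)"
    then show ?thesis using usable_intros(1) const_wf by auto
  next
    assume "(T, q) \<in> {(T, q). (T, q) \<in> nd1 (Bs n) \<and> acce (Bs n) \<and> follow T q}"
    then show ?thesis using follow_rel2 nd1_reach[of "Bs n" T q] by auto
  qed
next
  case (6 f p)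
  show ?case using "6.prems"(2) unfolding pos2s_def
  proof (elim UnE)
    assume "(T, q) \<in> birth2 (Nl f p)"
    then show ?thesis using 6 usable_intros(1)[of "Gn (frel f)"] by (auto split: if_splits)
  next
    assume "(T, q) \<in> {(T, q). (T, q) \<in> nd1 (Nl f p) \<and> acce (Nl f p) \<and> follow T q}"
    then show ?thesis using follow_rel2 "6.prems"(1) up_wf by (auto elim!: nd1E)
  qed
qed auto

lemma nd2_rel2: "d2 e \<Longrightarrow> (T, q) \<in> nd2 e \<Longrightarrow> rel2 T \<and> q < ar T"
  by (erule nd2E) (meson d2_pos2s rel2_up up_wf)

lemma d2_d1: "d2 e \<Longrightarrow> acce e \<Longrightarrow> d1 e"
proof (cases e)
  case (Nl f p)
  then show "d2 e \<Longrightarrow> acce e \<Longrightarrow> ?thesis" by (cases f) (auto split: tg.splits)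
qed simp

lemma d1_d2: "d1 e \<Longrightarrow> acce e \<Longrightarrow> d2 e"
proof (cases e)
  case (Nl f p)
  then show "d1 e \<Longrightarrow> acce e \<Longrightarrow> ?thesis" by (cases f) (auto split: tg.splits)
qed simp

lemma tup_d2: "v2 f \<Longrightarrow> p < ar (frel f) \<Longrightarrow> d2 (tup f p)"
proof -
  assume v: "v2 f" and p: "p < ar (frel f)"
  have "d2 (tup f p)" if "v1 f" "shared f" using d1_d2 tup_d1 shared_acce that p by blast
  then show ?thesis using v p by (cases f) (auto split: if_splits)
qed

text \<open>Values stand outside \<open>pos2s\<close> only in private facts, and there only at the
  position of creation. Since private facts are created outside \<open>pos2s\<close>, they cannot
  meet another fact at that position.\<close>

lemma tup_pos2s:
  assumes v: "v2 f" and p: "p < ar (frel f)" and nV: "\<And>e. f \<noteq> Fi VT e (frel f) p"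
  shows "(frel f, p) \<in> pos2s (tup f p)"
proof -
  have own: "(frel f, p) \<in> pos2s (tup f p)" if "own f p"
  proof -
    have "\<not> hid f" using v that by (cases f) (auto split: if_splits)
    then show ?thesis using own_tup[OF that] by (simp add: pos2s_def)
  qed
  have bp: "(T, p) \<in> pos2s (Bs (rep n))" if "usable b m" "det m p" "brel b = T" "p < ar T" "rep (bnm b p) = rep n" for b m T n
    using that by (auto simp: pos2s_def)
  have g2: "(T, p) \<in> pos2s (Bs (rep (G2 T p)))" if "rel2 T" "const_pos T p" for T
    using that by (auto simp: pos2s_def)
  show ?thesis
  proof (cases f)
    case (Gf T)
    then show ?thesis using own g2 v by (cases "const_pos T p") auto
  next
    case (Fi t e T q)
    show ?thesis
    proof (cases "t = VT")
      case True
      then have "p \<noteq> q" using nV Fi by auto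
      then show ?thesis using own g2[of T] v2_rel2[OF v] Fi True by (cases "const_pos T p") auto
    next
      case False
      then have t: "t = OT" "acce e" "follow T q" "(T, q) \<in> nd1 e" using v Fi by auto
      then obtain m where m: "usable (Kn T q) m" unfolding follow_def by blast
      have "(T, p) \<in> pos2s (Bs (rep (Ge T p)))" if c: "const_pos T p"
        using bp[OF m, of T "Ge T p"] det_const[of m p] m c p Fi rep_sim[OF const_sim[OF c, of "Kn T q"]]
        unfolding usable_def by simp
      moreover have "(T, q) \<in> pos2s e" using t unfolding pos2s_def by blast
      ultimately show ?thesis using own t Fi by (cases "p = q"; cases "const_pos T p") auto
    qed
  next
    case (Cp g m i)
    show ?thesis
    proof (cases "det m p")
      case True
      have "v1 (Cp g m i)" using v Cp by simp
      then show ?thesis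
      proof (cases rule: copy_cases)
        case (base b)
        then show ?thesis using base Cp True p bp[of b m "brel b" "bnm b p"] by simp
      next
        case (hidden e T q)
        have "p \<noteq> q" using True hidden by auto
        moreover have "(T, p) \<in> pos2s (Bs (rep (Ge T p)))"
          using bp[OF hidden(2) True, of T "Ge T p"] p Cp hidden by simp
        moreover have "(T, p) \<in> pos2s (Nl (Fi HT e T q) p)"
          using hidden True by (auto simp: pos2s_def)
        ultimately show ?thesis using Cp True hidden by auto
      qed
    qed (use own Cp in simp)
  qed (use v in simp)
qed

lemma tup_nd2: "v2 f \<Longrightarrow> p < ar (frel f) \<Longrightarrow> (frel f, p) \<in> nd2 (tup f p)"
proof (cases "\<exists>e. f = Fi VT e (frel f) p")
  case True
  then obtain e T where "f = Fi VT e T p" by blast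
  then show "v2 f \<Longrightarrow> ?thesis" by simp
next
  case False
  then show "v2 f \<Longrightarrow> p < ar (frel f) \<Longrightarrow> ?thesis" using tup_pos2s pos2s_nd2 by blast
qed

lemma copy_hidden:
  assumes v: "v1 f" "f = Fi HT e T q" and m: "usable (Gn T) m"
  shows "v1 (Cp f m i)"
proof -
  have m': "m < nmeth" "mrel m = T" "\<And>p. p \<in> set (mins m) \<Longrightarrow> kn (Ge T p)" "reach T"
    using m unfolding usable_def by auto
  have "acce (tup f p)" if p: "p \<in> set (mins m)" for p
  proof -
    have "p < ar T" using meth_wf m' p by blast
    then have "kn (rep (Ge T p))" using kn_rep[of "Gn T" p] m' p by simp
    moreover have "acce e" if "p = q" using acce_of_gen[of e T q] v m'(3)[OF p] that by auto
    ultimately show ?thesis using v m'(3)[OF p] by auto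
  qed
  then show ?thesis using v m' by auto
qed

text \<open>Recorded positions need no new fact: a copy, a witness \<open>Gf\<close>, the birth fact
  or an open fact already carries the value there.\<close>

lemma pos2s_fact:
  assumes e: "d2 e" "(T, q) \<in> pos2s e"
  shows "\<exists>g. v2 g \<and> frel g = T \<and> tup g q = e"
proof -
  have base: "\<exists>g. v2 g \<and> frel g = T \<and> tup g q = Bs (rep (bnm f q))" if "usable f m" "det m q" "brel f = T" for f m
    using that usable_Bf[of f m 0] by (intro exI[of _ "Cp (Bf f) m 0"]) auto
  have hidden: "\<exists>g. v2 g \<and> frel g = T \<and> tup g q = Nl f q"
    if "v1 f" "own f q" "hid f" "frel f = T" "usable (Gn T) m" "det m q" for f m
  proof -
    have "\<exists>e0 q0. f = Fi HT e0 T q0" using that by (cases f) auto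
    then obtain e0 q0 where f: "f = Fi HT e0 T q0" by blast
    then have "v1 (Cp f m 0)" using copy_hidden that by blast
    then show ?thesis using that own_tup[OF that(2)] by (intro exI[of _ "Cp f m 0"]) simp
  qed
  show ?thesis using e(2) unfolding pos2s_def
  proof (elim UnE)
    assume b: "(T, q) \<in> birth2 e"
    show ?thesis
    proof (cases e)
      case (Bs n)
      then consider f m where "usable f m" "det m q" "brel f = T" "rep (bnm f q) = n"
        | "rel2 T" "const_pos T q" "rep (G2 T q) = n" using b by auto
      then show ?thesis
      proof cases
        case 1
        then show ?thesis using base Bs by blast
      next
        case 2
        then show ?thesis using Bs by (intro exI[of _ "Gf T"]) simp
      qed
    next
      case (Nl f p)
      show ?thesis
      proof (cases "hid f")
        case True
        then show ?thesis using b Nl e(1) hidden[of f] by (auto split: if_splits)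
      next
        case False
        then show ?thesis using b Nl e(1) own_tup[of f p] by (intro exI[of _ f]) auto
      qed
    qed
  next
    assume "(T, q) \<in> {(T, q). (T, q) \<in> nd1 e \<and> acce e \<and> follow T q}"
    then have a: "(T, q) \<in> nd1 e" "acce e" "follow T q" by auto
    then have d: "d1 e" using d2_d1 e by blast
    obtain m where m: "usable (Kn T q) m" "det m q" using a(3) unfolding follow_def by blast
    then have m': "m < nmeth" "mrel m = T" "\<And>p. p \<in> set (mins m) \<Longrightarrow> kn (Kg T q p)" "q < ar T" unfolding usable_def by auto
    \<comment> \<open>Once the value at \<open>q\<close> is known, the remaining inputs known for
      \<open>Kn T q\<close> are known for \<open>f\<close> by \<open>kn_rel\<close>.\<close>
    have us: "usable f m" if f: "bok f" "brel f = T" "kn (bnm f q)" for f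
      unfolding usable_def using f m' kn_rel[of f q] meth_wf[OF m'(1)] by auto
    show ?thesis
    proof (cases "(T, q) \<in> pos1 e")
      case True
      show ?thesis
      proof (cases e)
        case (Bs n)
        then obtain f where f: "bok f" "brel f = T" "rep (bnm f q) = n" using True by auto
        then have "kn (bnm f q)" using a(2) Bs kn_rep[of f q] m'(4) by simp
        then show ?thesis using base[OF us[OF f(1,2)] m(2) f(2)] f Bs by simp
      next
        case (Nl f p)
        then have f: "frel f = T" "p = q" "v1 f" "own f q" using True d by auto
        show ?thesis
        proof (cases "hid f")
          case True
          then have "kn (Ge T q)" using a(2) Nl f by (cases f) auto
          moreover have "reach T" using v1_reach f by blast
          ultimately have "usable (Gn T) m" using us[of "Gn T"] by simp
          then show ?thesis using hidden[OF f(3,4) True f(1) _ m(2)] Nl f by simp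
        next
          case False
          then have "v2 f" using e(1) Nl by simp
          then show ?thesis using f own_tup Nl by blast
        qed
      qed
    next
      case False
      then show ?thesis using a d by (intro exI[of _ "Fi OT e T q"]) auto
    qed
  qed
qed

lemma uid2:
  assumes f: "v2 f" and u: "U (frel f) i T j"
  shows "\<exists>g. v2 g \<and> frel g = T \<and> tup g j = tup f i"
proof -
  let ?e = "tup f i"
  have i: "i < ar (frel f)" using uid_wf u by blast
  have e: "d2 ?e" "(T, j) \<in> nd2 ?e" using tup_d2[OF f i] nd2_step[OF tup_nd2[OF f i] u] by auto
  show ?thesis
  proof (cases "(T, j) \<in> pos2s ?e")
    case True
    then show ?thesis using pos2s_fact e by blast
  next
    case False
    then show ?thesis using e by (intro exI[of _ "Fi VT ?e T j"]) auto
  qed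
qed

lemma G2_up: "((R, i), (T, q)) \<in> up \<Longrightarrow> const_pos T q \<Longrightarrow> rel2 R \<longrightarrow> sim (G2 R i) (G2 T q)"
proof (induction rule: up_induct_back)
  case refl
  then show ?case using sim_g2 const_wf by blast
next
  case (step R i R' i')
  have "const_pos R' i'" using const_up[OF step(2)] step by blast
  then show ?case using step sim_uid2[of R i R' i'] rel2_uid[of R i R' i'] sim_trans[of "G2 R i" "G2 R' i'"] by blast
qed

lemma const_el2:
  assumes e: "d2 e" "(T, q) \<in> nd2 e" and c: "const_pos T q"
  shows "e = Bs (rep (G2 T q))"
  using e(2)
proof (rule nd2E)
  fix R i assume p: "(R, i) \<in> pos2s e" and u: "((R, i), (T, q)) \<in> up"
  have cR: "const_pos R i" using const_up[OF u c] .
  have R: "rel2 R" "i < ar R" using d2_pos2s[OF e(1) p] by auto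
  have "e = Bs (rep (G2 R i))"
    using p unfolding pos2s_def
  proof (elim UnE)
    assume b: "(R, i) \<in> birth2 e"
    show ?thesis
    proof (cases e)
      case (Bs n)
      then show ?thesis using b rep_sim[OF usable_intros(4)] cR by auto
    next
      case (Nl f j)
      then show ?thesis using own_not_const[of f j] e(1) b cR by (auto split: if_splits)
    qed
  next
    assume "(R, i) \<in> {(T, q). (T, q) \<in> nd1 e \<and> acce e \<and> follow T q}"
    then have a: "(R, i) \<in> nd1 e" "acce e" "follow R i" by auto
    then obtain m where m: "usable (Kn R i) m" unfolding follow_def by blast
    \<comment> \<open>A usable access links the constants of the two models through the fact
      \<open>Kn R i\<close>.\<close>
    have "sim (Kg R i i) (G2 R i)" using usable_intros(4)[OF m, of i] cR R by simp
    moreover have "sim (Kg R i i) (Ge R i)" using const_sim[OF cR, of "Kn R i"] m unfolding usable_def by simp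
    ultimately have "rep (Ge R i) = rep (G2 R i)" using rep_sim by metis
    then show ?thesis using const_el[OF _ a(1) cR] d2_d1 e a by simp
  qed
  moreover have "rep (G2 R i) = rep (G2 T q)" using G2_up[OF u c] R rep_sim by blast
  ultimately show ?thesis by simp
qed

lemma tup_const2: "v2 f \<Longrightarrow> const_pos (frel f) p \<Longrightarrow> tup f p = Bs (rep (G2 (frel f) p))"
  using const_el2 tup_d2 tup_nd2 const_wf by blast

text \<open>Two shared facts lie in the first model, where \<open>agree1\<close> decides. A private
  fact is recognised at its position of creation, and any other fact that is not shared has its own
  null at \<open>d\<close>, which does not occur in the first model.\<close>

lemma agree2:
  assumes f: "v2 f" and g: "v2 g" and T: "frel f = T" "frel g = T" and d: "d < ar T" "\<not> const_pos T d"
    and eq: "tup f d = tup g d"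
  shows "f = g \<or> dt f d \<and> dt g d \<and> (root f = root g \<or> (\<exists>a b. root f = Bf a \<and> root g = Bf b))"
proof -
  have V: "f = g" if f: "v2 f" and g: "v2 g" and T: "frel f = T" "frel g = T" and eq: "tup f d = tup g d"
    and fV: "f = Fi VT e T d" for f g e
  proof (rule ccontr)
    assume ne: "f \<noteq> g"
    have "tup f d = e" "(T, d) \<notin> pos2s e" using f fV by auto
    moreover have "g \<noteq> Fi VT e' (frel g) d" for e'
    proof
      assume "g = Fi VT e' (frel g) d"
      then have g': "g = Fi VT e' T d" using T by simp
      then have "e' = e" using eq fV by simp
      then show False using ne g' fV by simp
    qed
    ultimately show False using tup_pos2s[OF g] T eq d by auto
  qed
  have v1: "v1 f" if "v2 f" "shared f" for f using that by (cases f) auto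
  have nv1: "tup f d = Nl f d \<and> \<not> v1 f" if "v2 f" "\<not> shared f" "frel f = T" "\<And>e. f \<noteq> Fi VT e T d" for f
    using that d by (cases f) (auto split: if_splits)
  have d1n: "v1 g \<Longrightarrow> frel g = T \<Longrightarrow> tup g d = Nl f d \<Longrightarrow> v1 f" for f g using tup_d1[of g d] d by auto
  consider e where "f = Fi VT e T d" | e where "g = Fi VT e T d"
    | "shared f" "shared g" | "\<not> shared f \<or> \<not> shared g" "\<And>e. f \<noteq> Fi VT e T d" "\<And>e. g \<noteq> Fi VT e T d" by blast
  then show ?thesis
  proof cases
    case 1
    then show ?thesis using V[OF f g T eq] by blast
  next
    case 2
    then show ?thesis using V[OF g f T(2,1) eq[symmetric]] by blast
  next
    case 3
    then show ?thesis using agree1[OF v1[OF f] v1[OF g] T d eq] by simp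
  next
    case 4
    have "f = g"
    proof (cases "shared f")
      case True
      then have "\<not> shared g" using 4(1) by simp
      then have "tup g d = Nl g d" "\<not> v1 g" using nv1[OF g _ T(2) 4(3)] by simp_all
      then show ?thesis using d1n[OF v1[OF f True] T(1), of g] eq by simp
    next
      case False
      then have 5: "tup f d = Nl f d" "\<not> v1 f" using nv1[OF f _ T(1) 4(2)] by simp_all
      show ?thesis
      proof (cases "shared g")
        case True
        then show ?thesis using d1n[OF v1[OF g True] T(2), of f] eq 5 by simp
      next
        case False
        then show ?thesis using nv1[OF g _ T(2) 4(3)] 5 eq by simp
      qed
    qed
    then show ?thesis by blast
  qed
qed

lemma fd2:
  assumes "(R, D, j) \<in> set (fds S)" "v2 f" "v2 g" "frel f = R" "frel g = R" "\<And>d. d \<in> set D \<Longrightarrow> tup f d = tup g d"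
  shows "tup f j = tup g j"
proof (rule fd_from_agreement[OF assms(1,6)])
  show "const_pos R j \<Longrightarrow> tup f j = tup g j" using tup_const2 assms by metis
  show "root f = Bf a \<Longrightarrow> bok a \<and> brel a = R" for a using assms by (cases f) auto
  show "root g = Bf a \<Longrightarrow> bok a \<and> brel a = R" for a using assms by (cases g) auto
  show "f = g \<or> dt f d \<and> dt g d \<and> (root f = root g \<or> (\<exists>a b. root f = Bf a \<and> root g = Bf b))"
    if "d \<in> set D" "\<not> const_pos R d" for d
    using agree2[OF assms(2-5) _ that(2)] assms(6) that(1) fd_wf[OF assms(1)] by blast
qed (use assms in auto)

end

section \<open>Realisation as instances and extraction of a certificate\<close>

context problem
begin

definition img :: "(el \<Rightarrow> 'v) \<Rightarrow> fd \<Rightarrow> nat \<times> 'v list" where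
  "img \<gamma> f = (frel f, map (\<lambda>p. \<gamma> (tup f p)) [0..<ar (frel f)])"

lemma img_iff: "(R, u) = img \<gamma> f \<longleftrightarrow> R = frel f \<and> u = map (\<lambda>p. \<gamma> (tup f p)) [0..<ar R]"
  by (auto simp: img_def)

end

context wf_problem
begin

lemma img_inst:
  assumes P: "\<And>f. P f \<Longrightarrow> frel f < nrel"
    and fd: "\<And>R D j f g. (R, D, j) \<in> set (fds S) \<Longrightarrow> P f \<Longrightarrow> P g \<Longrightarrow> frel f = R \<Longrightarrow> frel g = R \<Longrightarrow>
      (\<And>d. d \<in> set D \<Longrightarrow> tup f d = tup g d) \<Longrightarrow> tup f j = tup g j"
    and uid: "\<And>f i T j. P f \<Longrightarrow> U (frel f) i T j \<Longrightarrow> \<exists>g. P g \<and> frel g = T \<and> tup g j = tup f i"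
    and \<gamma>: "inj \<gamma>"
  shows "inst_ok S (img \<gamma> ` Collect P)" "satisfies S (img \<gamma> ` Collect P)"
proof -
  show "inst_ok S (img \<gamma> ` Collect P)" unfolding inst_ok_def using P by (auto simp: img_def)
  show "satisfies S (img \<gamma> ` Collect P)" unfolding satisfies_def
  proof (intro conjI ballI)
    fix c assume c: "c \<in> set (uids S)"
    obtain R i T j where c': "c = (R, i, T, j)" by (cases c)
    have wf: "i < ar R" "j < ar T" using uid_wf c c' by blast+
    have "\<exists>u. (T, u) \<in> img \<gamma> ` Collect P \<and> u ! j = t ! i" if t: "(R, t) \<in> img \<gamma> ` Collect P" for t
    proof -
      obtain f where f: "P f" "R = frel f" "t = map (\<lambda>p. \<gamma> (tup f p)) [0..<ar R]" using t by (auto simp: img_iff)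
      then obtain g where g: "P g" "frel g = T" "tup g j = tup f i" using uid c c' by blast
      then have "(T, map (\<lambda>p. \<gamma> (tup g p)) [0..<ar T]) \<in> img \<gamma> ` Collect P"
        by (intro image_eqI[of _ _ g]) (auto simp: img_iff)
      then show ?thesis using f g wf by (intro exI[of _ "map (\<lambda>p. \<gamma> (tup g p)) [0..<ar T]"]) simp
    qed
    then show "sat_uid (img \<gamma> ` Collect P) c" unfolding sat_uid_def c' by simp
  next
    fix c assume c: "c \<in> set (fds S)"
    obtain R D j where c': "c = (R, D, j)" by (cases c)
    have wf: "j < ar R" "\<And>d. d \<in> set D \<Longrightarrow> d < ar R" using fd_wf c c' by blast+
    have "t ! j = u ! j" if t: "(R, t) \<in> img \<gamma> ` Collect P" and u: "(R, u) \<in> img \<gamma> ` Collect P"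
      and e: "\<forall>d\<in>set D. t ! d = u ! d" for t u
    proof -
      obtain f where f: "P f" "R = frel f" "t = map (\<lambda>p. \<gamma> (tup f p)) [0..<ar R]" using t by (auto simp: img_iff)
      obtain g where g: "P g" "R = frel g" "u = map (\<lambda>p. \<gamma> (tup g p)) [0..<ar R]" using u by (auto simp: img_iff)
      have eq: "tup f d = tup g d" if d: "d \<in> set D" for d
      proof -
        have "t ! d = u ! d" using e d by blast
        then have "\<gamma> (tup f d) = \<gamma> (tup g d)" using f(3) g(3) wf(2)[OF d] by simp
        then show ?thesis using \<gamma> by (simp add: inj_eq)
      qed
      have "tup f j = tup g j" by (rule fd[of R D j f g]) (use c c' f g eq in auto)
      then show ?thesis using f(3) g(3) wf(1) by simp
    qed
    then show "sat_fd (img \<gamma> ` Collect P) c" unfolding sat_fd_def c' by blast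
  qed
qed

text \<open>Either all matches lie in the common part and any valid output will do, or some match is
  hidden and the method leaves a position open. In the latter case the method has a bound
  \<open>k\<close>, and \<open>k\<close> of the copies form a valid output.\<close>

lemma shared_access:
  assumes \<gamma>: "inj \<gamma>" and m: "m < nmeth" and b: "length b = length (mins m)"
    and vals: "set b \<subseteq> (\<Union>(R, u)\<in>img \<gamma> ` {f. v1 f \<and> shared f}. set u)"
  shows "\<exists>J. valid_output (matching (img \<gamma> ` Collect v1) (mrel m) (mins m) b) (mbound m) J
     \<and> (\<forall>u\<in>J. (mrel m, u) \<in> img \<gamma> ` {f. v1 f \<and> shared f})"
proof -
  let ?I = "img \<gamma> ` Collect v1" and ?A = "img \<gamma> ` {f. v1 f \<and> shared f}"
  let ?M = "matching ?I (mrel m) (mins m) b"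
  let ?t = "\<lambda>f. map (\<lambda>p. \<gamma> (tup f p)) [0..<ar (mrel m)]"
  have known: "\<exists>e. acce e \<and> v = \<gamma> e" if "v \<in> set b" for v
  proof -
    have "v \<in> (\<Union>(R, u)\<in>img \<gamma> ` {f. v1 f \<and> shared f}. set u)" using vals that by blast
    then obtain f where f: "v1 f" "shared f" "v \<in> set (snd (img \<gamma> f))" by (auto simp: case_prod_beta)
    then obtain p where "p < ar (frel f)" "v = \<gamma> (tup f p)" by (auto simp: img_def)
    then show ?thesis using shared_acce f by blast
  qed
  have match: "\<exists>f. v1 f \<and> frel f = mrel m \<and> u = ?t f \<and> (\<forall>p\<in>set (mins m). acce (tup f p))" if u: "u \<in> ?M" for u
  proof -
    have "(mrel m, u) \<in> ?I" "\<forall>k<length (mins m). u ! (mins m ! k) = b ! k" using u by (auto simp: matching_def)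
    then obtain f where f: "v1 f" "mrel m = frel f" "u = ?t f" "\<forall>k<length (mins m). u ! (mins m ! k) = b ! k"
      by (auto simp: img_iff)
    have "acce (tup f p)" if p: "p \<in> set (mins m)" for p
    proof -
      obtain k where k: "k < length (mins m)" "mins m ! k = p" using p by (meson in_set_conv_nth)
      have "p < ar (mrel m)" using meth_wf m p by blast
      then have "\<gamma> (tup f p) = b ! k" using f(3,4) k by auto
      moreover obtain e where "acce e" "b ! k = \<gamma> e" using known[of "b ! k"] k b by auto
      ultimately show ?thesis using \<gamma> by (simp add: inj_eq)
    qed
    then show ?thesis using f by auto
  qed
  have hs: "hid f" if "v1 f" "\<not> shared f" for f
  proof (cases f)
    case (Fi t e T q)
    then show ?thesis using that by (cases t) auto
  qed (use that in auto)
  have copy: "v1 (Cp f m i)" if "v1 f" "\<not> shared f" "frel f = mrel m" "\<forall>p\<in>set (mins m). acce (tup f p)" for f i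
    using that hs m by simp
  have inA: "(mrel m, ?t f) \<in> ?A" if "v1 f" "shared f" "frel f = mrel m" for f
    using that by (intro image_eqI[of _ _ f]) (auto simp: img_iff)
  \<comment> \<open>When every position is determined, a copy is the same tuple as the original, so
    the hidden fact is in the common part as a tuple.\<close>
  have same: "?t (Cp f m i) = ?t f" if "\<And>p. p < ar (mrel m) \<Longrightarrow> det m p" for f i
    using that by simp
  have "?M \<subseteq> {u. (mrel m, u) \<in> ?A}" if "\<And>p. p < ar (mrel m) \<Longrightarrow> det m p"
  proof
    fix u assume "u \<in> ?M"
    then obtain f where f: "v1 f" "frel f = mrel m" "u = ?t f" "\<forall>p\<in>set (mins m). acce (tup f p)" using match by blast
    show "u \<in> {u. (mrel m, u) \<in> ?A}"
    proof (cases "shared f")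
      case True
      then show ?thesis using inA f by blast
    next
      case False
      have c: "v1 (Cp f m 0)" using copy[OF f(1) False f(2,4)] .
      have "(mrel m, ?t (Cp f m 0)) \<in> ?A" by (rule inA[OF c]) (use f in simp_all)
      then have "(mrel m, ?t f) \<in> ?A" by (simp only: same[OF that, of f 0])
      then show ?thesis using f(3) by blast
    qed
  qed
  moreover obtain J where J: "valid_output ?M (mbound m) J" using valid_output_exists by blast
  moreover have "J \<subseteq> ?M" using J by (simp add: valid_output_def)
  ultimately have alldet: ?thesis if "\<And>p. p < ar (mrel m) \<Longrightarrow> det m p" using that by blast
  show ?thesis
  proof (cases "?M \<subseteq> {u. (mrel m, u) \<in> ?A} \<or> (\<forall>p<ar (mrel m). det m p)")
    case True
    then show ?thesis using alldet J \<open>J \<subseteq> ?M\<close> by blast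
  next
    case False
    then obtain p0 where p0: "p0 < ar (mrel m)" "\<not> det m p0" by blast
    then obtain k where k: "mbound m = Some k" unfolding det_def by auto
    obtain u where u: "u \<in> ?M" "(mrel m, u) \<notin> ?A" using False by blast
    then obtain f where f: "v1 f" "frel f = mrel m" "u = ?t f" "\<forall>p\<in>set (mins m). acce (tup f p)" using match by blast
    have ns: "\<not> shared f" using inA f u by blast
    \<comment> \<open>Different indices give different nulls at \<open>p0\<close>, so there are as
      many matching tuples as the bound asks for.\<close>
    define ti where "ti = (\<lambda>i. ?t (Cp f m i))"
    have tiA: "(mrel m, ti i) \<in> ?A" for i
      unfolding ti_def by (rule inA[OF copy[OF f(1) ns f(2,4)]]) (use f in simp_all)
    have tiM: "ti i \<in> ?M" for i
    proof -
      have "(mrel m, ti i) \<in> ?I" using tiA by blast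
      moreover have "ti i ! (mins m ! k) = b ! k" if k: "k < length (mins m)" for k
      proof -
        have "mins m ! k \<in> set (mins m)" using k by simp
        then have "det m (mins m ! k)" "mins m ! k < ar (mrel m)" using det_ins meth_wf m by blast+
        then have "ti i ! (mins m ! k) = u ! (mins m ! k)" using f(3) by (simp add: ti_def)
        then show ?thesis using u(1) k by (simp add: matching_def)
      qed
      ultimately show ?thesis by (simp add: matching_def)
    qed
    have inj: "inj ti"
    proof (rule injI)
      fix i j assume "ti i = ti j"
      then have "ti i ! p0 = ti j ! p0" by simp
      then have "\<gamma> (Nl (Cp f m i) p0) = \<gamma> (Nl (Cp f m j) p0)" using p0 by (simp add: ti_def)
      then show "i = j" using \<gamma> by (simp add: inj_eq)
    qed
    have card: "card (ti ` {..<k}) = k" using inj by (simp add: card_image inj_on_subset)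
    have "valid_output ?M (Some k) (ti ` {..<k})"
      unfolding valid_output_def using tiM card by auto
    then show ?thesis using k tiA by (intro exI[of _ "ti ` {..<k}"]) auto
  qed
qed

lemma query_v1: "cq_holds Q (img \<gamma> ` Collect v1)"
  unfolding cq_holds_def
proof (intro exI ballI, clarify)
  fix R vs assume "(R, vs) \<in> set Q"
  then obtain a where a: "a < length Q" "Q ! a = (R, vs)" by (meson in_set_conv_nth)
  then have "length vs = ar R" using query_wf by force
  then have "map (\<lambda>x. \<gamma> (Bs (rep (Va x)))) vs = map (\<lambda>p. \<gamma> (tup (Bf (At a)) p)) [0..<ar R]"
    using a by (auto intro: nth_equalityI)
  then show "(R, map (\<lambda>x. \<gamma> (Bs (rep (Va x)))) vs) \<in> img \<gamma> ` Collect v1"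
    using a by (intro image_eqI[of _ _ "Bf (At a)"]) (auto simp: img_iff)
qed

lemma pnsim_sym: "pnsim a b \<Longrightarrow> pnsim b a"
  by (cases a; cases b) (auto intro: sim_sym)

lemma pnsim_trans: "pnsim a b \<Longrightarrow> pnsim b c \<Longrightarrow> pnsim a c"
  by (cases a; cases b; cases c) (auto intro: sim_trans)

lemma pos2_pos2s_Bs: "(R, i) \<in> pos2s (Bs n) \<Longrightarrow> pos2 n R i"
  unfolding pos2s_def
proof (elim UnE)
  assume "(R, i) \<in> birth2 (Bs n)"
  then consider f m where "usable f m" "det m i" "brel f = R" "i < ar R" "rep (bnm f i) = n"
    | "rel2 R" "const_pos R i" "rep (G2 R i) = n" by auto
  then show ?thesis
  proof cases
    case 1
    then have "sim (bnm f i) n" using sim_rep_base[of f i] unfolding usable_def by auto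
    then show ?thesis unfolding pos2_def using 1 by blast
  next
    case 2
    then have "i < ar R" "sim (G2 R i) n" using const_wf sim_rep[OF sim_g2, of R i] by auto
    then show ?thesis unfolding pos2_def using 2 by blast
  qed
next
  assume "(R, i) \<in> {(T, q). (T, q) \<in> nd1 (Bs n) \<and> acce (Bs n) \<and> follow T q}"
  then have a: "(R, i) \<in> nd1 (Bs n)" "kn n" "follow R i" by auto
  from a(1) show ?thesis
  proof (rule nd1E)
    fix R0 p assume "(R0, p) \<in> pos1 (Bs n)" and u: "((R0, p), (R, i)) \<in> up"
    then obtain f where f: "bok f" "p < ar (brel f)" "brel f = R0" "rep (bnm f p) = n" by auto
    have "sim (bnm f p) n" "kn (bnm f p)" "i < ar R" using sim_rep_base kn_rep up_wf u f a(2) by blast+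
    then show ?thesis unfolding pos2_def using f u a(3) by blast
  qed
qed

text \<open>In a certificate a null from a hidden fact is represented by the generic name of its
  position; its recorded positions are those that the analysis grants to this name.\<close>

lemma pos2_pos2s_hidden:
  assumes "(R, i) \<in> pos2s (Nl f p)" "f = Fi HT e T q" "v1 f" "p < ar T"
  shows "pos2 (Ge T p) R i"
proof -
  have T: "bok (Gn T)" using v1_reach[OF assms(3)] assms(2) by simp
  have s: "sim (bnm (Gn T) p) (Ge T p)" using sim_base[OF T, of p] assms(4) by simp
  show ?thesis using assms(1) unfolding pos2s_def
  proof (elim UnE)
    assume "(R, i) \<in> birth2 (Nl f p)"
    then obtain m where "usable (Gn T) m" "det m p" "R = T" "i = p" using assms(2) by (auto split: if_splits)
    moreover have "brel (Gn T) = T" by simp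
    ultimately show ?thesis unfolding pos2_def using s assms(4) by blast
  next
    assume "(R, i) \<in> {(T, q). (T, q) \<in> nd1 (Nl f p) \<and> acce (Nl f p) \<and> follow T q}"
    then have a: "((T, p), (R, i)) \<in> up" "kn (bnm (Gn T) p)" "follow R i" using assms(2) by (auto elim!: nd1E)
    moreover have "i < ar R" using up_wf a(1) assms(4) by blast
    moreover have "brel (Gn T) = T" by simp
    ultimately show ?thesis unfolding pos2_def using s T assms(4) by metis
  qed
qed

text \<open>The facts of the second model that are hit by the query, together with the birth facts
  of the nulls they import, become the slots. No earlier ancestors are needed, since a UID chain
  from the birth position covers the whole way.\<close>

lemma v2_query_cert:
  assumes \<gamma>: "inj \<gamma>" and q: "cq_holds Q (img \<gamma> ` Collect v2)"
  shows cert
proof -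
  obtain h where h: "\<And>R vs. (R, vs) \<in> set Q \<Longrightarrow> (R, map h vs) \<in> img \<gamma> ` Collect v2"
    using q unfolding cq_holds_def by blast
  have "\<exists>f. v2 f \<and> frel f = fst (Q ! a) \<and> (\<forall>p<length (snd (Q ! a)). h (snd (Q ! a) ! p) = \<gamma> (tup f p))"
    if a: "a < length Q" for a
  proof -
    have "(fst (Q ! a), map h (snd (Q ! a))) \<in> img \<gamma> ` Collect v2" using h a by simp
    then obtain f where f: "v2 f" "fst (Q ! a) = frel f" "map h (snd (Q ! a)) = map (\<lambda>p. \<gamma> (tup f p)) [0..<ar (fst (Q ! a))]"
      by (auto simp: img_iff)
    have l: "length (snd (Q ! a)) = ar (fst (Q ! a))" using query_wf a by blast
    have "h (snd (Q ! a) ! p) = \<gamma> (tup f p)" if p: "p < length (snd (Q ! a))" for p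
    proof -
      have "map h (snd (Q ! a)) ! p = map (\<lambda>p. \<gamma> (tup f p)) [0..<ar (fst (Q ! a))] ! p" using f(3) by simp
      then show ?thesis using p l by simp
    qed
    then show ?thesis using f by auto
  qed
  then obtain F where F: "\<And>a. a < length Q \<Longrightarrow> v2 (F a)" "\<And>a. a < length Q \<Longrightarrow> frel (F a) = fst (Q ! a)"
    "\<And>a p. a < length Q \<Longrightarrow> p < length (snd (Q ! a)) \<Longrightarrow> h (snd (Q ! a) ! p) = \<gamma> (tup (F a) p)"
    by metis
  define X where "X = F ` {..<length Q}"
  \<comment> \<open>The birth fact of the null for which a fact was created; all other facts are
    their own parent and add nothing.\<close>
  define par where "par = (\<lambda>f. case f of Fi t (Nl g p) T q \<Rightarrow> g | _ \<Rightarrow> f)"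
  \<comment> \<open>Parents missing from the second model are hidden facts. They need no slot,
    because their nulls receive generic names.\<close>
  define Y where "Y = X \<union> {g \<in> par ` X. v2 g}"
  have finX: "finite X" "card X \<le> length Q" unfolding X_def using card_image_le[of "{..<length Q}" F] by auto
  have finY: "finite Y" unfolding Y_def using finX by simp
  have "card {g \<in> par ` X. v2 g} \<le> card X"
    using card_mono[of "par ` X" "{g \<in> par ` X. v2 g}"] card_image_le[OF finX(1), of par] finX by fastforce
  then have cardY: "card Y \<le> 2 * length Q" unfolding Y_def
    using card_Un_le[of X "{g \<in> par ` X. v2 g}"] finX by linarith
  have Xv: "v2 f" if "f \<in> X" for f using that F unfolding X_def by auto
  have Yv: "v2 f" if "f \<in> Y" for f using that Xv unfolding Y_def by auto
  obtain zs where zs: "set zs = Y" "distinct zs" using finite_distinct_list[OF finY] by blast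
  \<comment> \<open>A fact is larger than the birth fact of the null it imports, so sorting by size
    puts parents first.\<close>
  define ys where "ys = sort_key size zs"
  have ys: "set ys = Y" "distinct ys" "sorted (map size ys)" using zs by (auto simp: ys_def)
  define N where "N = length ys"
  have N: "N \<le> 2 * length Q" using cardY ys distinct_card[of ys] by (simp add: N_def)
  define idx where "idx = (\<lambda>f. THE i. i < N \<and> ys ! i = f)"
  have idx: "idx f < N \<and> ys ! idx f = f" if f: "f \<in> Y" for f
  proof -
    obtain i where i: "i < N" "ys ! i = f" using f ys(1) by (metis N_def in_set_conv_nth)
    have "\<exists>!i. i < N \<and> ys ! i = f"
      by (rule ex1I[of _ i]) (use i ys(2) in \<open>auto simp: N_def nth_eq_iff_index_eq\<close>)
    then show ?thesis unfolding idx_def by (rule theI')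
  qed
  have idx_ys: "idx (ys ! k) = k" if k: "k < N" for k
  proof -
    have "ys ! k \<in> Y" using k ys(1) by (auto simp: N_def)
    then show ?thesis using idx[of "ys ! k"] k nth_eq_iff_index_eq[OF ys(2), of "idx (ys ! k)" k] by (simp add: N_def)
  qed
  have idx_less: "idx g < idx f" if "g \<in> Y" "f \<in> Y" "size g < size f" for g f
  proof (rule ccontr)
    assume "\<not> idx g < idx f"
    then have "map size ys ! idx f \<le> map size ys ! idx g"
      using ys(3) idx[OF that(1)] by (intro sorted_nth_mono) (auto simp: N_def)
    then show False using idx[OF that(1)] idx[OF that(2)] that(3) by (simp add: N_def)
  qed
  define \<psi> where "\<psi> = (\<lambda>e. case e of Bs n \<Rightarrow> PB n | Nl f p \<Rightarrow> if hid f then PB (Ge (frel f) p) else PN (idx f) p)"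
  \<comment> \<open>A parent that is not hit by the query is needed only for the null born in it, so
    an arbitrary fact of its relation can serve as its slot.\<close>
  define sl where "sl = (\<lambda>f. if f \<in> X then (case f of Cp (Bf b) m i \<Rightarrow> SC b m | Cp g m i \<Rightarrow> SC (Gn (frel g)) m
     | Fi t e T q \<Rightarrow> SF T q (\<psi> e) | _ \<Rightarrow> SR (frel f)) else SR (frel f))"
  have srel: "srel (sl f) = frel f" for f
    unfolding sl_def by (cases f) (auto split: fd.split)
  have refl: "pnsim (\<psi> e) (\<psi> e)" if e: "d2 e" "x \<in> pos2s e" for e x
  proof (cases e)
    case (Bs n)
    obtain R i where "x = (R, i)" by (cases x)
    then have "pos2 n R i" using e Bs pos2_pos2s_Bs by blast
    then have "\<exists>a. sim a n" unfolding pos2_def by blast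
    then have "sim n n" using sim_sym sim_trans by blast
    then show ?thesis using Bs by (simp add: \<psi>_def)
  next
    case (Nl f p)
    show ?thesis
    proof (cases "hid f")
      case True
      then have "bok (Gn (frel f))" "p < ar (frel f)" using e Nl v1_reach by auto
      then have "sim (Ge (frel f) p) (Ge (frel f) p)" using sim_base[of "Gn (frel f)" p] by simp
      then show ?thesis using Nl True by (simp add: \<psi>_def)
    qed (use Nl in \<open>simp add: \<psi>_def\<close>)
  qed
  have need: "\<exists>x. x \<in> pos2s e \<and> (x, (T, q)) \<in> up" if "v2 (Fi t e T q)" for t e T q
  proof (cases "t = VT")
    case True
    then show ?thesis using that by (auto elim!: nd2E)
  next
    case False
    then have "(T, q) \<in> pos2s e" using that by (auto simp: pos2s_def)
    then show ?thesis using up_refl by blast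
  qed
  have d2e: "d2 e" "q < ar T" if v: "v2 (Fi t e T q)" for t e T q
  proof -
    show q: "q < ar T"
    proof (cases "t = VT")
      case True then show ?thesis using v nd2_rel2[of e T q] by auto
    next
      case False then show ?thesis using v nd1_reach[of e T q] by auto
    qed
    show "d2 e" using tup_d2[OF v, of q] q by simp
  qed
  have ok: "slot_ok (\<lambda>k. sl (ys ! k)) (idx f) (sl f)" if f: "f \<in> Y" for f
  proof (cases "f \<in> X \<and> (\<forall>T. f \<noteq> Gf T)")
    case False
    then have "sl f = SR (frel f)" unfolding sl_def by (auto split: fd.split)
    then show ?thesis using v2_rel2 Yv f by simp
  next
    case True
    then have fX: "f \<in> X" and v: "v2 f" using Xv by auto
    show ?thesis
    proof (cases f)
      case (Cp g m i)
      have "v1 (Cp g m i)" using v Cp by simp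
      then show ?thesis by (cases rule: copy_cases) (use fX Cp in \<open>auto simp: sl_def\<close>)
    next
      case (Fi t e T q)
      have e: "d2 e" "q < ar T" using d2e v Fi by blast+
      obtain R i where x: "(R, i) \<in> pos2s e" "((R, i), (T, q)) \<in> up" using need v Fi by (metis prod.collapse)
      have sf: "sl f = SF T q (\<psi> e)" using fX Fi by (simp add: sl_def)
      show ?thesis
      proof (cases e)
        case (Bs n)
        have "pos2 n R i" using pos2_pos2s_Bs x(1) Bs by blast
        then show ?thesis using sf e x(2) Bs by (auto simp: \<psi>_def)
      next
        case (Nl g p)
        show ?thesis
        proof (cases "hid g")
          case True
          then have "\<exists>e0 q0. g = Fi HT e0 (frel g) q0" using Nl e(1) by (cases g) auto
          then obtain e0 q0 where g: "g = Fi HT e0 (frel g) q0" by blast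
          have "pos2 (Ge (frel g) p) R i" using pos2_pos2s_hidden[OF _ g] x(1) Nl e(1) True by auto
          then show ?thesis using sf e x Nl True by (auto simp: \<psi>_def)
        next
          case False
          then have g: "v2 g" "p < ar (frel g)" using Nl e(1) by auto
          have "g = par f" using Fi Nl by (simp add: par_def)
          then have gY: "g \<in> Y" using fX g unfolding Y_def by blast
          have "size g < size f" using Fi Nl by simp
          then have lt: "idx g < idx f" using idx_less gY f by blast
          have "((frel g, p), (R, i)) \<in> up"
            using x(1) Nl False unfolding pos2s_def by (auto elim!: nd1E split: if_splits)
          then have "((frel g, p), (T, q)) \<in> up" using x(2) up_trans by blast
          then show ?thesis using sf e lt g idx[OF gY] srel Nl False by (simp add: \<psi>_def)
        qed
      qed
    qed (use v True in auto)
  qed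
  have name: "pnsim (sname (idx f) (sl f) p) (\<psi> (tup f p))" if f: "f \<in> X" and p: "p < ar (frel f)" for f p
  proof -
    have v: "v2 f" using Xv f by blast
    have g2: "sim (G2 (frel f) p) (rep (G2 (frel f) p))" using sim_rep[OF sim_g2] v2_rel2[OF v] p by blast
    have cst: "sim (G2 (frel f) p) n" if "const_pos (frel f) p" "tup f p = Bs n" for n
      using tup_const2[OF v that(1)] that(2) g2 by simp
    show ?thesis
    proof (cases f)
      case (Gf T)
      then show ?thesis using f g2 by (auto simp: sl_def \<psi>_def)
    next
      case (Fi t e T q)
      show ?thesis
      proof (cases "p = q")
        case True
        obtain x where "x \<in> pos2s e" using need v Fi by blast
        then have "pnsim (\<psi> e) (\<psi> e)" using refl d2e v Fi by blast
        then show ?thesis using True Fi f by (simp add: sl_def)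
      next
        case False
        then show ?thesis using Fi f cst v by (auto simp: sl_def \<psi>_def split: if_splits)
      qed
    next
      case (Cp g m i)
      have "v1 (Cp g m i)" using v Cp by simp
      then show ?thesis
      proof (cases rule: copy_cases)
        case (base b)
        then show ?thesis using f Cp p sim_rep_base[of b p] unfolding usable_def by (auto simp: sl_def \<psi>_def)
      next
        case (hidden e T q)
        have T: "bok (Gn T)" using hidden(2) unfolding usable_def by simp
        have "sim (Ge T p) (Ge T p)" "sim (Ge T p) (rep (Ge T p))"
          using sim_base[OF T, of p] sim_rep_base[OF T, of p] p Cp hidden(1) by simp_all
        moreover have "det m p \<Longrightarrow> p \<noteq> q" using hidden by auto
        ultimately show ?thesis using f Cp hidden by (auto simp: sl_def \<psi>_def)
      qed
    qed (use v in simp)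
  qed
  show cert unfolding cert_def
  proof (intro exI[of _ N] conjI N exI[of _ "\<lambda>k. sl (ys ! k)"] exI[of _ "\<lambda>a. idx (F a)"] allI impI)
    fix k assume k: "k < N"
    then have "ys ! k \<in> Y" using ys(1) by (auto simp: N_def)
    then show "slot_ok (\<lambda>k. sl (ys ! k)) k (sl (ys ! k))" using ok[of "ys ! k"] idx_ys[OF k] by simp
  next
    fix a assume a: "a < length Q"
    then have FX: "F a \<in> X" "F a \<in> Y" unfolding X_def Y_def by auto
    show "idx (F a) < N" using idx FX by blast
    show "srel (sl (ys ! idx (F a))) = fst (Q ! a)" using idx[OF FX(2)] srel F(2)[OF a] by simp
  next
    fix a b p q assume a: "a < length Q" and b: "b < length Q" and p: "p < length (snd (Q ! a))"
      and q: "q < length (snd (Q ! b))" and e: "snd (Q ! a) ! p = snd (Q ! b) ! q"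
    have X: "F a \<in> X" "F b \<in> X" "F a \<in> Y" "F b \<in> Y" using a b unfolding X_def Y_def by auto
    have "\<gamma> (tup (F a) p) = \<gamma> (tup (F b) q)" using F(3)[OF a p] F(3)[OF b q] e by simp
    then have t: "tup (F a) p = tup (F b) q" using \<gamma> by (simp add: inj_eq)
    have "pnsim (sname (idx (F a)) (sl (F a)) p) (\<psi> (tup (F a) p))" using name[OF X(1)] p query_wf[OF a] F(2)[OF a] by simp
    moreover have "pnsim (\<psi> (tup (F a) p)) (sname (idx (F b)) (sl (F b)) q)"
      using pnsim_sym[OF name[OF X(2), of q]] q query_wf[OF b] F(2)[OF b] t by simp
    ultimately show "pnsim (sname (idx (F a)) (sl (ys ! idx (F a))) p) (sname (idx (F b)) (sl (ys ! idx (F b))) q)"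
      using pnsim_trans idx[OF X(3)] idx[OF X(4)] by simp
  qed
qed

theorem answerable_iff_cert:
  assumes inf: "infinite (UNIV :: 'v set)"
  shows "monotone_answerable TYPE('v) S Q \<longleftrightarrow> cert"
proof
  assume a: "monotone_answerable TYPE('v) S Q"
  obtain n :: "nat \<Rightarrow> 'v" where n: "inj n" using inf infinite_countable_subset by blast
  define \<gamma> where "\<gamma> = (\<lambda>e :: el. n (to_nat e))"
  have \<gamma>: "inj \<gamma>" unfolding \<gamma>_def by (rule injI) (simp add: inj_eq[OF n])
  have I1: "inst_ok S (img \<gamma> ` Collect v1)" "satisfies S (img \<gamma> ` Collect v1)"
    by (rule img_inst; use v1_reach reach_wf fd1 uid1 \<gamma> in blast)+
  have I2: "inst_ok S (img \<gamma> ` Collect v2)" "satisfies S (img \<gamma> ` Collect v2)"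
    by (rule img_inst; use v2_rel2 rel2_wf fd2 uid2 \<gamma> in blast)+
  have sh: "v2 f" if "v1 f" "shared f" for f using that by (cases f) auto
  have "cq_holds Q (img \<gamma> ` Collect v2)"
  proof (rule ccontr)
    assume no: "\<not> cq_holds Q (img \<gamma> ` Collect v2)"
    have "\<not> monotone_answerable TYPE('v) S Q"
      by (rule not_answerable[OF I1 query_v1 I2 no, of "img \<gamma> ` {f. v1 f \<and> shared f}"])
        (use sh shared_access[OF \<gamma>] in blast)+
    then show False using a by blast
  qed
  then show cert using v2_query_cert \<gamma> by blast
qed (rule cert_answerable)

end

section \<open>While programs on a single-tape machine\<close>

text \<open>Programs work on counters \<open>v\<close> and bit arrays \<open>a\<close>; arrays are addressed by counters. On the tape each
  bit of a symbol is a track: a counter is a block of ones, an array is stored in place, bits 0 and 1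
  hold the input and bit 2 marks the origin.\<close>

type_synonym st = "(nat \<Rightarrow> nat) \<times> (nat \<Rightarrow> nat \<Rightarrow> bool)"

datatype cond = Lt nat nat | Ar nat nat

datatype com = Inc nat | Clr nat | Put nat nat bool | Seq com com | If cond com com | Wh cond com

fun cnd :: "cond \<Rightarrow> st \<Rightarrow> bool" where
  "cnd (Lt x y) (v, a) = (v x < v y)"
| "cnd (Ar j x) (v, a) = a j (v x)"

inductive ex :: "com \<Rightarrow> st \<Rightarrow> nat \<Rightarrow> st \<Rightarrow> bool" where
  ex_Inc: "ex (Inc x) (v, a) 1 (v(x := Suc (v x)), a)"
| ex_Clr: "ex (Clr x) (v, a) 1 (v(x := 0), a)"
| ex_Put: "ex (Put j x b) (v, a) 1 (v, a(j := (a j)(v x := b)))"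
| ex_Seq: "ex c s t s' \<Longrightarrow> ex d s' u s'' \<Longrightarrow> ex (Seq c d) s (t + u) s''"
| ex_IfT: "cnd b s \<Longrightarrow> ex c s t s' \<Longrightarrow> ex (If b c d) s (Suc t) s'"
| ex_IfF: "\<not> cnd b s \<Longrightarrow> ex d s t s' \<Longrightarrow> ex (If b c d) s (Suc t) s'"
| ex_WhF: "\<not> cnd b s \<Longrightarrow> ex (Wh b c) s 1 s"
| ex_WhT: "cnd b s \<Longrightarrow> ex c s t s' \<Longrightarrow> ex (Wh b c) s' u s'' \<Longrightarrow> ex (Wh b c) s (Suc (t + u)) s''"

text \<open>Counters occupy the odd tracks from 3 on; arrays other than the two of the input occupy
  the even tracks from 4 on.\<close>

definition tv :: "nat \<Rightarrow> nat" where "tv i = 2 * i + 3"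
definition ta :: "nat \<Rightarrow> nat" where "ta j = (if j < 2 then j else 2 * j)"

type_synonym row = "nat \<Rightarrow> nat \<times> nat \<times> int"

fun clen :: "com \<Rightarrow> nat" where
  "clen (Inc x) = 2" | "clen (Clr x) = 2" | "clen (Put j x b) = 2"
| "clen (Seq c d) = clen c + clen d" | "clen (If b c d) = 4 + clen c + clen d" | "clen (Wh b c) = 4 + clen c"

definition ret_row :: "nat \<Rightarrow> nat \<Rightarrow> row" where
  "ret_row q e s = (if bit s 2 then (e, s, 0) else (q, s, -1))"

definition seek_row :: "nat \<Rightarrow> nat \<Rightarrow> nat \<Rightarrow> (nat \<Rightarrow> nat) \<Rightarrow> row" where
  "seek_row q t e f s = (if bit s t then (q, s, 1) else (e, f s, 0))"

definition clear_row :: "nat \<Rightarrow> nat \<Rightarrow> nat \<Rightarrow> row" where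
  "clear_row q t e s = (if bit s t then (q, unset_bit t s, 1) else (e, s, 0))"

definition goto_row :: "nat \<Rightarrow> row" where
  "goto_row e s = (e, s, 0)"

fun test_row :: "nat \<Rightarrow> cond \<Rightarrow> row" where
  "test_row q (Lt x y) s = (if bit s (tv x) then (q, s, 1) else if bit s (tv y) then (Suc q, s, 0) else (q + 2, s, 0))"
| "test_row q (Ar j x) s = (if bit s (tv x) then (q, s, 1) else if bit s (ta j) then (Suc q, s, 0) else (q + 2, s, 0))"

text \<open>The block is entered in state \<open>q\<close> and left in state
  \<open>q + clen c\<close>, both times with the head at the origin, so blocks can be
  concatenated.\<close>

fun comp :: "nat \<Rightarrow> com \<Rightarrow> row list" where
  "comp q (Inc x) = [seek_row q (tv x) (q + 1) (set_bit (tv x)), ret_row (q + 1) (q + 2)]"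
| "comp q (Clr x) = [clear_row q (tv x) (q + 1), ret_row (q + 1) (q + 2)]"
| "comp q (Put j x b) = [seek_row q (tv x) (q + 1) ((if b then set_bit else unset_bit) (ta j)), ret_row (q + 1) (q + 2)]"
| "comp q (Seq c d) = comp q c @ comp (q + clen c) d"
| "comp q (If b c d) = [test_row q b, ret_row (q + 1) (q + 3), ret_row (q + 2) (q + 4 + clen c)] @ comp (q + 3) c
     @ [goto_row (q + 4 + clen c + clen d)] @ comp (q + 4 + clen c) d"
| "comp q (Wh b c) = [test_row q b, ret_row (q + 1) (q + 3), ret_row (q + 2) (q + 4 + clen c)] @ comp (q + 3) c
     @ [goto_row q]"

lemma comp_length [simp]: "length (comp q c) = clen c"
  by (induction c arbitrary: q) auto

fun trk :: "st \<Rightarrow> nat \<Rightarrow> nat \<Rightarrow> bool" where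
  "trk (v, a) t p = (if t < 2 then a t p else if t = 2 then p = 0
     else if odd t then p < v ((t - 3) div 2) else a (t div 2) p)"

lemma trk_tv [simp]: "trk (v, a) (tv x) p = (p < v x)"
  by (simp add: tv_def)

lemma trk_ta [simp]: "trk (v, a) (ta j) p = a j p"
  by (simp add: ta_def)

lemma trk_2 [simp]: "trk s 2 p = (p = 0)"
  by (cases s) simp

lemma tv_eq [simp]: "tv x = tv y \<longleftrightarrow> x = y" "tv x \<noteq> 2"
  by (auto simp: tv_def)

lemma trk_upd_v: "trk (v(x := n), a) t p = (if t = tv x then p < n else trk (v, a) t p)"
  by (auto simp: tv_def elim!: oddE)

lemma trk_upd_a: "trk (v, a(j := (a j)(q := b))) t p = (if t = ta j \<and> p = q then b else trk (v, a) t p)"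
  by (auto simp: ta_def elim!: oddE evenE)

declare trk.simps [simp del]

text \<open>Only the right half of the tape is described: every sweep stops at the origin
  mark.\<close>

definition rp :: "st \<Rightarrow> (int \<Rightarrow> nat) \<Rightarrow> bool" where
  "rp s tp \<longleftrightarrow> (\<forall>p t. bit (tp (int p)) t = trk s t p)"

lemma rpD: "rp s tp \<Longrightarrow> bit (tp (int p)) t = trk s t p"
  by (simp add: rp_def)

definition code_at :: "tm \<Rightarrow> nat \<Rightarrow> row list \<Rightarrow> bool" where
  "code_at M q rs \<longleftrightarrow> 3 \<le> q \<and> (\<forall>i<length rs. delta M (q + i) = rs ! i)"

lemma code_at_append: "code_at M q (rs @ rs') \<longleftrightarrow> code_at M q rs \<and> code_at M (q + length rs) rs'"
proof -
  have "delta M (q + length rs + i) = rs' ! i" if "\<forall>i<length rs + length rs'. delta M (q + i) = (rs @ rs') ! i" "i < length rs'" for i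
    using that(1)[rule_format, of "length rs + i"] that(2) by (simp add: add.assoc)
  moreover have "delta M (q + i) = (rs @ rs') ! i"
    if "\<forall>i<length rs. delta M (q + i) = rs ! i" "\<forall>i<length rs'. delta M (q + length rs + i) = rs' ! i"
       "i < length rs + length rs'" for i
    using that(1)[rule_format, of i] that(2)[rule_format, of "i - length rs"] that(3) by (cases "i < length rs") (auto simp: nth_append)
  ultimately show ?thesis unfolding code_at_def by (auto simp: nth_append)
qed

lemma code_at_Cons: "code_at M q (r # rs) \<longleftrightarrow> 3 \<le> q \<and> delta M q = r \<and> code_at M (Suc q) rs"
  using code_at_append[of M q "[r]" rs] by (auto simp: code_at_def)

lemma code_at_Nil: "code_at M q [] \<longleftrightarrow> 3 \<le> q"
  by (simp add: code_at_def)

definition steps :: "tm \<Rightarrow> config \<Rightarrow> nat \<Rightarrow> config \<Rightarrow> bool" where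
  "steps M cf n cf' \<longleftrightarrow> (tm_step M ^^ n) cf = cf'"

lemma steps_0: "steps M cf 0 cf"
  by (simp add: steps_def)

lemma steps_trans: "steps M a m b \<Longrightarrow> steps M b n c \<Longrightarrow> steps M a (m + n) c"
  unfolding steps_def by (subst add.commute) (auto simp: funpow_add)

lemma steps_1: "3 \<le> q \<Longrightarrow> delta M q (tp h) = (q', s', d) \<Longrightarrow> steps M (q, tp, h) 1 (q', tp(h := s'), h + d)"
  by (simp add: steps_def tm_step_def)

lemma steps_stay: "3 \<le> q \<Longrightarrow> delta M q (tp h) = (q', tp h, d) \<Longrightarrow> steps M (q, tp, h) 1 (q', tp, h + d)"
  using steps_1[of q M tp h q' "tp h" d] by simp

lemma seek_right:
  assumes "3 \<le> q" "\<And>s. bit s t \<Longrightarrow> delta M q s = (q, s, 1)" "\<And>p. p < n \<Longrightarrow> bit (tp (int p)) t"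
  shows "steps M (q, tp, 0) n (q, tp, int n)"
  using assms(3)
proof (induction n)
  case (Suc n)
  have 2: "steps M (q, tp, int n) 1 (q, tp, int n + 1)" using Suc assms by (intro steps_stay) auto
  have 1: "steps M (q, tp, 0) n (q, tp, int n)" using Suc by simp
  show ?case using steps_trans[OF 1 2] by (simp add: add.commute)
qed (simp add: steps_0)

lemma return_left:
  assumes "3 \<le> q" "delta M q = ret_row q e" "rp s tp"
  shows "steps M (q, tp, int n) (Suc n) (e, tp, 0)"
proof (induction n)
  case 0
  have "bit (tp 0) 2" using rpD[OF assms(3), of 0 2] by simp
  then have "steps M (q, tp, 0) 1 (e, tp, 0 + 0)" using assms by (intro steps_stay) (auto simp: ret_row_def)
  then show ?case by simp
next
  case (Suc n)
  have "\<not> bit (tp (int (Suc n))) 2" using rpD[OF assms(3), of "Suc n" 2] by simp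
  then have "steps M (q, tp, int (Suc n)) 1 (q, tp, int (Suc n) + -1)"
    using assms by (intro steps_stay) (auto simp: ret_row_def)
  then show ?case using steps_trans[OF _ Suc] by fastforce
qed

lemma clear_right:
  assumes q: "3 \<le> q" "delta M q = clear_row q (tv x) e" and r: "rp (v, a) tp"
  shows "i \<le> v x \<Longrightarrow> \<exists>tp'. steps M (q, tp, 0) i (q, tp', int i) \<and>
    (\<forall>p t. bit (tp' (int p)) t = (if t = tv x \<and> p < i then False else trk (v, a) t p))"
proof (induction i)
  case 0
  then show ?case using r by (intro exI[of _ tp]) (auto simp: rp_def steps_0)
next
  case (Suc i)
  then obtain tp' where tp': "steps M (q, tp, 0) i (q, tp', int i)"
    "\<And>p t. bit (tp' (int p)) t = (if t = tv x \<and> p < i then False else trk (v, a) t p)" by auto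
  have "bit (tp' (int i)) (tv x)" using tp'(2) Suc by simp
  then have 2: "steps M (q, tp', int i) 1 (q, tp'(int i := unset_bit (tv x) (tp' (int i))), int i + 1)"
    using q by (intro steps_1) (auto simp: clear_row_def)
  then have "steps M (q, tp, 0) (Suc i) (q, tp'(int i := unset_bit (tv x) (tp' (int i))), int (Suc i))"
    using steps_trans[OF tp'(1) 2] by (simp add: add.commute)
  then show ?case using tp'(2) by (intro exI conjI) (assumption, auto simp: bit_unset_bit_iff less_Suc_eq)
qed

lemma test_steps:
  assumes c: "code_at M q [test_row q b, ret_row (q + 1) e1, ret_row (q + 2) e2]"
    and r: "rp (v, a) tp" and B: "\<And>x. v x \<le> B"
  shows "\<exists>n\<le>2 * B + 2. steps M (q, tp, 0) n (if cnd b (v, a) then e1 else e2, tp, 0)"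
proof -
  have q: "3 \<le> q" "delta M q = test_row q b" "delta M (q + 1) = ret_row (q + 1) e1" "delta M (q + 2) = ret_row (q + 2) e2"
    using c by (auto simp: code_at_Cons)
  obtain x t where xt: "\<And>s. test_row q b s = (if bit s (tv x) then (q, s, 1) else if bit s t then (Suc q, s, 0) else (q + 2, s, 0))"
    "trk (v, a) t (v x) = cnd b (v, a)" by (cases b) (auto)
  have 1: "steps M (q, tp, 0) (v x) (q, tp, int (v x))"
    by (rule seek_right[where t = "tv x"]) (use q xt rpD[OF r] in auto)
  have "\<not> bit (tp (int (v x))) (tv x)" "bit (tp (int (v x))) t = cnd b (v, a)" using rpD[OF r] xt by auto
  then have 2: "steps M (q, tp, int (v x)) 1 (if cnd b (v, a) then q + 1 else q + 2, tp, int (v x))"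
    using q xt steps_stay[of q M tp "int (v x)" "if cnd b (v, a) then q + 1 else q + 2" 0] by auto
  have 3: "steps M (if cnd b (v, a) then q + 1 else q + 2, tp, int (v x)) (Suc (v x)) (if cnd b (v, a) then e1 else e2, tp, 0)"
    using return_left[OF _ q(3) r] return_left[OF _ q(4) r] q(1) by auto
  have "steps M (q, tp, 0) (v x + 1 + Suc (v x)) (if cnd b (v, a) then e1 else e2, tp, 0)"
    by (rule steps_trans[OF steps_trans[OF 1 2] 3])
  then show ?thesis using B[of x] by (intro exI[of _ "v x + 1 + Suc (v x)"]) simp
qed

text \<open>A step raises a counter by at most one, so the running time also bounds how far the head
  has to travel.\<close>

lemma ex_bound: "ex c s t s' \<Longrightarrow> (\<forall>x. fst s x \<le> B) \<Longrightarrow> \<forall>x. fst s' x \<le> B + t"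
proof (induction arbitrary: B rule: ex.induct)
  case (ex_Seq c s t s' d u s'')
  then have "\<forall>x. fst s'' x \<le> B + t + u" by blast
  then show ?case by (simp add: add.assoc)
next
  case (ex_WhT b s c t s' u s'')
  then have "\<forall>x. fst s'' x \<le> B + t + u" by blast
  then show ?case by (metis add.assoc add_Suc_right le_SucI)
qed (auto simp: le_SucI)

lemma set_track:
  assumes "rp s tp" "\<And>t p. trk s' t p = (if t = t0 \<and> p = p0 then b else trk s t p)"
  shows "rp s' (tp(int p0 := (if b then set_bit else unset_bit) t0 (tp (int p0))))"
  using assms unfolding rp_def by (auto simp: bit_set_bit_iff bit_unset_bit_iff)

lemma seek_act:
  assumes c: "code_at M q [seek_row q (tv x) (q + 1) f, ret_row (q + 1) e]"
    and r: "rp (v, a) tp" and r': "rp s' (tp(int (v x) := f (tp (int (v x)))))"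
  shows "steps M (q, tp, 0) (2 * v x + 2) (e, tp(int (v x) := f (tp (int (v x)))), 0)"
proof -
  have q: "3 \<le> q" "delta M q = seek_row q (tv x) (q + 1) f" "delta M (q + 1) = ret_row (q + 1) e"
    using c by (auto simp: code_at_Cons)
  have 1: "steps M (q, tp, 0) (v x) (q, tp, int (v x))"
    by (rule seek_right[where t = "tv x"]) (use q rpD[OF r] in \<open>auto simp: seek_row_def\<close>)
  have "\<not> bit (tp (int (v x))) (tv x)" using rpD[OF r] by auto
  then have 2: "steps M (q, tp, int (v x)) 1 (q + 1, tp(int (v x) := f (tp (int (v x)))), int (v x))"
    using q steps_1[of q M tp "int (v x)" "q + 1" "f (tp (int (v x)))" 0] by (auto simp: seek_row_def)
  have 3: "steps M (q + 1, tp(int (v x) := f (tp (int (v x)))), int (v x)) (Suc (v x)) (e, tp(int (v x) := f (tp (int (v x)))), 0)"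
    using return_left[OF _ q(3) r'] q(1) by simp
  show ?thesis using steps_trans[OF steps_trans[OF 1 2] 3] by (simp add: mult_2)
qed

text \<open>Each step of the program is a sweep to the cell addressed by a counter and back, hence
  at most \<open>2 * B + 6\<close> moves.\<close>

lemma program_steps:
  "ex c s t s' \<Longrightarrow> code_at M q (comp q c) \<Longrightarrow> rp s tp \<Longrightarrow> (\<And>x. fst s x + t \<le> B) \<Longrightarrow>
   \<exists>n\<le>t * (2 * B + 6). \<exists>tp'. steps M (q, tp, 0) n (q + clen c, tp', 0) \<and> rp s' tp'"
proof (induction arbitrary: q tp rule: ex.induct)
  case (ex_Inc x v a)
  let ?tp = "tp(int (v x) := set_bit (tv x) (tp (int (v x))))"
  have r: "rp (v(x := Suc (v x)), a) ?tp"
    using set_track[OF ex_Inc(2), of "(v(x := Suc (v x)), a)" "tv x" "v x" True]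
    by (auto simp: trk_upd_v less_Suc_eq)
  have "steps M (q, tp, 0) (2 * v x + 2) (q + 2, ?tp, 0)"
    by (rule seek_act[where f = "set_bit (tv x)", OF _ ex_Inc(2) r]) (use ex_Inc(1) in simp)
  then show ?case using r ex_Inc(3)[of x] by (intro exI[of _ "2 * v x + 2"]) auto
next
  case (ex_Put j x b v a)
  let ?tp = "tp(int (v x) := (if b then set_bit else unset_bit) (ta j) (tp (int (v x))))"
  have r: "rp (v, a(j := (a j)(v x := b))) ?tp"
    using set_track[OF ex_Put(2), of "(v, a(j := (a j)(v x := b)))" "ta j" "v x" b]
    by (auto simp: trk_upd_a)
  have "steps M (q, tp, 0) (2 * v x + 2) (q + 2, ?tp, 0)"
    by (rule seek_act[where f = "(if b then set_bit else unset_bit) (ta j)", OF _ ex_Put(2) r]) (use ex_Put(1) in simp)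
  then show ?case using r ex_Put(3)[of x] by (intro exI[of _ "2 * v x + 2"]) auto
next
  case (ex_Clr x v a)
  have q: "3 \<le> q" "delta M q = clear_row q (tv x) (q + 1)" "delta M (q + 1) = ret_row (q + 1) (q + 2)"
    using ex_Clr(1) by (auto simp: code_at_Cons)
  obtain tp' where tp': "steps M (q, tp, 0) (v x) (q, tp', int (v x))"
    "\<And>p t. bit (tp' (int p)) t = (if t = tv x \<and> p < v x then False else trk (v, a) t p)"
    using clear_right[OF q(1,2) ex_Clr(2), of "v x"] by auto
  have r: "rp (v(x := 0), a) tp'" unfolding rp_def using tp'(2) by (auto simp: trk_upd_v)
  have "\<not> bit (tp' (int (v x))) (tv x)" using tp'(2) by auto
  then have 2: "steps M (q, tp', int (v x)) 1 (q + 1, tp', int (v x))"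
    using q steps_stay[of q M tp' "int (v x)" "q + 1" 0] by (auto simp: clear_row_def)
  have 3: "steps M (q + 1, tp', int (v x)) (Suc (v x)) (q + 2, tp', 0)" using return_left[OF _ q(3) r] q(1) by simp
  have "steps M (q, tp, 0) (v x + 1 + Suc (v x)) (q + 2, tp', 0)"
    by (rule steps_trans[OF steps_trans[OF tp'(1) 2] 3])
  then show ?case using r ex_Clr(3)[of x] by (intro exI[of _ "v x + 1 + Suc (v x)"]) auto
next
  case (ex_Seq c s t s' d u s'')
  have c: "code_at M q (comp q c)" "code_at M (q + clen c) (comp (q + clen c) d)"
    using ex_Seq.prems(1) by (auto simp: code_at_append)
  have "fst s x + t \<le> B" for x using ex_Seq.prems(3)[of x] by simp
  then obtain n tp' where n: "n \<le> t * (2 * B + 6)" "steps M (q, tp, 0) n (q + clen c, tp', 0)" "rp s' tp'"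
    using ex_Seq.IH(1)[OF c(1) ex_Seq.prems(2)] by blast
  have "fst s' x + u \<le> B" for x
  proof -
    have "\<forall>x. fst s x \<le> B - (t + u)" by (intro allI add_le_imp_le_diff) (rule ex_Seq.prems(3))
    then have "fst s' x \<le> B - (t + u) + t" using ex_bound[OF ex_Seq.hyps(1)] by blast
    then show ?thesis using ex_Seq.prems(3)[of x] by simp
  qed
  then obtain m tp'' where m: "m \<le> u * (2 * B + 6)" "steps M (q + clen c, tp', 0) m (q + clen c + clen d, tp'', 0)" "rp s'' tp''"
    using ex_Seq.IH(2)[OF c(2) n(3)] by blast
  have "n + m \<le> (t + u) * (2 * B + 6)" using n(1) m(1) by (simp add: add_mult_distrib)
  moreover have "steps M (q, tp, 0) (n + m) (q + clen (Seq c d), tp'', 0)" using steps_trans[OF n(2) m(2)] by (simp add: add.assoc)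
  ultimately show ?case using m(3) by blast
next
  case (ex_IfT b s c t s' d)
  obtain v a where s: "s = (v, a)" by (cases s)
  have vB: "v x \<le> B" for x using ex_IfT.prems(3)[of x] s by simp
  have c: "code_at M q [test_row q b, ret_row (q + 1) (q + 3), ret_row (q + 2) (q + 4 + clen c)]"
    "code_at M (q + 3) (comp (q + 3) c)" "code_at M (q + 3 + clen c) [goto_row (q + 4 + clen c + clen d)]"
    using ex_IfT.prems(1) by (auto simp: code_at_append code_at_Cons code_at_Nil eval_nat_numeral)
  obtain k where k: "k \<le> 2 * B + 2" "steps M (q, tp, 0) k (q + 3, tp, 0)"
    using test_steps[OF c(1), where v = v and a = a and tp = tp and B = B, OF _ vB] ex_IfT.prems(2) ex_IfT.hyps(1) s by auto
  have "fst s x + t \<le> B" for x using ex_IfT.prems(3)[of x] by simp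
  then obtain n tp' where n: "n \<le> t * (2 * B + 6)" "steps M (q + 3, tp, 0) n (q + 3 + clen c, tp', 0)" "rp s' tp'"
    using ex_IfT.IH[OF c(2) ex_IfT.prems(2)] by blast
  have g: "steps M (q + 3 + clen c, tp', 0) 1 (q + clen (If b c d), tp', 0)"
    using c(3) steps_stay[of _ M tp' 0 _ 0] by (auto simp: code_at_Cons goto_row_def)
  have "steps M (q, tp, 0) (k + n + 1) (q + clen (If b c d), tp', 0)"
    using steps_trans[OF steps_trans[OF k(2) n(2)] g] by simp
  moreover have "k + n + 1 \<le> Suc t * (2 * B + 6)" using k(1) n(1) by simp
  ultimately show ?case using n(3) by blast
next
  case (ex_IfF b s d t s' c)
  obtain v a where s: "s = (v, a)" by (cases s)
  have vB: "v x \<le> B" for x using ex_IfF.prems(3)[of x] s by simp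
  have c: "code_at M q [test_row q b, ret_row (q + 1) (q + 3), ret_row (q + 2) (q + 4 + clen c)]"
    "code_at M (q + 4 + clen c) (comp (q + 4 + clen c) d)"
    using ex_IfF.prems(1) by (auto simp: code_at_append code_at_Cons code_at_Nil eval_nat_numeral)
  obtain k where k: "k \<le> 2 * B + 2" "steps M (q, tp, 0) k (q + 4 + clen c, tp, 0)"
    using test_steps[OF c(1), where v = v and a = a and tp = tp and B = B, OF _ vB] ex_IfF.prems(2) ex_IfF.hyps(1) s by auto
  have "fst s x + t \<le> B" for x using ex_IfF.prems(3)[of x] by simp
  then obtain n tp' where n: "n \<le> t * (2 * B + 6)" "steps M (q + 4 + clen c, tp, 0) n (q + 4 + clen c + clen d, tp', 0)" "rp s' tp'"
    using ex_IfF.IH[OF c(2) ex_IfF.prems(2)] by blast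
  have "steps M (q, tp, 0) (k + n) (q + clen (If b c d), tp', 0)" using steps_trans[OF k(2) n(2)] by (simp add: add.assoc)
  moreover have "k + n \<le> Suc t * (2 * B + 6)" using k(1) n(1) by simp
  ultimately show ?case using n(3) by blast
next
  case (ex_WhF b s c)
  obtain v a where s: "s = (v, a)" by (cases s)
  have vB: "v x \<le> B" for x using ex_WhF.prems(3)[of x] s by simp
  have c: "code_at M q [test_row q b, ret_row (q + 1) (q + 3), ret_row (q + 2) (q + 4 + clen c)]"
    using ex_WhF.prems(1) by (auto simp: code_at_append code_at_Cons code_at_Nil eval_nat_numeral)
  obtain k where k: "k \<le> 2 * B + 2" "steps M (q, tp, 0) k (q + 4 + clen c, tp, 0)"
    using test_steps[OF c(1), where v = v and a = a and tp = tp and B = B, OF _ vB] ex_WhF.prems(2) ex_WhF.hyps(1) s by auto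
  then show ?case using ex_WhF.prems(2) by (intro exI[of _ k]) (auto simp: add.assoc)
next
  case (ex_WhT b s c t s' u s'')
  obtain v a where s: "s = (v, a)" by (cases s)
  have vB: "v x \<le> B" for x using ex_WhT.prems(3)[of x] s by simp
  have c: "code_at M q [test_row q b, ret_row (q + 1) (q + 3), ret_row (q + 2) (q + 4 + clen c)]"
    "code_at M (q + 3) (comp (q + 3) c)" "code_at M (q + 3 + clen c) [goto_row q]"
    using ex_WhT.prems(1) by (auto simp: code_at_append code_at_Cons code_at_Nil eval_nat_numeral)
  obtain k where k: "k \<le> 2 * B + 2" "steps M (q, tp, 0) k (q + 3, tp, 0)"
    using test_steps[OF c(1), where v = v and a = a and tp = tp and B = B, OF _ vB] ex_WhT.prems(2) ex_WhT.hyps(1) s by auto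
  have "fst s x + t \<le> B" for x using ex_WhT.prems(3)[of x] by simp
  then obtain n tp' where n: "n \<le> t * (2 * B + 6)" "steps M (q + 3, tp, 0) n (q + 3 + clen c, tp', 0)" "rp s' tp'"
    using ex_WhT.IH(1)[OF c(2) ex_WhT.prems(2)] by blast
  have g: "steps M (q + 3 + clen c, tp', 0) 1 (q, tp', 0)"
    using c(3) steps_stay[of _ M tp' 0 _ 0] by (auto simp: code_at_Cons goto_row_def)
  have "fst s' x + u \<le> B" for x
  proof -
    have "\<forall>x. fst s x \<le> B - Suc (t + u)" by (intro allI add_le_imp_le_diff) (rule ex_WhT.prems(3))
    then have "fst s' x \<le> B - Suc (t + u) + t" using ex_bound[OF ex_WhT.hyps(2)] by blast
    then show ?thesis using ex_WhT.prems(3)[of x] by simp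
  qed
  then obtain m tp'' where m: "m \<le> u * (2 * B + 6)" "steps M (q, tp', 0) m (q + clen (Wh b c), tp'', 0)" "rp s'' tp''"
    using ex_WhT.IH(2)[OF ex_WhT.prems(1) n(3)] by blast
  have "steps M (q, tp, 0) (k + n + 1 + m) (q + clen (Wh b c), tp'', 0)"
    using steps_trans[OF steps_trans[OF steps_trans[OF k(2) n(2)] g]] m(2) by simp
  moreover have "k + n + 1 + m \<le> Suc (t + u) * (2 * B + 6)" using k(1) n(1) m(1) by (simp add: add_mult_distrib)
  ultimately show ?case using m(3) by blast
qed

section \<open>Well-formedness of the machine\<close>

fun ctrk :: "cond \<Rightarrow> nat" where
  "ctrk (Lt x y) = max (tv x) (tv y)" | "ctrk (Ar j x) = max (ta j) (tv x)"

fun trks :: "com \<Rightarrow> nat" where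
  "trks (Inc x) = tv x" | "trks (Clr x) = tv x" | "trks (Put j x b) = max (ta j) (tv x)"
| "trks (Seq c d) = max (trks c) (trks d)" | "trks (If b c d) = max (ctrk b) (max (trks c) (trks d))"
| "trks (Wh b c) = max (ctrk b) (trks c)"

definition row_ok :: "nat \<Rightarrow> nat \<Rightarrow> row \<Rightarrow> bool" where
  "row_ok e k r \<longleftrightarrow> (\<forall>s<2 ^ k. case r s of (q', s', d) \<Rightarrow> q' \<le> e \<and> s' < 2 ^ k \<and> d \<in> {-1, 0, 1})"

lemma less_exp_iff_bit: "(s :: nat) < 2 ^ k \<longleftrightarrow> (\<forall>n\<ge>k. \<not> bit s n)"
proof
  assume "s < 2 ^ k"
  then show "\<forall>n\<ge>k. \<not> bit s n"
    by (metis bit_take_bit_iff not_le take_bit_nat_eq_self)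
next
  assume "\<forall>n\<ge>k. \<not> bit s n"
  then have "take_bit k s = s" by (intro bit_eqI) (metis bit_take_bit_iff not_le)
  then show "s < 2 ^ k" by (metis take_bit_nat_less_exp)
qed

lemma set_bit_less: "(s :: nat) < 2 ^ k \<Longrightarrow> t < k \<Longrightarrow> set_bit t s < 2 ^ k"
  unfolding less_exp_iff_bit by (auto simp: bit_set_bit_iff)

lemma unset_bit_less: "(s :: nat) < 2 ^ k \<Longrightarrow> unset_bit t s < 2 ^ k"
  unfolding less_exp_iff_bit by (auto simp: bit_unset_bit_iff)

lemma ret_row_ok: "q \<le> e \<Longrightarrow> e' \<le> e \<Longrightarrow> row_ok e k (ret_row q e')"
  by (auto simp: row_ok_def ret_row_def)

lemma goto_row_ok: "e' \<le> e \<Longrightarrow> row_ok e k (goto_row e')"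
  by (auto simp: row_ok_def goto_row_def)

lemma seek_row_ok: "q \<le> e \<Longrightarrow> e' \<le> e \<Longrightarrow> (\<And>s. s < 2 ^ k \<Longrightarrow> f s < 2 ^ k) \<Longrightarrow> row_ok e k (seek_row q t e' f)"
  by (auto simp: row_ok_def seek_row_def)

lemma clear_row_ok: "q \<le> e \<Longrightarrow> e' \<le> e \<Longrightarrow> row_ok e k (clear_row q t e')"
  by (auto simp: row_ok_def clear_row_def unset_bit_less)

lemma test_row_ok: "q + 2 \<le> e \<Longrightarrow> row_ok e k (test_row q b)"
  by (cases b) (auto simp: row_ok_def)

lemma comp_rows_ok: "trks c < k \<Longrightarrow> r \<in> set (comp q c) \<Longrightarrow> q + clen c \<le> e \<Longrightarrow> row_ok e k r"
proof (induction c arbitrary: q)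
  case (If b c d)
  have "row_ok e k r" if "r \<in> set (comp (q + 3) c) \<or> r \<in> set (comp (q + 4 + clen c) d)"
    using If.IH(1)[of "q + 3"] If.IH(2)[of "q + 4 + clen c"] If.prems that by auto
  then show ?case using If.prems by (auto intro!: ret_row_ok goto_row_ok test_row_ok)
next
  case (Wh b c)
  have "row_ok e k r" if "r \<in> set (comp (q + 3) c)"
    using Wh.IH[of "q + 3"] Wh.prems that by auto
  then show ?case using Wh.prems by (auto intro!: ret_row_ok goto_row_ok test_row_ok)
next
  case (Seq c d)
  then show ?case using Seq.IH(1)[of q] Seq.IH(2)[of "q + clen c"] by auto
qed (auto intro!: ret_row_ok seek_row_ok clear_row_ok simp: set_bit_less unset_bit_less)

text \<open>State 0 marks the origin, the halting states 1 and 2 have placeholder rows, and the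
  state behind the code tests at the origin whether counter \<open>x\<close> is positive. The
  exponent of \<open>nsyms\<close> exceeds every track in use, including bits 0 to 2.\<close>

definition machine :: "com \<Rightarrow> nat \<Rightarrow> tm" where
  "machine c x = \<lparr>nstates = 4 + clen c, nsyms = 2 ^ Suc (Suc (Suc (max (trks c) (tv x)))),
     delta = (\<lambda>q s. if q = 0 then (3, set_bit 2 s, 0)
       else if q < 3 then (1, s, 0)
       else if q < 3 + clen c then (comp 3 c ! (q - 3)) s
       else if bit s (tv x) then (1, s, 0) else (2, s, 0))\<rparr>"

lemma machine_ok: "tm_ok (machine c x)"
proof -
  define k where "k = Suc (Suc (Suc (max (trks c) (tv x))))"
  have rows: "row_ok (3 + clen c) k (comp 3 c ! i)" if "i < clen c" for i
  proof (rule comp_rows_ok[of c k _ 3])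
    show "trks c < k" by (simp add: k_def)
    show "comp 3 c ! i \<in> set (comp 3 c)" using that by simp
  qed simp
  have "case delta (machine c x) q s of (q', s', d) \<Rightarrow> q' < nstates (machine c x) \<and> s' < nsyms (machine c x) \<and> d \<in> {-1, 0, 1}"
    if q: "q < nstates (machine c x)" and s: "s < nsyms (machine c x)" for q s
  proof -
    have s': "s < 2 ^ k" using s by (simp add: machine_def k_def)
    have ns: "nsyms (machine c x) = 2 ^ k" by (simp add: machine_def k_def)
    show ?thesis
    proof (cases "3 \<le> q \<and> q < 3 + clen c")
      case True
      then have ok: "row_ok (3 + clen c) k (comp 3 c ! (q - 3))" using rows[of "q - 3"] by (metis less_diff_conv2 add.commute)
      obtain q' s'' d where r: "(comp 3 c ! (q - 3)) s = (q', s'', d)" by (cases "(comp 3 c ! (q - 3)) s")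
      then have "q' \<le> 3 + clen c \<and> s'' < 2 ^ k \<and> d \<in> {-1, 0, 1}" using ok s' unfolding row_ok_def by fastforce
      then show ?thesis unfolding ns using True r by (simp add: machine_def)
    next
      case False
      then show ?thesis unfolding ns using s' set_bit_less[OF s', of 2] by (auto simp: machine_def k_def)
    qed
  qed
  moreover have "(4 :: nat) \<le> 2 ^ k" using power_increasing[of 2 k "2 :: nat"] by (simp add: k_def)
  ultimately show ?thesis unfolding tm_ok_def by (simp add: machine_def k_def)
qed

text \<open>The blank 3 has both bits set, so past the end both input arrays are true, a combination
  that no input symbol 0, 1 or 2 has.\<close>

definition inbits :: "nat list \<Rightarrow> nat \<Rightarrow> nat \<Rightarrow> bool" where
  "inbits w j p = (j < 2 \<and> bit (if p < length w then w ! p else 3) j)"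

lemma bit_3: "bit (3 :: nat) t \<longleftrightarrow> t < 2"
proof -
  have "(3 :: nat) = mask 2" by (simp add: mask_eq_exp_minus_1)
  then show ?thesis by (metis bit_mask_iff possible_bit_nat UNIV_I)
qed

theorem machine_run:
  assumes w: "set w \<subseteq> {0, 1, 2}" and e: "ex c (\<lambda>_. 0, inbits w) t (v, a)"
  shows "\<exists>n\<le>t * (2 * t + 6) + 2. tm_state_after (machine c x) w n = (if 0 < v x then 1 else 2)"
proof -
  let ?M = "machine c x"
  obtain q0 tp0 h0 where i: "tm_init w = (q0, tp0, h0)" by (cases "tm_init w")
  then have i': "q0 = 0" "h0 = 0" "tp0 = (\<lambda>i. if 0 \<le> i \<and> i < int (length w) then w ! nat i else 3)" by (auto simp: tm_init_def)
  define tp where "tp = tp0(0 := set_bit 2 (tp0 0))"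
  have 1: "steps ?M (tm_init w) 1 (3, tp, 0)" by (simp add: i i' steps_def tm_step_def machine_def tp_def)
  have low: "s < 4" if "s \<in> {0, 1, 2, 3 :: nat}" for s using that by auto
  have "tp0 (int p) < 2 ^ 2" for p
  proof -
    have "w ! p < 4" if "p < length w" using w nth_mem[OF that] low by blast
    then show ?thesis by (simp add: i'(3))
  qed
  then have hi: "\<not> bit (tp0 (int p)) t" if "2 \<le> t" for p t using that unfolding less_exp_iff_bit by blast
  have lo: "bit (tp0 (int p)) t = inbits w t p" if "t < 2" for p t using that by (simp add: i'(3) inbits_def)
  have "bit (tp (int p)) t = trk (\<lambda>_. 0, inbits w) t p" for p t
  proof -
    have b: "bit (tp (int p)) t = (bit (tp0 (int p)) t \<or> (t = 2 \<and> p = 0))" by (auto simp: tp_def bit_set_bit_iff)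
    consider "t < 2" | "t = 2" | "t = 3" | "4 \<le> t" by linarith
    then show ?thesis
    proof cases
      case 1
      then show ?thesis using b lo[of t p] by (simp add: trk.simps)
    next
      case 2
      then show ?thesis using b hi[of 2 p] by simp
    next
      case 3
      then show ?thesis using b hi[of 3 p] by (simp add: trk.simps)
    next
      case 4
      then have "\<not> trk (\<lambda>_. 0, inbits w) t p" by (auto simp: trk.simps inbits_def)
      then show ?thesis using b hi[of t p] 4 by simp
    qed
  qed
  then have r: "rp (\<lambda>_. 0, inbits w) tp" by (simp add: rp_def)
  have "code_at ?M 3 (comp 3 c)" by (auto simp: code_at_def machine_def)
  then obtain n tp' where n: "n \<le> t * (2 * t + 6)" "steps ?M (3, tp, 0) n (3 + clen c, tp', 0)" "rp (v, a) tp'"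
    using program_steps[OF e _ r, of ?M 3 t] by auto
  have "bit (tp' 0) (tv x) = (0 < v x)" using rpD[OF n(3), of 0 "tv x"] by simp
  then have "delta ?M (3 + clen c) (tp' 0) = (if 0 < v x then 1 else 2, tp' 0, 0)" by (simp add: machine_def)
  then have 2: "steps ?M (3 + clen c, tp', 0) 1 (if 0 < v x then 1 else 2, tp', 0)" using steps_stay[of "3 + clen c" ?M tp' 0 _ 0] by simp
  have "steps ?M (tm_init w) (1 + n + 1) (if 0 < v x then 1 else 2, tp', 0)"
    by (rule steps_trans[OF steps_trans[OF 1 n(2)] 2])
  then have "tm_state_after ?M w (1 + n + 1) = (if 0 < v x then 1 else 2)" unfolding steps_def tm_state_after_def by simp
  then show ?thesis using n(1) by (intro exI[of _ "1 + n + 1"]) simp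
qed

section \<open>A class of functions computable in time polynomial in their arguments\<close>

definition exb :: "com \<Rightarrow> st \<Rightarrow> nat \<Rightarrow> st \<Rightarrow> bool" where
  "exb c s T s' \<longleftrightarrow> (\<exists>t\<le>T. ex c s t s')"

lemma exb_mono: "exb c s T s' \<Longrightarrow> T \<le> T' \<Longrightarrow> exb c s T' s'"
  unfolding exb_def by (meson le_trans)

lemma exb_Inc: "exb (Inc x) (v, a) 1 (v(x := Suc (v x)), a)"
  unfolding exb_def using ex_Inc by blast

lemma exb_Clr: "exb (Clr x) (v, a) 1 (v(x := 0), a)"
  unfolding exb_def using ex_Clr by blast

lemma exb_Put: "exb (Put j x b) (v, a) 1 (v, a(j := (a j)(v x := b)))"
  unfolding exb_def using ex_Put by blast

lemma exb_Seq: "exb c s T s' \<Longrightarrow> exb d s' T' s'' \<Longrightarrow> exb (Seq c d) s (T + T') s''"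
  unfolding exb_def by (meson add_mono ex_Seq)

lemma exb_If: "exb (if cnd b s then c else d) s T s' \<Longrightarrow> exb (If b c d) s (Suc T) s'"
  unfolding exb_def using ex_IfT ex_IfF by (cases "cnd b s") (metis Suc_le_mono)+

definition For :: "nat \<Rightarrow> nat \<Rightarrow> com \<Rightarrow> com" where
  "For i y c = Seq (Clr i) (Wh (Lt i y) (Seq c (Inc i)))"

text \<open>The 2 in each round pays for test and increment, the final 2 for clearing the loop
  counter and for the last test. \<open>reg\<close> demands that the invariant fixes both the loop
  counter and the limit.\<close>

lemma For_loop:
  assumes P0: "P 0 (v(i := 0), a)"
    and reg: "\<And>k v a. P k (v, a) \<Longrightarrow> v i = k \<and> v y = n"
    and step: "\<And>k v a. k < n \<Longrightarrow> P k (v, a) \<Longrightarrow> \<exists>v' a'. exb c (v, a) T (v', a') \<and> v' i = k \<and> P (Suc k) (v'(i := Suc k), a')"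
  shows "\<exists>s'. exb (For i y c) (v, a) (n * (T + 2) + 2) s' \<and> P n s'"
proof -
  have "P k s \<Longrightarrow> k \<le> n \<Longrightarrow> \<exists>s'. exb (Wh (Lt i y) (Seq c (Inc i))) s ((n - k) * (T + 2) + 1) s' \<and> P n s'" for k s
  proof (induction "n - k" arbitrary: k s)
    case 0
    obtain v a where s: "s = (v, a)" by (cases s)
    have "\<not> cnd (Lt i y) s" "k = n" using 0 reg[of k v a] s by auto
    then show ?case using 0 ex_WhF unfolding exb_def by (metis le_add2)
  next
    case (Suc m)
    obtain v a where s: "s = (v, a)" by (cases s)
    have kn: "k < n" using Suc by simp
    obtain v' a' where b: "exb c (v, a) T (v', a')" "v' i = k" "P (Suc k) (v'(i := Suc k), a')"
      using step[OF kn] Suc.prems(1) s by blast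
    have m: "m = n - Suc k" using Suc.hyps(2) by simp
    have body: "exb (Seq c (Inc i)) s (T + 1) (v'(i := Suc k), a')"
      using exb_Seq[OF b(1) exb_Inc[of i v' a']] b(2) s by simp
    obtain s' where s': "exb (Wh (Lt i y) (Seq c (Inc i))) (v'(i := Suc k), a') ((n - Suc k) * (T + 2) + 1) s'" "P n s'"
      using Suc.hyps(1)[OF m b(3) Suc_leI[OF kn]] by blast
    have c: "cnd (Lt i y) s" using reg Suc.prems(1) kn s by auto
    obtain t1 t2 where t: "t1 \<le> T + 1" "ex (Seq c (Inc i)) s t1 (v'(i := Suc k), a')"
      "t2 \<le> (n - Suc k) * (T + 2) + 1" "ex (Wh (Lt i y) (Seq c (Inc i))) (v'(i := Suc k), a') t2 s'"
      using body s'(1) unfolding exb_def by blast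
    have "ex (Wh (Lt i y) (Seq c (Inc i))) s (Suc (t1 + t2)) s'" by (rule ex_WhT[OF c t(2,4)])
    moreover have "n - k = Suc (n - Suc k)" using kn by simp
    then have "Suc (t1 + t2) \<le> (n - k) * (T + 2) + 1" using t(1,3) by simp
    ultimately show ?case using s'(2) unfolding exb_def by blast
  qed
  from this[OF P0] obtain s' where s': "exb (Wh (Lt i y) (Seq c (Inc i))) (v(i := 0), a) (n * (T + 2) + 1) s'" "P n s'" by auto
  have "exb (For i y c) (v, a) (1 + (n * (T + 2) + 1)) s'"
    unfolding For_def by (rule exb_Seq[OF exb_Clr s'(1)])
  then show ?thesis using s'(2) by (intro exI[of _ s']) simp
qed

definition Copy :: "nat \<Rightarrow> nat \<Rightarrow> com" where
  "Copy x y = Seq (Clr x) (Wh (Lt x y) (Inc x))"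

lemma exb_Copy: "x \<noteq> y \<Longrightarrow> exb (Copy x y) (v, a) (2 * v y + 2) (v(x := v y), a)"
proof -
  assume xy: "x \<noteq> y"
  have "v x \<le> v y \<Longrightarrow> ex (Wh (Lt x y) (Inc x)) (v, a) (2 * (v y - v x) + 1) (v(x := v y), a)" for v
  proof (induction "v y - v x" arbitrary: v)
    case 0
    then have "v(x := v y) = v" by auto
    then show ?case using ex_WhF[of "Lt x y" "(v, a)"] 0 by simp
  next
    case (Suc m)
    let ?v = "v(x := Suc (v x))"
    have "ex (Wh (Lt x y) (Inc x)) (?v, a) (2 * (?v y - ?v x) + 1) (?v(x := ?v y), a)" by (rule Suc.hyps(1)) (use Suc.hyps(2) xy in auto)
    then have "ex (Wh (Lt x y) (Inc x)) (v, a) (Suc (1 + (2 * (?v y - ?v x) + 1))) (?v(x := ?v y), a)"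
      using ex_WhT[OF _ ex_Inc] Suc.hyps(2) by simp
    moreover have "Suc (1 + (2 * (?v y - ?v x) + 1)) = 2 * (v y - v x) + 1" using Suc.hyps(2) xy by simp
    ultimately show ?case using xy by simp
  qed
  from this[of "v(x := 0)"] have "ex (Wh (Lt x y) (Inc x)) (v(x := 0), a) (2 * v y + 1) (v(x := v y), a)" using xy by simp
  then have "ex (Copy x y) (v, a) (1 + (2 * v y + 1)) (v(x := v y), a)" unfolding Copy_def by (rule ex_Seq[OF ex_Clr])
  then show ?thesis unfolding exb_def by (intro exI[of _ "1 + (2 * v y + 1)"]) simp
qed

text \<open>A base of at least 2 absorbs the constant factor, so time bounds can be pure powers
  \<open>M ^ d\<close> throughout.\<close>

lemma pow_add_le: "2 \<le> M \<Longrightarrow> s \<le> M ^ a \<Longrightarrow> t \<le> M ^ b \<Longrightarrow> s + t \<le> (M :: nat) ^ (a + b + 1)"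
proof -
  assume M: "2 \<le> M" and s: "s \<le> M ^ a" and t: "t \<le> M ^ b"
  have "M ^ a \<le> M ^ (a + b)" "M ^ b \<le> M ^ (a + b)" using M by (auto intro: power_increasing)
  then have "s + t \<le> 2 * M ^ (a + b)" using s t by linarith
  also have "\<dots> \<le> M * M ^ (a + b)" using M by simp
  finally show ?thesis by simp
qed

lemma pow_mult_le: "s \<le> M ^ a \<Longrightarrow> t \<le> M ^ b \<Longrightarrow> s * t \<le> (M :: nat) ^ (a + b)"
  by (simp add: power_add mult_le_mono)

lemma pow_const_le: "2 \<le> M \<Longrightarrow> k \<le> (M :: nat) ^ k"
proof -
  assume "2 \<le> M"
  then have "2 ^ k \<le> M ^ k" by (rule power_mono) simp
  then show ?thesis by (meson le_trans less_exp less_imp_le)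
qed

lemma pow_self_le: "k \<le> M \<Longrightarrow> k \<le> (M :: nat) ^ 1"
  by simp

text \<open>Bound variables are positional: an environment holds the input and two stacks, of array and of
  number variables, \<open>topv\<close> is the innermost number variable and \<open>popv\<close> skips it.\<close>

type_synonym 'x env = "'x \<times> (nat \<Rightarrow> bool) list \<times> nat list"

fun px :: "'x env \<Rightarrow> 'x" where "px (x, A, V) = x"
fun popv :: "'x env \<Rightarrow> 'x env" where "popv (x, A, V) = (x, A, tl V)"
fun topv :: "'x env \<Rightarrow> nat" where "topv (x, A, V) = (case V of [] \<Rightarrow> 0 | z # _ \<Rightarrow> z)"
fun popa :: "'x env \<Rightarrow> 'x env" where "popa (x, A, V) = (x, tl A, V)"
fun topa :: "'x env \<Rightarrow> nat \<Rightarrow> bool" where "topa (x, A, V) = (case A of [] \<Rightarrow> (\<lambda>_. False) | X # _ \<Rightarrow> X)"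

lemma px_pop [simp]: "px (popv e) = px e" "px (popa e) = px e"
  by (cases e; simp)+

lemma popa_popv: "popa (popv e) = popv (popa e)" "topv (popa e) = topv e" "topa (popv e) = topa e"
  by (cases e; simp)+

text \<open>Limited recursion: truncation at \<open>b\<close> keeps every intermediate value, and
  with it the running time, polynomial.\<close>

function crec :: "nat \<Rightarrow> nat \<Rightarrow> (nat \<Rightarrow> nat \<Rightarrow> nat) \<Rightarrow> nat \<Rightarrow> nat" where
  "crec b g h 0 = min g b"
| "crec b g h (Suc i) = min (h i (crec b g h i)) b"
  by pat_completeness auto
termination by lexicographic_order

lemma crec_le: "crec b g h n \<le> b"
  by (cases n) auto

text \<open>The intersection of all sets closed under \<open>\<Phi>\<close> below \<open>b\<close>,
  which gives induction directly; for monotone \<open>\<Phi>\<close> the computable description is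
  by \<open>stages\<close>.\<close>

definition lfpb :: "nat \<Rightarrow> ((nat \<Rightarrow> bool) \<Rightarrow> nat \<Rightarrow> bool) \<Rightarrow> nat \<Rightarrow> bool" where
  "lfpb b \<Phi> i \<longleftrightarrow> i < b \<and> (\<forall>Y. (\<forall>k<b. \<Phi> Y k \<longrightarrow> Y k) \<longrightarrow> Y i)"

lemma lfpb_closed:
  assumes m: "\<And>X Y k. (\<And>p. X p \<Longrightarrow> Y p) \<Longrightarrow> \<Phi> X k \<Longrightarrow> \<Phi> Y k" and "\<Phi> (lfpb b \<Phi>) i" "i < b"
  shows "lfpb b \<Phi> i"
  unfolding lfpb_def
proof (intro conjI allI impI)
  fix Y assume Y: "\<forall>k<b. \<Phi> Y k \<longrightarrow> Y k"
  have "\<Phi> Y i" by (rule m[OF _ assms(2)]) (use Y in \<open>auto simp: lfpb_def\<close>)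
  then show "Y i" using Y assms(3) by blast
qed (rule assms(3))

fun stages :: "nat \<Rightarrow> ((nat \<Rightarrow> bool) \<Rightarrow> nat \<Rightarrow> bool) \<Rightarrow> nat \<Rightarrow> nat \<Rightarrow> bool" where
  "stages b \<Phi> 0 i = False"
| "stages b \<Phi> (Suc n) i = (i < b \<and> \<Phi> (stages b \<Phi> n) i)"

text \<open>The stages increase within a set of \<open>b\<close> elements, so two consecutive ones
  coincide after at most \<open>b\<close> steps.\<close>

lemma lfpb_stages:
  assumes m: "\<And>X Y k. (\<And>p. X p \<Longrightarrow> Y p) \<Longrightarrow> \<Phi> X k \<Longrightarrow> \<Phi> Y k" and i: "lfpb b \<Phi> i"
  shows "stages b \<Phi> b i"
proof -
  have mono: "stages b \<Phi> n i \<Longrightarrow> stages b \<Phi> (Suc n) i" for n i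
  proof (induction n arbitrary: i)
    case (Suc n)
    show ?case using Suc.prems m[of "stages b \<Phi> n" "stages b \<Phi> (Suc n)" i, OF Suc.IH] by simp
  qed simp
  define J where "J = (\<lambda>n. {i. stages b \<Phi> n i})"
  have sub: "J n \<subseteq> {..<b}" for n unfolding J_def by (cases n) auto
  then have fin: "finite (J n)" for n using finite_subset by blast
  have inc: "J n \<subseteq> J (Suc n)" for n using mono unfolding J_def by auto
  have "\<exists>n\<le>b. J n = J (Suc n)"
  proof (rule ccontr)
    assume no: "\<not> (\<exists>n\<le>b. J n = J (Suc n))"
    have "n \<le> Suc b \<Longrightarrow> n \<le> card (J n)" for n
    proof (induction n)
      case (Suc n)
      have "J n \<subset> J (Suc n)" using no inc[of n] Suc.prems by auto
      then have "card (J n) < card (J (Suc n))" using psubset_card_mono[OF fin] by blast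
      then show ?case using Suc by simp
    qed simp
    then have "Suc b \<le> card (J (Suc b))" by blast
    moreover have "card (J (Suc b)) \<le> b" using card_mono[OF _ sub, of "Suc b"] by simp
    ultimately show False by simp
  qed
  then obtain n where n: "n \<le> b" "J n = J (Suc n)" by blast
  have eq: "stages b \<Phi> (n + k) = stages b \<Phi> n" for k
  proof (induction k)
    case (Suc k)
    have "stages b \<Phi> (Suc n) = stages b \<Phi> n" using n(2) unfolding J_def by auto
    moreover have "stages b \<Phi> (n + Suc k) = stages b \<Phi> (Suc n)" using Suc by (intro ext) simp
    ultimately show ?case by simp
  qed simp
  have nb: "stages b \<Phi> b = stages b \<Phi> n" using eq[of "b - n"] n(1) by simp
  have "\<forall>k<b. \<Phi> (stages b \<Phi> n) k \<longrightarrow> stages b \<Phi> n k" using n(2) unfolding J_def by (auto simp: set_eq_iff)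
  then show ?thesis using i nb unfolding lfpb_def by metis
qed

locale coding =
  fixes enc :: "'x \<Rightarrow> nat list" and bnd :: "'x \<Rightarrow> nat"
  assumes bnd2: "2 \<le> bnd x"
begin

definition good :: "'x \<Rightarrow> (nat \<Rightarrow> nat) \<Rightarrow> (nat \<Rightarrow> nat \<Rightarrow> bool) \<Rightarrow> nat \<Rightarrow> bool" where
  "good x v a M \<longleftrightarrow> v 0 = bnd x \<and> a 0 = inbits (enc x) 0 \<and> a 1 = inbits (enc x) 1 \<and> bnd x \<le> M"

definition agree :: "nat \<Rightarrow> (nat \<Rightarrow> nat) \<Rightarrow> (nat \<Rightarrow> nat) \<Rightarrow> bool" where
  "agree w v v' \<longleftrightarrow> (\<forall>i<w. v' i = v i)"

text \<open>\<open>vs\<close> and \<open>as\<close> are the counters and arrays holding the environment, \<open>w\<close> and \<open>u\<close> the first free ones.\<close>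

definition computes :: "nat list \<Rightarrow> nat list \<Rightarrow> nat \<Rightarrow> nat \<Rightarrow> ('x env \<Rightarrow> nat) \<Rightarrow> com \<Rightarrow> nat \<Rightarrow> bool" where
  "computes vs as w u f c d \<longleftrightarrow> (\<forall>x v a M. good x v a M \<longrightarrow> (\<forall>i<w. v i \<le> M) \<longrightarrow> (\<forall>j\<ge>u. \<forall>p. \<not> a j p) \<longrightarrow>
     f (x, map a as, map v vs) \<le> M ^ d \<and>
     (\<exists>v'. exb c (v, a) (M ^ d) (v', a) \<and> v' w = f (x, map a as, map v vs) \<and> agree w v v'))"

text \<open>All layouts are covered, so a subexpression can be compiled while other counters and
  arrays are in use.\<close>

definition fn :: "('x env \<Rightarrow> nat) \<Rightarrow> bool" where
  "fn f \<longleftrightarrow> (\<forall>vs as w u. (\<forall>i\<in>set vs. i < w) \<longrightarrow> (\<forall>j\<in>set as. j < u) \<longrightarrow> 1 \<le> w \<longrightarrow> 2 \<le> u \<longrightarrow>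
     (\<exists>c d. computes vs as w u f c d))"

lemma fnI:
  assumes "\<And>vs as w u. \<forall>i\<in>set vs. i < w \<Longrightarrow> \<forall>j\<in>set as. j < u \<Longrightarrow> 1 \<le> w \<Longrightarrow> 2 \<le> u \<Longrightarrow>
     \<exists>c d. computes vs as w u f c d"
  shows "fn f"
  unfolding fn_def using assms by blast

lemma fnE:
  assumes "fn f" "\<forall>i\<in>set vs. i < w" "\<forall>j\<in>set as. j < u" "1 \<le> w" "2 \<le> u"
  obtains c d where "computes vs as w u f c d"
  using assms unfolding fn_def by blast

lemma good_M: "good x v a M \<Longrightarrow> 2 \<le> M"
  unfolding good_def using bnd2[of x] by simp

lemma good_agree: "good x v a M \<Longrightarrow> agree w v v' \<Longrightarrow> 1 \<le> w \<Longrightarrow> M \<le> M' \<Longrightarrow> good x v' a M'"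
  unfolding good_def agree_def by auto

lemma agree_map: "agree w v v' \<Longrightarrow> \<forall>i\<in>set vs. i < w \<Longrightarrow> map v' vs = map v vs"
  unfolding agree_def by auto

lemma agree_trans: "agree w v v' \<Longrightarrow> agree w' v' v'' \<Longrightarrow> w \<le> w' \<Longrightarrow> agree w v v''"
  unfolding agree_def by auto

lemma agree_refl [simp]: "agree w v v"
  unfolding agree_def by simp

lemma agree_upd: "agree w v v' \<Longrightarrow> w \<le> i \<Longrightarrow> agree w v (v'(i := n))"
  unfolding agree_def by auto

lemma computesD:
  assumes "computes vs as w u f c d" "good x v a M" "\<And>i. i < w \<Longrightarrow> v i \<le> M" "\<And>j p. u \<le> j \<Longrightarrow> \<not> a j p"
  obtains v' where "f (x, map a as, map v vs) \<le> M ^ d" "exb c (v, a) (M ^ d) (v', a)"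
    "v' w = f (x, map a as, map v vs)" "agree w v v'"
  using assms unfolding computes_def by blast

lemma fn_popv: "fn f \<Longrightarrow> fn (\<lambda>e. f (popv e))"
proof (rule fnI)
  fix vs as :: "nat list" and w u
  assume f: "fn f" and h: "\<forall>i\<in>set vs. i < w" "\<forall>j\<in>set as. j < u" "1 \<le> w" "2 \<le> u"
  have t: "\<forall>i\<in>set (tl vs). i < w" using h(1) by (cases vs) auto
  obtain c d where "computes (tl vs) as w u f c d" using fnE[OF f t h(2-4)] .
  then have "computes vs as w u (\<lambda>e. f (popv e)) c d" unfolding computes_def by (simp add: map_tl)
  then show "\<exists>c d. computes vs as w u (\<lambda>e. f (popv e)) c d" by blast
qed

lemma fn_popa: "fn f \<Longrightarrow> fn (\<lambda>e. f (popa e))"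
proof (rule fnI)
  fix vs as :: "nat list" and w u
  assume f: "fn f" and h: "\<forall>i\<in>set vs. i < w" "\<forall>j\<in>set as. j < u" "1 \<le> w" "2 \<le> u"
  have t: "\<forall>i\<in>set (tl as). i < u" using h(2) by (cases as) auto
  obtain c d where "computes vs (tl as) w u f c d" using fnE[OF f h(1) t h(3-4)] .
  then have "computes vs as w u (\<lambda>e. f (popa e)) c d" unfolding computes_def by (simp add: map_tl)
  then show "\<exists>c d. computes vs as w u (\<lambda>e. f (popa e)) c d" by blast
qed

lemma copy_time: "2 \<le> M \<Longrightarrow> k \<le> M \<Longrightarrow> 2 * k + 2 \<le> (M :: nat) ^ 3"
proof -
  assume "2 \<le> M" "k \<le> M"
  then have "2 * k + 2 \<le> M * M + M" by (intro add_mono mult_le_mono) auto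
  also have "\<dots> \<le> M * M + M * M" using \<open>2 \<le> M\<close> by simp
  also have "\<dots> = 2 * (M * M)" by simp
  also have "\<dots> \<le> M * (M * M)" using \<open>2 \<le> M\<close> by (rule mult_le_mono1)
  finally show ?thesis by (simp add: power3_eq_cube mult.assoc)
qed

lemma computes_copy:
  assumes "x0 < w" shows "\<And>f. (\<And>x a v. good x v a (v 0) \<Longrightarrow> f (x, map a as, map v vs) = v x0) \<Longrightarrow> computes vs as w u f (Copy w x0) 3"
  unfolding computes_def
proof (intro allI impI conjI)
  fix f and x :: 'x and v a M
  assume f: "\<And>x a v. good x v a (v 0) \<Longrightarrow> f (x, map a as, map v vs) = v x0" and h: "good x v a M" "\<forall>i<w. v i \<le> M"
  have M: "2 \<le> M" "v x0 \<le> M" using good_M h assms by auto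
  have fv: "f (x, map a as, map v vs) = v x0" using f[of x v a] h(1) unfolding good_def by simp
  have b: "2 * v x0 + 2 \<le> M ^ 3" by (rule copy_time[OF M])
  show "f (x, map a as, map v vs) \<le> M ^ 3" using b fv by simp
  show "\<exists>v'. exb (Copy w x0) (v, a) (M ^ 3) (v', a) \<and> v' w = f (x, map a as, map v vs) \<and> agree w v v'"
    using exb_mono[OF exb_Copy[of w x0 v a] b] assms fv
    by (intro exI[of _ "v(w := v x0)"]) (auto simp: agree_def)
qed

lemma fn_bnd: "fn (\<lambda>e. bnd (px e))"
proof (rule fnI)
  fix vs as :: "nat list" and w u :: nat
  assume "1 \<le> w"
  then show "\<exists>c d. computes vs as w u (\<lambda>e. bnd (px e)) c d"
    by (intro exI) (rule computes_copy[of 0], auto simp: good_def)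
qed

fun Incs :: "nat \<Rightarrow> nat \<Rightarrow> com" where
  "Incs x 0 = Clr x" | "Incs x (Suc n) = Seq (Incs x n) (Inc x)"

lemma exb_Incs: "exb (Incs x n) (v, a) (Suc n) (v(x := n), a)"
proof (induction n)
  case 0
  show ?case using exb_Clr[of x v a] by (simp add: fun_upd_def)
next
  case (Suc n)
  then show ?case using exb_Seq[OF Suc exb_Inc[of x "v(x := n)" a]] by (simp add: fun_upd_def cong: if_cong)
qed

lemma fn_const: "fn (\<lambda>e. n)"
proof (rule fnI)
  fix vs as :: "nat list" and w u :: nat
  have "computes vs as w u (\<lambda>e. n) (Incs w n) (Suc n)" unfolding computes_def
  proof (intro allI impI conjI)
    fix x :: 'x and v a M assume h: "good x v a M"
    have b: "Suc n \<le> M ^ Suc n" using pow_const_le[OF good_M[OF h]] .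
    then show "n \<le> M ^ Suc n" by simp
    show "\<exists>v'. exb (Incs w n) (v, a) (M ^ Suc n) (v', a) \<and> v' w = n \<and> agree w v v'"
      using exb_mono[OF exb_Incs b] by (intro exI[of _ "v(w := n)"]) (auto simp: agree_def)
  qed
  then show "\<exists>c d. computes vs as w u (\<lambda>e. n) c d" by blast
qed

lemma fn_topv: "fn topv"
proof (rule fnI)
  fix vs as :: "nat list" and w u
  assume h: "\<forall>i\<in>set vs. i < w" "\<forall>j\<in>set as. j < u" "1 \<le> w" "2 \<le> u"
  show "\<exists>c d. computes vs as w u topv c d"
  proof (cases vs)
    case Nil
    obtain c d where "computes vs as w u (\<lambda>e. 0) c d" using fnE[OF fn_const h] .
    then have "computes vs as w u topv c d" using Nil by (simp add: computes_def)
    then show ?thesis by blast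
  next
    case (Cons i js)
    then show ?thesis using h(1) by (intro exI) (rule computes_copy[of i], auto)
  qed
qed

lemma fn_op2:
  assumes f: "fn f" and g: "fn g"
    and op: "\<And>w. \<exists>c d. \<forall>v a M. 2 \<le> M \<longrightarrow> v w \<le> M \<longrightarrow> v (w + 1) \<le> M \<longrightarrow> h (v w) (v (w + 1)) \<le> M ^ d \<and>
      (\<exists>v'. exb c (v, a) (M ^ d) (v', a) \<and> v' w = h (v w) (v (w + 1)) \<and> agree w v v')"
  shows "fn (\<lambda>e. h (f e) (g e))"
proof (rule fnI)
  fix vs as :: "nat list" and w u
  assume A: "\<forall>i\<in>set vs. i < w" "\<forall>j\<in>set as. j < u" "1 \<le> w" "2 \<le> u"
  obtain c1 d1 where c1: "computes vs as w u f c1 d1" using fnE[OF f A] .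
  have A1: "\<forall>i\<in>set vs. i < w + 1" "1 \<le> w + 1" using A by auto
  obtain c2 d2 where c2: "computes vs as (w + 1) u g c2 d2" using fnE[OF g A1(1) A(2) A1(2) A(4)] .
  obtain c3 d3 where c3: "\<And>v a M. 2 \<le> M \<Longrightarrow> v w \<le> M \<Longrightarrow> v (w + 1) \<le> M \<Longrightarrow> h (v w) (v (w + 1)) \<le> M ^ d3 \<and>
      (\<exists>v'. exb c3 (v, a) (M ^ d3) (v', a) \<and> v' w = h (v w) (v (w + 1)) \<and> agree w v v')" using op by meson
  \<comment> \<open>\<open>M ^ e1\<close> and \<open>M ^ e2\<close> bound the counters after
    evaluation of the first and of the second operand.\<close>
  define e1 where "e1 = d1 + 1"
  define e2 where "e2 = e1 * (d2 + 1)"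
  define d where "d = d1 + (e1 * d2 + e2 * d3 + 1) + 1"
  have "computes vs as w u (\<lambda>e. h (f e) (g e)) (Seq c1 (Seq c2 c3)) d"
    unfolding computes_def
  proof (intro allI impI)
    fix x :: 'x and v a M
    assume gd: "good x v a M" and vM: "\<forall>i<w. v i \<le> M" and au: "\<forall>j\<ge>u. \<forall>p. \<not> a j p"
    let ?f = "f (x, map a as, map v vs)" and ?g = "g (x, map a as, map v vs)"
    have M: "2 \<le> M" using good_M[OF gd] .
    have pw: "M ^ a \<le> M ^ b" if "a \<le> b" for a b using that M by (simp add: power_increasing)
    obtain v1 where v1: "?f \<le> M ^ d1" "exb c1 (v, a) (M ^ d1) (v1, a)" "v1 w = ?f" "agree w v v1"
      using computesD[OF c1 gd] vM au by blast
    have M1: "M \<le> M ^ e1" "M ^ d1 \<le> M ^ e1" using pw[of 1 e1] pw[of d1 e1] by (simp_all add: e1_def)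
    have gd1: "good x v1 a (M ^ e1)" using good_agree[OF gd v1(4) A(3) M1(1)] .
    have vM1: "v1 i \<le> M ^ e1" if "i < w + 1" for i
    proof (cases "i = w")
      case False
      then have "v1 i = v i" "v i \<le> M" using v1(4) vM that unfolding agree_def by auto
      then show ?thesis using M1 by simp
    qed (use v1 M1 in simp)
    have m: "map v1 vs = map v vs" using agree_map[OF v1(4) A(1)] .
    obtain v2 where v2: "?g \<le> (M ^ e1) ^ d2" "exb c2 (v1, a) ((M ^ e1) ^ d2) (v2, a)" "v2 (w + 1) = ?g" "agree (w + 1) v1 v2"
      using computesD[OF c2 gd1 vM1] au unfolding m by blast
    have M2: "M ^ e1 \<le> M ^ e2" "(M ^ e1) ^ d2 \<le> M ^ e2"
      using pw[of e1 e2] pw[of "e1 * d2" e2] by (simp_all add: e2_def power_mult)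
    have w2: "v2 w = ?f" using v2(4) v1(3) unfolding agree_def by simp
    have "2 \<le> M ^ e2" "v2 w \<le> M ^ e2" "v2 (w + 1) \<le> M ^ e2"
      unfolding w2 v2(3) by (meson M M1 M2 v1(1) v2(1) le_trans)+
    then obtain v3 where v3: "h ?f ?g \<le> (M ^ e2) ^ d3" "exb c3 (v2, a) ((M ^ e2) ^ d3) (v3, a)" "v3 w = h ?f ?g" "agree w v2 v3"
      using c3[of "M ^ e2" v2 a] w2 v2(3) by metis
    have "exb (Seq c1 (Seq c2 c3)) (v, a) (M ^ d1 + ((M ^ e1) ^ d2 + (M ^ e2) ^ d3)) (v3, a)"
      by (rule exb_Seq[OF v1(2) exb_Seq[OF v2(2) v3(2)]])
    moreover have "M ^ d1 + ((M ^ e1) ^ d2 + (M ^ e2) ^ d3) \<le> M ^ d"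
      unfolding d_def power_mult[symmetric] by (intro pow_add_le M le_refl)
    ultimately have t: "exb (Seq c1 (Seq c2 c3)) (v, a) (M ^ d) (v3, a)" using exb_mono by blast
    have "agree w v v3" using agree_trans[OF agree_trans[OF v1(4) v2(4)] v3(4)] agree_trans[OF v1(4) agree_trans[OF _ v3(4), of w v1]] v2(4)
      unfolding agree_def by simp
    moreover have "h ?f ?g \<le> M ^ d"
      using v3(1) pw[of "e2 * d3" d] by (simp add: d_def power_mult)
    ultimately show "h ?f ?g \<le> M ^ d \<and> (\<exists>v'. exb (Seq c1 (Seq c2 c3)) (v, a) (M ^ d) (v', a) \<and> v' w = h ?f ?g \<and> agree w v v')"
      using t v3(3) by blast
  qed
  then show "\<exists>c d. computes vs as w u (\<lambda>e. h (f e) (g e)) c d" by blast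
qed

definition Bit :: "nat \<Rightarrow> cond \<Rightarrow> com" where
  "Bit w b = If b (Seq (Clr w) (Inc w)) (Clr w)"

lemma exb_Bit: "exb (Bit w b) (v, a) 3 (v(w := of_bool (cnd b (v, a))), a)"
proof -
  have "exb (if cnd b (v, a) then Seq (Clr w) (Inc w) else Clr w) (v, a) 2 (v(w := of_bool (cnd b (v, a))), a)"
    using exb_Seq[OF exb_Clr[of w v a] exb_Inc[of w "v(w := 0)" a]] exb_mono[OF exb_Clr[of w v a], of 2] by (auto simp: fun_upd_def numeral_2_eq_2 cong: if_cong)
  then show ?thesis unfolding Bit_def by (metis exb_If numeral_2_eq_2 numeral_3_eq_3)
qed

lemma three_le: "2 \<le> M \<Longrightarrow> 3 \<le> (M :: nat) ^ 2"
  using mult_le_mono[of 2 M 2 M] by (simp add: power2_eq_square)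

lemma fn_less: "fn f \<Longrightarrow> fn g \<Longrightarrow> fn (\<lambda>e. of_bool (f e < g e))"
proof (rule fn_op2[of f g "\<lambda>a b. of_bool (a < b)"])
  fix w :: nat
  show "\<exists>c d. \<forall>v a M. 2 \<le> M \<longrightarrow> v w \<le> M \<longrightarrow> v (w + 1) \<le> M \<longrightarrow> of_bool (v w < v (w + 1)) \<le> M ^ d \<and>
      (\<exists>v'. exb c (v, a) (M ^ d) (v', a) \<and> v' w = of_bool (v w < v (w + 1)) \<and> agree w v v')"
  proof (intro exI allI impI conjI)
    fix v :: "nat \<Rightarrow> nat" and a and M :: nat assume M: "2 \<le> M"
    show "of_bool (v w < v (w + 1)) \<le> M ^ 2" using three_le[OF M] by (simp add: of_bool_def)
    show "exb (Bit w (Lt w (w + 1))) (v, a) (M ^ 2) (v(w := of_bool (v w < v (w + 1))), a)"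
      using exb_mono[OF exb_Bit three_le[OF M], of w "Lt w (w + 1)" v a] by simp
  qed (auto simp: agree_def)
qed

lemma fn_plus: "fn f \<Longrightarrow> fn g \<Longrightarrow> fn (\<lambda>e. f e + g e)"
proof (rule fn_op2[of f g "\<lambda>a b. a + b"])
  fix w :: nat
  show "\<exists>c d. \<forall>v a M. 2 \<le> M \<longrightarrow> v w \<le> M \<longrightarrow> v (w + 1) \<le> M \<longrightarrow> v w + v (w + 1) \<le> M ^ d \<and>
      (\<exists>v'. exb c (v, a) (M ^ d) (v', a) \<and> v' w = v w + v (w + 1) \<and> agree w v v')"
  proof (intro exI[of _ "For (w + 2) (w + 1) (Inc w)"] exI[of _ 5] allI impI)
    fix v :: "nat \<Rightarrow> nat" and a :: "nat \<Rightarrow> nat \<Rightarrow> bool" and M :: nat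
    assume M: "2 \<le> M" "v w \<le> M" "v (w + 1) \<le> M"
    define P where "P = (\<lambda>k (s :: st). s = (v(w := v w + k, w + 2 := k), a))"
    have "\<exists>s'. exb (For (w + 2) (w + 1) (Inc w)) (v, a) (v (w + 1) * (1 + 2) + 2) s' \<and> P (v (w + 1)) s'"
    proof (rule For_loop[where P = P])
      fix k v' a' assume "P k (v', a')"
      then show "\<exists>v'' a''. exb (Inc w) (v', a') 1 (v'', a'') \<and> v'' (w + 2) = k \<and> P (Suc k) (v''(w + 2 := Suc k), a'')"
        using exb_Inc[of w v' a'] by (intro exI conjI) (assumption, auto simp: P_def fun_eq_iff)
    qed (auto simp: P_def fun_eq_iff)
    then have e: "exb (For (w + 2) (w + 1) (Inc w)) (v, a) (v (w + 1) * 3 + 2) (v(w := v w + v (w + 1), w + 2 := v (w + 1)), a)"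
      using exb_mono unfolding P_def by fastforce
    have e5: "1 + 2 + 1 + 1 = (5 :: nat)" by simp
    have t: "v (w + 1) * 3 + 2 \<le> M ^ 5" unfolding e5[symmetric]
      by (rule pow_add_le[OF M(1) pow_mult_le[OF pow_self_le[OF M(3)] three_le[OF M(1)]]]) (use M(1) in simp)
    have "v w + v (w + 1) \<le> M ^ (1 + 1 + 1)" using pow_add_le[OF M(1)] M(2,3) by (metis power_one_right)
    also have "\<dots> \<le> M ^ 5" using M(1) by (intro power_increasing) auto
    finally show "v w + v (w + 1) \<le> M ^ 5 \<and>
      (\<exists>v'. exb (For (w + 2) (w + 1) (Inc w)) (v, a) (M ^ 5) (v', a) \<and> v' w = v w + v (w + 1) \<and> agree w v v')"
      using exb_mono[OF e t] by (intro conjI exI) (assumption, assumption, auto simp: agree_def)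
  qed
qed

end

definition pb :: "(nat \<Rightarrow> nat) \<Rightarrow> bool" where
  "pb T \<longleftrightarrow> (\<exists>d. \<forall>M\<ge>2. T M \<le> M ^ d)"

lemma pb_const: "pb (\<lambda>M. k)"
  unfolding pb_def using pow_const_le by blast

lemma pb_id: "pb (\<lambda>M. M)"
  unfolding pb_def by (intro exI[of _ 1]) simp

lemma pb_add: "pb S \<Longrightarrow> pb T \<Longrightarrow> pb (\<lambda>M. S M + T M)"
  unfolding pb_def using pow_add_le by meson

lemma pb_mult: "pb S \<Longrightarrow> pb T \<Longrightarrow> pb (\<lambda>M. S M * T M)"
  unfolding pb_def using pow_mult_le by meson

lemma pb_power: "pb T \<Longrightarrow> pb (\<lambda>M. T M ^ k)"
proof -
  assume "pb T"
  then obtain d where d: "\<And>M. 2 \<le> M \<Longrightarrow> T M \<le> M ^ d" unfolding pb_def by blast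
  have "T M ^ k \<le> M ^ (d * k)" if "2 \<le> M" for M
    using power_mono[OF d[OF that], of k] by (simp add: power_mult)
  then show ?thesis unfolding pb_def by blast
qed

lemma pb_Suc: "pb T \<Longrightarrow> pb (\<lambda>M. Suc (T M))"
  using pb_add[OF _ pb_const[of 1]] by simp

lemmas pb_intros = pb_const pb_id pb_add pb_mult pb_power pb_Suc

context coding
begin

lemma computes_pb:
  assumes "pb T" and "\<And>x v a M. good x v a M \<Longrightarrow> (\<And>i. i < w \<Longrightarrow> v i \<le> M) \<Longrightarrow> (\<And>j p. u \<le> j \<Longrightarrow> \<not> a j p) \<Longrightarrow>
     f (x, map a as, map v vs) \<le> T M \<and>
     (\<exists>v'. exb c (v, a) (T M) (v', a) \<and> v' w = f (x, map a as, map v vs) \<and> agree w v v')"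
  shows "\<exists>c d. computes vs as w u f c d"
proof -
  obtain d where d: "\<And>M. 2 \<le> M \<Longrightarrow> T M \<le> M ^ d" using assms(1) unfolding pb_def by blast
  have "computes vs as w u f c d" unfolding computes_def
  proof (intro allI impI)
    fix x :: 'x and v a M
    assume h: "good x v a M" "\<forall>i<w. v i \<le> M" "\<forall>j\<ge>u. \<forall>p. \<not> a j p"
    have t: "T M \<le> M ^ d" using d good_M[OF h(1)] by blast
    obtain v' where "f (x, map a as, map v vs) \<le> T M" "exb c (v, a) (T M) (v', a)" "v' w = f (x, map a as, map v vs)" "agree w v v'"
      using assms(2)[OF h(1)] h(2,3) by blast
    then show "f (x, map a as, map v vs) \<le> M ^ d \<and>
      (\<exists>v'. exb c (v, a) (M ^ d) (v', a) \<and> v' w = f (x, map a as, map v vs) \<and> agree w v v')"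
      using t exb_mono le_trans by blast
  qed
  then show ?thesis by blast
qed

lemma fn_times: "fn f \<Longrightarrow> fn g \<Longrightarrow> fn (\<lambda>e. f e * g e)"
proof (rule fn_op2[of f g "\<lambda>a b. a * b"])
  fix w :: nat
  define c where "c = Seq (Clr (w + 2)) (Seq (For (w + 3) w (For (w + 4) (w + 1) (Inc (w + 2)))) (Copy w (w + 2)))"
  define T where "T = (\<lambda>M :: nat. 1 + (M * (M * 3 + 2 + 2) + 2 + (2 * (M * M) + 2)))"
  have "pb T" unfolding T_def by (intro pb_intros)
  then obtain d where d: "\<And>M. 2 \<le> M \<Longrightarrow> T M \<le> M ^ d" unfolding pb_def by blast
  have "v w * v (w + 1) \<le> M ^ d \<and> (\<exists>v'. exb c (v, a) (M ^ d) (v', a) \<and> v' w = v w * v (w + 1) \<and> agree w v v')"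
    if M: "2 \<le> M" "v w \<le> M" "v (w + 1) \<le> M" for v :: "nat \<Rightarrow> nat" and a M
  proof -
    let ?m = "v w" and ?n = "v (w + 1)"
    define P where "P = (\<lambda>k (s :: st). fst s w = ?m \<and> fst s (w + 1) = ?n \<and> fst s (w + 2) = k * ?n \<and> fst s (w + 3) = k
      \<and> agree w v (fst s) \<and> snd s = a)"
    have "\<exists>s'. exb (For (w + 3) w (For (w + 4) (w + 1) (Inc (w + 2)))) (v(w + 2 := 0), a) (?m * (?n * (1 + 2) + 2 + 2) + 2) s' \<and> P ?m s'"
    proof (rule For_loop[where P = P])
      fix k v1 a1 assume P1: "P k (v1, a1)"
      define R where "R = (\<lambda>j (s :: st). fst s w = ?m \<and> fst s (w + 1) = ?n \<and> fst s (w + 2) = k * ?n + j \<and> fst s (w + 3) = k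
        \<and> fst s (w + 4) = j \<and> agree w v (fst s) \<and> snd s = a)"
      have "\<exists>s'. exb (For (w + 4) (w + 1) (Inc (w + 2))) (v1, a1) (?n * (1 + 2) + 2) s' \<and> R ?n s'"
      proof (rule For_loop[where P = R])
        fix j v2 a2 assume "R j (v2, a2)"
        then show "\<exists>v' a'. exb (Inc (w + 2)) (v2, a2) 1 (v', a') \<and> v' (w + 4) = j \<and> R (Suc j) (v'(w + 4 := Suc j), a')"
          using exb_Inc[of "w + 2" v2 a2] by (intro exI conjI) (assumption, auto simp: R_def agree_def)
      qed (use P1 in \<open>auto simp: P_def R_def agree_def\<close>)
      then obtain v2 a2 where "exb (For (w + 4) (w + 1) (Inc (w + 2))) (v1, a1) (?n * (1 + 2) + 2) (v2, a2)" "R ?n (v2, a2)"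
        by (metis surj_pair)
      then show "\<exists>v' a'. exb (For (w + 4) (w + 1) (Inc (w + 2))) (v1, a1) (?n * (1 + 2) + 2) (v', a') \<and> v' (w + 3) = k \<and> P (Suc k) (v'(w + 3 := Suc k), a')"
        by (intro exI conjI) (assumption, auto simp: R_def P_def agree_def)
    qed (auto simp: P_def agree_def)
    then obtain v1 where l: "exb (For (w + 3) w (For (w + 4) (w + 1) (Inc (w + 2)))) (v(w + 2 := 0), a) (?m * (?n * (1 + 2) + 2 + 2) + 2) (v1, a)"
      "v1 (w + 2) = ?m * ?n" "agree w v v1" unfolding P_def by fastforce
    have e: "exb c (v, a) (1 + (?m * (?n * (1 + 2) + 2 + 2) + 2 + (2 * v1 (w + 2) + 2))) (v1(w := v1 (w + 2)), a)"
      unfolding c_def by (intro exb_Seq[OF exb_Clr exb_Seq[OF l(1) exb_Copy]]) simp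
    have mn: "?m * ?n \<le> M * M" using M by (intro mult_le_mono)
    have "?m * (?n * (1 + 2) + 2 + 2) \<le> M * (M * 3 + 2 + 2)" by (intro mult_le_mono add_le_mono) (use M in auto)
    then have le: "1 + (?m * (?n * (1 + 2) + 2 + 2) + 2 + (2 * v1 (w + 2) + 2)) \<le> T M" "?m * ?n \<le> T M"
      using mn unfolding T_def l(2) by linarith+
    then have "?m * ?n \<le> M ^ d" using d[OF M(1)] by linarith
    moreover have "exb c (v, a) (M ^ d) (v1(w := v1 (w + 2)), a)"
      by (rule exb_mono[OF e]) (use le d[OF M(1)] in linarith)
    ultimately show ?thesis using l(2,3)
      by (intro conjI exI[of _ "v1(w := v1 (w + 2))"]) (auto simp: agree_def)
  qed
  then show "\<exists>c d. \<forall>v a M. 2 \<le> M \<longrightarrow> v w \<le> M \<longrightarrow> v (w + 1) \<le> M \<longrightarrow> v w * v (w + 1) \<le> M ^ d \<and>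
      (\<exists>v'. exb c (v, a) (M ^ d) (v', a) \<and> v' w = v w * v (w + 1) \<and> agree w v v')" by blast
qed

lemma computes_bit:
  assumes c: "computes vs as w u f c d"
    and r: "\<And>x a v. good x v a (v 0) \<Longrightarrow> a j (f (x, map a as, map v vs)) = r (x, map a as, map v vs)"
  shows "\<exists>c d. computes vs as w u (\<lambda>e. of_bool (r e)) c d"
proof (rule computes_pb[where T = "\<lambda>M. M ^ d + 3" and c = "Seq c (Bit w (Ar j w))"])
  show "pb (\<lambda>M. M ^ d + 3)" by (rule pb_add[OF pb_power[OF pb_id] pb_const])
  fix x :: 'x and v a M
  assume h: "good x v a M" "\<And>i. i < w \<Longrightarrow> v i \<le> M" "\<And>j p. u \<le> j \<Longrightarrow> \<not> a j p"
  obtain v' where v': "exb c (v, a) (M ^ d) (v', a)" "v' w = f (x, map a as, map v vs)" "agree w v v'"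
    using computesD[OF c h] by blast
  have "good x v a (v 0)" using h(1) by (simp add: good_def)
  then have "cnd (Ar j w) (v', a) = r (x, map a as, map v vs)" using r v'(2) by simp
  then have "exb (Seq c (Bit w (Ar j w))) (v, a) (M ^ d + 3) (v'(w := of_bool (r (x, map a as, map v vs))), a)"
    using exb_Seq[OF v'(1) exb_Bit[of w "Ar j w" v' a]] by simp
  then show "of_bool (r (x, map a as, map v vs)) \<le> M ^ d + 3 \<and>
     (\<exists>v'. exb (Seq c (Bit w (Ar j w))) (v, a) (M ^ d + 3) (v', a) \<and> v' w = of_bool (r (x, map a as, map v vs)) \<and> agree w v v')"
    using agree_upd[OF v'(3), of w] by (intro conjI exI) (simp add: of_bool_def, assumption, auto)
qed

lemma fn_inbits: "fn f \<Longrightarrow> j < 2 \<Longrightarrow> fn (\<lambda>e. of_bool (inbits (enc (px e)) j (f e)))"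
proof (rule fnI)
  fix vs as :: "nat list" and w u
  assume f: "fn f" and j: "j < 2" and h: "\<forall>i\<in>set vs. i < w" "\<forall>j\<in>set as. j < u" "1 \<le> w" "2 \<le> u"
  obtain c d where c: "computes vs as w u f c d" using fnE[OF f h] .
  show "\<exists>c d. computes vs as w u (\<lambda>e. of_bool (inbits (enc (px e)) j (f e))) c d"
    by (rule computes_bit[OF c, of j]) (use j in \<open>auto simp: good_def less_2_cases_iff\<close>)
qed

lemma fn_topa: "fn f \<Longrightarrow> fn (\<lambda>e. of_bool (topa e (f e)))"
proof (rule fnI)
  fix vs as :: "nat list" and w u
  assume f: "fn f" and h: "\<forall>i\<in>set vs. i < w" "\<forall>j\<in>set as. j < u" "1 \<le> w" "2 \<le> u"
  show "\<exists>c d. computes vs as w u (\<lambda>e. of_bool (topa e (f e))) c d"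
  proof (cases as)
    case Nil
    obtain c d where "computes vs as w u (\<lambda>e. 0) c d" using fnE[OF fn_const h] .
    then have "computes vs as w u (\<lambda>e. of_bool (topa e (f e))) c d" using Nil by (simp add: computes_def)
    then show ?thesis by blast
  next
    case (Cons j js)
    obtain c d where c: "computes vs as w u f c d" using fnE[OF f h] .
    show ?thesis by (rule computes_bit[OF c, of j]) (simp add: Cons)
  qed
qed

definition MinCopy :: "nat \<Rightarrow> nat \<Rightarrow> nat \<Rightarrow> com" where
  "MinCopy r x y = If (Lt x y) (Copy r x) (Copy r y)"

lemma exb_MinCopy: "r \<noteq> x \<Longrightarrow> r \<noteq> y \<Longrightarrow> exb (MinCopy r x y) (v, a) (2 * v x + 3) (v(r := min (v y) (v x)), a)"
proof -
  assume r: "r \<noteq> x" "r \<noteq> y"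
  have "exb (if cnd (Lt x y) (v, a) then Copy r x else Copy r y) (v, a) (2 * v x + 2) (v(r := min (v y) (v x)), a)"
    using exb_Copy[OF r(1), of v a] exb_mono[OF exb_Copy[OF r(2), of v a], of "2 * v x + 2"]
    by (cases "v x < v y") (auto simp: min_def not_less)
  then show ?thesis unfolding MinCopy_def using exb_If by (metis add_Suc_right numeral_2_eq_2 numeral_3_eq_3)
qed

text \<open>Counter \<open>w\<close> holds the number of rounds, \<open>w + 1\<close> the bound,
  \<open>w + 2\<close> the current value, \<open>w + 3\<close> the index and \<open>w + 4\<close>
  each newly computed value. For the body, the value is the innermost variable and the index the
  next one.\<close>

lemma fn_crec:
  assumes b: "fn b" and g: "fn g" and n: "fn n" and h: "fn (\<lambda>e. h (popv (popv e)) (topv (popv e)) (topv e))"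
  shows "fn (\<lambda>e. crec (b e) (g e) (h e) (n e))"
proof (rule fnI)
  fix vs as :: "nat list" and w u
  assume A: "\<forall>i\<in>set vs. i < w" "\<forall>j\<in>set as. j < u" "1 \<le> w" "2 \<le> u"
  obtain c1 d1 where c1: "computes vs as w u n c1 d1" using fnE[OF n A] .
  have A1: "\<forall>i\<in>set vs. i < w + 1" "1 \<le> w + 1" "\<forall>i\<in>set vs. i < w + 4" "1 \<le> w + 4"
    "\<forall>i\<in>set ((w + 2) # (w + 3) # vs). i < w + 4" using A by auto
  obtain c2 d2 where c2: "computes vs as (w + 1) u b c2 d2" using fnE[OF b A1(1) A(2) A1(2) A(4)] .
  obtain c3 d3 where c3: "computes vs as (w + 4) u g c3 d3" using fnE[OF g A1(3) A(2) A1(4) A(4)] .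
  obtain c4 d4 where c4: "computes ((w + 2) # (w + 3) # vs) as (w + 4) u (\<lambda>e. h (popv (popv e)) (topv (popv e)) (topv e)) c4 d4"
    using fnE[OF h A1(5) A(2) A1(4) A(4)] .
  define M1 where "M1 = (\<lambda>M :: nat. M + M ^ d1)"
  define M2 where "M2 = (\<lambda>M :: nat. M1 M + M1 M ^ d2)"
  let ?mc = "MinCopy (w + 2) (w + 1) (w + 4)"
  define B where "B = (\<lambda>M :: nat. M2 M ^ d4 + (2 * M2 M + 3))"
  define T where "T = (\<lambda>M :: nat. M ^ d1 + (M1 M ^ d2 + (1 + (1 + (M2 M ^ d3 + (2 * M2 M + 3 + (M2 M * (B M + 2) + 2 + (2 * M2 M + 2))))))))"
  let ?loop = "For (w + 3) w (Seq c4 ?mc)"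
  show "\<exists>c d. computes vs as w u (\<lambda>e. crec (b e) (g e) (h e) (n e)) c d"
  proof (rule computes_pb[where T = T])
    show "pb T" unfolding T_def B_def M2_def M1_def by (intro pb_intros)
    fix x :: 'x and v a M
    assume gd: "good x v a M" and vM: "\<And>i. i < w \<Longrightarrow> v i \<le> M" and au: "\<And>j p. u \<le> j \<Longrightarrow> \<not> a j p"
    let ?e = "(x, map a as, map v vs)"
    let ?rec = "crec (b ?e) (g ?e) (h ?e)"
    obtain v1 where v1: "n ?e \<le> M ^ d1" "exb c1 (v, a) (M ^ d1) (v1, a)" "v1 w = n ?e" "agree w v v1"
      using computesD[OF c1 gd vM au] by blast
    have gd1: "good x v1 a (M1 M)" by (rule good_agree[OF gd v1(4) A(3)]) (simp add: M1_def)
    have vM1: "v1 i \<le> M1 M" if "i < w + 1" for i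
    proof (cases "i = w")
      case False
      then have "v1 i \<le> M" using v1(4) vM that unfolding agree_def by simp
      then show ?thesis by (simp add: M1_def)
    qed (use v1 in \<open>simp add: M1_def\<close>)
    obtain v2 where v2: "b ?e \<le> M1 M ^ d2" "exb c2 (v1, a) (M1 M ^ d2) (v2, a)" "v2 (w + 1) = b ?e" "agree (w + 1) v1 v2"
      using computesD[OF c2 gd1 vM1 au] unfolding agree_map[OF v1(4) A(1)] by blast
    have ag2: "agree w v v2" using agree_trans[OF v1(4) v2(4)] by simp
    have w2: "v2 w = n ?e" using v2(4) v1(3) by (simp add: agree_def)
    have nb: "n ?e \<le> M2 M" "b ?e \<le> M2 M" using v1(1) v2(1) by (simp_all add: M2_def M1_def)
    define v3 where "v3 = v2(w + 2 := 0, w + 3 := 0)"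
    have e3: "exb (Clr (w + 2)) (v2, a) 1 (v2(w + 2 := 0), a)" "exb (Clr (w + 3)) (v2(w + 2 := 0), a) 1 (v3, a)"
      using exb_Clr unfolding v3_def by blast+
    have low: "v' i \<le> M2 M" if h: "agree w v v'" "v' w = n ?e" "v' (w + 1) = b ?e" "v' (w + 2) \<le> M2 M" "v' (w + 3) \<le> M2 M" "i < w + 4" for v' i
    proof -
      consider "i < w" | "i = w" | "i = w + 1" | "i = w + 2" | "i = w + 3" using h(6) by linarith
      then show ?thesis
      proof cases
        case 1
        then have "v' i \<le> M" using h(1) vM unfolding agree_def by simp
        then show ?thesis by (simp add: M2_def M1_def)
      qed (use h nb in auto)
    qed
    have gdl: "good x v' a (M2 M)" if "agree w v v'" for v'
      by (rule good_agree[OF gd that A(3)]) (simp add: M2_def M1_def)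
    have ag3: "agree w v v3" using ag2 by (simp add: v3_def agree_def)
    have v3: "v3 w = n ?e" "v3 (w + 1) = b ?e" "v3 (w + 2) \<le> M2 M" "v3 (w + 3) \<le> M2 M" using w2 v2(3) by (simp_all add: v3_def)
    obtain v4 where v4: "exb c3 (v3, a) (M2 M ^ d3) (v4, a)" "v4 (w + 4) = g ?e" "agree (w + 4) v3 v4"
      using computesD[OF c3 gdl[OF ag3] low[OF ag3 v3] au] unfolding agree_map[OF ag3 A(1)] by blast
    define v5 where "v5 = v4(w + 2 := ?rec 0)"
    have b4: "v4 (w + 1) = b ?e" using v4(3) v3 by (simp add: agree_def)
    have "exb ?mc (v4, a) (2 * v4 (w + 1) + 3) (v5, a)"
      using exb_MinCopy[of "w + 2" "w + 1" "w + 4" v4 a] v4(2) b4 by (simp add: v5_def)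
    then have e5: "exb ?mc (v4, a) (2 * M2 M + 3) (v5, a)" by (rule exb_mono) (use b4 nb in simp)
    define P where "P = (\<lambda>k (s :: st). fst s w = n ?e \<and> fst s (w + 1) = b ?e \<and> fst s (w + 2) = ?rec k \<and> fst s (w + 3) = k
      \<and> agree w v (fst s) \<and> snd s = a)"
    have "\<exists>s'. exb ?loop (v5, a) (n ?e * (B M + 2) + 2) s' \<and> P (n ?e) s'"
    proof (rule For_loop[where P = P])
      have "agree w v v4" using agree_trans[OF ag3 v4(3)] by simp
      then show "P 0 (v5(w + 3 := 0), a)" using v4(3) v3 b4 unfolding P_def v5_def by (simp add: agree_def)
    next
      fix k va aa assume k: "k < n ?e" and "P k (va, aa)"
      then have p: "va w = n ?e" "va (w + 1) = b ?e" "va (w + 2) = ?rec k" "va (w + 3) = k" "agree w v va" "aa = a" by (auto simp: P_def)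
      have r: "va (w + 2) \<le> M2 M" "va (w + 3) \<le> M2 M" using p crec_le[of "b ?e" "g ?e" "h ?e" k] nb k by simp_all
      obtain vb where vb: "exb c4 (va, a) (M2 M ^ d4) (vb, a)" "vb (w + 4) = h ?e k (?rec k)" "agree (w + 4) va vb"
        using computesD[OF c4 gdl[OF p(5)] low[OF p(5,1,2) r] au] p agree_map[OF p(5) A(1)] by auto
      have bb: "vb (w + 1) = b ?e" using vb(3) p by (simp add: agree_def)
      have "exb ?mc (vb, a) (2 * vb (w + 1) + 3) (vb(w + 2 := ?rec (Suc k)), a)"
        using exb_MinCopy[of "w + 2" "w + 1" "w + 4" vb a] vb(2) bb by simp
      then have "exb ?mc (vb, a) (2 * M2 M + 3) (vb(w + 2 := ?rec (Suc k)), a)" by (rule exb_mono) (use bb nb in simp)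
      then have "exb (Seq c4 ?mc) (va, aa) (B M) (vb(w + 2 := ?rec (Suc k)), a)"
        unfolding B_def p(6) by (rule exb_Seq[OF vb(1)])
      moreover have "agree w v vb" using agree_trans[OF p(5) vb(3)] by simp
      ultimately show "\<exists>v' a'. exb (Seq c4 ?mc) (va, aa) (B M) (v', a') \<and> v' (w + 3) = k \<and> P (Suc k) (v'(w + 3 := Suc k), a')"
        using vb(3) p unfolding P_def
        by (intro exI[of _ "vb(w + 2 := ?rec (Suc k))"] exI[of _ a]) (auto simp: agree_def)
    qed (auto simp: P_def)
    then obtain v6 where v6: "exb ?loop (v5, a) (n ?e * (B M + 2) + 2) (v6, a)" "v6 (w + 2) = ?rec (n ?e)" "agree w v v6"
      unfolding P_def by fastforce
    have e6: "exb ?loop (v5, a) (M2 M * (B M + 2) + 2) (v6, a)" by (rule exb_mono[OF v6(1)]) (intro add_le_mono mult_le_mono1 le_refl nb)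
    have rb: "?rec (n ?e) \<le> M2 M" using crec_le[of "b ?e" "g ?e" "h ?e" "n ?e"] nb by simp
    have e7: "exb (Copy w (w + 2)) (v6, a) (2 * M2 M + 2) (v6(w := ?rec (n ?e)), a)"
      using exb_mono[OF exb_Copy[of w "w + 2" v6 a], of "2 * M2 M + 2"] v6(2) rb by simp
    have "exb (Seq c1 (Seq c2 (Seq (Clr (w + 2)) (Seq (Clr (w + 3)) (Seq c3 (Seq ?mc (Seq ?loop (Copy w (w + 2)))))))))
       (v, a) (T M) (v6(w := ?rec (n ?e)), a)"
      unfolding T_def
      by (rule exb_Seq[OF v1(2) exb_Seq[OF v2(2) exb_Seq[OF e3(1) exb_Seq[OF e3(2) exb_Seq[OF v4(1) exb_Seq[OF e5 exb_Seq[OF e6 e7]]]]]]])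
    moreover have "?rec (n ?e) \<le> T M" using rb unfolding T_def by simp
    ultimately show "?rec (n ?e) \<le> T M \<and>
       (\<exists>v'. exb (Seq c1 (Seq c2 (Seq (Clr (w + 2)) (Seq (Clr (w + 3)) (Seq c3 (Seq ?mc (Seq ?loop (Copy w (w + 2)))))))))
       (v, a) (T M) (v', a) \<and> v' w = ?rec (n ?e) \<and> agree w v v')"
      using agree_upd[OF v6(3), of w] by (intro conjI exI) (assumption, assumption, auto)
  qed
qed

text \<open>A scratch array is swept \<open>b\<close> times, and a bit is set as soon as
  \<open>\<Phi>\<close> derives it from the current contents. Updating in place keeps the array
  between the stage reached so far and the fixed point; after \<open>b\<close> sweeps the two
  coincide.\<close>

lemma fn_lfpb:
  assumes b: "fn b" and g: "fn g" and \<Phi>: "fn (\<lambda>e. of_bool (\<Phi> (popa (popv e)) (topa e) (topv e)))"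
    and mono: "\<And>e X Y k. (\<And>p. X p \<Longrightarrow> Y p) \<Longrightarrow> \<Phi> e X k \<Longrightarrow> \<Phi> e Y k"
  shows "fn (\<lambda>e. of_bool (lfpb (b e) (\<Phi> e) (g e)))"
proof (rule fnI)
  fix vs as :: "nat list" and w u
  assume A: "\<forall>i\<in>set vs. i < w" "\<forall>j\<in>set as. j < u" "1 \<le> w" "2 \<le> u"
  obtain c1 d1 where c1: "computes vs as w u b c1 d1" using fnE[OF b A] .
  have A1: "\<forall>i\<in>set vs. i < w + 1" "1 \<le> w + 1" "\<forall>i\<in>set ((w + 3) # vs). i < w + 4" "1 \<le> w + 4"
    "\<forall>j\<in>set (u # as). j < u + 1" "2 \<le> u + 1" using A by auto
  obtain c2 d2 where c2: "computes vs as (w + 1) u g c2 d2" using fnE[OF g A1(1) A(2) A1(2) A(4)] .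
  obtain c3 d3 where c3: "computes ((w + 3) # vs) (u # as) (w + 4) (u + 1) (\<lambda>e. of_bool (\<Phi> (popa (popv e)) (topa e) (topv e))) c3 d3"
    using fnE[OF \<Phi> A1(3) A1(5) A1(4) A1(6)] .
  define M1 where "M1 = (\<lambda>M :: nat. M + M ^ d1)"
  define M2 where "M2 = (\<lambda>M :: nat. M1 M + M1 M ^ d2)"
  let ?set = "Seq (Clr (w + 5)) (If (Lt (w + 5) (w + 4)) (Put u (w + 3) True) (Clr (w + 5)))"
  let ?body = "Seq c3 ?set"
  let ?sweep = "For (w + 3) w ?body"
  let ?loop = "For (w + 2) w ?sweep"
  let ?query = "If (Lt (w + 1) w) (Bit (w + 4) (Ar u (w + 1))) (Clr (w + 4))"
  let ?clean = "For (w + 3) w (Put u (w + 3) False)"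
  define B where "B = (\<lambda>M :: nat. M2 M ^ d3 + 3)"
  define C where "C = (\<lambda>M :: nat. M2 M * (B M + 2) + 2)"
  define T where "T = (\<lambda>M :: nat. M ^ d1 + (M1 M ^ d2 + (M2 M * (C M + 2) + 2 + (4 + (M2 M * 3 + 2 + 4)))))"
  show "\<exists>c d. computes vs as w u (\<lambda>e. of_bool (lfpb (b e) (\<Phi> e) (g e))) c d"
  proof (rule computes_pb[where T = T])
    show "pb T" unfolding T_def C_def B_def M2_def M1_def by (intro pb_intros)
    fix x :: 'x and v a M
    assume gd: "good x v a M" and vM: "\<And>i. i < w \<Longrightarrow> v i \<le> M" and au: "\<And>j p. u \<le> j \<Longrightarrow> \<not> a j p"
    let ?e = "(x, map a as, map v vs)"
    let ?b = "b ?e" and ?g = "g ?e"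
    let ?L = "lfpb ?b (\<Phi> ?e)"
    obtain v1 where v1: "?b \<le> M ^ d1" "exb c1 (v, a) (M ^ d1) (v1, a)" "v1 w = ?b" "agree w v v1"
      using computesD[OF c1 gd vM au] by blast
    have gd1: "good x v1 a (M1 M)" by (rule good_agree[OF gd v1(4) A(3)]) (simp add: M1_def)
    have vM1: "v1 i \<le> M1 M" if "i < w + 1" for i
    proof (cases "i = w")
      case False
      then have "v1 i \<le> M" using v1(4) vM that unfolding agree_def by simp
      then show ?thesis by (simp add: M1_def)
    qed (use v1 in \<open>simp add: M1_def\<close>)
    obtain v2 where v2: "?g \<le> M1 M ^ d2" "exb c2 (v1, a) (M1 M ^ d2) (v2, a)" "v2 (w + 1) = ?g" "agree (w + 1) v1 v2"
      using computesD[OF c2 gd1 vM1 au] unfolding agree_map[OF v1(4) A(1)] by blast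
    have ag2: "agree w v v2" using agree_trans[OF v1(4) v2(4)] by simp
    have w2: "v2 w = ?b" using v2(4) v1(3) by (simp add: agree_def)
    have nb: "?b \<le> M2 M" "?g \<le> M2 M" using v1(1) v2(1) by (simp_all add: M2_def M1_def)
    have low: "v' i \<le> M2 M" if h: "agree w v v'" "v' w = ?b" "v' (w + 1) = ?g" "v' (w + 2) \<le> M2 M" "v' (w + 3) \<le> M2 M" "i < w + 4" for v' i
    proof -
      consider "i < w" | "i = w" | "i = w + 1" | "i = w + 2" | "i = w + 3" using h(6) by linarith
      then show ?thesis
      proof cases
        case 1
        then have "v' i \<le> M" using h(1) vM unfolding agree_def by simp
        then show ?thesis by (simp add: M2_def M1_def)
      qed (use h nb in auto)
    qed
    have gdl: "good x v' (a(u := X)) (M2 M)" if "agree w v v'" for v' X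
      using gd that A(3,4) unfolding good_def agree_def by (auto simp: M2_def M1_def)
    have lcl: "\<Phi> ?e X i \<Longrightarrow> i < ?b \<Longrightarrow> (\<And>p. X p \<Longrightarrow> ?L p) \<Longrightarrow> ?L i" for X i
      using lfpb_closed[of "\<Phi> ?e" ?b i] mono by blast
    define P where "P = (\<lambda>j (s :: st). fst s w = ?b \<and> fst s (w + 1) = ?g \<and> fst s (w + 2) = j \<and> agree w v (fst s) \<and>
      (\<exists>X. snd s = a(u := X) \<and> (\<forall>p. X p \<longrightarrow> ?L p) \<and> (\<forall>p. stages ?b (\<Phi> ?e) j p \<longrightarrow> X p)))"
    have "\<exists>s'. exb ?loop (v2, a) (?b * (C M + 2) + 2) s' \<and> P ?b s'"
    proof (rule For_loop[where P = P])
      have "a = a(u := (\<lambda>_. False))" using au by (auto simp: fun_eq_iff)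
      then show "P 0 (v2(w + 2 := 0), a)" unfolding P_def using w2 v2(3) ag2
        by (auto simp: agree_def intro!: exI[of _ "\<lambda>_. False"])
    next
      fix j va aa assume j: "j < ?b" and "P j (va, aa)"
      then obtain X0 where p: "va w = ?b" "va (w + 1) = ?g" "va (w + 2) = j" "agree w v va" "aa = a(u := X0)"
        "\<And>p. X0 p \<Longrightarrow> ?L p" "\<And>p. stages ?b (\<Phi> ?e) j p \<Longrightarrow> X0 p" unfolding P_def by auto
      define R where "R = (\<lambda>i (s :: st). fst s w = ?b \<and> fst s (w + 1) = ?g \<and> fst s (w + 2) = j \<and> fst s (w + 3) = i \<and> agree w v (fst s) \<and>
        (\<exists>X. snd s = a(u := X) \<and> (\<forall>p. X p \<longrightarrow> ?L p) \<and> (\<forall>p. X0 p \<longrightarrow> X p) \<and> (\<forall>p<i. \<Phi> ?e X0 p \<longrightarrow> X p)))"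
      have "\<exists>s'. exb ?sweep (va, aa) (?b * (B M + 2) + 2) s' \<and> R ?b s'"
      proof (rule For_loop[where P = R])
        show "R 0 (va(w + 3 := 0), aa)" unfolding R_def using p by (auto simp: agree_def)
      next
        fix i vb ab assume i: "i < ?b" and "R i (vb, ab)"
        then obtain X where q: "vb w = ?b" "vb (w + 1) = ?g" "vb (w + 2) = j" "vb (w + 3) = i" "agree w v vb" "ab = a(u := X)"
          "\<And>p. X p \<Longrightarrow> ?L p" "\<And>p. X0 p \<Longrightarrow> X p" "\<And>p. p < i \<Longrightarrow> \<Phi> ?e X0 p \<Longrightarrow> X p" unfolding R_def by auto
        have r: "vb (w + 2) \<le> M2 M" "vb (w + 3) \<le> M2 M" using q nb i j by simp_all
        have am: "map ab as = map a as" using A(2) q(6) by auto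
        have au': "\<not> ab j p" if "u + 1 \<le> j" for j p using that au q(6) by simp
        have pop: "popa (popv (x, map ab (u # as), map vb ((w + 3) # vs))) = ?e"
          "topa (x, map ab (u # as), map vb ((w + 3) # vs)) = X" "topv (x, map ab (u # as), map vb ((w + 3) # vs)) = i"
          using am agree_map[OF q(5) A(1)] q by simp_all
        obtain vc where vc: "exb c3 (vb, ab) (M2 M ^ d3) (vc, ab)" "vc (w + 4) = of_bool (\<Phi> ?e X i)" "agree (w + 4) vb vc"
          using computesD[OF c3 gdl[OF q(5), of X, folded q(6)] low[OF q(5,1,2) r] au'] unfolding pop by blast
        define X' where "X' = (if \<Phi> ?e X i then X(i := True) else X)"
        have v3: "vc (w + 3) = i" using vc(3) q(4) by (simp add: agree_def)
        have "exb (if cnd (Lt (w + 5) (w + 4)) (vc(w + 5 := 0), ab) then Put u (w + 3) True else Clr (w + 5)) (vc(w + 5 := 0), ab) 1 (vc(w + 5 := 0), a(u := X'))"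
          using exb_Put[of u "w + 3" True "vc(w + 5 := 0)" ab] exb_Clr[of "w + 5" "vc(w + 5 := 0)" ab] vc(2) v3 q(6)
          by (auto simp: X'_def)
        then have "exb (If (Lt (w + 5) (w + 4)) (Put u (w + 3) True) (Clr (w + 5))) (vc(w + 5 := 0), ab) 2 (vc(w + 5 := 0), a(u := X'))"
          using exb_If by (metis numeral_2_eq_2 One_nat_def)
        from exb_Seq[OF vc(1) exb_Seq[OF exb_Clr this]]
        have "exb ?body (vb, ab) (B M) (vc(w + 5 := 0), a(u := X'))" unfolding B_def by (rule exb_mono) simp
        moreover have "agree w v vc" using agree_trans[OF q(5) vc(3)] by simp
        moreover have "\<forall>p. X' p \<longrightarrow> ?L p" unfolding X'_def using q(7) lcl[OF _ i, of X] by auto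
        moreover have "\<forall>p. X0 p \<longrightarrow> X' p" unfolding X'_def using q(8) by auto
        \<comment> \<open>The array may have grown since the sweep began; by monotonicity the test
          still finds everything derivable from the contents at the start.\<close>
        moreover have "\<Phi> ?e X0 i \<longrightarrow> \<Phi> ?e X i" using mono[of X0 X ?e i] q(8) by blast
        then have "\<forall>p<Suc i. \<Phi> ?e X0 p \<longrightarrow> X' p" unfolding X'_def using q(9) by (auto simp: less_Suc_eq)
        ultimately show "\<exists>v' a'. exb ?body (vb, ab) (B M) (v', a') \<and> v' (w + 3) = i \<and> R (Suc i) (v'(w + 3 := Suc i), a')"
          using vc(3) q unfolding R_def
          by (intro exI[of _ "vc(w + 5 := 0)"] exI[of _ "a(u := X')"]) (auto simp: agree_def)
      qed (auto simp: R_def)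
      then obtain vb ab where s: "exb ?sweep (va, aa) (?b * (B M + 2) + 2) (vb, ab)" "R ?b (vb, ab)" by (metis surj_pair)
      have "exb ?sweep (va, aa) (C M) (vb, ab)" unfolding C_def by (rule exb_mono[OF s(1)]) (intro add_le_mono mult_le_mono1 le_refl nb)
      moreover have "P (Suc j) (vb(w + 2 := Suc j), ab)"
      proof -
        obtain X where X: "ab = a(u := X)" "\<forall>p. X p \<longrightarrow> ?L p" "\<forall>p<?b. \<Phi> ?e X0 p \<longrightarrow> X p" using s(2) unfolding R_def by auto
        have "\<forall>p. stages ?b (\<Phi> ?e) (Suc j) p \<longrightarrow> X p"
          using X(3) mono[of "stages ?b (\<Phi> ?e) j" X0 ?e] p(7) by auto
        then show ?thesis using s(2) X unfolding P_def R_def by (auto simp: agree_def)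
      qed
      moreover have "vb (w + 2) = j" using s(2) by (simp add: R_def)
      ultimately show "\<exists>v' a'. exb ?sweep (va, aa) (C M) (v', a') \<and> v' (w + 2) = j \<and> P (Suc j) (v'(w + 2 := Suc j), a')" by blast
    qed (auto simp: P_def)
    then obtain v3 a3 where s3: "exb ?loop (v2, a) (?b * (C M + 2) + 2) (v3, a3)" "P ?b (v3, a3)" by (metis surj_pair)
    then obtain X where X: "a3 = a(u := X)" "\<forall>p. X p \<longrightarrow> ?L p" "\<forall>p. stages ?b (\<Phi> ?e) ?b p \<longrightarrow> X p" unfolding P_def by auto
    have XL: "X = ?L" using X(2,3) lfpb_stages[of "\<Phi> ?e" ?b] mono by blast
    have v3: "v3 w = ?b" "v3 (w + 1) = ?g" "agree w v v3" using s3(2) by (auto simp: P_def)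
    have e3: "exb ?loop (v2, a) (M2 M * (C M + 2) + 2) (v3, a3)" by (rule exb_mono[OF s3(1)]) (intro add_le_mono mult_le_mono1 le_refl nb)
    have "exb (if cnd (Lt (w + 1) w) (v3, a3) then Bit (w + 4) (Ar u (w + 1)) else Clr (w + 4)) (v3, a3) 3 (v3(w + 4 := of_bool (?L ?g)), a3)"
    proof (cases "?g < ?b")
      case True
      then show ?thesis using exb_Bit[of "w + 4" "Ar u (w + 1)" v3 a3] v3(1,2) X(1) XL by simp
    next
      case False
      then have "\<not> ?L ?g" unfolding lfpb_def by simp
      then show ?thesis using exb_mono[OF exb_Clr[of "w + 4" v3 a3], of 3] v3(1,2) False by simp
    qed
    then have e4: "exb ?query (v3, a3) 4 (v3(w + 4 := of_bool (?L ?g)), a3)"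
      by (rule exb_mono[OF exb_If]) simp
    define v4 where "v4 = v3(w + 4 := of_bool (?L ?g))"
    define R where "R = (\<lambda>i (s :: st). fst s w = ?b \<and> fst s (w + 4) = of_bool (?L ?g) \<and> fst s (w + 3) = i \<and> agree w v (fst s) \<and>
        snd s = a(u := (\<lambda>p. i \<le> p \<and> X p)))"
    \<comment> \<open>\<open>computes\<close> promises unchanged arrays, so the scratch array is
      emptied again.\<close>
    have "\<exists>s'. exb ?clean (v4, a3) (?b * (1 + 2) + 2) s' \<and> R ?b s'"
    proof (rule For_loop[where P = R])
      show "R 0 (v4(w + 3 := 0), a3)" unfolding R_def v4_def using v3 X by (auto simp: agree_def)
    next
      fix i vb ab assume "R i (vb, ab)"
      then have q: "vb w = ?b" "vb (w + 4) = of_bool (?L ?g)" "vb (w + 3) = i" "agree w v vb" "ab = a(u := (\<lambda>p. i \<le> p \<and> X p))" unfolding R_def by auto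
      have "ab(u := (ab u)(vb (w + 3) := False)) = a(u := (\<lambda>p. Suc i \<le> p \<and> X p))" using q(3,5) by (auto simp: fun_eq_iff)
      then show "\<exists>v' a'. exb (Put u (w + 3) False) (vb, ab) 1 (v', a') \<and> v' (w + 3) = i \<and> R (Suc i) (v'(w + 3 := Suc i), a')"
        using exb_Put[of u "w + 3" False vb ab] q unfolding R_def
        by (intro exI[of _ vb] exI[of _ "a(u := (\<lambda>p. Suc i \<le> p \<and> X p))"]) (auto simp: agree_def)
    qed (auto simp: R_def)
    then obtain v5 a5 where s5: "exb ?clean (v4, a3) (?b * (1 + 2) + 2) (v5, a5)" "R ?b (v5, a5)" by (metis surj_pair)
    have "a5 = a(u := (\<lambda>p. ?b \<le> p \<and> X p))" using s5(2) unfolding R_def by simp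
    also have "\<dots> = a" using XL au by (auto simp: fun_eq_iff lfpb_def)
    finally have a5: "a5 = a" .
    have e5: "exb ?clean (v4, a3) (M2 M * 3 + 2) (v5, a)" by (rule exb_mono[OF s5(1)[unfolded a5]]) (use nb in simp)
    have v5: "v5 (w + 4) = of_bool (?L ?g)" "agree w v v5" using s5(2) by (auto simp: R_def)
    have e6: "exb (Copy w (w + 4)) (v5, a) 4 (v5(w := of_bool (?L ?g)), a)"
      using exb_mono[OF exb_Copy[of w "w + 4" v5 a], of 4] v5(1) by simp
    have "exb (Seq c1 (Seq c2 (Seq ?loop (Seq ?query (Seq ?clean (Copy w (w + 4))))))) (v, a) (T M) (v5(w := of_bool (?L ?g)), a)"
      unfolding T_def
      by (rule exb_Seq[OF v1(2) exb_Seq[OF v2(2) exb_Seq[OF e3 exb_Seq[OF e4[folded v4_def] exb_Seq[OF e5 e6]]]]])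
    moreover have "of_bool (?L ?g) \<le> T M" unfolding T_def by (simp add: of_bool_def)
    ultimately show "of_bool (?L ?g) \<le> T M \<and>
       (\<exists>v'. exb (Seq c1 (Seq c2 (Seq ?loop (Seq ?query (Seq ?clean (Copy w (w + 4))))))) (v, a) (T M) (v', a) \<and> v' w = of_bool (?L ?g) \<and> agree w v v')"
      using agree_upd[OF v5(2), of w] by (intro conjI exI) (assumption, assumption, auto)
  qed
qed

end

lemma crec_eq:
  assumes "\<And>i. i \<le> n \<Longrightarrow> R i \<le> b" "R 0 = g" "\<And>i. i < n \<Longrightarrow> R (Suc i) = h i (R i)"
  shows "crec b g h n = R n"
proof -
  have "i \<le> n \<Longrightarrow> crec b g h i = R i" for i
  proof (induction i)
    case 0
    show ?case using assms(1)[of 0] assms(2) by (simp add: min_def)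
  next
    case (Suc i)
    then show ?case using assms(1)[of "Suc i"] assms(3)[of i] by (simp add: min_def)
  qed
  then show ?thesis by simp
qed

text \<open>The value keeps pace with the index until \<open>P\<close> holds for the first time and
  stays there afterwards.\<close>

definition bmin :: "nat \<Rightarrow> (nat \<Rightarrow> bool) \<Rightarrow> nat" where
  "bmin b P = crec b 0 (\<lambda>i r. r + of_bool (r = i \<and> \<not> P i)) b"

lemma bmin_eq:
  assumes "z < b" "P z" "\<And>y. P y \<Longrightarrow> z \<le> y"
  shows "bmin b P = z"
proof -
  have "crec b 0 (\<lambda>i r. r + of_bool (r = i \<and> \<not> P i)) b = min b z"
  proof (rule crec_eq[where R = "\<lambda>i. min i z"])
    fix i
    have "min i z = i \<and> \<not> P i \<longleftrightarrow> i < z" using assms(2) assms(3)[of i] by (cases "i = z") auto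
    then show "min (Suc i) z = min i z + of_bool (min i z = i \<and> \<not> P i)" by (simp add: min_def)
  qed (use assms(1) in auto)
  then show ?thesis unfolding bmin_def using assms(1) by simp
qed

definition dig :: "nat \<Rightarrow> nat \<Rightarrow> nat \<Rightarrow> nat" where
  "dig K c k = (c div K ^ k) mod K"

lemma ex_dig:
  assumes "\<And>k. k < n \<Longrightarrow> f k < K"
  shows "\<exists>c<K ^ n. \<forall>k<n. dig K c k = f k"
  using assms
proof (induction n arbitrary: f)
  case (Suc n)
  obtain c where c: "c < K ^ n" "\<And>k. k < n \<Longrightarrow> dig K c k = f (Suc k)"
    using Suc.IH[of "\<lambda>k. f (Suc k)"] Suc.prems by auto
  have f0: "f 0 < K" using Suc.prems by simp
  then have d: "(f 0 + K * c) div K ^ Suc k = c div K ^ k" for k by (simp add: div_mult2_eq)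
  have "f 0 + K * c < K * (c + 1)" using f0 by simp
  also have "\<dots> \<le> K * K ^ n" using c(1) by (intro mult_le_mono2) simp
  finally have "f 0 + K * c < K ^ Suc n" by simp
  moreover have "dig K (f 0 + K * c) k = f k" if "k < Suc n" for k
  proof (cases k)
    case 0
    then show ?thesis using f0 by (simp add: dig_def)
  next
    case (Suc j)
    then show ?thesis using c(2)[of j] that unfolding dig_def by (simp only: d)
  qed
  ultimately show ?case by blast
qed simp

section \<open>Logic, bounded search and arithmetic within the class\<close>

context coding
begin

abbreviation "fnb P \<equiv> fn (\<lambda>e. of_bool (P e))"

lemma fnb_not: "fnb P \<Longrightarrow> fnb (\<lambda>e. \<not> P e)"
proof -
  assume "fnb P"
  moreover have "of_bool (of_bool b < (1 :: nat)) = (of_bool (\<not> b) :: nat)" for b by simp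
  ultimately show ?thesis using fn_less[of "\<lambda>e. of_bool (P e)" "\<lambda>e. 1"] fn_const[of 1] by simp
qed

lemma fnb_conj: "fnb P \<Longrightarrow> fnb P' \<Longrightarrow> fnb (\<lambda>e. P e \<and> P' e)"
  using fn_times[of "\<lambda>e. of_bool (P e)" "\<lambda>e. of_bool (P' e)"] by (simp only: of_bool_conj)

lemma fnb_disj: "fnb P \<Longrightarrow> fnb P' \<Longrightarrow> fnb (\<lambda>e. P e \<or> P' e)"
  using fnb_not[OF fnb_conj[OF fnb_not fnb_not], of P P'] by simp

lemma fnb_imp: "fnb P \<Longrightarrow> fnb P' \<Longrightarrow> fnb (\<lambda>e. P e \<longrightarrow> P' e)"
  using fnb_disj[OF fnb_not, of P P'] by (simp only: imp_conv_disj)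

lemma fnb_le: "fn f \<Longrightarrow> fn g \<Longrightarrow> fnb (\<lambda>e. f e \<le> g e)"
  using fnb_not[OF fn_less, of g f] by (simp only: not_less)

lemma fnb_eq: "fn f \<Longrightarrow> fn g \<Longrightarrow> fnb (\<lambda>e. f e = g e)"
  using fnb_conj[OF fnb_le fnb_le, of f g g f] by (simp only: eq_iff[symmetric])

lemma fn_if: "fnb P \<Longrightarrow> fn f \<Longrightarrow> fn g \<Longrightarrow> fn (\<lambda>e. if P e then f e else g e)"
proof -
  assume P: "fnb P" and f: "fn f" and g: "fn g"
  have eq: "(\<lambda>e. if P e then f e else g e) = (\<lambda>e. of_bool (P e) * f e + of_bool (\<not> P e) * g e)" by (intro ext) simp
  show ?thesis unfolding eq by (intro fn_plus fn_times P f g fnb_not)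
qed

lemma fnb_ex: "fn b \<Longrightarrow> fnb (\<lambda>e. P (popv e) (topv e)) \<Longrightarrow> fnb (\<lambda>e. \<exists>z<b e. P e z)"
proof -
  assume b: "fn b" and P: "fnb (\<lambda>e. P (popv e) (topv e))"
  have eq: "crec 1 0 (\<lambda>i r. r + of_bool (P e i)) n = of_bool (\<exists>z<n. P e z)" for e n
  proof (induction n)
    case (Suc n)
    then show ?case by (auto simp: less_Suc_eq)
  qed simp
  have "fn (\<lambda>e. crec 1 0 (\<lambda>i r. r + of_bool (P e i)) (b e))"
    by (rule fn_crec[OF fn_const fn_const b], rule fn_plus[OF fn_topv], rule fn_popv[OF P])
  then show ?thesis unfolding eq .
qed

lemma fnb_all: "fn b \<Longrightarrow> fnb (\<lambda>e. P (popv e) (topv e)) \<Longrightarrow> fnb (\<lambda>e. \<forall>z<b e. P e z)"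
  using fnb_not[OF fnb_ex[OF _ fnb_not], of b P] by simp

lemma fn_bmin: "fn b \<Longrightarrow> fnb (\<lambda>e. P (popv e) (topv e)) \<Longrightarrow> fn (\<lambda>e. bmin (b e) (P e))"
proof -
  assume b: "fn b" and P: "fnb (\<lambda>e. P (popv e) (topv e))"
  show ?thesis unfolding bmin_def
    by (rule fn_crec[OF b fn_const b], rule fn_plus[OF fn_topv], rule fnb_conj[OF fnb_eq[OF fn_topv fn_popv[OF fn_topv]] fnb_not[OF fn_popv[OF P]]])
qed

text \<open>Subtraction, division and the decoding of pairs are bounded searches for a number with
  the defining property.\<close>

lemma fn_minus: "fn f \<Longrightarrow> fn g \<Longrightarrow> fn (\<lambda>e. f e - g e)"
proof -
  assume f: "fn f" and g: "fn g"
  have eq: "bmin (a + 1) (\<lambda>z. a \<le> b + z) = a - b" for a b :: nat by (rule bmin_eq) auto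
  have "fn (\<lambda>e. bmin (f e + 1) (\<lambda>z. f e \<le> g e + z))"
    by (intro fn_bmin fn_plus f fn_const fnb_le fn_topv; rule fn_popv; intro f g)
  then show ?thesis unfolding eq .
qed

lemma fn_div: "fn f \<Longrightarrow> fn g \<Longrightarrow> fn (\<lambda>e. f e div g e)"
proof -
  assume f: "fn f" and g: "fn g"
  have eq: "(if b = 0 then 0 else bmin (a + 1) (\<lambda>z. a < (z + 1) * b)) = a div b" for a b :: nat
  proof (cases "b = 0")
    case False
    then have b: "0 < b" by simp
    have lt: "a < (z + 1) * b \<longleftrightarrow> a div b \<le> z" for z
      using div_less_iff_less_mult[OF b, of a "z + 1"] by (metis less_Suc_eq_le Suc_eq_plus1)
    have "bmin (a + 1) (\<lambda>z. a < (z + 1) * b) = a div b"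
      unfolding lt by (rule bmin_eq) (auto simp: less_Suc_eq_le)
    then show ?thesis using b by simp
  qed simp
  have "fn (\<lambda>e. if g e = 0 then 0 else bmin (f e + 1) (\<lambda>z. f e < (z + 1) * g e))"
    by (intro fn_if fnb_eq fn_bmin fn_plus fn_times f g fn_const fn_less fn_topv; rule fn_popv; intro f g)
  then show ?thesis unfolding eq .
qed

lemma fn_mod: "fn f \<Longrightarrow> fn g \<Longrightarrow> fn (\<lambda>e. f e mod g e)"
  using fn_minus[OF _ fn_times[OF fn_div], of f f g g] by (simp only: modulo_nat_def)

lemma fn_dig: "fn f \<Longrightarrow> fn g \<Longrightarrow> fn h \<Longrightarrow> fn (\<lambda>e. dig (f e) (g e) (h e))"
proof -
  assume f: "fn f" and g: "fn g" and h: "fn h"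
  have eq: "crec c c (\<lambda>i r. r div K) k mod K = dig K c k" for K c k :: nat
  proof -
    have "crec c c (\<lambda>i r. r div K) k = c div K ^ k"
      by (rule crec_eq[where R = "\<lambda>i. c div K ^ i"]) (auto simp: div_mult2_eq[symmetric] mult.commute)
    then show ?thesis by (simp add: dig_def)
  qed
  have "fn (\<lambda>e. crec (g e) (g e) (\<lambda>i r. r div f e) (h e) mod f e)"
    by (intro fn_mod fn_crec f g h fn_div fn_topv; (rule fn_popv)+; rule f)
  then show ?thesis unfolding eq .
qed

lemma fn_prod_encode: "fn f \<Longrightarrow> fn g \<Longrightarrow> fn (\<lambda>e. prod_encode (f e, g e))"
  unfolding prod_encode_def triangle_def split Suc_eq_plus1 by (intro fn_plus fn_div fn_times fn_const)

lemma fst_prod_decode: "bmin (c + 1) (\<lambda>a. \<exists>b<c + 1. prod_encode (a, b) = c) = fst (prod_decode c)"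
proof (rule bmin_eq)
  have e: "prod_encode (fst (prod_decode c), snd (prod_decode c)) = c" by simp
  show "fst (prod_decode c) < c + 1" using le_prod_encode_1[of "fst (prod_decode c)" "snd (prod_decode c)"] e by linarith
  have "snd (prod_decode c) < c + 1" using le_prod_encode_2[of "snd (prod_decode c)" "fst (prod_decode c)"] e by linarith
  then show "\<exists>b<c + 1. prod_encode (fst (prod_decode c), b) = c" using e by blast
qed auto

lemma snd_prod_decode: "bmin (c + 1) (\<lambda>b. \<exists>a<c + 1. prod_encode (a, b) = c) = snd (prod_decode c)"
proof (rule bmin_eq)
  have e: "prod_encode (fst (prod_decode c), snd (prod_decode c)) = c" by simp
  show "snd (prod_decode c) < c + 1" using le_prod_encode_2[of "snd (prod_decode c)" "fst (prod_decode c)"] e by linarith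
  have "fst (prod_decode c) < c + 1" using le_prod_encode_1[of "fst (prod_decode c)" "snd (prod_decode c)"] e by linarith
  then show "\<exists>b<c + 1. prod_encode (b, snd (prod_decode c)) = c" using e by blast
qed auto

lemma fn_fst_decode: "fn f \<Longrightarrow> fn (\<lambda>e. fst (prod_decode (f e)))"
proof -
  assume f: "fn f"
  have "fn (\<lambda>e. bmin (f e + 1) (\<lambda>a. \<exists>b<f e + 1. prod_encode (a, b) = f e))"
    by (intro fn_bmin fn_plus f fn_const fnb_ex fnb_eq fn_prod_encode fn_topv; (rule fn_popv)+; intro f fn_topv)
  then show ?thesis unfolding fst_prod_decode .
qed

lemma fn_snd_decode: "fn f \<Longrightarrow> fn (\<lambda>e. snd (prod_decode (f e)))"
proof -
  assume f: "fn f"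
  have "fn (\<lambda>e. bmin (f e + 1) (\<lambda>b. \<exists>a<f e + 1. prod_encode (a, b) = f e))"
    by (intro fn_bmin fn_plus f fn_const fnb_ex fnb_eq fn_prod_encode fn_topv; (rule fn_popv)+; intro f fn_topv)
  then show ?thesis unfolding snd_prod_decode .
qed

lemma fnb_topa_popv: "fn f \<Longrightarrow> fnb (\<lambda>e. topa ((popv ^^ k) e) (f e))"
proof -
  have "topa ((popv ^^ k) e) = topa e" for e :: "'x env" by (induction k) (simp_all add: popa_popv)
  then show "fn f \<Longrightarrow> ?thesis" using fn_topa by simp
qed

text \<open>Bounded quantifiers push number variables but leave the array stack alone. The instances
  cover zero to seven pushed variables, as deep as the quantifiers of the operators below are
  nested.\<close>

lemmas fnb_topas = fn_topa fnb_topa_popv[of _ 1, simplified] fnb_topa_popv[of _ 2, unfolded funpow.simps numeral_2_eq_2 o_def id_def]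
  fnb_topa_popv[of _ "Suc (Suc (Suc 0))", unfolded funpow.simps o_def id_def]
  fnb_topa_popv[of _ "Suc (Suc (Suc (Suc 0)))", unfolded funpow.simps o_def id_def]
  fnb_topa_popv[of _ "Suc (Suc (Suc (Suc (Suc 0))))", unfolded funpow.simps o_def id_def]
  fnb_topa_popv[of _ "Suc (Suc (Suc (Suc (Suc (Suc 0)))))", unfolded funpow.simps o_def id_def]
  fnb_topa_popv[of _ "Suc (Suc (Suc (Suc (Suc (Suc (Suc 0))))))", unfolded funpow.simps o_def id_def]

lemmas fn_intros = fn_const fn_plus fn_times fn_minus fn_div fn_mod fn_dig fn_prod_encode fn_fst_decode fn_snd_decode
  fn_if fn_less fnb_le fnb_eq fnb_conj fnb_disj fnb_imp fnb_not fnb_ex fnb_all fnb_topas fn_inbits fn_topv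

end

section \<open>Programs for the input length and for the exponential bound\<close>

lemma exb_WhT: "cnd b s \<Longrightarrow> exb c s T s' \<Longrightarrow> exb (Wh b c) s' T' s'' \<Longrightarrow> exb (Wh b c) s (Suc (T + T')) s''"
  unfolding exb_def by (meson Suc_le_mono add_mono ex_WhT)

lemma exb_WhF: "\<not> cnd b s \<Longrightarrow> exb (Wh b c) s 1 s"
  unfolding exb_def using ex_WhF by blast

text \<open>Counter 3 stays 0, so the loop runs while counter 2 is positive; the first blank,
  recognised by its two set bits, clears counter 2. The length is counted in counter 0, which at the
  same time addresses the cell.\<close>

definition Scan :: com where
  "Scan = Seq (Inc 2) (Wh (Lt 3 2) (If (Ar 0 0) (If (Ar 1 0) (Clr 2) (Inc 0)) (Inc 0)))"

lemma exb_Scan: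
  assumes w: "set w \<subseteq> {0, 1, 2}"
  shows "exb Scan (\<lambda>_. 0, inbits w) (length w * 4 + 6) ((\<lambda>_. 0)(0 := length w), inbits w)"
proof -
  let ?n = "length w" and ?c = "If (Ar 0 0) (If (Ar 1 0) (Clr 2) (Inc 0)) (Inc 0)"
  let ?v = "\<lambda>k. (\<lambda>_. 0)(0 := k, 2 := 1) :: nat \<Rightarrow> nat"
  have "k \<le> ?n \<Longrightarrow> exb (Wh (Lt 3 2) ?c) (?v k, inbits w) ((?n - k) * 4 + 5) ((\<lambda>_. 0)(0 := ?n), inbits w)" for k
  proof (induction "?n - k" arbitrary: k)
    case 0
    have u: "(?v ?n)(2 := 0) = (\<lambda>_. 0)(0 := ?n)" by (auto simp: fun_eq_iff)
    have b: "inbits w 0 ?n" "inbits w 1 ?n" by (simp_all add: inbits_def bit_numeral_rec bit_0)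
    have "exb (If (Ar 1 0) (Clr 2) (Inc 0)) (?v ?n, inbits w) (Suc 1) ((\<lambda>_. 0)(0 := ?n), inbits w)"
      using exb_Clr[of 2 "?v ?n" "inbits w"] b by (intro exb_If) (simp only: u cnd.simps fun_upd_apply if_True simp_thms zero_neq_numeral if_False)
    then have "exb ?c (?v ?n, inbits w) (Suc (Suc 1)) ((\<lambda>_. 0)(0 := ?n), inbits w)" using b by (intro exb_If) simp
    then have "exb (Wh (Lt 3 2) ?c) (?v ?n, inbits w) (Suc (Suc (Suc 1) + 1)) ((\<lambda>_. 0)(0 := ?n), inbits w)"
      by (rule exb_WhT[rotated]) (auto intro!: exb_WhF[unfolded One_nat_def])
    moreover have "k = ?n" using 0 by simp
    ultimately show ?case by (auto simp del: fun_upd_apply intro: exb_mono)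
  next
    case (Suc m)
    have k: "k < ?n" using Suc by simp
    have "w ! k \<in> {0, 1, 2}" using w k nth_mem by blast
    then have b: "\<not> (inbits w 0 k \<and> inbits w 1 k)" using k by (auto simp: inbits_def)
    have i: "exb (Inc 0) (?v k, inbits w) 1 (?v (Suc k), inbits w)"
    proof -
      have "(?v k)(0 := Suc (?v k 0)) = ?v (Suc k)" by (auto simp: fun_eq_iff)
      then show ?thesis using exb_Inc[of 0 "?v k" "inbits w"] by (simp only:)
    qed
    have "exb ?c (?v k, inbits w) (Suc 2) (?v (Suc k), inbits w)"
    proof (intro exb_If, cases "inbits w 0 k")
      case True
      then have "exb (If (Ar 1 0) (Clr 2) (Inc 0)) (?v k, inbits w) (Suc 1) (?v (Suc k), inbits w)"
        using i b by (intro exb_If) simp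
      then show "exb (if cnd (Ar 0 0) (?v k, inbits w) then If (Ar 1 0) (Clr 2) (Inc 0) else Inc 0) (?v k, inbits w) 2 (?v (Suc k), inbits w)"
        using True by (simp add: numeral_2_eq_2)
    next
      case False
      then show "exb (if cnd (Ar 0 0) (?v k, inbits w) then If (Ar 1 0) (Clr 2) (Inc 0) else Inc 0) (?v k, inbits w) 2 (?v (Suc k), inbits w)"
        using exb_mono[OF i, of 2] by simp
    qed
    moreover have "exb (Wh (Lt 3 2) ?c) (?v (Suc k), inbits w) ((?n - Suc k) * 4 + 5) ((\<lambda>_. 0)(0 := ?n), inbits w)"
      by (rule Suc.hyps(1)) (use Suc.hyps(2) k in auto)
    ultimately have "exb (Wh (Lt 3 2) ?c) (?v k, inbits w) (Suc (Suc 2 + ((?n - Suc k) * 4 + 5))) ((\<lambda>_. 0)(0 := ?n), inbits w)"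
      by (intro exb_WhT) auto
    then show ?case by (rule exb_mono) (use k in simp)
  qed
  from this[of 0] have "exb (Wh (Lt 3 2) ?c) (?v 0, inbits w) (?n * 4 + 5) ((\<lambda>_. 0)(0 := ?n), inbits w)" by simp
  moreover have "exb (Inc 2) (\<lambda>_. 0, inbits w) 1 (?v 0, inbits w)"
  proof -
    have "(\<lambda>_. 0)(2 := Suc 0) = ?v 0" by (auto simp: fun_eq_iff)
    then show ?thesis using exb_Inc[of 2 "\<lambda>_. 0" "inbits w"] by (simp only:)
  qed
  ultimately show ?thesis unfolding Scan_def by (intro exb_mono[OF exb_Seq]) auto
qed

text \<open>The exponent is expected in counter 1, where a program compiled with
  \<open>w = 1\<close> leaves its result; the power goes to counter 0, where \<open>good\<close>
  expects the bound.\<close>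

definition Pow2 :: com where
  "Pow2 = Seq (Seq (Clr 0) (Inc 0)) (For 2 1 (Seq (Copy 3 0) (For 4 3 (Inc 0))))"

lemma exb_Pow2:
  "\<exists>v'. exb Pow2 (v, a) (2 + (v 1 * ((2 * 2 ^ v 1 + 2) + (2 ^ v 1 * 3 + 2) + 2) + 2)) (v', a) \<and> v' 0 = 2 ^ v 1"
proof -
  let ?r = "v 1"
  let ?T = "(2 * 2 ^ v 1 + 2) + (2 ^ v 1 * 3 + 2)"
  define P where "P = (\<lambda>k (s :: st). k \<le> ?r \<and> fst s 0 = 2 ^ k \<and> fst s 1 = ?r \<and> fst s 2 = k \<and> snd s = a)"
  have "\<exists>s'. exb (For 2 1 (Seq (Copy 3 0) (For 4 3 (Inc 0)))) (v(0 := 1), a) (?r * (?T + 2) + 2) s' \<and> P ?r s'"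
  proof (rule For_loop[where P = P])
    fix k v1 a1 assume k: "k < ?r" and "P k (v1, a1)"
    then have p: "v1 0 = 2 ^ k" "v1 1 = ?r" "v1 2 = k" "a1 = a" by (auto simp: P_def)
    define v2 where "v2 = v1(3 := v1 0)"
    define R where "R = (\<lambda>j (s :: st). fst s 0 = 2 ^ k + j \<and> fst s 1 = ?r \<and> fst s 2 = k \<and> fst s 3 = 2 ^ k \<and> fst s 4 = j \<and> snd s = a)"
    have "\<exists>s'. exb (For 4 3 (Inc 0)) (v2, a) (2 ^ k * (1 + 2) + 2) s' \<and> R (2 ^ k) s'"
    proof (rule For_loop[where P = R])
      fix j v3 a3 assume "R j (v3, a3)"
      then show "\<exists>v' a'. exb (Inc 0) (v3, a3) 1 (v', a') \<and> v' 4 = j \<and> R (Suc j) (v'(4 := Suc j), a')"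
        using exb_Inc[of 0 v3 a3] by (intro exI conjI) (assumption, auto simp: R_def)
    qed (use p in \<open>auto simp: R_def v2_def\<close>)
    then obtain v3 where v3: "exb (For 4 3 (Inc 0)) (v2, a) (2 ^ k * (1 + 2) + 2) (v3, a)" "R (2 ^ k) (v3, a)"
      unfolding R_def by (metis prod.collapse snd_conv)
    have c: "exb (Copy 3 0) (v1, a) (2 * v1 0 + 2) (v2, a)" unfolding v2_def by (rule exb_Copy) simp
    have le: "(2 :: nat) ^ k \<le> 2 ^ ?r" using k by (simp add: power_increasing)
    have "exb (Seq (Copy 3 0) (For 4 3 (Inc 0))) (v1, a) ((2 * v1 0 + 2) + (2 ^ k * (1 + 2) + 2)) (v3, a)"
      by (rule exb_Seq[OF c v3(1)])
    then have "exb (Seq (Copy 3 0) (For 4 3 (Inc 0))) (v1, a) ?T (v3, a)"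
      by (rule exb_mono, unfold p(1)) (intro add_le_mono mult_le_mono le_refl le, simp)
    moreover have "v3 2 = k" "P (Suc k) (v3(2 := Suc k), a)" using v3(2) k by (auto simp: R_def P_def)
    ultimately show "\<exists>v' a'. exb (Seq (Copy 3 0) (For 4 3 (Inc 0))) (v1, a1) ?T (v', a') \<and> v' 2 = k \<and> P (Suc k) (v'(2 := Suc k), a')"
      unfolding p(4) by blast
  qed (auto simp: P_def)
  then obtain v' where v': "exb (For 2 1 (Seq (Copy 3 0) (For 4 3 (Inc 0)))) (v(0 := 1), a) (?r * (?T + 2) + 2) (v', a)" "v' 0 = 2 ^ ?r"
    unfolding P_def by (metis prod.collapse snd_conv)
  have "exb (Seq (Clr 0) (Inc 0)) (v, a) 2 (v(0 := 1), a)"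
    using exb_Seq[OF exb_Clr[of 0 v a] exb_Inc[of 0 "v(0 := 0)" a]] by (simp add: numeral_2_eq_2)
  from exb_Seq[OF this v'(1)] v'(2) show ?thesis unfolding Pow2_def by blast
qed

text \<open>The exponential bound has to be computed first. The class is therefore used twice: with
  bound \<open>n + 2\<close> for the exponent, and with the resulting power for
  \<open>L\<close>.\<close>

theorem coding_decides:
  fixes enc :: "'x \<Rightarrow> nat list" and L :: "'x \<Rightarrow> bool"
  assumes w: "\<And>x. set (enc x) \<subseteq> {0, 1, 2}" and k: "1 \<le> k"
    and L: "coding.fn enc (\<lambda>x. 2 ^ ((length (enc x) + 2) ^ k)) (\<lambda>e. of_bool (L (px e)))"
  shows "decidable enc L \<and> in_EXPTIME enc L"
proof -
  let ?n = "\<lambda>x. length (enc x) + 2"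
  let ?B = "\<lambda>x. 2 ^ (?n x ^ k) :: nat"
  interpret c1: coding enc ?n by unfold_locales simp
  interpret c2: coding enc ?B by unfold_locales (use self_le_power[of 2 "?n _ ^ k"] in \<open>simp add: Suc_leI\<close>)
  have "c1.fn (\<lambda>e. ?n (px e) ^ j)" for j
  proof (induction j)
    case 0
    show ?case using c1.fn_const[of 1] by simp
  next
    case (Suc j)
    show ?case using c1.fn_times[OF c1.fn_bnd Suc] by simp
  qed
  then obtain p1 d1 where p1: "c1.computes [] [] 1 2 (\<lambda>e. ?n (px e) ^ k) p1 d1"
    by (rule c1.fnE[of _ "[]" 1 "[]" 2]) auto
  obtain p2 d2 where p2: "c2.computes [] [] 1 2 (\<lambda>e. of_bool (L (px e))) p2 d2"
    by (rule c2.fnE[OF L, of "[]" 1 "[]" 2]) auto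
  \<comment> \<open>The two increments turn the length found by \<open>Scan\<close> into
    \<open>n + 2\<close>.\<close>
  define p where "p = Seq Scan (Seq (Inc 0) (Seq (Inc 0) (Seq p1 (Seq Pow2 p2))))"
  define T where "T = (\<lambda>B :: nat. (B * 4 + 6) + (1 + (1 + (B ^ d1 + ((2 + (B * ((2 * B + 2) + (B * 3 + 2) + 2) + 2)) + B ^ d2)))))"
  have run: "\<exists>v a. exb p (\<lambda>_. 0, inbits (enc x)) (T (?B x)) (v, a) \<and> v 1 = of_bool (L x)" for x
  proof -
    let ?a = "inbits (enc x)" and ?M = "?B x"
    have nB: "?n x ^ k \<le> ?M" by (rule less_imp_le[OF less_exp])
    have nB': "?n x \<le> ?M" using self_le_power[of "?n x" k] k nB by linarith
    have au: "\<not> ?a j q" if "2 \<le> j" for j q using that by (simp add: inbits_def)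
    define v0 where "v0 = (\<lambda>_ :: nat. 0 :: nat)(0 := length (enc x))"
    define v1 where "v1 = v0(0 := Suc (v0 0))"
    define v2 where "v2 = v1(0 := Suc (v1 0))"
    have e0: "exb Scan (\<lambda>_. 0, ?a) (?M * 4 + 6) (v0, ?a)"
      unfolding v0_def by (rule exb_mono[OF exb_Scan[OF w]]) (use nB' in simp)
    have e1: "exb (Inc 0) (v0, ?a) 1 (v1, ?a)" "exb (Inc 0) (v1, ?a) 1 (v2, ?a)" unfolding v1_def v2_def by (rule exb_Inc)+
    have v2: "v2 0 = ?n x" by (simp add: v2_def v1_def v0_def)
    have g1: "c1.good x v2 ?a (?n x)" unfolding c1.good_def using v2 by simp
    obtain v3 where v3: "exb p1 (v2, ?a) (?n x ^ d1) (v3, ?a)" "v3 1 = ?n x ^ k"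
      by (rule c1.computesD[OF p1 g1]) (use v2 au in auto)
    obtain v4 where v4: "exb Pow2 (v3, ?a) (2 + (v3 1 * ((2 * 2 ^ v3 1 + 2) + (2 ^ v3 1 * 3 + 2) + 2) + 2)) (v4, ?a)" "v4 0 = 2 ^ v3 1"
      using exb_Pow2 by blast
    have g2: "c2.good x v4 ?a ?M" unfolding c2.good_def using v4(2) v3(2) by simp
    obtain v5 where v5: "exb p2 (v4, ?a) (?M ^ d2) (v5, ?a)" "v5 1 = of_bool (L x)"
      by (rule c2.computesD[OF p2 g2]) (use v4(2) v3(2) au in auto)
    have e3: "exb p1 (v2, ?a) (?M ^ d1) (v3, ?a)" by (rule exb_mono[OF v3(1)]) (intro power_mono nB', simp)
    have e4: "exb Pow2 (v3, ?a) (2 + (?M * ((2 * ?M + 2) + (?M * 3 + 2) + 2) + 2)) (v4, ?a)"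
      by (rule exb_mono[OF v4(1)], unfold v3(2)) (intro add_le_mono mult_le_mono1 le_refl nB)
    have "exb p (\<lambda>_. 0, ?a) (T ?M) (v5, ?a)" unfolding p_def T_def
      by (intro exb_Seq[OF e0] exb_Seq[OF e1(1)] exb_Seq[OF e1(2)] exb_Seq[OF e3] exb_Seq[OF e4] v5(1))
    then show ?thesis using v5(2) by blast
  qed
  define T' where "T' = (\<lambda>B. T B * (2 * T B + 6) + 2)"
  have "pb T'" unfolding T'_def T_def by (intro pb_intros)
  then obtain d where d: "\<And>B. 2 \<le> B \<Longrightarrow> T' B \<le> B ^ d" unfolding pb_def by blast
  have "\<exists>n\<le>2 ^ (?n x ^ (k + d)). tm_state_after (machine p 1) (enc x) n = (if L x then 1 else 2)" for x
  proof -
    obtain v a t where r: "t \<le> T (?B x)" "ex p (\<lambda>_. 0, inbits (enc x)) t (v, a)" "v 1 = of_bool (L x)"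
      using run[of x] unfolding exb_def by blast
    obtain n where n: "n \<le> t * (2 * t + 6) + 2" "tm_state_after (machine p 1) (enc x) n = (if L x then 1 else 2)"
      using machine_run[OF w r(2), of 1] r(3) by (auto split: if_splits)
    have "t * (2 * t + 6) + 2 \<le> T' (?B x)" unfolding T'_def by (intro add_le_mono mult_le_mono le_refl r(1))
    also have "\<dots> \<le> ?B x ^ d" by (rule d[OF c2.bnd2])
    also have "\<dots> = 2 ^ (?n x ^ k * d)" by (simp add: power_mult)
    \<comment> \<open>The factor \<open>d\<close> in the exponent is absorbed because
      \<open>d \<le> (n + 2) ^ d\<close>.\<close>
    also have "\<dots> \<le> 2 ^ (?n x ^ (k + d))"
      using pow_const_le[of "?n x" d] by (simp add: power_add)
    finally show ?thesis using n le_trans by blast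
  qed
  then have "tm_decides_within (machine p 1) enc L (\<lambda>n. 2 ^ ((n + 2) ^ (k + d)))"
    unfolding tm_decides_within_def using machine_ok by (metis insertCI one_neq_zero numeral_eq_one_iff semiring_norm(85))
  then show ?thesis unfolding decidable_def in_EXPTIME_def tm_decides_within_def by blast
qed

section \<open>Reading the input\<close>

declare bits.simps [simp del]

text \<open>The \<open>k\<close>-th of the numbers written in \<open>w\<close>, each ended by the symbol 2.\<close>

fun tokv :: "nat list \<Rightarrow> nat \<Rightarrow> nat" where
  "tokv [] k = 0"
| "tokv (s # w) k = (if s = 2 then (if k = 0 then 0 else tokv w (k - 1)) else if k = 0 then 2 * tokv w 0 + s else tokv w k)"

lemma tokv_bits: "tokv (bits v @ 2 # w) k = (if k = 0 then v else tokv w (k - 1))"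
proof (induction v rule: bits.induct)
  case (1 v)
  show ?case
  proof (cases "v = 0")
    case True
    then show ?thesis by (simp add: bits.simps)
  next
    case False
    have "bits v = v mod 2 # bits (v div 2)" "v mod 2 \<noteq> 2" using False by (simp_all add: bits.simps[of v])
    then show ?thesis using 1[OF False] False by (cases "k = 0") auto
  qed
qed

lemma tokv_concat: "k < length ts \<Longrightarrow> tokv (concat (map enc_nat ts)) k = ts ! k"
  by (induction ts arbitrary: k) (auto simp: enc_nat_def tokv_bits nth_Cons')

lemma tokv_less: "set w \<subseteq> {0, 1, 2} \<Longrightarrow> tokv w k < 2 ^ length w"
proof (induction w arbitrary: k)
  case (Cons s w)
  have "tokv w j < 2 ^ length w" for j using Cons by simp
  from this[of 0] this[of k] this[of "k - 1"] Cons.prems show ?case by auto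
qed simp

lemma set_bits: "set (bits v) \<subseteq> {0, 1}"
proof (induction v rule: bits.induct)
  case (1 v)
  then show ?case by (cases "v = 0") (auto simp: bits.simps[of v] bits.simps[of 0])
qed

lemma set_enc_nats: "set (concat (map enc_nat ts)) \<subseteq> {0, 1, 2}"
  by (auto simp: enc_nat_def dest!: subsetD[OF set_bits])

lemma inbits_simps:
  assumes "set w \<subseteq> {0, 1, 2}"
  shows "inbits w 0 p \<and> inbits w 1 p \<longleftrightarrow> length w \<le> p"
    "\<not> inbits w 0 p \<and> inbits w 1 p \<longleftrightarrow> p < length w \<and> w ! p = 2"
    "inbits w 0 p \<and> \<not> inbits w 1 p \<longleftrightarrow> p < length w \<and> w ! p = 1"
proof -
  have "w ! p \<in> {0, 1, 2}" if "p < length w" using assms nth_mem[OF that] by blast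
  then show "inbits w 0 p \<and> inbits w 1 p \<longleftrightarrow> length w \<le> p"
    "\<not> inbits w 0 p \<and> inbits w 1 p \<longleftrightarrow> p < length w \<and> w ! p = 2"
    "inbits w 0 p \<and> \<not> inbits w 1 p \<longleftrightarrow> p < length w \<and> w ! p = 1"
    unfolding inbits_def by (cases "p < length w"; auto simp: bit_numeral_rec bit_0)+
qed

locale coding2 = coding +
  assumes alpha: "set (enc x) \<subseteq> {0, 1, 2}" and big: "2 ^ length (enc x) \<le> bnd x"
begin

lemma len_less: "length (enc x) < bnd x"
  using less_exp[of "length (enc x)"] big[of x] by linarith

lemma fn_length: "fn (\<lambda>e. length (enc (px e)))"
proof -
  have eq: "crec (bnd x) 0 (\<lambda>i r. r + of_bool (\<not> (inbits (enc x) 0 i \<and> inbits (enc x) 1 i))) (bnd x) = length (enc x)" for x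
  proof -
    have "crec (bnd x) 0 (\<lambda>i r. r + of_bool (\<not> (inbits (enc x) 0 i \<and> inbits (enc x) 1 i))) (bnd x) = min (bnd x) (length (enc x))"
      unfolding inbits_simps[OF alpha] by (rule crec_eq[where R = "\<lambda>i. min i (length (enc x))"]) auto
    then show ?thesis using len_less[of x] by simp
  qed
  have "fn (\<lambda>e. crec (bnd (px e)) 0 (\<lambda>i r. r + of_bool (\<not> (inbits (enc (px e)) 0 i \<and> inbits (enc (px e)) 1 i))) (bnd (px e)))"
    by (rule fn_crec[OF fn_bnd fn_const fn_bnd]) (simp only: px_pop, intro fn_intros, simp_all add: fn_popv fn_topv)
  then show ?thesis unfolding eq .
qed

definition cnt :: "'a \<Rightarrow> nat \<Rightarrow> nat" where
  "cnt x p = length (filter ((=) 2) (take p (enc x)))"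

lemma fn_cnt: "fn f \<Longrightarrow> fn (\<lambda>e. cnt (px e) (f e))"
proof -
  assume f: "fn f"
  have eq: "crec (bnd x) 0 (\<lambda>i r. r + of_bool (\<not> inbits (enc x) 0 i \<and> inbits (enc x) 1 i)) p = cnt x p" for x p
    unfolding inbits_simps[OF alpha]
  proof (rule crec_eq[where R = "cnt x"])
    fix i
    show "cnt x i \<le> bnd x" unfolding cnt_def using len_less[of x] length_filter_le[of "(=) 2" "take i (enc x)"] by simp
    show "cnt x (Suc i) = cnt x i + of_bool (i < length (enc x) \<and> enc x ! i = 2)"
      unfolding cnt_def by (cases "i < length (enc x)") (auto simp: take_Suc_conv_app_nth)
  qed (simp add: cnt_def)
  have "fn (\<lambda>e. crec (bnd (px e)) 0 (\<lambda>i r. r + of_bool (\<not> inbits (enc (px e)) 0 i \<and> inbits (enc (px e)) 1 i)) (f e))"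
    by (rule fn_crec[OF fn_bnd fn_const f]) (simp only: px_pop, intro fn_intros, simp_all add: fn_popv fn_topv)
  then show ?thesis unfolding eq .
qed

text \<open>Bits are written with the least significant one first, so the input is read from right
  to left by Horner's rule; token \<open>k\<close> consists of the bits preceded by exactly
  \<open>k\<close> terminators.\<close>

lemma fn_tokv: "fn f \<Longrightarrow> fn (\<lambda>e. tokv (enc (px e)) (f e))"
proof -
  assume f: "fn f"
  let ?two = "\<lambda>x q. \<not> inbits (enc x) 0 q \<and> inbits (enc x) 1 q"
  let ?one = "\<lambda>x q. inbits (enc x) 0 q \<and> \<not> inbits (enc x) 1 q"
  let ?h = "\<lambda>x k i r. if cnt x (length (enc x) - 1 - i) = k \<and> \<not> ?two x (length (enc x) - 1 - i)
      then 2 * r + of_bool (?one x (length (enc x) - 1 - i)) else r"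
  have eq: "crec (bnd x) 0 (?h x k) (length (enc x)) = tokv (enc x) k" for x k
  proof -
    let ?w = "enc x" and ?n = "length (enc x)"
    \<comment> \<open>The part of token \<open>k\<close> that lies at or after position
      \<open>p\<close>; it is 0 once more than \<open>k\<close> terminators precede
      \<open>p\<close>.\<close>
    define V where "V = (\<lambda>p. if cnt x p \<le> k then tokv (drop p ?w) (k - cnt x p) else 0)"
    have "crec (bnd x) 0 (?h x k) ?n = V (?n - ?n)"
      unfolding inbits_simps[OF alpha]
    proof (rule crec_eq[where R = "\<lambda>i. V (?n - i)"])
      fix i
      have "tokv (drop (?n - i) ?w) (k - cnt x (?n - i)) < 2 ^ length (drop (?n - i) ?w)"
        by (rule tokv_less) (meson alpha order_trans set_drop_subset)
      also have "\<dots> \<le> 2 ^ ?n" by (rule power_increasing) auto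
      finally show "V (?n - i) \<le> bnd x" using big[of x] unfolding V_def by simp
      assume i: "i < ?n"
      define q where "q = ?n - 1 - i"
      have q: "?n - Suc i = q" "?n - i = Suc q" "q < ?n" using i by (auto simp: q_def)
      have d: "drop q ?w = ?w ! q # drop (Suc q) ?w" using q(3) by (rule Cons_nth_drop_Suc[symmetric])
      have c: "cnt x (Suc q) = cnt x q + of_bool (?w ! q = 2)" unfolding cnt_def using q(3) by (simp add: take_Suc_conv_app_nth)
      have s: "?w ! q \<in> {0, 1, 2}" using alpha q(3) nth_mem by blast
      show "V (?n - Suc i) = (if cnt x (?n - 1 - i) = k \<and> \<not> (?n - 1 - i < ?n \<and> ?w ! (?n - 1 - i) = 2)
          then 2 * V (?n - i) + of_bool (?n - 1 - i < ?n \<and> ?w ! (?n - 1 - i) = 1) else V (?n - i))"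
        unfolding q_def[symmetric] q(1,2) V_def d c using q(3) s by (auto simp: Suc_le_eq diff_Suc split: nat.splits)
    qed (simp add: V_def)
    then show ?thesis by (simp add: V_def cnt_def)
  qed
  have len: "fn (\<lambda>e. length (enc (px e)) - 1 - topv (popv e))" by (rule fn_minus[OF fn_minus[OF fn_length fn_const] fn_popv[OF fn_topv]])
  have "fn (\<lambda>e. crec (bnd (px e)) 0 (?h (px e) (f e)) (length (enc (px e))))"
    by (rule fn_crec[OF fn_bnd fn_const fn_length]) (simp only: px_pop, intro fn_intros fn_cnt fn_length fn_popv[OF fn_popv[OF f]] fn_popv[OF fn_topv], simp_all)
  then show ?thesis unfolding eq .
qed

end

section \<open>Locating items in the list of tokens\<close>

definition at :: "'a list \<Rightarrow> nat \<Rightarrow> 'a list \<Rightarrow> bool" where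
  "at W q us \<longleftrightarrow> (\<exists>pre post. W = pre @ us @ post \<and> length pre = q)"

lemma at_append: "at W q (us @ vs) \<Longrightarrow> at W q us" "at W q (us @ vs) \<Longrightarrow> at W (q + length us) vs"
proof -
  assume "at W q (us @ vs)"
  then obtain pre post where "W = pre @ us @ (vs @ post)" "length pre = q" unfolding at_def by auto
  then show "at W q us" "at W (q + length us) vs" unfolding at_def by (auto intro: exI[of _ "pre @ us"])
qed

lemma at_nth: "at W q us \<Longrightarrow> k < length us \<Longrightarrow> W ! (q + k) = us ! k \<and> q + k < length W"
  unfolding at_def by (auto simp: nth_append)

lemma at_le: "at W q us \<Longrightarrow> q + length us \<le> length W"
  unfolding at_def by auto

text \<open>Items differ in length, so item \<open>k\<close> is reached by \<open>k\<close> jumps,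
  each of a length that can be read off at the item itself.\<close>

lemma at_crec:
  assumes "at W q (concat (map f xs) @ rest)" "length W \<le> b" "k \<le> length xs"
    and h: "\<And>r z. z \<in> set xs \<Longrightarrow> at W r (f z) \<Longrightarrow> h r = r + length (f z)"
  shows "at W (crec b q (\<lambda>i. h) k) (concat (map f (drop k xs)) @ rest)"
proof -
  define R where "R = (\<lambda>i. q + length (concat (map f (take i xs))))"
  have a: "at W (R i) (concat (map f (drop i xs)) @ rest)" for i
  proof -
    have "concat (map f xs) = concat (map f (take i xs)) @ concat (map f (drop i xs))"
      by (metis append_take_drop_id concat_append map_append)
    then show ?thesis using at_append(2)[of W q "concat (map f (take i xs))"] assms(1) unfolding R_def by simp
  qed
  have "crec b q (\<lambda>i. h) k = R k"
  proof (rule crec_eq)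
    fix i
    show "R i \<le> b" using at_le[OF a[of i]] assms(2) by simp
    assume i: "i < k"
    then have d: "drop i xs = xs ! i # drop (Suc i) xs" using assms(3) by (intro Cons_nth_drop_Suc[symmetric]) simp
    have "at W (R i) (f (xs ! i))" using a[of i] unfolding d by (auto dest: at_append(1))
    then have "h (R i) = R i + length (f (xs ! i))" using h[of "xs ! i"] i assms(3) by simp
    then show "R (Suc i) = h (R i)" using i assms(3) unfolding R_def by (simp add: take_Suc_conv_app_nth)
  qed (simp add: R_def)
  then show ?thesis using a by simp
qed

lemma at_crec_nth:
  assumes "at W q (concat (map f xs) @ rest)" "length W \<le> b" "k < length xs"
    and "\<And>r z. z \<in> set xs \<Longrightarrow> at W r (f z) \<Longrightarrow> h r = r + length (f z)"
  shows "at W (crec b q (\<lambda>i. h) k) (f (xs ! k))"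
proof -
  have "at W (crec b q (\<lambda>i. h) k) (concat (map f (drop k xs)) @ rest)"
    by (rule at_crec) (use assms in auto)
  moreover have "drop k xs = xs ! k # drop (Suc k) xs" using assms(3) by (rule Cons_nth_drop_Suc[symmetric])
  ultimately show ?thesis by (auto dest: at_append(1))
qed

fun toks_uid where "toks_uid (a, b, c, d) = [a, b, c, d :: nat]"
fun toks_fd where "toks_fd (R, D, j) = R # length D # D @ [j :: nat]"
fun toks_meth where "toks_meth (R, ins, bd) = R # length ins # ins @ [case bd of None \<Rightarrow> 0 | Some k \<Rightarrow> Suc k]"
fun toks_atom where "toks_atom (R, vs) = (R :: nat) # length vs # vs"

fun toks :: "schema \<times> cq \<Rightarrow> nat list" where
  "toks (S, Q) = length (rel_arities S) # rel_arities S @ length (uids S) # concat (map toks_uid (uids S)) @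
     length (fds S) # concat (map toks_fd (fds S)) @ length (methods S) # concat (map toks_meth (methods S)) @
     length Q # concat (map toks_atom Q)"

lemma enc_list_toks:
  assumes "\<And>z. f z = concat (map enc_nat (g z))"
  shows "enc_list f xs = concat (map enc_nat (length xs # concat (map g xs)))"
proof -
  have "concat (map f xs) = concat (map enc_nat (concat (map g xs)))" by (induction xs) (simp_all add: assms)
  then show ?thesis by (simp add: enc_list_def)
qed

lemma enc_toks: "enc_problem x = concat (map enc_nat (toks x))"
proof -
  have nats: "enc_list enc_nat xs = concat (map enc_nat (length xs # xs))" for xs
    using enc_list_toks[of enc_nat "\<lambda>z. [z]" xs] by (simp add: map_concat)
  have u: "enc_uid z = concat (map enc_nat (toks_uid z))" for z by (cases z) simp
  have o: "enc_opt b = enc_nat (case b of None \<Rightarrow> 0 | Some k \<Rightarrow> Suc k)" for b by (cases b) simp_all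
  have f: "enc_fd z = concat (map enc_nat (toks_fd z))" for z by (cases z) (simp add: nats)
  have m: "enc_meth z = concat (map enc_nat (toks_meth z))" for z by (cases z) (simp add: nats o)
  have a: "enc_atom z = concat (map enc_nat (toks_atom z))" for z by (cases z) (simp add: nats)
  obtain S Q where x: "x = (S, Q)" by (cases x)
  show ?thesis unfolding x
    by (simp add: nats enc_list_toks[OF u] enc_list_toks[OF f] enc_list_toks[OF m] enc_list_toks[OF a])
qed

text \<open>The exponent leaves room for the digits of a certificate: at most \<open>2 n\<close> slots of \<open>16 n + 33\<close> bits.\<close>

definition pbnd :: "schema \<times> cq \<Rightarrow> nat" where
  "pbnd x = 2 ^ ((length (enc_problem x) + 2) ^ 10)"

interpretation PB: coding2 enc_problem pbnd
proof unfold_locales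
  fix x
  show "2 \<le> pbnd x" unfolding pbnd_def using self_le_power[of 2 "(length (enc_problem x) + 2) ^ 10"] by (simp add: Suc_leI)
  show "set (enc_problem x) \<subseteq> {0, 1, 2}" unfolding enc_toks by (rule set_enc_nats)
  have "length (enc_problem x) \<le> (length (enc_problem x) + 2) ^ 10" using self_le_power[of "length (enc_problem x) + 2" 10] by simp
  then show "2 ^ length (enc_problem x) \<le> pbnd x" unfolding pbnd_def by (rule power_increasing) simp
qed

abbreviation "FN \<equiv> PB.fn"
abbreviation "FB P \<equiv> FN (\<lambda>e. of_bool (P e))"

text \<open>Access to the input: numbers of relations (\<open>NR\<close>), UIDs, FDs, methods and atoms (\<open>NU\<close>, \<open>NF\<close>, \<open>NM\<close>,
  \<open>NQ\<close>); arities \<open>AR\<close>; component \<open>i\<close> of UID \<open>k\<close> (\<open>UQ x k i\<close>); relation, number of listed positions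
  (variables) and the listed positions of FD, method and atom \<open>k\<close> (\<open>FR\<close>, \<open>FL\<close>, \<open>FD\<close> etc.); the
  determined position \<open>FJ\<close>; the bound \<open>MB\<close>, shifted by one with 0 for no bound. \<open>UO\<close>, \<open>FO\<close>, \<open>MO\<close>, \<open>QO\<close>
  are token offsets.\<close>

definition "TK x k = tokv (enc_problem x) k"
definition "NR x = TK x 0"
text \<open>The default 0 outside the signature makes \<open>q < AR x R\<close> imply that
  \<open>R\<close> is a relation.\<close>

definition "AR x R = (if R < NR x then TK x (1 + R) else 0)"
definition "NU x = TK x (1 + NR x)"
definition "UO x k = crec (pbnd x) (1 + NR x + 1) (\<lambda>i r. r + 4) k"
definition "UQ x k i = TK x (UO x k + i)"
definition "NF x = TK x (UO x (NU x))"
definition "FO x k = crec (pbnd x) (UO x (NU x) + 1) (\<lambda>i r. r + (3 + TK x (r + 1))) k"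
definition "FR x k = TK x (FO x k)"
definition "FL x k = TK x (FO x k + 1)"
definition "FD x k d = TK x (FO x k + (2 + d))"
definition "FJ x k = TK x (FO x k + (2 + FL x k))"
definition "NM x = TK x (FO x (NF x))"
definition "MO x k = crec (pbnd x) (FO x (NF x) + 1) (\<lambda>i r. r + (3 + TK x (r + 1))) k"
definition "MR x k = TK x (MO x k)"
definition "MN x k = TK x (MO x k + 1)"
definition "MI x k d = TK x (MO x k + (2 + d))"
definition "MB x k = TK x (MO x k + (2 + MN x k))"
definition "NQ x = TK x (MO x (NM x))"
definition "QO x k = crec (pbnd x) (MO x (NM x) + 1) (\<lambda>i r. r + (2 + TK x (r + 1))) k"
definition "QR x k = TK x (QO x k)"
definition "QL x k = TK x (QO x k + 1)"
definition "QV x k d = TK x (QO x k + (2 + d))"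

lemma fn_TK: "FN f \<Longrightarrow> FN (\<lambda>e. TK (px e) (f e))"
  unfolding TK_def by (rule PB.fn_tokv)

lemma fn_NR: "FN (\<lambda>e. NR (px e))"
  unfolding NR_def by (intro fn_TK PB.fn_intros)

lemma fn_AR: "FN f \<Longrightarrow> FN (\<lambda>e. AR (px e) (f e))"
  unfolding AR_def by (intro fn_TK fn_NR PB.fn_intros)

lemma fn_NU: "FN (\<lambda>e. NU (px e))"
  unfolding NU_def by (intro fn_TK fn_NR PB.fn_intros)

lemma fn_offs:
  assumes "FN q" "FN f"
  shows "FN (\<lambda>e. crec (pbnd (px e)) (q e) (\<lambda>i r. r + (c + TK (px e) (r + 1))) (f e))"
  by (rule PB.fn_crec[OF PB.fn_bnd assms]) (simp only: px_pop, intro fn_TK PB.fn_intros)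

lemma fn_UO: "FN f \<Longrightarrow> FN (\<lambda>e. UO (px e) (f e))"
  unfolding UO_def by (rule PB.fn_crec[OF PB.fn_bnd]) (intro fn_NR PB.fn_intros | assumption)+

lemma fn_UQ: "FN f \<Longrightarrow> FN g \<Longrightarrow> FN (\<lambda>e. UQ (px e) (f e) (g e))"
  unfolding UQ_def by (intro fn_TK fn_UO PB.fn_intros)

lemma fn_NF: "FN (\<lambda>e. NF (px e))"
  unfolding NF_def by (intro fn_TK fn_UO fn_NU)

lemma fn_FO: "FN f \<Longrightarrow> FN (\<lambda>e. FO (px e) (f e))"
  unfolding FO_def by (intro fn_offs fn_UO fn_NU PB.fn_intros)

lemma fn_FR: "FN f \<Longrightarrow> FN (\<lambda>e. FR (px e) (f e))"
  unfolding FR_def by (intro fn_TK fn_FO)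

lemma fn_FL: "FN f \<Longrightarrow> FN (\<lambda>e. FL (px e) (f e))"
  unfolding FL_def by (intro fn_TK fn_FO PB.fn_intros)

lemma fn_FD: "FN f \<Longrightarrow> FN g \<Longrightarrow> FN (\<lambda>e. FD (px e) (f e) (g e))"
  unfolding FD_def by (intro fn_TK fn_FO PB.fn_intros)

lemma fn_FJ: "FN f \<Longrightarrow> FN (\<lambda>e. FJ (px e) (f e))"
  unfolding FJ_def by (intro fn_TK fn_FO fn_FL PB.fn_intros)

lemma fn_NM: "FN (\<lambda>e. NM (px e))"
  unfolding NM_def by (intro fn_TK fn_FO fn_NF)

lemma fn_MO: "FN f \<Longrightarrow> FN (\<lambda>e. MO (px e) (f e))"
  unfolding MO_def by (intro fn_offs fn_FO fn_NF PB.fn_intros)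

lemma fn_MR: "FN f \<Longrightarrow> FN (\<lambda>e. MR (px e) (f e))"
  unfolding MR_def by (intro fn_TK fn_MO)

lemma fn_MN: "FN f \<Longrightarrow> FN (\<lambda>e. MN (px e) (f e))"
  unfolding MN_def by (intro fn_TK fn_MO PB.fn_intros)

lemma fn_MI: "FN f \<Longrightarrow> FN g \<Longrightarrow> FN (\<lambda>e. MI (px e) (f e) (g e))"
  unfolding MI_def by (intro fn_TK fn_MO PB.fn_intros)

lemma fn_MB: "FN f \<Longrightarrow> FN (\<lambda>e. MB (px e) (f e))"
  unfolding MB_def by (intro fn_TK fn_MO fn_MN PB.fn_intros)

lemma fn_NQ: "FN (\<lambda>e. NQ (px e))"
  unfolding NQ_def by (intro fn_TK fn_MO fn_NM)

lemma fn_QO: "FN f \<Longrightarrow> FN (\<lambda>e. QO (px e) (f e))"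
  unfolding QO_def by (intro fn_offs fn_MO fn_NM PB.fn_intros)

lemma fn_QR: "FN f \<Longrightarrow> FN (\<lambda>e. QR (px e) (f e))"
  unfolding QR_def by (intro fn_TK fn_QO)

lemma fn_QL: "FN f \<Longrightarrow> FN (\<lambda>e. QL (px e) (f e))"
  unfolding QL_def by (intro fn_TK fn_QO PB.fn_intros)

lemma fn_QV: "FN f \<Longrightarrow> FN g \<Longrightarrow> FN (\<lambda>e. QV (px e) (f e) (g e))"
  unfolding QV_def by (intro fn_TK fn_QO PB.fn_intros)

lemmas fn_reads = fn_NR fn_AR fn_NU fn_UQ fn_NF fn_FR fn_FL fn_FD fn_FJ fn_NM fn_MR fn_MN fn_MI fn_MB fn_NQ fn_QR fn_QL fn_QV

lemma TK_less: "TK x k < 2 ^ length (enc_problem x)"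
  unfolding TK_def by (rule tokv_less[OF PB.alpha])

lemma at_TK: "at (toks x) q us \<Longrightarrow> k < length us \<Longrightarrow> TK x (q + k) = us ! k"
  using at_nth[of "toks x" q us k] tokv_concat[of "q + k" "toks x"] by (simp add: TK_def enc_toks)

lemma at_Cons: "at (toks x) q (u # us) \<Longrightarrow> TK x q = u" "at (toks x) q (u # us) \<Longrightarrow> at (toks x) (q + 1) us"
  using at_TK[of x q "u # us" 0] at_append(2)[of "toks x" q "[u]" us] by auto

lemma length_toks_enc: "length (toks x) \<le> length (enc_problem x)"
proof -
  have "length ts \<le> length (concat (map enc_nat ts))" for ts by (induction ts) (auto simp: enc_nat_def)
  then show ?thesis unfolding enc_toks .
qed

lemma length_toks: "length (toks x) \<le> pbnd x"
  using length_toks_enc[of x] PB.len_less[of x] by simp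

context
  fixes S :: schema and Q :: cq
begin

abbreviation "x0 \<equiv> (S, Q)"

lemma at_parts:
  "NR x0 = length (rel_arities S)"
  "at (toks x0) 1 (rel_arities S)"
  "NU x0 = length (uids S)"
  "k < length (uids S) \<Longrightarrow> at (toks x0) (UO x0 k) (toks_uid (uids S ! k))"
  "NF x0 = length (fds S)"
  "k < length (fds S) \<Longrightarrow> at (toks x0) (FO x0 k) (toks_fd (fds S ! k))"
  "NM x0 = length (methods S)"
  "k < length (methods S) \<Longrightarrow> at (toks x0) (MO x0 k) (toks_meth (methods S ! k))"
  "NQ x0 = length Q"
  "k < length Q \<Longrightarrow> at (toks x0) (QO x0 k) (toks_atom (Q ! k))"
proof -
  define r4 where "r4 = length Q # concat (map toks_atom Q)"
  define r3 where "r3 = length (methods S) # concat (map toks_meth (methods S)) @ r4"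
  define r2 where "r2 = length (fds S) # concat (map toks_fd (fds S)) @ r3"
  define r1 where "r1 = length (uids S) # concat (map toks_uid (uids S)) @ r2"
  have "at (toks x0) 0 (toks x0)" unfolding at_def by auto
  then have a0: "at (toks x0) 0 (length (rel_arities S) # (rel_arities S @ r1))"
    unfolding r1_def r2_def r3_def r4_def by simp
  show nr: "NR x0 = length (rel_arities S)" using at_Cons(1)[OF a0] by (simp add: NR_def)
  have a1: "at (toks x0) 1 (rel_arities S @ r1)" using at_Cons(2)[OF a0] by simp
  show "at (toks x0) 1 (rel_arities S)" by (rule at_append(1)[OF a1])
  have a2: "at (toks x0) (1 + NR x0) r1" using at_append(2)[OF a1] nr by simp
  show nu: "NU x0 = length (uids S)" using at_Cons(1)[OF a2[unfolded r1_def]] by (simp add: NU_def)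
  note a3 = at_Cons(2)[OF a2[unfolded r1_def]]
  have hu: "r + 4 = r + length (toks_uid z)" for r z by (cases z) simp
  show "at (toks x0) (UO x0 k) (toks_uid (uids S ! k))" if "k < length (uids S)"
    unfolding UO_def by (rule at_crec_nth[OF a3 length_toks that hu])
  have a4: "at (toks x0) (UO x0 (NU x0)) r2"
    unfolding UO_def nu using at_crec[OF a3 length_toks le_refl hu] by simp
  show nf: "NF x0 = length (fds S)" using at_Cons(1)[OF a4[unfolded r2_def]] by (simp add: NF_def)
  note a5 = at_Cons(2)[OF a4[unfolded r2_def]]
  have hf: "r + (3 + TK x0 (r + 1)) = r + length (toks_fd z)" if "at (toks x0) r (toks_fd z)" for r z
    using at_TK[OF that, of 1] by (cases z) simp
  show "at (toks x0) (FO x0 k) (toks_fd (fds S ! k))" if "k < length (fds S)"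
    unfolding FO_def by (rule at_crec_nth[OF a5 length_toks that hf])
  have a6: "at (toks x0) (FO x0 (NF x0)) r3"
    unfolding FO_def nf using at_crec[OF a5 length_toks le_refl hf] by simp
  show nm: "NM x0 = length (methods S)" using at_Cons(1)[OF a6[unfolded r3_def]] by (simp add: NM_def)
  note a7 = at_Cons(2)[OF a6[unfolded r3_def]]
  have hm: "r + (3 + TK x0 (r + 1)) = r + length (toks_meth z)" if "at (toks x0) r (toks_meth z)" for r z
    using at_TK[OF that, of 1] by (cases z) simp
  show "at (toks x0) (MO x0 k) (toks_meth (methods S ! k))" if "k < length (methods S)"
    unfolding MO_def by (rule at_crec_nth[OF a7 length_toks that hm])
  have a8: "at (toks x0) (MO x0 (NM x0)) r4"
    unfolding MO_def nm using at_crec[OF a7 length_toks le_refl hm] by simp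
  show nq: "NQ x0 = length Q" using at_Cons(1)[OF a8[unfolded r4_def]] by (simp add: NQ_def)
  have a9: "at (toks x0) (MO x0 (NM x0) + 1) (concat (map toks_atom Q) @ [])"
    using at_Cons(2)[OF a8[unfolded r4_def]] by simp
  have hq: "r + (2 + TK x0 (r + 1)) = r + length (toks_atom z)" if "at (toks x0) r (toks_atom z)" for r z
    using at_TK[OF that, of 1] by (cases z) simp
  show "at (toks x0) (QO x0 k) (toks_atom (Q ! k))" if "k < length Q"
    unfolding QO_def by (rule at_crec_nth[OF a9 length_toks that hq])
qed

lemma AR_eq: "R < length (rel_arities S) \<Longrightarrow> AR x0 R = rel_arities S ! R"
  using at_TK[OF at_parts(2), of R] at_parts(1) by (simp add: AR_def)

lemma uid_eq: "k < length (uids S) \<Longrightarrow> uids S ! k = (UQ x0 k 0, UQ x0 k 1, UQ x0 k 2, UQ x0 k 3)"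
proof -
  assume k: "k < length (uids S)"
  obtain a b c d where u: "uids S ! k = (a, b, c, d)" by (cases "uids S ! k")
  note t = at_TK[OF at_parts(4)[OF k], unfolded u toks_uid.simps]
  show ?thesis using t[of 0] t[of 1] t[of 2] t[of 3] by (simp add: u UQ_def numeral_2_eq_2 numeral_3_eq_3)
qed

lemma fd_eq: "k < length (fds S) \<Longrightarrow> fds S ! k = (FR x0 k, map (FD x0 k) [0..<FL x0 k], FJ x0 k)"
proof -
  assume k: "k < length (fds S)"
  obtain R D j where u: "fds S ! k = (R, D, j)" by (cases "fds S ! k")
  note t = at_TK[OF at_parts(6)[OF k], unfolded u toks_fd.simps]
  have R: "FR x0 k = R" and L: "FL x0 k = length D" using t[of 0] t[of 1] by (simp_all add: FR_def FL_def)
  have "FJ x0 k = j" using t[of "2 + length D"] by (simp add: FJ_def L nth_append)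
  moreover have "FD x0 k d = D ! d" if "d < length D" for d using t[of "2 + d"] that by (simp add: FD_def nth_append)
  then have "map (FD x0 k) [0..<length D] = D" by (intro nth_equalityI) auto
  ultimately show ?thesis by (simp add: u R L)
qed

lemma meth_eq: "k < length (methods S) \<Longrightarrow>
  methods S ! k = (MR x0 k, map (MI x0 k) [0..<MN x0 k], if MB x0 k = 0 then None else Some (MB x0 k - 1))"
proof -
  assume k: "k < length (methods S)"
  obtain R D b where u: "methods S ! k = (R, D, b)" by (cases "methods S ! k")
  note t = at_TK[OF at_parts(8)[OF k], unfolded u toks_meth.simps]
  have R: "MR x0 k = R" and L: "MN x0 k = length D" using t[of 0] t[of 1] by (simp_all add: MR_def MN_def)
  have "MB x0 k = (case b of None \<Rightarrow> 0 | Some k \<Rightarrow> Suc k)" using t[of "2 + length D"] by (simp add: MB_def L nth_append)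
  moreover have "MI x0 k d = D ! d" if "d < length D" for d using t[of "2 + d"] that by (simp add: MI_def nth_append)
  then have "map (MI x0 k) [0..<length D] = D" by (intro nth_equalityI) auto
  ultimately show ?thesis by (cases b) (simp_all add: u R L)
qed

lemma atom_eq: "k < length Q \<Longrightarrow> Q ! k = (QR x0 k, map (QV x0 k) [0..<QL x0 k])"
proof -
  assume k: "k < length Q"
  obtain R D where u: "Q ! k = (R, D)" by (cases "Q ! k")
  note t = at_TK[OF at_parts(10)[OF k], unfolded u toks_atom.simps]
  have R: "QR x0 k = R" and L: "QL x0 k = length D" using t[of 0] t[of 1] by (simp_all add: QR_def QL_def)
  moreover have "QV x0 k d = D ! d" if "d < length D" for d using t[of "2 + d"] that by (simp add: QV_def)
  then have "map (QV x0 k) [0..<length D] = D" by (intro nth_equalityI) auto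
  ultimately show ?thesis by (simp add: u R L)
qed

end

section \<open>The criterion on numeric codes\<close>

text \<open>A term is coded by its constructor, given as the remainder modulo 2, 3 or 4, and by \<open>prod_encode\<close> of its
  arguments (see \<open>cn\<close>, \<open>cb\<close>, \<open>cpn\<close>, \<open>csl\<close> below). \<open>X\<close> is the current stage of a fixed point of judgement
  codes \<open>JE\<close> (for \<open>sim\<close>), \<open>JK\<close> (for \<open>kn\<close>) and \<open>JR\<close> (for \<open>rel2\<close>). In a certificate, the base \<open>K\<close> digits of \<open>c\<close>
  are the slots and those of \<open>c'\<close> assign slots to the atoms of the query.\<close>

abbreviation pe :: "nat \<Rightarrow> nat \<Rightarrow> nat" where "pe a b \<equiv> prod_encode (a, b)"
abbreviation pf :: "nat \<Rightarrow> nat" where "pf c \<equiv> fst (prod_decode c)"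
abbreviation ps :: "nat \<Rightarrow> nat" where "ps c \<equiv> snd (prod_decode c)"

lemma fnb_if: "FB P \<Longrightarrow> FB P' \<Longrightarrow> FB P'' \<Longrightarrow> FB (\<lambda>e. if P e then P' e else P'' e)"
proof -
  assume "FB P" "FB P'" "FB P''"
  then have "FB (\<lambda>e. (P e \<and> P' e) \<or> (\<not> P e \<and> P'' e))" by (intro PB.fn_intros)
  moreover have "((P e \<and> P' e) \<or> (\<not> P e \<and> P'' e)) = (if P e then P' e else P'' e)" for e by simp
  ultimately show ?thesis by (simp only:)
qed

text \<open>Bounds are shifted by one, so \<open>MB x k = 1\<close> would be the forbidden bound
  0.\<close>

definition "WF x \<longleftrightarrow>
  (\<forall>k<NU x. UQ x k 0 < NR x \<and> UQ x k 2 < NR x \<and> UQ x k 1 < AR x (UQ x k 0) \<and> UQ x k 3 < AR x (UQ x k 2)) \<and>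
  (\<forall>k<NF x. FR x k < NR x \<and> (\<forall>d<FL x k. FD x k d < AR x (FR x k)) \<and> FJ x k < AR x (FR x k)) \<and>
  (\<forall>k<NM x. MR x k < NR x \<and> (\<forall>i<MN x k. \<forall>j<MN x k. MI x k i = MI x k j \<longrightarrow> i = j) \<and>
     (\<forall>d<MN x k. MI x k d < AR x (MR x k)) \<and> \<not> MB x k = 1) \<and>
  (\<forall>k<NQ x. QR x k < NR x \<and> QL x k = AR x (QR x k))"

text \<open>The pattern of the fixed points below: one round of the rules as an operator in
  \<open>X\<close>, then its least fixed point below \<open>pbnd x\<close>.\<close>

definition "CPs x X c \<longleftrightarrow>
  (\<exists>k<NF x. c = pe (FR x k) (FJ x k) \<and> (\<forall>d<FL x k. X (pe (FR x k) (FD x k d)))) \<or>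
  (\<exists>k<NU x. c = pe (UQ x k 0) (UQ x k 1) \<and> X (pe (UQ x k 2) (UQ x k 3)))"
definition "CP x R p \<longleftrightarrow> lfpb (pbnd x) (CPs x) (pe R p)"

definition "DTs x m X p \<longleftrightarrow> (\<exists>i<MN x m. p = MI x m i) \<or> CP x (MR x m) p \<or>
  (\<exists>k<NF x. FR x k = MR x m \<and> p = FJ x k \<and> (\<forall>d<FL x k. X (FD x k d)))"
definition "DT x m p \<longleftrightarrow> MB x m = 0 \<or> lfpb (pbnd x) (DTs x m) p"

definition "REs x X T \<longleftrightarrow> (\<exists>k<NQ x. T = QR x k) \<or> (\<exists>k<NU x. T = UQ x k 2 \<and> X (UQ x k 0))"
definition "RE x T \<longleftrightarrow> lfpb (pbnd x) (REs x) T"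

definition "UPs x R i X c \<longleftrightarrow> c = pe R i \<or> (\<exists>k<NU x. c = pe (UQ x k 2) (UQ x k 3) \<and> X (pe (UQ x k 0) (UQ x k 1)))"
definition "UPr x R i T j \<longleftrightarrow> lfpb (pbnd x) (UPs x R i) (pe T j)"

definition "BOK x f \<longleftrightarrow> (if f mod 3 = 0 then f div 3 < NQ x else if f mod 3 = 1 then RE x (f div 3)
  else RE x (pf (f div 3)) \<and> ps (f div 3) < AR x (pf (f div 3)))"
definition "BR x f = (if f mod 3 = 0 then QR x (f div 3) else if f mod 3 = 1 then f div 3 else pf (f div 3))"
definition "BN x f p = (if f mod 3 = 0 then 4 * QV x (f div 3) p else if f mod 3 = 1 then 4 * pe (f div 3) p + 1
  else 4 * pe (pf (f div 3)) (pe (ps (f div 3)) p) + 2)"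

abbreviation "Gec T p \<equiv> 4 * pe T p + 1"
abbreviation "Kgc T q p \<equiv> 4 * pe T (pe q p) + 2"
abbreviation "G2c T p \<equiv> 4 * pe T p + 3"
abbreviation "JE a b \<equiv> 3 * pe a b"
abbreviation "JK a \<equiv> 3 * a + (1 :: nat)"
abbreviation "JR T \<equiv> 3 * T + (2 :: nat)"

definition "US x X f m \<longleftrightarrow> BOK x f \<and> m < NM x \<and> MR x m = BR x f \<and> (\<forall>d<MN x m. X (JK (BN x f (MI x m d))))"

text \<open>The rules of \<open>sim\<close>, \<open>kn\<close> and \<open>rel2\<close> in their
  original order, split into four groups. Every rule becomes a bounded search for its
  parameters.\<close>

definition "JS1 x X c \<longleftrightarrow>
  (\<exists>f<pbnd x. \<exists>p<AR x (BR x f). BOK x f \<and> c = JE (BN x f p) (BN x f p)) \<or>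
  (\<exists>T<pbnd x. \<exists>p<AR x T. X (JR T) \<and> c = JE (G2c T p) (G2c T p)) \<or>
  (\<exists>a<pbnd x. \<exists>b<pbnd x. X (JE a b) \<and> c = JE b a) \<or>
  (\<exists>a<pbnd x. \<exists>b<pbnd x. \<exists>d<pbnd x. X (JE a b) \<and> X (JE b d) \<and> c = JE a d) \<or>
  (\<exists>f<pbnd x. \<exists>g<pbnd x. \<exists>k<NF x. BOK x f \<and> BOK x g \<and> BR x f = FR x k \<and> BR x g = FR x k \<and>
     (\<forall>d<FL x k. X (JE (BN x f (FD x k d)) (BN x g (FD x k d)))) \<and> c = JE (BN x f (FJ x k)) (BN x g (FJ x k)))"

definition "JS2 x X c \<longleftrightarrow>
  (\<exists>f<pbnd x. \<exists>k<NU x. BOK x f \<and> BR x f = UQ x k 0 \<and> CP x (UQ x k 2) (UQ x k 3) \<and>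
     c = JE (BN x f (UQ x k 1)) (Gec (UQ x k 2) (UQ x k 3))) \<or>
  (\<exists>f<pbnd x. \<exists>m<pbnd x. \<exists>p<AR x (BR x f). US x X f m \<and> CP x (BR x f) p \<and> c = JE (BN x f p) (G2c (BR x f) p)) \<or>
  (\<exists>k<NU x. X (JR (UQ x k 0)) \<and> CP x (UQ x k 2) (UQ x k 3) \<and> c = JE (G2c (UQ x k 0) (UQ x k 1)) (G2c (UQ x k 2) (UQ x k 3))) \<or>
  (\<exists>f<pbnd x. \<exists>m<pbnd x. US x X f m \<and> c = JR (BR x f)) \<or>
  (\<exists>k<NU x. X (JR (UQ x k 0)) \<and> c = JR (UQ x k 2))"

definition "JS3 x X c \<longleftrightarrow>
  (\<exists>a<pbnd x. \<exists>b<pbnd x. X (JK a) \<and> X (JE a b) \<and> c = JK b) \<or>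
  (\<exists>f<pbnd x. \<exists>m<pbnd x. \<exists>p<AR x (BR x f). US x X f m \<and> DT x m p \<and> c = JK (BN x f p)) \<or>
  (\<exists>f<pbnd x. \<exists>p<AR x (BR x f). BOK x f \<and> X (JK (Gec (BR x f) p)) \<and> c = JK (BN x f p)) \<or>
  (\<exists>f<pbnd x. \<exists>k<NU x. BOK x f \<and> BR x f = UQ x k 0 \<and> X (JK (Gec (UQ x k 2) (UQ x k 3))) \<and> c = JK (BN x f (UQ x k 1)))"

definition "JS4 x X c \<longleftrightarrow>
  (\<exists>f<pbnd x. \<exists>q<AR x (BR x f). \<exists>p<AR x (BR x f). BOK x f \<and> X (JK (BN x f q)) \<and> X (JK (Kgc (BR x f) q p)) \<and> c = JK (BN x f p)) \<or>
  (\<exists>f<pbnd x. \<exists>p<AR x (BR x f). BOK x f \<and> X (JK (BN x f p)) \<and> c = JK (Kgc (BR x f) p p)) \<or>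
  (\<exists>f<pbnd x. \<exists>k<NU x. BOK x f \<and> BR x f = UQ x k 0 \<and> X (JK (BN x f (UQ x k 1))) \<and> c = JK (Kgc (UQ x k 2) (UQ x k 3) (UQ x k 3))) \<or>
  (\<exists>f<pbnd x. \<exists>m<pbnd x. \<exists>q<AR x (BR x f). US x X f m \<and> c = JK (Kgc (BR x f) q q))"

definition "JS x X c \<longleftrightarrow> JS1 x X c \<or> JS2 x X c \<or> JS3 x X c \<or> JS4 x X c"
definition "JL x c \<longleftrightarrow> lfpb (pbnd x) (JS x) c"

definition "FW x T q \<longleftrightarrow> (\<exists>m<pbnd x. US x (JL x) (3 * pe T q + 2) m \<and> DT x m q)"

definition "P2 x n T q \<longleftrightarrow> q < AR x T \<and>
  ((\<exists>f<pbnd x. \<exists>m<pbnd x. US x (JL x) f m \<and> DT x m q \<and> BR x f = T \<and> JL x (JE (BN x f q) n)) \<or>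
   (JL x (JR T) \<and> CP x T q \<and> JL x (JE (G2c T q) n)) \<or>
   (\<exists>f<pbnd x. \<exists>p<AR x (BR x f). BOK x f \<and> JL x (JK (BN x f p)) \<and> JL x (JE (BN x f p) n) \<and> UPr x (BR x f) p T q \<and> FW x T q))"

definition "SL x z = (if z mod 3 = 0 then BR x (pf (z div 3)) else if z mod 3 = 1 then z div 3 else pf (z div 3))"

definition "SN x k z p = (if z mod 3 = 0 then (if DT x (ps (z div 3)) p then 2 * BN x (pf (z div 3)) p + 1 else 2 * pe k p)
  else if z mod 3 = 1 then (if CP x (z div 3) p then 2 * G2c (z div 3) p + 1 else 2 * pe k p)
  else if p = pf (ps (z div 3)) then ps (ps (z div 3))
  else if CP x (pf (z div 3)) p then 2 * G2c (pf (z div 3)) p + 1 else 2 * pe k p)"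

definition "PS x a b \<longleftrightarrow> (if a mod 2 = 0 then a = b else b mod 2 = 1 \<and> JL x (JE (a div 2) (b div 2)))"

definition "SF' x K c k T q e \<longleftrightarrow> q < AR x T \<and> (if e mod 2 = 0
  then pf (e div 2) < k \<and> ps (e div 2) < AR x (SL x (dig K c (pf (e div 2)))) \<and> UPr x (SL x (dig K c (pf (e div 2)))) (ps (e div 2)) T q
  else \<exists>R<pbnd x. \<exists>i<pbnd x. P2 x (e div 2) R i \<and> UPr x R i T q)"

definition "SO x K c k z \<longleftrightarrow> (if z mod 3 = 0 then US x (JL x) (pf (z div 3)) (ps (z div 3))
  else if z mod 3 = 1 then JL x (JR (z div 3))
  else SF' x K c k (pf (z div 3)) (pf (ps (z div 3))) (ps (ps (z div 3))))"

definition "SM x K c c' \<longleftrightarrow> (\<forall>a<NQ x. \<forall>b<NQ x. \<forall>p<QL x a. \<forall>q<QL x b. QV x a p = QV x b q \<longrightarrow>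
  PS x (SN x (dig K c' a) (dig K c (dig K c' a)) p) (SN x (dig K c' b) (dig K c (dig K c' b)) q))"

text \<open>The base \<open>K\<close> is searched for along with the digits and need not be
  computed; whatever base is found, its digits describe slots.\<close>

definition "CT x \<longleftrightarrow> (\<exists>N<2 * NQ x + 1. \<exists>K<pbnd x. \<exists>c<pbnd x. \<exists>c'<pbnd x. (\<forall>k<N. SO x K c k (dig K c k)) \<and>
  (\<forall>a<NQ x. dig K c' a < N \<and> SL x (dig K c (dig K c' a)) = QR x a) \<and> SM x K c c')"

section \<open>The coded notions belong to the class\<close>

lemma fnb_WF: "FB (\<lambda>e. WF (px e))"
  unfolding WF_def by (intro fn_reads PB.fn_intros | assumption | simp only: px_pop | rule PB.fn_popv)+

lemma fnb_CP: "FN f \<Longrightarrow> FN g \<Longrightarrow> FB (\<lambda>e. CP (px e) (f e) (g e))"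
  unfolding CP_def
proof (rule PB.fn_lfpb[OF PB.fn_bnd])
  show "FB (\<lambda>e. CPs (px (popa (popv e))) (topa e) (topv e))" unfolding CPs_def
    by (intro fn_reads PB.fn_intros | assumption | simp only: px_pop | rule PB.fn_popv)+
qed (intro PB.fn_prod_encode, auto simp: CPs_def)

lemma fnb_DT: "FN f \<Longrightarrow> FN g \<Longrightarrow> FB (\<lambda>e. DT (px e) (f e) (g e))"
  unfolding DT_def
proof (intro PB.fnb_disj PB.fnb_eq PB.fn_const fn_MB PB.fn_lfpb PB.fn_bnd)
  assume f: "FN f"
  have f': "FN (\<lambda>e. f (popa (popv e)))" by (rule PB.fn_popv[OF PB.fn_popa[OF f]])
  show "FB (\<lambda>e. DTs (px (popa (popv e))) (f (popa (popv e))) (topa e) (topv e))" unfolding DTs_def px_pop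
    by (intro f' fn_reads fnb_CP PB.fn_intros | simp only: px_pop | rule PB.fn_popv)+
qed (assumption | auto simp: DTs_def)+

lemma fnb_RE: "FN f \<Longrightarrow> FB (\<lambda>e. RE (px e) (f e))"
  unfolding RE_def
proof (rule PB.fn_lfpb[OF PB.fn_bnd])
  show "FB (\<lambda>e. REs (px (popa (popv e))) (topa e) (topv e))" unfolding REs_def
    by (intro fn_reads PB.fn_intros | assumption | simp only: px_pop | rule PB.fn_popv)+
qed (assumption | auto simp: REs_def)+

lemma fnb_UPr: "FN f \<Longrightarrow> FN g \<Longrightarrow> FN h \<Longrightarrow> FN k \<Longrightarrow> FB (\<lambda>e. UPr (px e) (f e) (g e) (h e) (k e))"
  unfolding UPr_def
proof (intro PB.fn_lfpb PB.fn_bnd PB.fn_prod_encode)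
  assume f: "FN f" and g: "FN g"
  have f': "FN (\<lambda>e. f (popa (popv e)))" "FN (\<lambda>e. g (popa (popv e)))"
    by (rule PB.fn_popv[OF PB.fn_popa[OF f]], rule PB.fn_popv[OF PB.fn_popa[OF g]])
  show "FB (\<lambda>e. UPs (px (popa (popv e))) (f (popa (popv e))) (g (popa (popv e))) (topa e) (topv e))" unfolding UPs_def px_pop
    by (intro f' fn_reads PB.fn_intros | simp only: px_pop | rule PB.fn_popv)+
qed (assumption | auto simp: UPs_def)+

lemma fnb_BOK: "FN f \<Longrightarrow> FB (\<lambda>e. BOK (px e) (f e))"
  unfolding BOK_def by (intro fn_reads fnb_RE fnb_if PB.fn_intros)

lemma fn_BR: "FN f \<Longrightarrow> FN (\<lambda>e. BR (px e) (f e))"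
  unfolding BR_def by (intro fn_reads PB.fn_intros)

lemma fn_BN: "FN f \<Longrightarrow> FN g \<Longrightarrow> FN (\<lambda>e. BN (px e) (f e) (g e))"
  unfolding BN_def by (intro fn_reads PB.fn_intros)

lemma fnb_JS:
  "FB (\<lambda>e. JS1 (px e) (topa e) (topv e))" "FB (\<lambda>e. JS2 (px e) (topa e) (topv e))"
  "FB (\<lambda>e. JS3 (px e) (topa e) (topv e))" "FB (\<lambda>e. JS4 (px e) (topa e) (topv e))"
  unfolding JS1_def JS2_def JS3_def JS4_def US_def
  by (intro fn_reads fnb_CP fnb_DT fnb_BOK fn_BR fn_BN PB.fn_bnd PB.fn_intros | assumption | simp only: px_pop | rule PB.fn_popv)+

lemma JS_mono:
  assumes "\<And>p. X p \<Longrightarrow> Y p"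
  shows "JS x X c \<Longrightarrow> JS x Y c"
proof -
  have X: "X p \<longrightarrow> Y p" for p using assms by blast
  have us: "US x X f m \<longrightarrow> US x Y f m" for f m
    unfolding US_def by (intro imp_refl conj_mono all_mono imp_mono X)
  have "JS x X c \<longrightarrow> JS x Y c" unfolding JS_def JS1_def JS2_def JS3_def JS4_def
    by (intro imp_refl disj_mono conj_mono ex_mono all_mono imp_mono X us)
  then show "JS x X c \<Longrightarrow> JS x Y c" by blast
qed

lemma fnb_JL:
  assumes f: "FN f"
  shows "FB (\<lambda>e. JL (px e) (f e))"
proof -
  have b: "FB (\<lambda>e. JS (px (popa (popv e))) (topa e) (topv e))" unfolding JS_def px_pop
    by (intro fnb_JS PB.fnb_disj)
  show ?thesis unfolding JL_def by (rule PB.fn_lfpb[OF PB.fn_bnd f b]) (rule JS_mono)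
qed

lemma fnb_US: "FN f \<Longrightarrow> FN g \<Longrightarrow> FB (\<lambda>e. US (px e) (JL (px e)) (f e) (g e))"
  unfolding US_def
  by (intro fn_reads fnb_JL fnb_BOK fn_BR fn_BN PB.fn_intros | assumption | simp only: px_pop | rule PB.fn_popv)+

lemma fnb_FW: "FN f \<Longrightarrow> FN g \<Longrightarrow> FB (\<lambda>e. FW (px e) (f e) (g e))"
  unfolding FW_def
  by (intro fnb_US fnb_DT PB.fn_bnd PB.fn_intros | assumption | simp only: px_pop | rule PB.fn_popv)+

lemma fnb_P2: "FN f \<Longrightarrow> FN g \<Longrightarrow> FN h \<Longrightarrow> FB (\<lambda>e. P2 (px e) (f e) (g e) (h e))"
  unfolding P2_def
  by (intro fn_reads fnb_US fnb_FW fnb_UPr fnb_DT fnb_CP fnb_BOK fn_BR fn_BN fnb_JL PB.fn_bnd PB.fn_intros | assumption | simp only: px_pop | rule PB.fn_popv)+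

lemma fn_SL: "FN f \<Longrightarrow> FN (\<lambda>e. SL (px e) (f e))"
  unfolding SL_def by (intro fn_BR PB.fn_intros)

lemma fn_SN: "FN f \<Longrightarrow> FN g \<Longrightarrow> FN h \<Longrightarrow> FN (\<lambda>e. SN (px e) (f e) (g e) (h e))"
  unfolding SN_def by (intro fnb_DT fnb_CP fn_BN PB.fn_intros)

lemma fnb_PS: "FN f \<Longrightarrow> FN g \<Longrightarrow> FB (\<lambda>e. PS (px e) (f e) (g e))"
  unfolding PS_def by (intro fnb_if fnb_JL PB.fn_intros)

lemma fnb_SF: "FN f \<Longrightarrow> FN g \<Longrightarrow> FN h \<Longrightarrow> FN i \<Longrightarrow> FN j \<Longrightarrow> FN k \<Longrightarrow>
    FB (\<lambda>e. SF' (px e) (f e) (g e) (h e) (i e) (j e) (k e))"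
  unfolding SF'_def
  by (intro fn_reads fnb_if fnb_P2 fnb_UPr fn_SL PB.fn_bnd PB.fn_intros | assumption | simp only: px_pop | rule PB.fn_popv)+

lemma fnb_SO: "FN f \<Longrightarrow> FN g \<Longrightarrow> FN h \<Longrightarrow> FN k \<Longrightarrow> FB (\<lambda>e. SO (px e) (f e) (g e) (h e) (k e))"
  unfolding SO_def
  by (intro fnb_if fnb_US fnb_JL fnb_SF PB.fn_intros)

lemma fnb_SM: "FN f \<Longrightarrow> FN g \<Longrightarrow> FN h \<Longrightarrow> FB (\<lambda>e. SM (px e) (f e) (g e) (h e))"
  unfolding SM_def
  by (intro fn_reads fnb_PS fn_SN PB.fn_intros | assumption | simp only: px_pop | rule PB.fn_popv)+

lemma fnb_CT: "FB (\<lambda>e. CT (px e))"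
  unfolding CT_def
  by (intro fn_reads fnb_SO fnb_SM fn_SL PB.fn_bnd PB.fn_intros | assumption | simp only: px_pop | rule PB.fn_popv)+

section \<open>Sizes and faithfulness of the codes\<close>

declare enc_problem.simps [simp del] toks.simps [simp del]

text \<open>Pairing doubles the number of bits and adds one; all size exponents below arise by
  iterating this.\<close>

lemma pe_less: "a < 2 ^ m \<Longrightarrow> b < 2 ^ m \<Longrightarrow> pe a b < 2 ^ (2 * m + 1)"
proof -
  assume ab: "a < 2 ^ m" "b < 2 ^ m"
  define A where "A = 2 ^ m - (1 :: nat)"
  have A: "2 ^ m = A + 1" "a \<le> A" "b \<le> A" using ab by (simp_all add: A_def)
  have "2 * pe a b = (a + b) * (a + b + 1) + 2 * a" by (simp add: prod_encode_def triangle_def)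
  also have "\<dots> \<le> (A + A) * (A + A + 1) + 2 * A" using A by (intro add_le_mono mult_le_mono) auto
  also have "\<dots> < 4 * ((A + 1) * (A + 1))" by (simp add: algebra_simps)
  also have "\<dots> = 2 * 2 ^ (2 * m + 1)" unfolding A(1)[symmetric] by (simp add: power_add power_mult power2_eq_square mult_2)
  finally show ?thesis by simp
qed

lemma pe_decode [simp]: "pe (pf c) (ps c) = c"
  by simp

lemma lfpb_sound: "lfpb b \<Phi> i \<Longrightarrow> (\<And>k. k < b \<Longrightarrow> \<Phi> Y k \<Longrightarrow> Y k) \<Longrightarrow> Y i"
  unfolding lfpb_def by blast

fun cn :: "nm \<Rightarrow> nat" where
  "cn (Va v) = 4 * v" | "cn (Ge T p) = Gec T p" | "cn (Kg T q p) = Kgc T q p" | "cn (G2 T p) = G2c T p"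

fun cb :: "bid \<Rightarrow> nat" where
  "cb (At k) = 3 * k" | "cb (Gn T) = 3 * T + 1" | "cb (Kn T q) = 3 * pe T q + 2"

fun cpn :: "pname \<Rightarrow> nat" where
  "cpn (PN l p) = 2 * pe l p" | "cpn (PB n) = 2 * cn n + 1"

fun csl :: "slot \<Rightarrow> nat" where
  "csl (SC f m) = 3 * pe (cb f) m" | "csl (SR T) = 3 * T + 1" | "csl (SF T q e) = 3 * pe T (pe q (cpn e)) + 2"

lemma num3: obtains k where "(c :: nat) = 3 * k" | k where "c = 3 * k + 1" | k where "c = 3 * k + 2"
proof -
  have "c = 3 * (c div 3) \<or> c = 3 * (c div 3) + 1 \<or> c = 3 * (c div 3) + 2" by presburger
  then show ?thesis using that by blast
qed

text \<open>Every number is the code of some term, so a search over numbers needs no test for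
  well-formed codes; the same holds for names, certificate values and slots.\<close>

lemma cb_surj: obtains F where "f = cb F"
proof (cases f rule: num3)
  case (1 k) then show ?thesis using that[of "At k"] by simp
next
  case (2 k) then show ?thesis using that[of "Gn k"] by simp
next
  case (3 k) then show ?thesis using that[of "Kn (pf k) (ps k)"] by simp
qed

lemma cn_surj: obtains a where "c = cn a"
proof -
  have "c = 4 * (c div 4) \<or> c = 4 * (c div 4) + 1 \<or> c = 4 * (c div 4) + 2 \<or> c = 4 * (c div 4) + 3" by presburger
  then consider "c = cn (Va (c div 4))" | "c = cn (Ge (pf (c div 4)) (ps (c div 4)))"
    | "c = cn (Kg (pf (c div 4)) (pf (ps (c div 4))) (ps (ps (c div 4))))" | "c = cn (G2 (pf (c div 4)) (ps (c div 4)))"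
    by (simp only: cn.simps pe_decode) blast
  then show ?thesis using that by cases blast+
qed

lemma cpn_surj: obtains a where "c = cpn a"
proof -
  obtain n where n: "c div 2 = cn n" by (rule cn_surj)
  have "c = 2 * (c div 2) \<or> c = 2 * (c div 2) + 1" by presburger
  then consider "c = cpn (PN (pf (c div 2)) (ps (c div 2)))" | "c = cpn (PB n)"
    by (simp only: cpn.simps pe_decode n[symmetric]) blast
  then show ?thesis using that by cases blast+
qed

lemma csl_surj: obtains a where "c = csl a"
proof (cases c rule: num3)
  case (1 k)
  obtain f where "pf k = cb f" by (rule cb_surj)
  then show ?thesis using that[of "SC f (ps k)"] 1 pe_decode[of k] by (simp only: csl.simps)
next
  case (2 k) then show ?thesis using that[of "SR k"] by simp
next
  case (3 k)
  obtain e where "ps (ps k) = cpn e" by (rule cpn_surj)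
  then show ?thesis using that[of "SF (pf k) (pf (ps k)) e"] 3 pe_decode[of k] pe_decode[of "ps k"] by (simp only: csl.simps)
qed

lemma cn_eq [simp]: "cn a = cn b \<longleftrightarrow> a = b"
  by (cases a; cases b; simp; presburger)

lemma code_cases:
  "(3 * a + 1) mod 3 = Suc 0" "(3 * a + 1) div 3 = a" "(3 * a + 2) mod 3 = 2" "(3 * a + 2) div 3 = (a :: nat)"
  "Suc (3 * a) mod 3 = Suc 0" "Suc (3 * a) div 3 = a" "Suc (Suc (3 * a)) mod 3 = 2" "Suc (Suc (3 * a)) div 3 = a"
  by presburger+

context wf_problem
begin

abbreviation "x \<equiv> (S, Q)"
abbreviation "B \<equiv> pbnd (S, Q)"
abbreviation "W \<equiv> length (enc_problem (S, Q))"

lemmas sizes = at_parts(1,3,5,7,9)[of S Q]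

lemma uid_iff: "U R i T j \<longleftrightarrow> (\<exists>k<NU x. R = UQ x k 0 \<and> i = UQ x k 1 \<and> T = UQ x k 2 \<and> j = UQ x k 3)"
  unfolding in_set_conv_nth sizes using uid_eq[of _ S Q] by fastforce

lemma fd_iff: "(R, D, j) \<in> set (fds S) \<longleftrightarrow> (\<exists>k<NF x. R = FR x k \<and> D = map (FD x k) [0..<FL x k] \<and> j = FJ x k)"
  unfolding in_set_conv_nth sizes using fd_eq[of _ S Q] by fastforce

lemma uidI: "k < NU x \<Longrightarrow> U (UQ x k 0) (UQ x k 1) (UQ x k 2) (UQ x k 3)"
  using uid_iff by blast

lemma fdI: "k < NF x \<Longrightarrow> (FR x k, map (FD x k) [0..<FL x k], FJ x k) \<in> set (fds S)"
  using fd_iff by blast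

lemma meth_simps:
  assumes "m < nmeth"
  shows "mrel m = MR x m" "mins m = map (MI x m) [0..<MN x m]" "mbound m = None \<longleftrightarrow> MB x m = 0"
  using meth_eq[OF assms, of Q] by (simp_all add: mrel_def mins_def mbound_def)

lemma atom_simps:
  assumes "k < length Q"
  shows "fst (Q ! k) = QR x k" "snd (Q ! k) = map (QV x k) [0..<QL x k]"
  using atom_eq[OF assms, of S] by simp_all

text \<open>Nine of the ten factors \<open>W + 2\<close> in the exponent of \<open>B\<close> already
  give \<open>2 ^ 9 = 512\<close>. This margin covers all single codes, whose lengths are linear in
  \<open>W\<close>.\<close>

lemma pow_B: "j \<le> 512 * (W + 2) \<Longrightarrow> 2 ^ j \<le> B"
proof -
  assume j: "j \<le> 512 * (W + 2)"
  have "2 ^ 9 \<le> (W + 2) ^ 9" by (rule power_mono) auto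
  then have "512 * (W + 2) \<le> (W + 2) ^ 9 * (W + 2)" by (intro mult_le_mono1) simp
  also have "\<dots> = (W + 2) ^ Suc 9" by (rule power_Suc2[symmetric])
  also have "Suc 9 = 10" by simp
  finally show ?thesis unfolding pbnd_def using j by (intro power_increasing) auto
qed

lemma less_B: "z < 2 ^ j \<Longrightarrow> j \<le> 512 * (W + 2) \<Longrightarrow> z < B"
  using pow_B less_le_trans by blast

lemma nrel_small: "nrel < 2 ^ W" and nmeth_small: "nmeth < 2 ^ W" and nq_small: "length Q < 2 ^ W"
  using TK_less[of x] unfolding sizes[symmetric] NR_def NM_def NQ_def by blast+

lemma ar_small: "T < nrel \<Longrightarrow> ar T < 2 ^ W"
  using TK_less[of x] unfolding AR_eq[of T S Q, symmetric] AR_def sizes(1) by simp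

lemma pos_small: "T < nrel \<Longrightarrow> p < ar T \<Longrightarrow> p < 2 ^ W"
  using ar_small less_trans by blast

lemma pair_small: "a < 2 ^ W \<Longrightarrow> b < 2 ^ W \<Longrightarrow> pe a b < B"
  by (rule less_B[OF pe_less]) auto

lemma pos_pair: "T < nrel \<Longrightarrow> p < ar T \<Longrightarrow> pe T p < B"
  by (rule pair_small[OF less_trans[OF _ nrel_small] pos_small])

lemma small_B: "a < 2 ^ W \<Longrightarrow> a < B"
  by (rule less_B) auto

lemma CPs_closed: "CPs y (lfpb b (CPs y)) c \<Longrightarrow> c < b \<Longrightarrow> lfpb b (CPs y) c"
proof (rule lfpb_closed)
  fix X Y k assume "\<And>p. X p \<Longrightarrow> Y p" "CPs y X k"
  then show "CPs y Y k" by (auto simp: CPs_def)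
qed

text \<open>Soundness decodes the judgements. For completeness, the conclusion of each rule must be
  seen to have a code below \<open>B\<close>, since the fixed point is cut off there; the
  equivalences that follow have the same shape.\<close>

lemma CP_eq: "CP x R p \<longleftrightarrow> const_pos R p"
proof
  assume "CP x R p"
  then have "lfpb B (CPs x) (pe R p)" by (simp add: CP_def)
  then have "const_pos (pf (pe R p)) (ps (pe R p))"
  proof (rule lfpb_sound[where Y = "\<lambda>c. const_pos (pf c) (ps c)"])
    fix c assume "CPs x (\<lambda>c. const_pos (pf c) (ps c)) c"
    then consider k where "k < NF x" "c = pe (FR x k) (FJ x k)" "\<forall>d<FL x k. const_pos (FR x k) (FD x k d)"
      | k where "k < NU x" "c = pe (UQ x k 0) (UQ x k 1)" "const_pos (UQ x k 2) (UQ x k 3)" unfolding CPs_def by auto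
    then show "const_pos (pf c) (ps c)"
    proof cases
      case (1 k)
      have "const_pos (FR x k) (FJ x k)" by (rule const_fd[OF fdI[OF 1(1)]]) (use 1(3) in auto)
      then show ?thesis using 1(2) by simp
    next
      case (2 k)
      then show ?thesis using const_uid[OF uidI[OF 2(1)]] by simp
    qed
  qed
  then show "const_pos R p" by simp
next
  assume "const_pos R p"
  then show "CP x R p"
  proof induction
    case (const_fd R D j)
    obtain k where k: "k < NF x" "R = FR x k" "D = map (FD x k) [0..<FL x k]" "j = FJ x k" using const_fd.hyps fd_iff by blast
    have "CPs x (lfpb B (CPs x)) (pe R j)" unfolding CPs_def[of x "lfpb B (CPs x)"]
      using k const_fd.IH by (intro disjI1 exI[of _ k]) (auto simp: CP_def)
    moreover have "pe R j < B" using fd_wf[OF const_fd.hyps(1)] by (intro pos_pair) auto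
    ultimately show ?case unfolding CP_def by (rule CPs_closed)
  next
    case (const_uid R i T j)
    obtain k where k: "k < NU x" "R = UQ x k 0" "i = UQ x k 1" "T = UQ x k 2" "j = UQ x k 3" using const_uid.hyps uid_iff by blast
    have "CPs x (lfpb B (CPs x)) (pe R i)" unfolding CPs_def[of x "lfpb B (CPs x)"]
      using k const_uid.IH by (intro disjI2 exI[of _ k]) (auto simp: CP_def)
    moreover have "pe R i < B" using uid_wf[OF const_uid.hyps(1)] by (intro pos_pair) auto
    ultimately show ?case unfolding CP_def by (rule CPs_closed)
  qed
qed

lemma const_rel: "const_pos R p \<Longrightarrow> R < nrel"
  by (erule const_pos.cases) (auto dest: fd_wf uid_wf)

lemma DTs_closed: "DTs y m (lfpb b (DTs y m)) c \<Longrightarrow> c < b \<Longrightarrow> lfpb b (DTs y m) c"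
proof (rule lfpb_closed)
  fix X Y k assume "\<And>p. X p \<Longrightarrow> Y p" "DTs y m X k"
  then show "DTs y m Y k" by (auto simp: DTs_def)
qed

lemma DT_eq: "m < nmeth \<Longrightarrow> DT x m p \<longleftrightarrow> det m p"
proof -
  assume m: "m < nmeth"
  let ?X = "set (mins m)"
  have "lfpb B (DTs x m) p \<longleftrightarrow> fdcl (mrel m) ?X p"
  proof
    assume "lfpb B (DTs x m) p"
    then show "fdcl (mrel m) ?X p"
    proof (rule lfpb_sound)
      fix c assume "DTs x m (fdcl (mrel m) ?X) c"
      then consider "c \<in> ?X" | "const_pos (mrel m) c"
        | k where "k < NF x" "FR x k = mrel m" "c = FJ x k" "\<forall>d<FL x k. fdcl (mrel m) ?X (FD x k d)"
        unfolding DTs_def meth_simps[OF m] CP_eq by auto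
      then show "fdcl (mrel m) ?X c"
      proof cases
        case (3 k)
        have "fdcl (mrel m) ?X (FJ x k)"
          by (rule fdcl_fd[of _ "map (FD x k) [0..<FL x k]"]) (use 3 fdI[OF 3(1)] in auto)
        then show ?thesis using 3(3) by simp
      qed (auto intro: fdcl.fdcl_base fdcl.fdcl_const)
    qed
  next
    assume "fdcl (mrel m) ?X p"
    then show "lfpb B (DTs x m) p"
    proof induction
      case (fdcl_base p)
      then have "DTs x m (lfpb B (DTs x m)) p" unfolding DTs_def[of x m "lfpb B (DTs x m)"] meth_simps[OF m] by auto
      moreover have "p < B" using meth_wf[OF m] fdcl_base by (intro small_B pos_small) auto
      ultimately show ?case by (rule DTs_closed)
    next
      case (fdcl_const p)
      then have "DTs x m (lfpb B (DTs x m)) p" unfolding DTs_def[of x m "lfpb B (DTs x m)"] meth_simps[OF m] CP_eq by auto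
      moreover have "p < B" using const_wf[OF fdcl_const] const_rel[OF fdcl_const] by (intro small_B pos_small) auto
      ultimately show ?case by (rule DTs_closed)
    next
      case (fdcl_fd D j)
      obtain k where k: "k < NF x" "mrel m = FR x k" "D = map (FD x k) [0..<FL x k]" "j = FJ x k" using fdcl_fd.hyps fd_iff by blast
      then have "DTs x m (lfpb B (DTs x m)) j" unfolding DTs_def[of x m "lfpb B (DTs x m)"]
        using fdcl_fd.IH meth_simps(1)[OF m] by (intro disjI2 exI[of _ k]) auto
      moreover have "j < B" using fd_wf[OF fdcl_fd.hyps(1)] by (intro small_B pos_small) auto
      ultimately show ?case by (rule DTs_closed)
    qed
  qed
  then show ?thesis unfolding DT_def det_def meth_simps(3)[OF m] by blast
qed

lemma REs_closed: "REs y (lfpb b (REs y)) c \<Longrightarrow> c < b \<Longrightarrow> lfpb b (REs y) c"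
proof (rule lfpb_closed)
  fix X Y k assume "\<And>p. X p \<Longrightarrow> Y p" "REs y X k"
  then show "REs y Y k" by (auto simp: REs_def)
qed

lemma atom_in: "k < length Q \<Longrightarrow> (QR x k, snd (Q ! k)) \<in> set Q"
  using atom_simps(1)[of k] nth_mem[of k Q] by (metis prod.collapse)

lemma RE_eq: "RE x T \<longleftrightarrow> reach T"
proof
  assume "RE x T"
  then have "lfpb B (REs x) T" by (simp add: RE_def)
  then show "reach T"
  proof (rule lfpb_sound)
    fix c assume "REs x reach c"
    then consider k where "k < length Q" "c = QR x k" | k where "k < NU x" "c = UQ x k 2" "reach (UQ x k 0)"
      unfolding REs_def sizes by auto
    then show "reach c"
    proof cases
      case (1 k)
      then show ?thesis using reach_atom[OF atom_in[OF 1(1)]] by simp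
    next
      case (2 k)
      then show ?thesis using reach_uid[OF _ uidI[OF 2(1)]] by simp
    qed
  qed
next
  assume "reach T"
  then show "RE x T"
  proof induction
    case (reach_atom T vs)
    obtain k where k: "k < length Q" "Q ! k = (T, vs)" using reach_atom by (metis in_set_conv_nth)
    have "REs x (lfpb B (REs x)) T" unfolding REs_def[of x "lfpb B (REs x)"] sizes using k atom_simps(1)[of k] by (intro disjI1 exI[of _ k]) auto
    moreover have "T < B" using reach_wf[OF reach.reach_atom[OF reach_atom]] nrel_small by (intro small_B) auto
    ultimately show ?case unfolding RE_def by (rule REs_closed)
  next
    case (reach_uid R i T j)
    obtain k where k: "k < NU x" "R = UQ x k 0" "i = UQ x k 1" "T = UQ x k 2" "j = UQ x k 3" using reach_uid.hyps uid_iff by blast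
    have "REs x (lfpb B (REs x)) T" unfolding REs_def[of x "lfpb B (REs x)"] using k reach_uid.IH by (intro disjI2 exI[of _ k]) (auto simp: RE_def)
    moreover have "T < B" using uid_wf[OF reach_uid.hyps(2)] nrel_small by (intro small_B) auto
    ultimately show ?case unfolding RE_def by (rule REs_closed)
  qed
qed

lemma UPs_closed: "UPs y R i (lfpb b (UPs y R i)) c \<Longrightarrow> c < b \<Longrightarrow> lfpb b (UPs y R i) c"
proof (rule lfpb_closed)
  fix X Y k assume "\<And>p. X p \<Longrightarrow> Y p" "UPs y R i X k"
  then show "UPs y R i Y k" by (auto simp: UPs_def)
qed

lemma UPr_sound: "UPr x R i T j \<Longrightarrow> ((R, i), (T, j)) \<in> up"
proof -
  assume "UPr x R i T j"
  then have "lfpb B (UPs x R i) (pe T j)" by (simp add: UPr_def)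
  then have "((R, i), prod_decode (pe T j)) \<in> up"
  proof (rule lfpb_sound[where Y = "\<lambda>c. ((R, i), prod_decode c) \<in> up"])
    fix c assume "UPs x R i (\<lambda>c. ((R, i), prod_decode c) \<in> up) c"
    then consider "c = pe R i" | k where "k < NU x" "c = pe (UQ x k 2) (UQ x k 3)" "((R, i), (UQ x k 0, UQ x k 1)) \<in> up"
      unfolding UPs_def by auto
    then show "((R, i), prod_decode c) \<in> up"
    proof cases
      case (2 k)
      then show ?thesis using up_step[OF 2(3) uidI[OF 2(1)]] by simp
    qed simp
  qed
  then show ?thesis by simp
qed

lemma UPr_complete: "((R, i), (T, j)) \<in> up \<Longrightarrow> R < nrel \<Longrightarrow> i < ar R \<Longrightarrow> UPr x R i T j"
proof (induction rule: up_induct)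
  case refl
  have "UPs x R i (lfpb B (UPs x R i)) (pe R i)" unfolding UPs_def[of x R i "lfpb B (UPs x R i)"] by simp
  moreover have "pe R i < B" using refl by (intro pos_pair) auto
  ultimately show ?case unfolding UPr_def by (rule UPs_closed)
next
  case (step T j T' j')
  obtain k where k: "k < NU x" "T = UQ x k 0" "j = UQ x k 1" "T' = UQ x k 2" "j' = UQ x k 3" using step.hyps uid_iff by blast
  have "UPs x R i (lfpb B (UPs x R i)) (pe T' j')" unfolding UPs_def[of x R i "lfpb B (UPs x R i)"]
    using k step.IH[OF step.prems] by (intro disjI2 exI[of _ k]) (auto simp: UPr_def)
  moreover have "pe T' j' < B" using uid_wf[OF step.hyps(2)] by (intro pos_pair) auto
  ultimately show ?case unfolding UPr_def by (rule UPs_closed)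
qed

lemma BOK_eq: "BOK x (cb F) \<longleftrightarrow> bok F"
proof (cases F)
  case (Kn T q)
  have "reach T \<and> q < AR x T \<longleftrightarrow> reach T \<and> q < ar T" using reach_wf[of T] AR_eq[of T S Q] by auto
  then show ?thesis using Kn by (simp add: BOK_def code_cases RE_eq)
qed (simp_all add: BOK_def code_cases sizes RE_eq)

lemma BR_eq: "bok F \<Longrightarrow> BR x (cb F) = brel F"
  by (cases F) (simp_all add: BR_def code_cases atom_simps)

lemma bok_nrel: "bok F \<Longrightarrow> brel F < nrel"
  using bok_reach reach_wf by blast

lemma AR_BR: "bok F \<Longrightarrow> AR x (BR x (cb F)) = ar (brel F)"
  using bok_nrel[of F] AR_eq[of "brel F" S Q] by (simp add: BR_eq)

lemma BN_eq: "bok F \<Longrightarrow> p < ar (brel F) \<Longrightarrow> BN x (cb F) p = cn (bnm F p)"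
proof (cases F)
  case (At k)
  assume "bok F" "p < ar (brel F)"
  then have "k < length Q" "p < length (snd (Q ! k))" using At query_wf[of k] by auto
  then show ?thesis using At atom_simps(2)[of k] by (simp add: BN_def)
qed (simp_all add: BN_def code_cases)

lemma code_mult: "z < 2 ^ j \<Longrightarrow> 3 * z + 2 < (2 :: nat) ^ (j + 2)" "z < 2 ^ j \<Longrightarrow> 4 * z + 3 < (2 :: nat) ^ (j + 2)"
  unfolding power_add by auto

lemma pow_up: "z < 2 ^ j \<Longrightarrow> j \<le> k \<Longrightarrow> z < (2 :: nat) ^ k"
  by (erule less_le_trans) (rule power_increasing, auto)

lemma cb_small: "bok F \<Longrightarrow> cb F < 2 ^ (2 * W + 3)"
proof (cases F)
  case (At k)
  assume "bok F"
  then have "3 * k + 2 < 2 ^ (W + 2)" using At nq_small by (intro code_mult) auto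
  then show ?thesis using At pow_up[of "3 * k" "W + 2" "2 * W + 3"] by simp
next
  case (Gn T)
  assume "bok F"
  then have "3 * T + 2 < 2 ^ (W + 2)" using Gn nrel_small reach_wf[of T] by (intro code_mult) auto
  then show ?thesis using Gn pow_up[of "3 * T + 1" "W + 2" "2 * W + 3"] by simp
next
  case (Kn T q)
  assume b: "bok F"
  have "3 * pe T q + 2 < 2 ^ ((2 * W + 1) + 2)"
    by (intro code_mult pe_less pos_small[of T q] less_trans[OF _ nrel_small]) (use b Kn reach_wf in auto)
  then show ?thesis unfolding Kn cb.simps by (rule pow_up) simp
qed

text \<open>The worst case is \<open>Kg\<close> with two nested pairings, of
  \<open>2 * W + 1\<close> and then \<open>4 * W + 3\<close> bits; the factor 4 for the constructor
  adds two more.\<close>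

lemma cn_small:
  "v < 2 ^ W \<Longrightarrow> cn (Va v) < 2 ^ (4 * W + 5)"
  "T < nrel \<Longrightarrow> p < ar T \<Longrightarrow> cn (Ge T p) < 2 ^ (4 * W + 5)"
  "T < nrel \<Longrightarrow> p < ar T \<Longrightarrow> q < ar T \<Longrightarrow> cn (Kg T q p) < 2 ^ (4 * W + 5)"
  "T < nrel \<Longrightarrow> p < ar T \<Longrightarrow> cn (G2 T p) < 2 ^ (4 * W + 5)"
proof -
  have up: "z < 2 ^ (2 * W + 1) \<Longrightarrow> 4 * z + 3 < 2 ^ (4 * W + 5)" for z :: nat
    by (rule pow_up[OF code_mult(2)], assumption) simp
  show "v < 2 ^ W \<Longrightarrow> cn (Va v) < 2 ^ (4 * W + 5)" using up[of v] pow_up[of v W "2 * W + 1"] by simp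
  show "T < nrel \<Longrightarrow> p < ar T \<Longrightarrow> cn (Ge T p) < 2 ^ (4 * W + 5)"
    using up[of "pe T p"] pe_less[OF less_trans[OF _ nrel_small] pos_small, of T T p] by simp
  show "T < nrel \<Longrightarrow> p < ar T \<Longrightarrow> cn (G2 T p) < 2 ^ (4 * W + 5)"
    using up[of "pe T p"] pe_less[OF less_trans[OF _ nrel_small] pos_small, of T T p] by simp
  assume T: "T < nrel" "p < ar T" "q < ar T"
  have q: "pe q p < 2 ^ (2 * W + 1)" using T by (intro pe_less pos_small[of T])
  have "T < 2 ^ (2 * W + 1)" using pow_up[of T W "2 * W + 1"] T(1) nrel_small by simp
  from code_mult(2)[OF pe_less[OF this q]] have "4 * pe T (pe q p) + 3 < 2 ^ (4 * W + 5)" by (rule pow_up) simp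
  then show "cn (Kg T q p) < 2 ^ (4 * W + 5)" by simp
qed

lemma bnm_small: "bok F \<Longrightarrow> p < ar (brel F) \<Longrightarrow> cn (bnm F p) < 2 ^ (4 * W + 5)"
proof (cases F)
  case (At k)
  assume "bok F" "p < ar (brel F)"
  then have "k < length Q" "p < length (snd (Q ! k))" using At query_wf[of k] by auto
  then have "snd (Q ! k) ! p < 2 ^ W" using atom_simps(2)[of k] TK_less[of x] by (simp add: QV_def)
  then show ?thesis using At cn_small(1) by simp
next
  case (Gn T)
  then show "bok F \<Longrightarrow> p < ar (brel F) \<Longrightarrow> ?thesis" using cn_small(2)[of T p] reach_wf by simp
next
  case (Kn T q)
  then show "bok F \<Longrightarrow> p < ar (brel F) \<Longrightarrow> ?thesis" using cn_small(3)[of T p q] reach_wf by simp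
qed

lemma US_eq: "US x X (cb F) m \<longleftrightarrow> bok F \<and> m < nmeth \<and> mrel m = brel F \<and> (\<forall>p\<in>set (mins m). X (JK (cn (bnm F p))))"
proof (cases "bok F \<and> m < nmeth \<and> mrel m = brel F")
  case True
  then have "BN x (cb F) (MI x m d) = cn (bnm F (MI x m d))" if "d < MN x m" for d
    using meth_wf[of m] that meth_simps(2)[of m] by (intro BN_eq) auto
  then show ?thesis using True unfolding US_def BOK_eq sizes by (auto simp: meth_simps BR_eq)
next
  case False
  then show ?thesis unfolding US_def BOK_eq sizes by (auto simp: meth_simps BR_eq)
qed

end

section \<open>Correctness of the coded mutual fixed point\<close>

context wf_problem
begin

lemma fBN: "bok F \<Longrightarrow> (R, D, j) \<in> set (fds S) \<Longrightarrow> brel F = R \<Longrightarrow> d \<in> set D \<or> d = j \<Longrightarrow> BN x (cb F) d = cn (bnm F d)"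
  using fd_wf[of R D j] BN_eq[of F d] by auto

lemma uBN: "bok F \<Longrightarrow> U (brel F) i T j \<Longrightarrow> BN x (cb F) i = cn (bnm F i)"
  using uid_wf BN_eq by blast

text \<open>Each rule in terms of codes, for any set \<open>X\<close>. The size premises make the
  bounded searches in \<open>JS\<close> find the parameters of the rule.\<close>

lemma JS_intros:
  "bok f \<Longrightarrow> p < ar (brel f) \<Longrightarrow> JS x X (JE (cn (bnm f p)) (cn (bnm f p)))"
  "T < nrel \<Longrightarrow> p < ar T \<Longrightarrow> X (JR T) \<Longrightarrow> JS x X (JE (cn (G2 T p)) (cn (G2 T p)))"
  "cn a < B \<Longrightarrow> cn b < B \<Longrightarrow> X (JE (cn a) (cn b)) \<Longrightarrow> JS x X (JE (cn b) (cn a))"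
  "cn a < B \<Longrightarrow> cn b < B \<Longrightarrow> cn c < B \<Longrightarrow> X (JE (cn a) (cn b)) \<Longrightarrow> X (JE (cn b) (cn c)) \<Longrightarrow> JS x X (JE (cn a) (cn c))"
  "bok f \<Longrightarrow> bok g \<Longrightarrow> brel f = R \<Longrightarrow> brel g = R \<Longrightarrow> (R, D, j) \<in> set (fds S) \<Longrightarrow>
     (\<And>d. d \<in> set D \<Longrightarrow> X (JE (cn (bnm f d)) (cn (bnm g d)))) \<Longrightarrow> JS x X (JE (cn (bnm f j)) (cn (bnm g j)))"
  "bok f \<Longrightarrow> U (brel f) i T j \<Longrightarrow> const_pos T j \<Longrightarrow> JS x X (JE (cn (bnm f i)) (cn (Ge T j)))"
  "US x X (cb f) m \<Longrightarrow> const_pos (brel f) p \<Longrightarrow> JS x X (JE (cn (bnm f p)) (cn (G2 (brel f) p)))"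
  "X (JR R) \<Longrightarrow> U R i T j \<Longrightarrow> const_pos T j \<Longrightarrow> JS x X (JE (cn (G2 R i)) (cn (G2 T j)))"
  "US x X (cb f) m \<Longrightarrow> JS x X (JR (brel f))"
  "X (JR R) \<Longrightarrow> U R i T j \<Longrightarrow> JS x X (JR T)"
  "cn a < B \<Longrightarrow> cn b < B \<Longrightarrow> X (JK (cn a)) \<Longrightarrow> X (JE (cn a) (cn b)) \<Longrightarrow> JS x X (JK (cn b))"
  "US x X (cb f) m \<Longrightarrow> det m p \<Longrightarrow> p < ar (brel f) \<Longrightarrow> JS x X (JK (cn (bnm f p)))"
  "bok f \<Longrightarrow> p < ar (brel f) \<Longrightarrow> X (JK (cn (Ge (brel f) p))) \<Longrightarrow> JS x X (JK (cn (bnm f p)))"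
  "bok f \<Longrightarrow> U (brel f) i T j \<Longrightarrow> X (JK (cn (Ge T j))) \<Longrightarrow> JS x X (JK (cn (bnm f i)))"
  "bok f \<Longrightarrow> q < ar (brel f) \<Longrightarrow> p < ar (brel f) \<Longrightarrow> X (JK (cn (bnm f q))) \<Longrightarrow> X (JK (cn (Kg (brel f) q p))) \<Longrightarrow> JS x X (JK (cn (bnm f p)))"
  "bok f \<Longrightarrow> p < ar (brel f) \<Longrightarrow> X (JK (cn (bnm f p))) \<Longrightarrow> JS x X (JK (cn (Kg (brel f) p p)))"
  "bok f \<Longrightarrow> U (brel f) i T j \<Longrightarrow> X (JK (cn (bnm f i))) \<Longrightarrow> JS x X (JK (cn (Kg T j j)))"
  "US x X (cb f) m \<Longrightarrow> q < ar (brel f) \<Longrightarrow> JS x X (JK (cn (Kg (brel f) q q)))"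
proof -
  have cB: "cb f < B" if "bok f" for f by (rule less_B[OF cb_small[OF that]]) simp
  have mB: "m < B" if "m < nmeth" for m using small_B nmeth_small that by simp
  note b = BOK_eq AR_BR BR_eq CP_eq
  show "JS x X (JE (cn (bnm f p)) (cn (bnm f p)))" if h: "bok f" "p < ar (brel f)"
  proof -
    have "cb f < B \<and> p < AR x (BR x (cb f)) \<and> BOK x (cb f) \<and> JE (cn (bnm f p)) (cn (bnm f p)) = JE (BN x (cb f) p) (BN x (cb f) p)"
      using h cB b BN_eq[OF h] by simp
    then show ?thesis unfolding JS_def JS1_def by blast
  qed
  show "JS x X (JE (cn (G2 T p)) (cn (G2 T p)))" if h: "T < nrel" "p < ar T" "X (JR T)"
  proof -
    have "T < B \<and> p < AR x T \<and> X (JR T) \<and> JE (cn (G2 T p)) (cn (G2 T p)) = JE (G2c T p) (G2c T p)"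
      using h small_B[of T] nrel_small AR_eq[of T S Q] by simp
    then show ?thesis unfolding JS_def JS1_def by blast
  qed
  show "cn a < B \<Longrightarrow> cn b < B \<Longrightarrow> X (JE (cn a) (cn b)) \<Longrightarrow> JS x X (JE (cn b) (cn a))"
    unfolding JS_def JS1_def by blast
  show "cn a < B \<Longrightarrow> cn b < B \<Longrightarrow> cn c < B \<Longrightarrow> X (JE (cn a) (cn b)) \<Longrightarrow> X (JE (cn b) (cn c)) \<Longrightarrow> JS x X (JE (cn a) (cn c))"
    unfolding JS_def JS1_def by blast
  show "JS x X (JE (cn (bnm f j)) (cn (bnm g j)))"
    if h: "bok f" "bok g" "brel f = R" "brel g = R" "(R, D, j) \<in> set (fds S)" "\<And>d. d \<in> set D \<Longrightarrow> X (JE (cn (bnm f d)) (cn (bnm g d)))"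
  proof -
    obtain k where k: "k < NF x" "R = FR x k" "D = map (FD x k) [0..<FL x k]" "j = FJ x k" using h(5) fd_iff by blast
    have d: "\<forall>d<FL x k. X (JE (BN x (cb f) (FD x k d)) (BN x (cb g) (FD x k d)))"
      using fBN[OF h(1,5,3)] fBN[OF h(2,5,4)] h(6) k(3) by auto
    have e: "JE (cn (bnm f j)) (cn (bnm g j)) = JE (BN x (cb f) (FJ x k)) (BN x (cb g) (FJ x k))"
      using fBN[OF h(1,5,3), of j] fBN[OF h(2,5,4), of j] k(4) by simp
    have "cb f < B \<and> cb g < B \<and> k < NF x \<and> BOK x (cb f) \<and> BOK x (cb g) \<and> BR x (cb f) = FR x k \<and> BR x (cb g) = FR x k"
      using h k cB b by auto
    then show ?thesis unfolding JS_def JS1_def using d e by blast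
  qed
  show "JS x X (JE (cn (bnm f i)) (cn (Ge T j)))" if h: "bok f" "U (brel f) i T j" "const_pos T j"
  proof -
    obtain k where k: "k < NU x" "brel f = UQ x k 0" "i = UQ x k 1" "T = UQ x k 2" "j = UQ x k 3" using h uid_iff by blast
    then have "cb f < B \<and> k < NU x \<and> BOK x (cb f) \<and> BR x (cb f) = UQ x k 0 \<and> CP x (UQ x k 2) (UQ x k 3) \<and>
      JE (cn (bnm f i)) (cn (Ge T j)) = JE (BN x (cb f) (UQ x k 1)) (Gec (UQ x k 2) (UQ x k 3))"
      using h cB b uBN[OF h(1,2)] by simp
    then show ?thesis unfolding JS_def JS2_def by blast
  qed
  show "JS x X (JE (cn (bnm f p)) (cn (G2 (brel f) p)))" if h: "US x X (cb f) m" "const_pos (brel f) p"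
  proof -
    have u: "bok f" "m < nmeth" "p < ar (brel f)" using h const_wf unfolding US_eq by auto
    then have "cb f < B \<and> m < B \<and> p < AR x (BR x (cb f)) \<and> US x X (cb f) m \<and> CP x (BR x (cb f)) p \<and>
      JE (cn (bnm f p)) (cn (G2 (brel f) p)) = JE (BN x (cb f) p) (G2c (BR x (cb f)) p)"
      using h cB mB b BN_eq[OF u(1,3)] by simp
    then show ?thesis unfolding JS_def JS2_def by blast
  qed
  show "JS x X (JE (cn (G2 R i)) (cn (G2 T j)))" if h: "X (JR R)" "U R i T j" "const_pos T j"
  proof -
    obtain k where k: "k < NU x" "R = UQ x k 0" "i = UQ x k 1" "T = UQ x k 2" "j = UQ x k 3" using h uid_iff by blast
    then have "k < NU x \<and> X (JR (UQ x k 0)) \<and> CP x (UQ x k 2) (UQ x k 3) \<and>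
      JE (cn (G2 R i)) (cn (G2 T j)) = JE (G2c (UQ x k 0) (UQ x k 1)) (G2c (UQ x k 2) (UQ x k 3))" using h CP_eq by simp
    then show ?thesis unfolding JS_def JS2_def by blast
  qed
  show "JS x X (JR (brel f))" if h: "US x X (cb f) m"
  proof -
    have u: "bok f" "m < nmeth" using h unfolding US_eq by auto
    then have "cb f < B \<and> m < B \<and> US x X (cb f) m \<and> JR (brel f) = JR (BR x (cb f))" using h cB mB b by simp
    then show ?thesis unfolding JS_def JS2_def by blast
  qed
  show "JS x X (JR T)" if h: "X (JR R)" "U R i T j"
    using h uid_iff[of R i T j] unfolding JS_def JS2_def by blast
  show "cn a < B \<Longrightarrow> cn b < B \<Longrightarrow> X (JK (cn a)) \<Longrightarrow> X (JE (cn a) (cn b)) \<Longrightarrow> JS x X (JK (cn b))"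
    unfolding JS_def JS3_def by blast
  show "JS x X (JK (cn (bnm f p)))" if h: "US x X (cb f) m" "det m p" "p < ar (brel f)"
  proof -
    have u: "bok f" "m < nmeth" using h unfolding US_eq by auto
    then have "cb f < B \<and> m < B \<and> p < AR x (BR x (cb f)) \<and> US x X (cb f) m \<and> DT x m p \<and> JK (cn (bnm f p)) = JK (BN x (cb f) p)"
      using h cB mB b DT_eq BN_eq[OF u(1) h(3)] by simp
    then show ?thesis unfolding JS_def JS3_def by blast
  qed
  show "JS x X (JK (cn (bnm f p)))" if h: "bok f" "p < ar (brel f)" "X (JK (cn (Ge (brel f) p)))"
  proof -
    have "cb f < B \<and> p < AR x (BR x (cb f)) \<and> BOK x (cb f) \<and> X (JK (Gec (BR x (cb f)) p)) \<and> JK (cn (bnm f p)) = JK (BN x (cb f) p)"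
      using h cB b BN_eq[OF h(1,2)] by simp
    then show ?thesis unfolding JS_def JS3_def by blast
  qed
  show "JS x X (JK (cn (bnm f i)))" if h: "bok f" "U (brel f) i T j" "X (JK (cn (Ge T j)))"
  proof -
    obtain k where k: "k < NU x" "brel f = UQ x k 0" "i = UQ x k 1" "T = UQ x k 2" "j = UQ x k 3" using h uid_iff by blast
    then have "cb f < B \<and> k < NU x \<and> BOK x (cb f) \<and> BR x (cb f) = UQ x k 0 \<and> X (JK (Gec (UQ x k 2) (UQ x k 3))) \<and>
      JK (cn (bnm f i)) = JK (BN x (cb f) (UQ x k 1))" using h cB b uBN[OF h(1,2)] by simp
    then show ?thesis unfolding JS_def JS3_def by blast
  qed
  show "JS x X (JK (cn (bnm f p)))" if h: "bok f" "q < ar (brel f)" "p < ar (brel f)" "X (JK (cn (bnm f q)))" "X (JK (cn (Kg (brel f) q p)))"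
  proof -
    have "cb f < B \<and> q < AR x (BR x (cb f)) \<and> p < AR x (BR x (cb f)) \<and> BOK x (cb f) \<and> X (JK (BN x (cb f) q)) \<and>
      X (JK (Kgc (BR x (cb f)) q p)) \<and> JK (cn (bnm f p)) = JK (BN x (cb f) p)"
      using h cB b BN_eq[OF h(1,2)] BN_eq[OF h(1,3)] by simp
    then show ?thesis unfolding JS_def JS4_def by blast
  qed
  show "JS x X (JK (cn (Kg (brel f) p p)))" if h: "bok f" "p < ar (brel f)" "X (JK (cn (bnm f p)))"
  proof -
    have "cb f < B \<and> p < AR x (BR x (cb f)) \<and> BOK x (cb f) \<and> X (JK (BN x (cb f) p)) \<and>
      JK (cn (Kg (brel f) p p)) = JK (Kgc (BR x (cb f)) p p)" using h cB b BN_eq[OF h(1,2)] by simp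
    then show ?thesis unfolding JS_def JS4_def by blast
  qed
  show "JS x X (JK (cn (Kg T j j)))" if h: "bok f" "U (brel f) i T j" "X (JK (cn (bnm f i)))"
  proof -
    obtain k where k: "k < NU x" "brel f = UQ x k 0" "i = UQ x k 1" "T = UQ x k 2" "j = UQ x k 3" using h uid_iff by blast
    then have "cb f < B \<and> k < NU x \<and> BOK x (cb f) \<and> BR x (cb f) = UQ x k 0 \<and> X (JK (BN x (cb f) (UQ x k 1))) \<and>
      JK (cn (Kg T j j)) = JK (Kgc (UQ x k 2) (UQ x k 3) (UQ x k 3))" using h cB b uBN[OF h(1,2)] by simp
    then show ?thesis unfolding JS_def JS4_def by blast
  qed
  show "JS x X (JK (cn (Kg (brel f) q q)))" if h: "US x X (cb f) m" "q < ar (brel f)"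
  proof -
    have u: "bok f" "m < nmeth" using h unfolding US_eq by auto
    then have "cb f < B \<and> m < B \<and> q < AR x (BR x (cb f)) \<and> US x X (cb f) m \<and> JK (cn (Kg (brel f) q q)) = JK (Kgc (BR x (cb f)) q q)"
      using h cB mB b by simp
    then show ?thesis unfolding JS_def JS4_def by blast
  qed
qed

text \<open>The meaning of judgement codes, the closed set used in the soundness proof; the
  remainders modulo 3 keep the three kinds apart.\<close>

definition HJ :: "nat \<Rightarrow> bool" where
  "HJ c \<longleftrightarrow> (\<exists>a b. c = JE (cn a) (cn b) \<and> sim a b) \<or> (\<exists>a. c = JK (cn a) \<and> kn a) \<or> (\<exists>T. c = JR T \<and> rel2 T)"

lemma HJ_simps [simp]: "HJ (JE (cn a) (cn b)) \<longleftrightarrow> sim a b" "HJ (JK (cn a)) \<longleftrightarrow> kn a" "HJ (JR T) \<longleftrightarrow> rel2 T"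
proof -
  have d: "3 * c \<noteq> Suc (3 * T)" "Suc (3 * T) \<noteq> 3 * c" "3 * c \<noteq> Suc (Suc (3 * T))" "Suc (Suc (3 * T)) \<noteq> 3 * c" for c T :: nat
    by presburger+
  show "HJ (JE (cn a) (cn b)) \<longleftrightarrow> sim a b" unfolding HJ_def by (auto simp: d)
  show "HJ (JK (cn a)) \<longleftrightarrow> kn a" unfolding HJ_def by (auto simp: d)
  show "HJ (JR T) \<longleftrightarrow> rel2 T" unfolding HJ_def by (auto simp: d)
qed

lemma usable_HJ: "US x HJ (cb f) m \<longleftrightarrow> usable f m"
  unfolding US_eq usable_def HJ_simps by blast

lemma cn_folds: "Gec T p = cn (Ge T p)" "Kgc T q p = cn (Kg T q p)" "G2c T p = cn (G2 T p)"
  by simp_all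

lemma usableD: "usable f m \<Longrightarrow> bok f \<and> m < nmeth \<and> mrel m = brel f \<and> (\<forall>p\<in>set (mins m). kn (bnm f p))"
  unfolding usable_def by blast

lemma HJ1: "JS1 x HJ c \<Longrightarrow> HJ c"
  unfolding JS1_def
proof (elim disjE exE conjE)
  fix f p assume h: "p < AR x (BR x f)" "BOK x f" "c = JE (BN x f p) (BN x f p)"
  obtain F where F: "f = cb F" by (rule cb_surj)
  have b: "bok F" using h F BOK_eq by simp
  then have p: "p < ar (brel F)" using h F AR_BR by simp
  show "HJ c" unfolding h(3) F BN_eq[OF b p] HJ_simps by (rule sim_base[OF b p])
next
  fix T p assume h: "p < AR x T" "HJ (JR T)" "c = JE (G2c T p) (G2c T p)"
  have T: "rel2 T" using h(2) unfolding HJ_simps .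
  then have "p < ar T" using h(1) AR_eq[OF rel2_wf[OF T]] by simp
  then show "HJ c" unfolding h(3) cn_folds HJ_simps by (rule sim_g2[OF T])
next
  fix a b assume h: "HJ (JE a b)" "c = JE b a"
  obtain a' b' where a: "a = cn a'" "b = cn b'" using cn_surj by metis
  show "HJ c" using h(1) unfolding h(2) a HJ_simps by (rule sim_sym)
next
  fix a b d assume h: "HJ (JE a b)" "HJ (JE b d)" "c = JE a d"
  obtain a' b' d' where a: "a = cn a'" "b = cn b'" "d = cn d'" using cn_surj by metis
  show "HJ c" using h(1,2) unfolding h(3) a HJ_simps by (rule sim_trans)
next
  fix f g k assume h: "k < NF x" "BOK x f" "BOK x g" "BR x f = FR x k" "BR x g = FR x k"
    "\<forall>d<FL x k. HJ (JE (BN x f (FD x k d)) (BN x g (FD x k d)))" "c = JE (BN x f (FJ x k)) (BN x g (FJ x k))"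
  obtain F G where F: "f = cb F" "g = cb G" using cb_surj by metis
  have b: "bok F" "bok G" using h F BOK_eq by simp_all
  have r: "brel F = FR x k" "brel G = FR x k" using h(4,5) F b BR_eq by simp_all
  note fd = fdI[OF h(1)]
  have j: "BN x f (FJ x k) = cn (bnm F (FJ x k))" "BN x g (FJ x k) = cn (bnm G (FJ x k))"
    using fBN[OF b(1) fd r(1), of "FJ x k"] fBN[OF b(2) fd r(2), of "FJ x k"] F by auto
  have "sim (bnm F d) (bnm G d)" if d: "d \<in> set (map (FD x k) [0..<FL x k])" for d
  proof -
    have "HJ (JE (BN x f d) (BN x g d))" using h(6) d by auto
    moreover have "BN x f d = cn (bnm F d)" "BN x g d = cn (bnm G d)"
      using fBN[OF b(1) fd r(1), of d] fBN[OF b(2) fd r(2), of d] F d by blast+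
    ultimately show ?thesis by simp
  qed
  then show "HJ c" unfolding h(7) j HJ_simps by (rule sim_fd[OF b r fd])
qed

lemma HJ2: "JS2 x HJ c \<Longrightarrow> HJ c"
  unfolding JS2_def
proof (elim disjE exE conjE)
  fix f k assume h: "k < NU x" "BOK x f" "BR x f = UQ x k 0" "CP x (UQ x k 2) (UQ x k 3)" "c = JE (BN x f (UQ x k 1)) (Gec (UQ x k 2) (UQ x k 3))"
  obtain F where F: "f = cb F" by (rule cb_surj)
  have b: "bok F" using h F BOK_eq by simp
  have u: "U (brel F) (UQ x k 1) (UQ x k 2) (UQ x k 3)" using uidI[OF h(1)] h(3) F BR_eq[OF b] by simp
  show "HJ c" unfolding h(5) F uBN[OF b u] cn_folds HJ_simps using sim_uid[OF b u] h(4) CP_eq by blast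
next
  fix f m p assume h: "p < AR x (BR x f)" "US x HJ f m" "CP x (BR x f) p" "c = JE (BN x f p) (G2c (BR x f) p)"
  obtain F where F: "f = cb F" by (rule cb_surj)
  have u: "usable F m" using h(2) F usable_HJ by simp
  note d = usableD[OF u]
  have p: "p < ar (brel F)" using h(1) F AR_BR d by simp
  have "const_pos (brel F) p" using h(3) F BR_eq d CP_eq by simp
  then have "sim (bnm F p) (G2 (brel F) p)" using sim_kn[of F m p] d p by blast
  then show "HJ c" using d unfolding h(4) F by (simp add: BR_eq BN_eq p cn_folds del: cn.simps)
next
  fix k assume h: "k < NU x" "HJ (JR (UQ x k 0))" "CP x (UQ x k 2) (UQ x k 3)" "c = JE (G2c (UQ x k 0) (UQ x k 1)) (G2c (UQ x k 2) (UQ x k 3))"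
  show "HJ c" using sim_uid2[OF _ uidI[OF h(1)]] h(2,3) CP_eq unfolding h(4) cn_folds HJ_simps by blast
next
  fix f m assume h: "US x HJ f m" "c = JR (BR x f)"
  obtain F where F: "f = cb F" by (rule cb_surj)
  note d = usableD[of F m]
  have u: "usable F m" using h(1) F usable_HJ by simp
  have "rel2 (brel F)" using rel2_kn[of F m] d[OF u] by blast
  then show "HJ c" unfolding h(2) F BR_eq[OF conjunct1[OF d[OF u]]] HJ_simps .
next
  fix k assume h: "k < NU x" "HJ (JR (UQ x k 0))" "c = JR (UQ x k 2)"
  show "HJ c" using rel2_uid[OF _ uidI[OF h(1)]] h(2) unfolding h(3) HJ_simps by blast
qed

lemma HJ3: "JS3 x HJ c \<Longrightarrow> HJ c"
  unfolding JS3_def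
proof (elim disjE exE conjE)
  fix a b assume h: "HJ (JK a)" "HJ (JE a b)" "c = JK b"
  obtain a' b' where a: "a = cn a'" "b = cn b'" using cn_surj by metis
  show "HJ c" using h(1,2) unfolding h(3) a HJ_simps by (rule kn_sim)
next
  fix f m p assume h: "p < AR x (BR x f)" "US x HJ f m" "DT x m p" "c = JK (BN x f p)"
  obtain F where F: "f = cb F" by (rule cb_surj)
  have u: "usable F m" using h(2) F usable_HJ by simp
  note d = usableD[OF u]
  have p: "p < ar (brel F)" using h(1) F AR_BR d by simp
  have "kn (bnm F p)" using kn_det[of F m p] d p h(3) DT_eq by blast
  then show "HJ c" unfolding h(4) F BN_eq[OF conjunct1[OF d] p] HJ_simps .
next
  fix f p assume h: "p < AR x (BR x f)" "BOK x f" "HJ (JK (Gec (BR x f) p))" "c = JK (BN x f p)"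
  obtain F where F: "f = cb F" by (rule cb_surj)
  have b: "bok F" using h F BOK_eq by simp
  then have p: "p < ar (brel F)" using h F AR_BR by simp
  show "HJ c" using kn_gen[OF b p] h(3) unfolding h(4) F BN_eq[OF b p] BR_eq[OF b] cn_folds HJ_simps by blast
next
  fix f k assume h: "k < NU x" "BOK x f" "BR x f = UQ x k 0" "HJ (JK (Gec (UQ x k 2) (UQ x k 3)))" "c = JK (BN x f (UQ x k 1))"
  obtain F where F: "f = cb F" by (rule cb_surj)
  have b: "bok F" using h F BOK_eq by simp
  have u: "U (brel F) (UQ x k 1) (UQ x k 2) (UQ x k 3)" using uidI[OF h(1)] h(3) F BR_eq[OF b] by simp
  show "HJ c" using kn_uid[OF b u] h(4) unfolding h(5) F uBN[OF b u] cn_folds HJ_simps by blast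
qed

lemma HJ4: "JS4 x HJ c \<Longrightarrow> HJ c"
  unfolding JS4_def
proof (elim disjE exE conjE)
  fix f q p assume h: "q < AR x (BR x f)" "p < AR x (BR x f)" "BOK x f" "HJ (JK (BN x f q))" "HJ (JK (Kgc (BR x f) q p))" "c = JK (BN x f p)"
  obtain F where F: "f = cb F" by (rule cb_surj)
  have b: "bok F" using h F BOK_eq by simp
  then have p: "q < ar (brel F)" "p < ar (brel F)" using h F AR_BR by simp_all
  show "HJ c" using kn_rel[OF b p] h(4,5) unfolding h(6) F BN_eq[OF b p(1)] BN_eq[OF b p(2)] BR_eq[OF b] cn_folds HJ_simps by blast
next
  fix f p assume h: "p < AR x (BR x f)" "BOK x f" "HJ (JK (BN x f p))" "c = JK (Kgc (BR x f) p p)"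
  obtain F where F: "f = cb F" by (rule cb_surj)
  have b: "bok F" using h F BOK_eq by simp
  then have p: "p < ar (brel F)" using h F AR_BR by simp
  show "HJ c" using kn_self[OF b p] h(3) unfolding h(4) F BN_eq[OF b p] BR_eq[OF b] cn_folds HJ_simps by blast
next
  fix f k assume h: "k < NU x" "BOK x f" "BR x f = UQ x k 0" "HJ (JK (BN x f (UQ x k 1)))" "c = JK (Kgc (UQ x k 2) (UQ x k 3) (UQ x k 3))"
  obtain F where F: "f = cb F" by (rule cb_surj)
  have b: "bok F" using h F BOK_eq by simp
  have u: "U (brel F) (UQ x k 1) (UQ x k 2) (UQ x k 3)" using uidI[OF h(1)] h(3) F BR_eq[OF b] by simp
  show "HJ c" using kn_step[OF b u] h(4) unfolding h(5) F uBN[OF b u] cn_folds HJ_simps by blast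
next
  fix f m q assume h: "q < AR x (BR x f)" "US x HJ f m" "c = JK (Kgc (BR x f) q q)"
  obtain F where F: "f = cb F" by (rule cb_surj)
  have u: "usable F m" using h(2) F usable_HJ by simp
  note d = usableD[OF u]
  have p: "q < ar (brel F)" using h(1) F AR_BR d by simp
  have "kn (Kg (brel F) q q)" using kn_all[of F m q] d p by blast
  then show "HJ c" unfolding h(3) F BR_eq[OF conjunct1[OF d]] cn_folds HJ_simps .
qed

lemma JL_sound: "JL x c \<Longrightarrow> HJ c"
proof -
  assume "JL x c"
  then have "lfpb B (JS x) c" by (simp add: JL_def)
  then show "HJ c" by (rule lfpb_sound) (use HJ1 HJ2 HJ3 HJ4 in \<open>unfold JS_def, blast\<close>)
qed

lemma JL_closed: "JS x (JL x) c \<Longrightarrow> c < B \<Longrightarrow> JL x c"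
proof -
  assume h: "JS x (JL x) c" "c < B"
  have e: "JL x = lfpb B (JS x)" by (intro ext) (simp add: JL_def)
  show ?thesis unfolding e
  proof (rule lfpb_closed)
    fix X Y k assume "\<And>p. X p \<Longrightarrow> Y p" "JS x X k"
    then show "JS x Y k" by (rule JS_mono)
  qed (use h e in simp_all)
qed

end

lemma length_query: "length Q \<le> length (enc_problem (S, Q))"
proof -
  have "length Q \<le> length (concat (map toks_atom Q))" by (induction Q) auto
  then have "length Q \<le> length (toks (S, Q))" by (simp add: toks.simps)
  then show ?thesis using length_toks_enc[of "(S, Q)"] by linarith
qed

context wf_problem
begin

text \<open>Completeness needs all names in a derivation to lie in the range of the searches,
  including the middle name of a transitivity step, so the induction carries size bounds along with
  derivability.\<close>

definition nbd :: "nm \<Rightarrow> bool" where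
  "nbd a \<longleftrightarrow> cn a < 2 ^ (4 * W + 5)"

definition "C1 a b \<longleftrightarrow> JL x (JE (cn a) (cn b)) \<and> nbd a \<and> nbd b"
definition "C2 a \<longleftrightarrow> JL x (JK (cn a)) \<and> nbd a"
definition "C3 T \<longleftrightarrow> JL x (JR T) \<and> T < nrel"

lemma nbd_B: "nbd a \<Longrightarrow> cn a < B"
  unfolding nbd_def by (erule less_B) simp

lemma nbd_simps:
  "bok F \<Longrightarrow> p < ar (brel F) \<Longrightarrow> nbd (bnm F p)"
  "T < nrel \<Longrightarrow> p < ar T \<Longrightarrow> nbd (Ge T p)"
  "T < nrel \<Longrightarrow> p < ar T \<Longrightarrow> q < ar T \<Longrightarrow> nbd (Kg T q p)"
  "T < nrel \<Longrightarrow> p < ar T \<Longrightarrow> nbd (G2 T p)"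
  unfolding nbd_def by (rule bnm_small cn_small; assumption)+

lemma C1I: "JS x (JL x) (JE (cn a) (cn b)) \<Longrightarrow> nbd a \<Longrightarrow> nbd b \<Longrightarrow> C1 a b"
proof -
  assume h: "JS x (JL x) (JE (cn a) (cn b))" "nbd a" "nbd b"
  have "3 * pe (cn a) (cn b) + 2 < 2 ^ ((2 * (4 * W + 5) + 1) + 2)"
    by (rule code_mult(1)[OF pe_less]) (use h in \<open>simp_all add: nbd_def\<close>)
  then have "3 * pe (cn a) (cn b) + 2 < B" by (rule less_B) simp
  then show ?thesis unfolding C1_def using JL_closed[OF h(1)] h(2,3) by linarith
qed

lemma C2I: "JS x (JL x) (JK (cn a)) \<Longrightarrow> nbd a \<Longrightarrow> C2 a"
proof -
  assume h: "JS x (JL x) (JK (cn a))" "nbd a"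
  have "3 * cn a + 2 < 2 ^ ((4 * W + 5) + 2)" by (rule code_mult(1)) (use h in \<open>simp add: nbd_def\<close>)
  then have "3 * cn a + 2 < B" by (rule less_B) simp
  then show ?thesis unfolding C2_def using JL_closed[OF h(1)] h(2) by linarith
qed

lemma C3I: "JS x (JL x) (JR T) \<Longrightarrow> T < nrel \<Longrightarrow> C3 T"
proof -
  assume h: "JS x (JL x) (JR T)" "T < nrel"
  have "3 * T + 2 < 2 ^ (W + 2)" by (rule code_mult(1)) (use h nrel_small in simp)
  then have "3 * T + 2 < B" by (rule less_B) simp
  then show ?thesis unfolding C3_def using JL_closed[OF h(1)] h(2) by linarith
qed

lemma US_JL: "bok f \<Longrightarrow> m < nmeth \<Longrightarrow> mrel m = brel f \<Longrightarrow> (\<And>p. p \<in> set (mins m) \<Longrightarrow> C2 (bnm f p)) \<Longrightarrow> US x (JL x) (cb f) m"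
  unfolding US_eq C2_def by blast

lemma JL_complete: "(sim a b \<longrightarrow> C1 a b) \<and> (kn c \<longrightarrow> C2 c) \<and> (rel2 T \<longrightarrow> C3 T)"
proof (induction rule: sim_kn_rel2.induct)
  case (sim_base f p)
  show ?case by (rule C1I[OF JS_intros(1)[OF sim_base] nbd_simps(1)[OF sim_base] nbd_simps(1)[OF sim_base]])
next
  case (sim_g2 T p)
  then have T: "T < nrel" "JL x (JR T)" by (auto simp: C3_def)
  show ?case by (rule C1I[OF JS_intros(2)[where X = "JL x", OF T(1) _ T(2)] nbd_simps(4)[OF T(1)] nbd_simps(4)[OF T(1)]]) (use sim_g2 in auto)
next
  case (sim_sym a b)
  then have h: "JL x (JE (cn a) (cn b))" "nbd a" "nbd b" by (auto simp: C1_def)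
  show ?case by (rule C1I[OF JS_intros(3)[where X = "JL x", OF nbd_B nbd_B h(1)]]) (use h in auto)
next
  case (sim_trans a b c)
  then have h: "JL x (JE (cn a) (cn b))" "JL x (JE (cn b) (cn c))" "nbd a" "nbd b" "nbd c" by (auto simp: C1_def)
  show ?case by (rule C1I[OF JS_intros(4)[where X = "JL x", OF nbd_B nbd_B nbd_B h(1,2)]]) (use h in auto)
next
  case (sim_fd f g R D j)
  note w = fd_wf[OF \<open>(R, D, j) \<in> set (fds S)\<close>]
  show ?case
    by (rule C1I[OF JS_intros(5)[of f g R D j "JL x"]]) (use sim_fd w in \<open>auto simp: C1_def intro: nbd_simps\<close>)
next
  case (sim_uid f i T j)
  note w = uid_wf[OF \<open>U (brel f) i T j\<close>]
  show ?case by (rule C1I[OF JS_intros(6)[of f i T j]]) (use sim_uid w in \<open>auto intro: nbd_simps\<close>)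
next
  case (sim_kn f m p)
  have "US x (JL x) (cb f) m" by (rule US_JL) (use sim_kn in auto)
  then show ?case by (rule C1I[OF JS_intros(7)]) (use sim_kn bok_nrel in \<open>auto intro: nbd_simps\<close>)
next
  case (sim_uid2 R i T j)
  note w = uid_wf[OF \<open>U R i T j\<close>]
  show ?case by (rule C1I[OF JS_intros(8)[of "JL x" R i T j]]) (use sim_uid2 w in \<open>auto simp: C3_def intro: nbd_simps\<close>)
next
  case (rel2_kn f m)
  have "US x (JL x) (cb f) m" by (rule US_JL) (use rel2_kn in auto)
  then show ?case by (rule C3I[OF JS_intros(9)]) (use rel2_kn bok_nrel in auto)
next
  case (rel2_uid R i T j)
  note w = uid_wf[OF \<open>U R i T j\<close>]
  show ?case by (rule C3I[OF JS_intros(10)[of "JL x" R i T j]]) (use rel2_uid w in \<open>auto simp: C3_def\<close>)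
next
  case (kn_sim a b)
  then have h: "JL x (JK (cn a))" "JL x (JE (cn a) (cn b))" "nbd a" "nbd b" by (auto simp: C1_def C2_def)
  show ?case by (rule C2I[OF JS_intros(11)[where X = "JL x", OF nbd_B nbd_B h(1,2)]]) (use h in auto)
next
  case (kn_det f m p)
  have "US x (JL x) (cb f) m" by (rule US_JL) (use kn_det in auto)
  then show ?case by (rule C2I[OF JS_intros(12)]) (use kn_det in \<open>auto intro: nbd_simps\<close>)
next
  case (kn_gen f p)
  show ?case by (rule C2I[OF JS_intros(13)[of f p "JL x"]]) (use kn_gen in \<open>auto simp: C2_def intro: nbd_simps\<close>)
next
  case (kn_uid f i T j)
  note w = uid_wf[OF \<open>U (brel f) i T j\<close>]
  show ?case by (rule C2I[OF JS_intros(14)[of f i T j "JL x"]]) (use kn_uid w in \<open>auto simp: C2_def intro: nbd_simps\<close>)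
next
  case (kn_rel f q p)
  show ?case by (rule C2I[OF JS_intros(15)[of f q p "JL x"]]) (use kn_rel in \<open>auto simp: C2_def intro: nbd_simps\<close>)
next
  case (kn_self f p)
  show ?case by (rule C2I[OF JS_intros(16)[of f p "JL x"]]) (use kn_self bok_nrel in \<open>auto simp: C2_def intro: nbd_simps\<close>)
next
  case (kn_step f i T j)
  note w = uid_wf[OF \<open>U (brel f) i T j\<close>]
  show ?case by (rule C2I[OF JS_intros(17)[of f i T j "JL x"]]) (use kn_step w in \<open>auto simp: C2_def intro: nbd_simps\<close>)
next
  case (kn_all f m q)
  have "US x (JL x) (cb f) m" by (rule US_JL) (use kn_all in auto)
  then show ?case by (rule C2I[OF JS_intros(18)]) (use kn_all bok_nrel in \<open>auto intro: nbd_simps\<close>)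
qed

lemma JL_eq: "JL x (JE (cn a) (cn b)) \<longleftrightarrow> sim a b" "JL x (JK (cn a)) \<longleftrightarrow> kn a" "JL x (JR T) \<longleftrightarrow> rel2 T"
  using JL_sound HJ_simps JL_complete[of a b a T] unfolding C1_def C2_def C3_def by blast+

lemma sim_nbd: "sim a b \<Longrightarrow> nbd b"
  using JL_complete[of a b] unfolding C1_def by blast

lemma usable_eq: "US x (JL x) (cb f) m \<longleftrightarrow> usable f m"
  unfolding US_eq usable_def JL_eq by blast

lemma nmeth_B: "m < nmeth \<Longrightarrow> m < B"
  using small_B nmeth_small by simp

lemma cb_B: "bok f \<Longrightarrow> cb f < B"
  by (rule less_B[OF cb_small]) simp_all

section \<open>Certificates on codes\<close>

lemma ex_usable: "(\<exists>f<B. \<exists>m<B. US x (JL x) f m \<and> P f m) \<longleftrightarrow> (\<exists>f m. usable f m \<and> P (cb f) m)"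
proof
  assume "\<exists>f<B. \<exists>m<B. US x (JL x) f m \<and> P f m"
  then obtain f m where h: "US x (JL x) f m" "P f m" by blast
  obtain F where "f = cb F" by (rule cb_surj)
  then show "\<exists>f m. usable f m \<and> P (cb f) m" using h usable_eq by blast
next
  assume "\<exists>f m. usable f m \<and> P (cb f) m"
  then obtain f m where h: "usable f m" "P (cb f) m" by blast
  then show "\<exists>f<B. \<exists>m<B. US x (JL x) f m \<and> P f m" using usableD[OF h(1)] usable_eq cb_B nmeth_B by blast
qed

lemma FW_eq: "FW x T q \<longleftrightarrow> follow T q"
proof -
  have "US x (JL x) (3 * pe T q + 2) m \<and> DT x m q \<longleftrightarrow> usable (Kn T q) m \<and> det m q" for m
    using usable_eq[of "Kn T q" m] DT_eq usableD[of "Kn T q" m] by auto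
  then show ?thesis unfolding FW_def follow_def using usableD nmeth_B by blast
qed

lemma up_nrel: "((R, i), (T, j)) \<in> up \<Longrightarrow> R < nrel \<Longrightarrow> T < nrel"
  by (induction rule: up_induct) (blast dest: uid_wf)+

lemma pos2_nrel: "pos2 n R i \<Longrightarrow> R < nrel \<and> i < ar R \<and> nbd n"
  unfolding pos2_def using bok_nrel usableD rel2_wf up_nrel sim_nbd by blast

lemma AR_iff: "q < AR x T \<longleftrightarrow> T < nrel \<and> q < ar T"
  using AR_eq[of T S Q] unfolding AR_def sizes by auto

lemma P2_eq: "P2 x (cn n) T q \<longleftrightarrow> pos2 n T q"
proof (cases "T < nrel \<and> q < ar T")
  case False
  then show ?thesis using pos2_nrel[of n T q] unfolding P2_def AR_iff by blast
next
  case True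
  have 1: "(\<exists>f<B. \<exists>m<B. US x (JL x) f m \<and> DT x m q \<and> BR x f = T \<and> JL x (JE (BN x f q) (cn n))) \<longleftrightarrow>
    (\<exists>f m. usable f m \<and> det m q \<and> brel f = T \<and> sim (bnm f q) n)"
  proof -
    have "usable f m \<and> DT x m q \<and> BR x (cb f) = T \<and> JL x (JE (BN x (cb f) q) (cn n)) \<longleftrightarrow>
      usable f m \<and> det m q \<and> brel f = T \<and> sim (bnm f q) n" for f m
    proof (cases "usable f m \<and> brel f = T")
      case t: True
      then have "bok f" "m < nmeth" using usableD by blast+
      then show ?thesis using t True BR_eq[of f] BN_eq[of f q] DT_eq[of m q] JL_eq(1) by simp
    next
      case False
      then show ?thesis using BR_eq[of f] usableD[of f m] by auto
    qed
    then show ?thesis unfolding ex_usable by blast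
  qed
  have 2: "JL x (JR T) \<and> CP x T q \<and> JL x (JE (G2c T q) (cn n)) \<longleftrightarrow> rel2 T \<and> const_pos T q \<and> sim (G2 T q) n"
    unfolding cn_folds JL_eq CP_eq ..
  have 3: "(\<exists>f<B. \<exists>p<AR x (BR x f). BOK x f \<and> JL x (JK (BN x f p)) \<and> JL x (JE (BN x f p) (cn n)) \<and> UPr x (BR x f) p T q \<and> FW x T q) \<longleftrightarrow>
    (\<exists>f p. bok f \<and> p < ar (brel f) \<and> kn (bnm f p) \<and> sim (bnm f p) n \<and> ((brel f, p), (T, q)) \<in> up \<and> follow T q)" (is "?l \<longleftrightarrow> ?r")
  proof
    assume ?l
    then obtain f p where h: "p < AR x (BR x f)" "BOK x f" "JL x (JK (BN x f p))" "JL x (JE (BN x f p) (cn n))" "UPr x (BR x f) p T q" "FW x T q" by blast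
    obtain F where F: "f = cb F" by (rule cb_surj)
    have b: "bok F" using h F BOK_eq by simp
    then have p: "p < ar (brel F)" using h F AR_BR by simp
    show ?r using h(3-6) b p unfolding F BN_eq[OF b p] BR_eq[OF b] JL_eq FW_eq using UPr_sound by blast
  next
    assume ?r
    then obtain f p where h: "bok f" "p < ar (brel f)" "kn (bnm f p)" "sim (bnm f p) n" "((brel f, p), (T, q)) \<in> up" "follow T q" by blast
    have "cb f < B \<and> p < AR x (BR x (cb f)) \<and> BOK x (cb f) \<and> JL x (JK (BN x (cb f) p)) \<and> JL x (JE (BN x (cb f) p) (cn n)) \<and> UPr x (BR x (cb f)) p T q \<and> FW x T q"
      unfolding BN_eq[OF h(1,2)] JL_eq FW_eq BR_eq[OF h(1)] BOK_eq AR_iff using h cb_B UPr_complete bok_nrel by blast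
    then show ?l by blast
  qed
  show ?thesis unfolding P2_def pos2_def 1 2 3 using True AR_eq[of T S Q] by simp
qed

text \<open>What is needed to read relation and values of a slot from its code; it follows from
  \<open>slot_ok\<close> by induction on the index, since imported values come from earlier
  slots.\<close>

definition sgood :: "slot \<Rightarrow> bool" where
  "sgood z \<longleftrightarrow> srel z < nrel \<and> (\<forall>f m. z = SC f m \<longrightarrow> usable f m)"

lemma SL_eq: "sgood z \<Longrightarrow> SL x (csl z) = srel z"
proof (cases z)
  case (SC f m)
  moreover assume "sgood z"
  ultimately have "bok f" using usableD unfolding sgood_def by blast
  then show ?thesis using SC by (simp add: SL_def BR_eq)
qed (simp_all add: SL_def code_cases)

lemma slot_good: "(\<And>l. l < k \<Longrightarrow> sgood (sl l)) \<Longrightarrow> slot_ok sl k z \<Longrightarrow> sgood z"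
proof (cases "(sl, k, z)" rule: slot_ok.cases)
  case (1 sl' k' f m)
  assume "slot_ok sl k z"
  then show ?thesis using 1 usableD[of f m] bok_nrel unfolding sgood_def by auto
next
  case (2 sl' k' T)
  assume "slot_ok sl k z"
  then show ?thesis using 2 rel2_wf unfolding sgood_def by auto
next
  case (3 sl' k' T q l p)
  assume "\<And>l. l < k \<Longrightarrow> sgood (sl l)" "slot_ok sl k z"
  then show ?thesis using 3 up_nrel unfolding sgood_def by fastforce
next
  case (4 sl' k' T q n)
  assume "slot_ok sl k z"
  then show ?thesis using 4 pos2_nrel up_nrel unfolding sgood_def by fastforce
qed

lemma SO_eq:
  assumes l: "\<And>l. l < k \<Longrightarrow> sgood (sl l)" "\<And>l. l < k \<Longrightarrow> dig K c l = csl (sl l)"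
  shows "SO x K c k (csl z) \<longleftrightarrow> slot_ok sl k z"
proof (cases "(sl, k, z)" rule: slot_ok.cases)
  case (1 sl' k' f m)
  then show ?thesis by (simp add: SO_def usable_eq)
next
  case (2 sl' k' T)
  then show ?thesis using JL_eq(3)[of T] by (simp add: SO_def code_cases)
next
  case (3 sl' k' T q l' p)
  have e: "q < AR x T \<and> l' < k \<and> p < AR x (SL x (dig K c l')) \<and> UPr x (SL x (dig K c l')) p T q \<longleftrightarrow>
    l' < k \<and> q < ar T \<and> p < ar (srel (sl l')) \<and> ((srel (sl l'), p), (T, q)) \<in> up" (is "?l \<longleftrightarrow> ?r")
  proof (cases "l' < k")
    case True
    then have s: "SL x (dig K c l') = srel (sl l')" "srel (sl l') < nrel" using l SL_eq sgood_def by auto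
    show ?thesis unfolding s AR_iff using True s(2) UPr_sound UPr_complete up_nrel by blast
  qed simp
  have "SO x K c k (csl (SF T q (PN l' p))) \<longleftrightarrow> ?l" unfolding SO_def SF'_def by (simp add: code_cases)
  then show ?thesis using 3 e by simp
next
  case (4 sl' k' T q n)
  have "SO x K c k (csl (SF T q (PB n))) \<longleftrightarrow> q < AR x T \<and> (\<exists>R<B. \<exists>i<B. P2 x (cn n) R i \<and> UPr x R i T q)"
    unfolding SO_def SF'_def by (simp add: code_cases)
  also have "\<dots> \<longleftrightarrow> q < ar T \<and> (\<exists>R i. pos2 n R i \<and> ((R, i), (T, q)) \<in> up)" (is "?l \<longleftrightarrow> ?r")
  proof
    assume ?l
    then show ?r unfolding AR_iff P2_eq using UPr_sound by blast
  next
    assume ?r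
    then obtain R i where h: "q < ar T" "pos2 n R i" "((R, i), (T, q)) \<in> up" by blast
    note w = pos2_nrel[OF h(2)]
    have "R < B" "i < B" using small_B[of R] small_B[of i] nrel_small pos_small w by auto
    moreover have "T < nrel" "UPr x R i T q" using w h(3) up_nrel UPr_complete by blast+
    ultimately show ?l unfolding AR_iff P2_eq using h by blast
  qed
  finally show ?thesis using 4 by simp
qed

lemma SN_eq: "sgood z \<Longrightarrow> p < ar (srel z) \<Longrightarrow> SN x k (csl z) p = cpn (sname k z p)"
proof (cases z)
  case (SC f m)
  assume h: "sgood z" "p < ar (srel z)"
  then have "usable f m" using SC unfolding sgood_def by blast
  then have b: "bok f" "m < nmeth" using usableD by blast+
  show ?thesis using h(2) SC BN_eq[OF b(1), of p] DT_eq[OF b(2), of p] by (simp add: SN_def)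
qed (simp_all add: SN_def code_cases CP_eq)

lemma PS_eq: "PS x (cpn a) (cpn b) \<longleftrightarrow> pnsim a b"
proof -
  have o: "(2 * c + 1) mod 2 = (1 :: nat)" "2 * c mod 2 = (0 :: nat)" "2 * c \<noteq> 2 * d + 1" "2 * c \<noteq> Suc (2 * d)" "(2 * c + 1) div 2 = c" for c d :: nat
    by presburger+
  show ?thesis by (cases a; cases b) (simp_all add: PS_def JL_eq o)
qed

lemma SM_eq:
  assumes "\<And>a. a < length Q \<Longrightarrow> dig K c' a = s a \<and> dig K c (s a) = csl (sl (s a)) \<and> sgood (sl (s a)) \<and> srel (sl (s a)) = fst (Q ! a)"
  shows "SM x K c c' \<longleftrightarrow> (\<forall>a<length Q. \<forall>b<length Q. \<forall>p<length (snd (Q ! a)). \<forall>q<length (snd (Q ! b)).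
        snd (Q ! a) ! p = snd (Q ! b) ! q \<longrightarrow> pnsim (sname (s a) (sl (s a)) p) (sname (s b) (sl (s b)) q))"
proof -
  have n: "SN x (dig K c' a) (dig K c (dig K c' a)) p = cpn (sname (s a) (sl (s a)) p)" if "a < length Q" "p < length (snd (Q ! a))" for a p
    using assms[OF that(1)] that(2) query_wf[OF that(1)] SN_eq[of "sl (s a)" p "s a"] by simp
  have l: "QL x a = length (snd (Q ! a))" "p < length (snd (Q ! a)) \<Longrightarrow> QV x a p = snd (Q ! a) ! p" if "a < length Q" for a p
    using atom_simps(2)[OF that] by simp_all
  have "SM x K c c' \<longleftrightarrow> (\<forall>a<length Q. \<forall>b<length Q. \<forall>p<length (snd (Q ! a)). \<forall>q<length (snd (Q ! b)). QV x a p = QV x b q \<longrightarrow>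
    PS x (SN x (dig K c' a) (dig K c (dig K c' a)) p) (SN x (dig K c' b) (dig K c (dig K c' b)) q))"
    unfolding SM_def sizes using l(1) by auto
  then show ?thesis using l(2) n PS_eq by auto
qed

text \<open>The worst case is \<open>SF\<close>: its imported value has at most
  \<open>4 * W + 7\<close> bits, two pairings give \<open>8 * W + 15\<close> and
  \<open>16 * W + 31\<close>, and the factor 3 adds two.\<close>

lemma slot_small:
  assumes "slot_ok sl k z" "k \<le> 2 * length Q" "sgood z" "\<And>l. l < k \<Longrightarrow> sgood (sl l)"
  shows "csl z < 2 ^ (16 * W + 33)"
proof (cases "(sl, k, z)" rule: slot_ok.cases)
  case (1 sl' k' f m)
  then have b: "bok f" "m < nmeth" using assms(1) usableD by auto
  have "m < 2 ^ (2 * W + 3)" by (rule pow_up[OF less_trans[OF b(2) nmeth_small]]) simp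
  from code_mult(1)[OF pe_less[OF cb_small[OF b(1)] this]]
  have "3 * pe (cb f) m + 2 < 2 ^ ((2 * (2 * W + 3) + 1) + 2)" .
  then have "3 * pe (cb f) m + 2 < 2 ^ (16 * W + 33)" by (rule pow_up) simp
  then show ?thesis using 1 by simp
next
  case (2 sl' k' T)
  have "3 * T + 2 < 2 ^ (W + 2)" by (rule code_mult(1)) (use 2 assms(3) nrel_small in \<open>auto simp: sgood_def\<close>)
  then have "3 * T + 2 < 2 ^ (16 * W + 33)" by (rule pow_up) simp
  then show ?thesis using 2 by simp
next
  have main: "csl (SF T q e) < 2 ^ (16 * W + 33)" if h: "cpn e < 2 ^ (4 * W + 7)" "T < nrel" "q < ar T" for T q e
  proof -
    have "q < 2 ^ (4 * W + 7)" by (rule pow_up[OF pos_small[OF h(2,3)]]) simp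
    then have q: "pe q (cpn e) < 2 ^ (2 * (4 * W + 7) + 1)" by (rule pe_less[OF _ h(1)])
    have "T < 2 ^ (2 * (4 * W + 7) + 1)" by (rule pow_up[OF less_trans[OF h(2) nrel_small]]) simp
    from code_mult(1)[OF pe_less[OF this q]] have "3 * pe T (pe q (cpn e)) + 2 < 2 ^ (16 * W + 33)" by (rule pow_up) simp
    then show ?thesis by simp
  qed
  {
    case (3 sl' k' T q l p)
    then have h: "l < k" "q < ar T" "p < ar (srel (sl l))" using assms(1) by auto
    have T: "T < nrel" using assms(3) 3 by (simp add: sgood_def)
    have "l < 2 ^ (W + 1)" using h(1) assms(2) nq_small by simp
    moreover have "p < 2 ^ (W + 1)" using pow_up[OF pos_small[of "srel (sl l)" p], of "W + 1"] assms(4)[OF h(1)] h(3) by (simp add: sgood_def)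
    ultimately have "pe l p < 2 ^ (2 * (W + 1) + 1)" by (rule pe_less)
    from code_mult(1)[OF this] have "3 * pe l p + 2 < 2 ^ (4 * W + 7)" by (rule pow_up) simp
    then have "cpn (PN l p) < 2 ^ (4 * W + 7)" by simp
    from main[OF this T h(2)] show ?thesis using 3 by simp
  next
    case (4 sl' k' T q n)
    then obtain R i where h: "q < ar T" "pos2 n R i" using assms(1) by auto
    have T: "T < nrel" using assms(3) 4 by (simp add: sgood_def)
    have "cn n < 2 ^ (4 * W + 5)" using pos2_nrel[OF h(2)] nbd_def by blast
    then have "4 * cn n + 3 < 2 ^ ((4 * W + 5) + 2)" by (rule code_mult(2))
    then have "4 * cn n + 3 < 2 ^ (4 * W + 7)" by (rule pow_up) simp
    then have "cpn (PB n) < 2 ^ (4 * W + 7)" by simp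
    from main[OF this T h(1)] show ?thesis using 4 by simp
  }
qed

text \<open>This fixes the exponent 10: all digits together need at most
  \<open>34 * (W + 2) ^ 2\<close> bits, and \<open>34 \<le> 2 ^ 8 \<le> (W + 2) ^ 8\<close>.\<close>

lemma digits_B: "N \<le> 2 * W \<Longrightarrow> (2 ^ (16 * W + 33)) ^ N \<le> B"
proof -
  assume N: "N \<le> 2 * W"
  have "(16 * W + 33) * N \<le> (17 * (W + 2)) * (2 * (W + 2))" using N by (intro mult_le_mono) auto
  also have "\<dots> = 34 * (W + 2) ^ 2" by (simp add: power2_eq_square algebra_simps)
  also have "\<dots> \<le> (W + 2) ^ 8 * (W + 2) ^ 2"
  proof (rule mult_le_mono1)
    have "(2 :: nat) ^ 8 \<le> (W + 2) ^ 8" by (rule power_mono) auto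
    then show "34 \<le> (W + 2) ^ 8" by simp
  qed
  also have "\<dots> = (W + 2) ^ (8 + 2)" by (rule power_add[symmetric])
  also have "8 + 2 = (10 :: nat)" by simp
  finally show ?thesis unfolding pbnd_def power_mult[symmetric] by (intro power_increasing) auto
qed

lemma CT_eq: "CT x \<longleftrightarrow> cert"
proof
  assume "CT x"
  then obtain N K c c' where h: "N < 2 * length Q + 1" "\<forall>k<N. SO x K c k (dig K c k)"
    "\<forall>a<length Q. dig K c' a < N \<and> SL x (dig K c (dig K c' a)) = QR x a" "SM x K c c'" unfolding CT_def sizes by blast
  \<comment> \<open>By surjectivity of the code each digit is some slot; whether it is admissible is
    checked by \<open>SO\<close> alone.\<close>
  have "\<forall>k. \<exists>z. dig K c k = csl z" using csl_surj by metis
  then obtain sl where sl: "\<And>k. dig K c k = csl (sl k)" by metis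
  have ok: "k < N \<Longrightarrow> slot_ok sl k (sl k) \<and> sgood (sl k)" for k
  proof (induction k rule: less_induct)
    case (less k)
    then have g: "\<And>l. l < k \<Longrightarrow> sgood (sl l)" by simp
    have "slot_ok sl k (sl k)" using SO_eq[of k sl K c "sl k", OF g sl] h(2)[rule_format, OF less.prems] unfolding sl by simp
    then show ?case using slot_good[of k sl "sl k", OF g] by blast
  qed
  have s: "dig K c' a < N \<and> srel (sl (dig K c' a)) = fst (Q ! a)" if "a < length Q" for a
    using h(3) that SL_eq ok sl atom_simps(1)[OF that] by auto
  have "\<forall>a<length Q. \<forall>b<length Q. \<forall>p<length (snd (Q ! a)). \<forall>q<length (snd (Q ! b)).
        snd (Q ! a) ! p = snd (Q ! b) ! q \<longrightarrow> pnsim (sname (dig K c' a) (sl (dig K c' a)) p) (sname (dig K c' b) (sl (dig K c' b)) q)"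
    by (rule iffD1[OF SM_eq[of K c' "dig K c'" c sl] h(4)]) (use s ok sl in auto)
  then show cert unfolding cert_def
    by (intro exI[of _ N] exI[of _ sl] exI[of _ "dig K c'"] conjI) (use h(1) ok s in auto)
next
  assume cert
  then obtain N sl s where h: "N \<le> 2 * length Q" "\<forall>k<N. slot_ok sl k (sl k)" "\<forall>a<length Q. s a < N \<and> srel (sl (s a)) = fst (Q ! a)"
    "\<forall>a<length Q. \<forall>b<length Q. \<forall>p<length (snd (Q ! a)). \<forall>q<length (snd (Q ! b)).
        snd (Q ! a) ! p = snd (Q ! b) ! q \<longrightarrow> pnsim (sname (s a) (sl (s a)) p) (sname (s b) (sl (s b)) q)"
    unfolding cert_def by blast
  define K where "K = (2 :: nat) ^ (16 * W + 33)"
  have qW: "length Q \<le> W" by (rule length_query)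
  have g: "k < N \<Longrightarrow> sgood (sl k)" for k
  proof (induction k rule: less_induct)
    case (less k)
    show ?case by (rule slot_good[of k sl]) (use less h(2) in auto)
  qed
  have "csl (sl k) < K" if "k < N" for k
    unfolding K_def by (rule slot_small[of sl k]) (use h that g in auto)
  then obtain c where c: "c < K ^ N" "\<And>k. k < N \<Longrightarrow> dig K c k = csl (sl k)" using ex_dig[of N "\<lambda>k. csl (sl k)" K] by blast
  have "s a < K" if "a < length Q" for a
  proof -
    have "s a < 2 ^ (W + 1)" using h(1,3) that nq_small by fastforce
    then show ?thesis unfolding K_def by (rule pow_up) simp
  qed
  then obtain c' where c': "c' < K ^ length Q" "\<And>a. a < length Q \<Longrightarrow> dig K c' a = s a" using ex_dig[of "length Q" s K] by blast
  have "K ^ N \<le> B" "K ^ length Q \<le> B" unfolding K_def by (rule digits_B; use h(1) qW in simp)+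
  then have "c < B" "c' < B" using c(1) c'(1) by simp_all
  moreover have "K < B" unfolding K_def by (rule less_B[of _ "16 * W + 34"]) auto
  moreover have "SO x K c k (dig K c k)" if "k < N" for k
    using SO_eq[of k sl K c "sl k"] g c(2) h(2) that by simp
  moreover have "SM x K c c'" by (rule iffD2[OF SM_eq[of K c' s c sl] h(4)]) (use h(3) g c(2) c'(2) in auto)
  moreover have "dig K c' a < N \<and> SL x (dig K c (dig K c' a)) = QR x a" if "a < length Q" for a
    using c'(2)[OF that] h(3) that c(2) SL_eq g atom_simps(1)[OF that] by auto
  moreover have "N < 2 * length Q + 1" using h(1) by simp
  ultimately show "CT x" unfolding CT_def sizes by blast
qed

end

lemma WF_eq: "WF (S, Q) \<longleftrightarrow> wf_schema S \<and> wf_query S Q"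
proof -
  note sz = at_parts(1,3,5,7,9)[of S Q]
  have AR: "q < AR (S, Q) R \<longleftrightarrow> R < length (rel_arities S) \<and> q < rel_arities S ! R" for q R
    using AR_eq[of R S Q] unfolding AR_def sz by auto
  have u: "(\<forall>(R,i,T,j)\<in>set (uids S). R < length (rel_arities S) \<and> T < length (rel_arities S)
      \<and> i < rel_arities S ! R \<and> j < rel_arities S ! T) \<longleftrightarrow> (\<forall>k<length (uids S). UQ (S, Q) k 0 < length (rel_arities S) \<and>
      UQ (S, Q) k 2 < length (rel_arities S) \<and> UQ (S, Q) k 1 < AR (S, Q) (UQ (S, Q) k 0) \<and> UQ (S, Q) k 3 < AR (S, Q) (UQ (S, Q) k 2))"
    unfolding all_set_conv_all_nth AR using uid_eq[of _ S Q] by auto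
  have f: "(\<forall>(R,D,j)\<in>set (fds S). R < length (rel_arities S) \<and> (\<forall>d\<in>set D. d < rel_arities S ! R) \<and> j < rel_arities S ! R) \<longleftrightarrow>
    (\<forall>k<length (fds S). FR (S, Q) k < length (rel_arities S) \<and> (\<forall>d<FL (S, Q) k. FD (S, Q) k d < AR (S, Q) (FR (S, Q) k)) \<and> FJ (S, Q) k < AR (S, Q) (FR (S, Q) k))"
    unfolding all_set_conv_all_nth AR using fd_eq[of _ S Q] by auto
  have m: "(\<forall>(R,ins,bd)\<in>set (methods S). R < length (rel_arities S) \<and> distinct ins
      \<and> (\<forall>p\<in>set ins. p < rel_arities S ! R) \<and> (\<forall>k. bd = Some k \<longrightarrow> 0 < k)) \<longleftrightarrow>
    (\<forall>k<length (methods S). MR (S, Q) k < length (rel_arities S) \<and> (\<forall>i<MN (S, Q) k. \<forall>j<MN (S, Q) k. MI (S, Q) k i = MI (S, Q) k j \<longrightarrow> i = j) \<and>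
     (\<forall>d<MN (S, Q) k. MI (S, Q) k d < AR (S, Q) (MR (S, Q) k)) \<and> \<not> MB (S, Q) k = 1)"
  proof -
    have d: "distinct (map f [0..<n]) \<longleftrightarrow> (\<forall>i<n. \<forall>j<n. f i = f j \<longrightarrow> i = j)" for f :: "nat \<Rightarrow> nat" and n
      by (auto simp: distinct_conv_nth)
    have e: "(\<forall>p\<in>set (map f [0..<n]). P p) \<longleftrightarrow> (\<forall>d<n. P (f d))" for f :: "nat \<Rightarrow> nat" and n P by auto
    have b: "(\<forall>k. (if b = 0 then None else Some (b - 1)) = Some k \<longrightarrow> 0 < k) \<longleftrightarrow> b \<noteq> 1" for b :: nat by auto
    have g: "A \<and> D \<and> (\<forall>d<n. P d) \<and> M \<longleftrightarrow> A \<and> D \<and> (\<forall>d<n :: nat. A \<and> P d) \<and> M" for A D n P M by blast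
    have "(case methods S ! k of (R,ins,bd) \<Rightarrow> R < length (rel_arities S) \<and> distinct ins
      \<and> (\<forall>p\<in>set ins. p < rel_arities S ! R) \<and> (\<forall>k. bd = Some k \<longrightarrow> 0 < k)) \<longleftrightarrow>
      MR (S, Q) k < length (rel_arities S) \<and> (\<forall>i<MN (S, Q) k. \<forall>j<MN (S, Q) k. MI (S, Q) k i = MI (S, Q) k j \<longrightarrow> i = j) \<and>
     (\<forall>d<MN (S, Q) k. MI (S, Q) k d < AR (S, Q) (MR (S, Q) k)) \<and> \<not> MB (S, Q) k = 1" if "k < length (methods S)" for k
      unfolding meth_eq[OF that, of Q] prod.case d e b AR by (rule g)
    then show ?thesis unfolding all_set_conv_all_nth by (intro iff_allI imp_cong refl)
  qed
  have q: "wf_query S Q \<longleftrightarrow> (\<forall>k<length Q. QR (S, Q) k < length (rel_arities S) \<and> QL (S, Q) k = AR (S, Q) (QR (S, Q) k))"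
    unfolding wf_query_def all_set_conv_all_nth using atom_eq[of _ Q S] AR_eq[of _ S Q] by auto
  show ?thesis unfolding WF_def wf_schema_def sz u f m q conj_assoc by (rule refl)
qed

theorem MonAns_iff:
  assumes "infinite (UNIV :: 'v set)"
  shows "MonAns TYPE('v) x \<longleftrightarrow> WF x \<and> CT x"
proof -
  obtain S Q where x: "x = (S, Q)" by (cases x)
  show ?thesis
  proof (cases "wf_schema S \<and> wf_query S Q")
    case True
    then interpret wf_problem S Q by unfold_locales auto
    show ?thesis using True answerable_iff_cert[OF assms] CT_eq WF_eq[of S Q] unfolding x MonAns_def by simp
  next
    case False
    then show ?thesis using WF_eq[of S Q] unfolding x MonAns_def by auto
  qed
qed

theorem mainTheorem9:
  assumes "infinite (UNIV :: 'v set)"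
  shows "decidable enc_problem (MonAns TYPE('v))
       \<and> in_EXPTIME enc_problem (MonAns TYPE('v))"
proof (rule coding_decides[where k = 10])
  have "FB (\<lambda>e. WF (px e) \<and> CT (px e))" by (rule PB.fnb_conj[OF fnb_WF fnb_CT])
  then have "FB (\<lambda>e. MonAns TYPE('v) (px e))" unfolding MonAns_iff[OF assms] .
  moreover have "pbnd = (\<lambda>x. 2 ^ ((length (enc_problem x) + 2) ^ 10))" by (intro ext) (rule pbnd_def)
  ultimately show "coding.fn enc_problem (\<lambda>x. 2 ^ ((length (enc_problem x) + 2) ^ 10)) (\<lambda>e. of_bool (MonAns TYPE('v) (px e)))"
    by simp
qed (use PB.alpha in auto)

end
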